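(* Let $(\Omega,\mathcal{F},\mathbb{P})$ be a probability space, $T:\Omega\to\Omega$ an invertible, bimeasurable, measure-preserving and ergodic transformation, and $(\mathcal{F}_k)_{k\in\mathbb{Z}}$ a $T$-filtration such that $\mathcal{F}_0$ is countably generated and $E_0=E[\,\cdot\,|\mathcal{F}_0]$ is regular. Let $B_1,B_2$ be independent standard Brownian motions on $[0,\infty)$ defined on a probability space $(\Omega',\mathcal{F}',\mathbb{P}')$. Let $\theta\in[0,2\pi)$ be such that $e^{-2i\theta}\notin Spec_p(T)$, let $D_0(\theta)\in L^2_{\mathbb{P}}(\mathcal{F}_0)\ominus L^2_{\mathbb{P}}(\mathcal{F}_{-1})$, and define, for $n\in\mathbb{N}$, $$M_n(\theta):=\sum_{k=0}^{n-1}T^kD_0(\theta)e^{ik\theta}.$$ Then the sequence $(V_n(\theta))_{n\ge1}$ of random elements of $D[[0,\infty),\mathbb{C}]$ defined by $V_n(\theta)(t):=M_{\lfloor nt\rfloor}(\theta)/\sqrt n$ converges in the quenched sense with respect to $\mathcal{F}_0$ to the random function $B(\theta):\Omega'\to D[[0,\infty),\mathbb{C}]$ given by $$B(\theta)(\omega')=\bigl[E|D_0(\theta)|^2/2\bigr]^{1/2}\bigl(B_1(\omega')+iB_2(\omega')\bigr).$$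
   Context: Random variables are complex-valued. $T^kY:=Y\circ T^k$ for a random variable $Y$. $L^2_{\mathbb{P}}(\mathcal{F}_0)\ominus L^2_{\mathbb{P}}(\mathcal{F}_{-1})$ is the orthogonal complement of $L^2_{\mathbb{P}}(\mathcal{F}_{-1})$ in $L^2_{\mathbb{P}}(\mathcal{F}_{0})$. $T$-filtration: a filtration of the form $\mathcal{F}_k=T^{-k}\mathcal{F}_0$ ($k\in\mathbb{Z}$), where $\mathcal{F}_0\subset\mathcal{F}$ is a sub-sigma-algebra with $\mathcal{F}_0\subset T^{-1}\mathcal{F}_0$. Regular: $E_0$ is regular if there is a family $\{\mathbb{P}_\omega\}_{\omega\in\Omega}$ of probability measures on $(\Omega,\mathcal{F})$ (a decomposition of $E_0$) such that for every $\mathbb{P}$-integrable $X:\Omega\to\mathbb{R}$ the function $\omega\mapsto\int X\,d\mathbb{P}_\omega$ (set to $0$ where the integral makes no sense) is an $\mathcal{F}_0$-measurable version of $E_0X$. Quenched convergence: random elements $V_n$ of a metric space $S$ defined on $(\Omega,\mathcal{F},\mathbb{P})$ converge to a random element $V$ of $S$ (possibly defined on another probability space) in the quenched sense with respect to $\mathcal{F}_0$ if for every bounded continuous $f:S\to\mathbb{R}$, $E[f(V_n)|\mathcal{F}_0]\to Ef(V)$ $\mathbb{P}$-a.s. $Spec_p(T)$ is the set of $\alpha\in\mathbb{C}$ for which there are $q>0$ and $X\in L^q_{\mathbb{P}}\setminus\{0\}$ with $X\circ T=\alpha X$ $\mathbb{P}$-a.s. $D[[0,\infty),\mathbb{C}]$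 is the space of cadlag functions $[0,\infty)\to\mathbb{C}$ with the metric $d(w_1,w_2)=(d(\mathrm{Re}\,w_1,\mathrm{Re}\,w_2)^2+d(\mathrm{Im}\,w_1,\mathrm{Im}\,w_2)^2)^{1/2}$, where on the right $d$ is the usual (Billingsley, $J_1$) Skorohod metric on real cadlag functions on $[0,\infty)$. *)

theory Defs
  imports "HOL-Probability.Probability"
begin

definition cadlag :: "(real \<Rightarrow> 'a::topological_space) \<Rightarrow> bool" where
  "cadlag x \<longleftrightarrow> (\<forall>t\<ge>0. (x \<longlongrightarrow> x t) (at_right t)) \<and> (\<forall>t>0. \<exists>l. (x \<longlongrightarrow> l) (at_left t))"

text \<open>Functions on the half-line are total functions that are \<open>undefined\<close> on the negative reals,
  so that equality of elements is equality on the half-line.\<close>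

definition cadlag_space :: "(real \<Rightarrow> 'a::topological_space) set" where
  "cadlag_space = {x \<in> extensional {0..}. cadlag x}"

definition time_changes :: "real \<Rightarrow> (real \<Rightarrow> real) set" where
  "time_changes b =
    {l. strict_mono_on {0..b} l \<and> continuous_on {0..b} l \<and> l ` {0..b} = {0..b}}"

text \<open>The metric of Billingsley's \<^emph>\<open>Convergence of Probability Measures\<close> (2nd edition):
  \<open>skorohod_dist_upto b\<close> is (12.13) on the interval from 0 to \<open>b\<close>, in the form of an infimum of
  those \<open>\<epsilon> > 0\<close> that bound both suprema; \<open>skorohod_dist\<close> is (16.4), where the paths are first
  multiplied by the ramp that equals 1 up to time \<open>m - 1\<close> and vanishes from time \<open>m\<close> on.\<close>

definition skorohod_bounds :: "real \<Rightarrow> (real \<Rightarrow> real) \<Rightarrow> (real \<Rightarrow> real) \<Rightarrow> real set" where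
  "skorohod_bounds b x y =
    {\<epsilon>. \<epsilon> > 0 \<and> (\<exists>l\<in>time_changes b. \<forall>t\<in>{0..b}. \<bar>l t - t\<bar> \<le> \<epsilon> \<and> \<bar>x t - y (l t)\<bar> \<le> \<epsilon>)}"

definition skorohod_dist_upto :: "real \<Rightarrow> (real \<Rightarrow> real) \<Rightarrow> (real \<Rightarrow> real) \<Rightarrow> real" where
  "skorohod_dist_upto b x y = Inf (skorohod_bounds b x y)"

definition damp :: "real \<Rightarrow> (real \<Rightarrow> real) \<Rightarrow> real \<Rightarrow> real" where
  "damp m x t = max 0 (min 1 (m - t)) * x t"

definition skorohod_dist :: "(real \<Rightarrow> real) \<Rightarrow> (real \<Rightarrow> real) \<Rightarrow> real" where
  "skorohod_dist x y =
    (\<Sum>k. (1/2) ^ Suc k *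
      min 1 (skorohod_dist_upto (real (Suc k)) (damp (real (Suc k)) x) (damp (real (Suc k)) y)))"

definition skorohod_cdist :: "(real \<Rightarrow> complex) \<Rightarrow> (real \<Rightarrow> complex) \<Rightarrow> real" where
  "skorohod_cdist w1 w2 =
    sqrt ((skorohod_dist (\<lambda>t. Re (w1 t)) (\<lambda>t. Re (w2 t)))\<^sup>2 +
          (skorohod_dist (\<lambda>t. Im (w1 t)) (\<lambda>t. Im (w2 t)))\<^sup>2)"

text \<open>The case distinction is only there because \<^locale>\<open>Metric_space\<close> asks for nonnegativity
  outside of the carrier as well; see \<open>Metric_space_skorohod\<close> and \<open>mdist_skorohod\<close> below.\<close>

definition skorohod_metric :: "(real \<Rightarrow> complex) metric" where
  "skorohod_metric = metric (cadlag_space,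
     \<lambda>w1 w2. if w1 \<in> cadlag_space \<and> w2 \<in> cadlag_space then skorohod_cdist w1 w2 else 0)"


lemma cadlag_bounded:
  fixes x :: "real \<Rightarrow> real"
  assumes "cadlag x" "0 \<le> b"
  shows "\<exists>K. \<forall>t\<in>{0..b}. \<bar>x t\<bar> \<le> K"
proof -
  define P where "P \<equiv> \<lambda>a c. \<exists>K. \<forall>t\<in>{a..c}. 0 \<le> t \<longrightarrow> \<bar>x t\<bar> \<le> K"
  from assms(2) have "P 0 b"
  proof (induction rule: Bolzano)
    case (trans a b c)
    then obtain K1 K2 where K: "\<forall>t\<in>{a..b}. 0 \<le> t \<longrightarrow> \<bar>x t\<bar> \<le> K1" "\<forall>t\<in>{b..c}. 0 \<le> t \<longrightarrow> \<bar>x t\<bar> \<le> K2"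
      unfolding P_def by blast
    have "\<forall>t\<in>{a..c}. 0 \<le> t \<longrightarrow> \<bar>x t\<bar> \<le> max K1 K2"
    proof (intro ballI impI)
      fix t assume "t \<in> {a..c}" "0 \<le> t"
      then show "\<bar>x t\<bar> \<le> max K1 K2"
        using K by (cases "t \<le> b") (auto simp: le_max_iff_disj)
    qed
    then show ?case unfolding P_def by blast
  next
    case (local t)
    have "(x \<longlongrightarrow> x t) (at_right t)" using assms(1) local unfolding cadlag_def by auto
    then have "eventually (\<lambda>s. dist (x s) (x t) < 1) (at_right t)" by (rule tendstoD) simp
    then obtain r where r: "r > t" "\<And>s. t < s \<Longrightarrow> s < r \<Longrightarrow> dist (x s) (x t) < 1"
      unfolding eventually_at_right_field by auto
    obtain l q where q: "q < t" "\<And>s. q < s \<Longrightarrow> s < t \<Longrightarrow> 0 \<le> s \<Longrightarrow> dist (x s) l < 1"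
    proof (cases "t > 0")
      case True
      then obtain l where "(x \<longlongrightarrow> l) (at_left t)" using assms(1) unfolding cadlag_def by auto
      then have "eventually (\<lambda>s. dist (x s) l < 1) (at_left t)" by (rule tendstoD) simp
      then show ?thesis using that unfolding eventually_at_left_field by auto
    next
      case False
      then show ?thesis using that[of "t - 1"] local by auto
    qed
    show ?case
    proof (intro exI[of _ "min (r - t) (t - q)"] conjI allI impI)
      fix a c assume ac: "a \<le> t \<and> t \<le> c \<and> c - a < min (r - t) (t - q)"
      have "\<bar>x s\<bar> \<le> \<bar>x t\<bar> + \<bar>l\<bar> + 1" if "s \<in> {a..c}" "0 \<le> s" for s
      proof -
        consider "s = t" | "s < t" | "s > t" by linarith
        then show ?thesis
        proof cases
          case 2
          have "dist (x s) l < 1" using ac that 2 by (intro q(2)) auto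
          then show ?thesis by (auto simp: dist_real_def)
        next
          case 3
          have "dist (x s) (x t) < 1" using ac that 3 by (intro r(2)) auto
          then show ?thesis by (auto simp: dist_real_def)
        qed auto
      qed
      then show "P a c" unfolding P_def by blast
    qed (use q(1) r(1) in auto)
  qed
  then show ?thesis unfolding P_def by auto
qed

lemma cadlag_damp:
  assumes "cadlag x"
  shows "cadlag (damp m x)"
proof -
  have 1: "((\<lambda>t. max 0 (min 1 (m - t))) \<longlongrightarrow> max 0 (min 1 (m - s))) (at s within A)" for s A
    by (intro tendsto_intros)
  show ?thesis
    using assms unfolding cadlag_def damp_def by (fast intro: tendsto_mult[OF 1])
qed

lemma id_time_change: "(\<lambda>t. t) \<in> time_changes b"
  by (auto simp: time_changes_def strict_mono_on_def)

lemma comp_time_change: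
  assumes "l1 \<in> time_changes b" "l2 \<in> time_changes b"
  shows "(\<lambda>t. l2 (l1 t)) \<in> time_changes b"
proof -
  have im: "l1 ` {0..b} = {0..b}" "l2 ` {0..b} = {0..b}"
    using assms by (auto simp: time_changes_def)
  have "strict_mono_on {0..b} (\<lambda>t. l2 (l1 t))"
    using assms im(1) unfolding time_changes_def strict_mono_on_def by blast
  moreover have "continuous_on {0..b} (\<lambda>t. l2 (l1 t))"
    using assms im(1) unfolding time_changes_def by (auto intro: continuous_on_compose2)
  moreover have "(\<lambda>t. l2 (l1 t)) ` {0..b} = {0..b}"
    using im by (metis image_image)
  ultimately show ?thesis by (simp add: time_changes_def)
qed

lemma inv_time_change:
  assumes "l \<in> time_changes b"
  shows "inv_into {0..b} l \<in> time_changes b"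
proof -
  have im: "l ` {0..b} = {0..b}" and mono: "strict_mono_on {0..b} l" and
    cont: "continuous_on {0..b} l"
    using assms by (auto simp: time_changes_def)
  have inj: "inj_on l {0..b}" using mono by (rule strict_mono_on_imp_inj_on)
  have mem: "inv_into {0..b} l t \<in> {0..b}" if "t \<in> {0..b}" for t
    using that im by (metis inv_into_into)
  have inv: "l (inv_into {0..b} l t) = t" if "t \<in> {0..b}" for t
    using that im by (simp add: f_inv_into_f)
  have "inv_into {0..b} l s < inv_into {0..b} l t" if "s \<in> {0..b}" "t \<in> {0..b}" "s < t" for s t
    using strict_mono_on_less[OF mono mem[OF that(1)] mem[OF that(2)]] that
    by (simp add: inv)
  then have "strict_mono_on {0..b} (inv_into {0..b} l)"
    by (auto simp: strict_mono_on_def)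
  moreover have "continuous_on {0..b} (inv_into {0..b} l)"
    using continuous_on_inv[OF cont compact_Icc, of "inv_into {0..b} l"] im inj by simp
  moreover have "inv_into {0..b} l ` {0..b} = {0..b}"
    using inv_into_image_cancel[OF inj, of "{0..b}"] im by simp
  ultimately show ?thesis by (simp add: time_changes_def)
qed

lemma skorohod_bounds_commute_aux:
  assumes "e \<in> skorohod_bounds b x y"
  shows "e \<in> skorohod_bounds b y x"
proof -
  obtain l where l: "l \<in> time_changes b" "e > 0"
    "\<And>t. t \<in> {0..b} \<Longrightarrow> \<bar>l t - t\<bar> \<le> e" "\<And>t. t \<in> {0..b} \<Longrightarrow> \<bar>x t - y (l t)\<bar> \<le> e"
    using assms by (auto simp: skorohod_bounds_def)
  have im: "l ` {0..b} = {0..b}" using l(1) by (simp add: time_changes_def)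
  have "\<bar>inv_into {0..b} l t - t\<bar> \<le> e \<and> \<bar>y t - x (inv_into {0..b} l t)\<bar> \<le> e" if "t \<in> {0..b}" for t
  proof -
    have "inv_into {0..b} l t \<in> {0..b}" "l (inv_into {0..b} l t) = t"
      using that im by (metis inv_into_into, simp add: f_inv_into_f)
    then show ?thesis using l(3,4)[of "inv_into {0..b} l t"] by (auto simp: abs_minus_commute)
  qed
  then show ?thesis using bexI[OF _ inv_time_change[OF l(1)]] l(2)
    by (simp add: skorohod_bounds_def)
qed

lemma skorohod_bounds_commute: "skorohod_bounds b x y = skorohod_bounds b y x"
  using skorohod_bounds_commute_aux by blast

lemma skorohod_bounds_triangle:
  assumes "e1 \<in> skorohod_bounds b x y" "e2 \<in> skorohod_bounds b y z"
  shows "e1 + e2 \<in> skorohod_bounds b x z"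
proof -
  obtain l1 where l1: "l1 \<in> time_changes b" "e1 > 0"
    "\<And>t. t \<in> {0..b} \<Longrightarrow> \<bar>l1 t - t\<bar> \<le> e1 \<and> \<bar>x t - y (l1 t)\<bar> \<le> e1"
    using assms(1) by (auto simp: skorohod_bounds_def)
  obtain l2 where l2: "l2 \<in> time_changes b" "e2 > 0"
    "\<And>t. t \<in> {0..b} \<Longrightarrow> \<bar>l2 t - t\<bar> \<le> e2 \<and> \<bar>y t - z (l2 t)\<bar> \<le> e2"
    using assms(2) by (auto simp: skorohod_bounds_def)
  have "\<bar>l2 (l1 t) - t\<bar> \<le> e1 + e2 \<and> \<bar>x t - z (l2 (l1 t))\<bar> \<le> e1 + e2" if "t \<in> {0..b}" for t
  proof -
    have "l1 t \<in> {0..b}" using that l1(1) by (auto simp: time_changes_def)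
    then show ?thesis using l1(3)[OF that] l2(3)[of "l1 t"] by linarith
  qed
  then show ?thesis using bexI[OF _ comp_time_change[OF l1(1) l2(1)]] l1(2) l2(2)
    by (simp add: skorohod_bounds_def)
qed

lemma skorohod_bounds_nonempty:
  assumes "cadlag x" "cadlag y" "0 \<le> b"
  shows "skorohod_bounds b x y \<noteq> {}"
proof -
  obtain K1 where K1: "\<forall>t\<in>{0..b}. \<bar>x t\<bar> \<le> K1" using cadlag_bounded assms by blast
  obtain K2 where K2: "\<forall>t\<in>{0..b}. \<bar>y t\<bar> \<le> K2" using cadlag_bounded assms by blast
  have "\<bar>x t - y t\<bar> \<le> \<bar>K1\<bar> + \<bar>K2\<bar> + 1" if "t \<in> {0..b}" for t
    using K1 K2 that by (smt (verit))
  then have "\<bar>K1\<bar> + \<bar>K2\<bar> + 1 \<in> skorohod_bounds b x y"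
    using id_time_change[of b] by (auto simp: skorohod_bounds_def intro!: bexI[of _ "\<lambda>t. t"])
  then show ?thesis by blast
qed

lemma skorohod_bounds_bdd: "bdd_below (skorohod_bounds b x y)"
  by (rule bdd_belowI[of _ 0]) (auto simp: skorohod_bounds_def)

lemma skorohod_dist_upto_commute: "skorohod_dist_upto b x y = skorohod_dist_upto b y x"
  using skorohod_bounds_commute by (simp add: skorohod_dist_upto_def)

lemma skorohod_dist_upto_nonneg:
  assumes "cadlag x" "cadlag y" "0 \<le> b"
  shows "0 \<le> skorohod_dist_upto b x y"
  unfolding skorohod_dist_upto_def
  by (intro cInf_greatest skorohod_bounds_nonempty assms) (auto simp: skorohod_bounds_def)

lemma skorohod_dist_upto_less:
  assumes "cadlag x" "cadlag y" "0 \<le> b" "skorohod_dist_upto b x y < c"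
  obtains e where "e \<in> skorohod_bounds b x y" "e < c"
  using assms cInf_lessD[OF skorohod_bounds_nonempty[OF assms(1-3)]]
  unfolding skorohod_dist_upto_def by blast

lemma skorohod_dist_upto_triangle:
  assumes "cadlag x" "cadlag y" "cadlag z" "0 \<le> b"
  shows "skorohod_dist_upto b x z \<le> skorohod_dist_upto b x y + skorohod_dist_upto b y z"
proof (rule field_le_epsilon)
  fix e :: real assume e: "e > 0"
  obtain e1 where e1: "e1 \<in> skorohod_bounds b x y" "e1 < skorohod_dist_upto b x y + e/2"
    using skorohod_dist_upto_less[OF assms(1,2,4), of "skorohod_dist_upto b x y + e/2"] e by auto
  obtain e2 where e2: "e2 \<in> skorohod_bounds b y z" "e2 < skorohod_dist_upto b y z + e/2"
    using skorohod_dist_upto_less[OF assms(2,3,4), of "skorohod_dist_upto b y z + e/2"] e by auto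
  have "skorohod_dist_upto b x z \<le> e1 + e2"
    unfolding skorohod_dist_upto_def
    by (rule cInf_lower[OF skorohod_bounds_triangle[OF e1(1) e2(1)] skorohod_bounds_bdd])
  then show "skorohod_dist_upto b x z \<le> skorohod_dist_upto b x y + skorohod_dist_upto b y z + e"
    using e1(2) e2(2) by linarith
qed

lemma skorohod_dist_upto_zeroD:
  assumes "cadlag x" "cadlag y" "skorohod_dist_upto b x y = 0" "0 \<le> t" "t < b"
  shows "x t = y t"
proof (rule ccontr)
  assume ne: "x t \<noteq> y t"
  define e where "e = \<bar>x t - y t\<bar> / 4"
  have e: "e > 0" using ne by (simp add: e_def)
  have "eventually (\<lambda>s. dist (x s) (x t) < e) (at_right t)"
    using assms(1,4) e unfolding cadlag_def by (intro tendstoD) auto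
  then obtain r1 where r1: "r1 > t" "\<And>s. t < s \<Longrightarrow> s < r1 \<Longrightarrow> dist (x s) (x t) < e"
    unfolding eventually_at_right_field by auto
  have "eventually (\<lambda>s. dist (y s) (y t) < e) (at_right t)"
    using assms(2,4) e unfolding cadlag_def by (intro tendstoD) auto
  then obtain r2 where r2: "r2 > t" "\<And>s. t < s \<Longrightarrow> s < r2 \<Longrightarrow> dist (y s) (y t) < e"
    unfolding eventually_at_right_field by auto
  define d where "d = min b (min r1 r2) - t"
  have d: "d > 0" "t + d \<le> b" "t + d \<le> r1" "t + d \<le> r2"
    using r1(1) r2(1) assms(5) by (auto simp: d_def)
  have "skorohod_dist_upto b x y < min e (d/2)" using assms(3) e d(1) by simp
  then obtain q where q: "q \<in> skorohod_bounds b x y" "q < min e (d/2)"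
    using skorohod_dist_upto_less[OF assms(1,2), of b "min e (d/2)"] assms(4,5) by auto
  define s where "s = t + d/2"
  have s: "s \<in> {0..b}" "t < s" "s < r1" using d assms(4) by (auto simp: s_def)
  obtain l where l: "\<bar>l s - s\<bar> \<le> q" "\<bar>x s - y (l s)\<bar> \<le> q"
    using q(1) s(1) unfolding skorohod_bounds_def by blast
  have "dist (x s) (x t) < e" using s by (intro r1(2))
  moreover have "dist (y (l s)) (y t) < e" using l(1) q(2) d by (intro r2(2)) (auto simp: s_def)
  ultimately have "\<bar>x t - y t\<bar> < e + q + e" using l(2) by (auto simp: dist_real_def)
  also have "\<dots> < 4 * e" using q(2) e by simp
  finally show False by (simp add: e_def)
qed

lemma skorohod_dist_upto_refl: "0 \<le> b \<Longrightarrow> cadlag x \<Longrightarrow> skorohod_dist_upto b x x = 0"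
proof -
  assume *: "0 \<le> b" "cadlag x"
  have "skorohod_dist_upto b x x \<le> e" if "e > 0" for e
    unfolding skorohod_dist_upto_def
    by (rule cInf_lower[OF _ skorohod_bounds_bdd])
      (use that id_time_change[of b] in \<open>auto simp: skorohod_bounds_def intro!: bexI[of _ "\<lambda>t. t"]\<close>)
  then have "skorohod_dist_upto b x x \<le> 0" by (rule field_le_epsilon) simp
  then show ?thesis using skorohod_dist_upto_nonneg[OF *(2,2,1)] by simp
qed

lemma skorohod_dist_upto_cong:
  assumes "\<And>t. t \<in> {0..b} \<Longrightarrow> x t = x' t" "\<And>t. t \<in> {0..b} \<Longrightarrow> y t = y' t"
  shows "skorohod_dist_upto b x y = skorohod_dist_upto b x' y'"
proof -
  have "(\<forall>t\<in>{0..b}. \<bar>l t - t\<bar> \<le> e \<and> \<bar>x t - y (l t)\<bar> \<le> e) \<longleftrightarrow>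
        (\<forall>t\<in>{0..b}. \<bar>l t - t\<bar> \<le> e \<and> \<bar>x' t - y' (l t)\<bar> \<le> e)" if "l \<in> time_changes b" for l e
  proof -
    have "l t \<in> {0..b}" if "t \<in> {0..b}" for t
      using that \<open>l \<in> time_changes b\<close> by (auto simp: time_changes_def)
    then show ?thesis by (intro ball_cong refl) (simp only: assms)
  qed
  then show ?thesis
    unfolding skorohod_dist_upto_def skorohod_bounds_def by (simp cong: bex_cong)
qed

lemma damp_at: "t \<le> m - 1 \<Longrightarrow> damp m x t = x t"
  by (simp add: damp_def)

context
  fixes x y :: "real \<Rightarrow> real"
  assumes cx: "cadlag x" and cy: "cadlag y"
begin

lemma skorohod_term_nonneg:
  "0 \<le> (1/2) ^ Suc k * min 1 (skorohod_dist_upto (real (Suc k)) (damp (real (Suc k)) x) (damp (real (Suc k)) y))"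
  using skorohod_dist_upto_nonneg[OF cadlag_damp[OF cx] cadlag_damp[OF cy]] by simp

lemma skorohod_summable:
  "summable (\<lambda>k. (1/2) ^ Suc k * min 1 (skorohod_dist_upto (real (Suc k)) (damp (real (Suc k)) x) (damp (real (Suc k)) y)))"
proof (rule summable_comparison_test')
  show "summable (\<lambda>k. (1/2::real) ^ Suc k)"
    using summable_geometric[of "1/2::real"] by (simp add: summable_mult)
  show "norm ((1/2) ^ Suc k * min 1 (skorohod_dist_upto (real (Suc k)) (damp (real (Suc k)) x) (damp (real (Suc k)) y))) \<le> (1/2) ^ Suc k" if "k \<ge> 0" for k
  proof -
    have "0 \<le> skorohod_dist_upto (real (Suc k)) (damp (real (Suc k)) x) (damp (real (Suc k)) y)"
      by (intro skorohod_dist_upto_nonneg cadlag_damp cx cy) simp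
    then show ?thesis by (subst norm_mult) (auto intro!: mult_left_le)
  qed
qed

lemma skorohod_dist_nonneg: "0 \<le> skorohod_dist x y"
  unfolding skorohod_dist_def by (intro suminf_nonneg skorohod_summable skorohod_term_nonneg)

lemma skorohod_dist_zero_iff: "skorohod_dist x y = 0 \<longleftrightarrow> (\<forall>t\<ge>0. x t = y t)"
proof
  assume "skorohod_dist x y = 0"
  then have "\<forall>k. (1/2) ^ Suc k * min 1 (skorohod_dist_upto (real (Suc k)) (damp (real (Suc k)) x) (damp (real (Suc k)) y)) = 0"
    unfolding skorohod_dist_def
    by (subst (asm) suminf_eq_zero_iff[OF skorohod_summable skorohod_term_nonneg])
  then have 0: "skorohod_dist_upto (real (Suc k)) (damp (real (Suc k)) x) (damp (real (Suc k)) y) = 0" for k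
    by (force simp: min_def split: if_splits)
  show "\<forall>t\<ge>0. x t = y t"
  proof (intro allI impI)
    fix t :: real assume t: "t \<ge> 0"
    obtain k where k: "t \<le> real k" using real_arch_simple by blast
    have "damp (real (Suc k)) x t = damp (real (Suc k)) y t"
      using skorohod_dist_upto_zeroD[OF cadlag_damp[OF cx] cadlag_damp[OF cy] 0] t k by simp
    then show "x t = y t" using k by (simp add: damp_at)
  qed
next
  assume eq: "\<forall>t\<ge>0. x t = y t"
  have "skorohod_dist_upto (real (Suc k)) (damp (real (Suc k)) x) (damp (real (Suc k)) y) =
        skorohod_dist_upto (real (Suc k)) (damp (real (Suc k)) x) (damp (real (Suc k)) x)" for k
    by (rule skorohod_dist_upto_cong) (use eq in \<open>auto simp: damp_def\<close>)
  then show "skorohod_dist x y = 0"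
    unfolding skorohod_dist_def using skorohod_dist_upto_refl cadlag_damp cx by simp
qed

end

lemma skorohod_dist_commute: "skorohod_dist x y = skorohod_dist y x"
  unfolding skorohod_dist_def by (simp only: skorohod_dist_upto_commute[of _ "damp _ x"])

lemma skorohod_dist_triangle:
  assumes c: "cadlag x" "cadlag y" "cadlag z"
  shows "skorohod_dist x z \<le> skorohod_dist x y + skorohod_dist y z"
proof -
  let ?d = "\<lambda>x y k. skorohod_dist_upto (real (Suc k)) (damp (real (Suc k)) x) (damp (real (Suc k)) y)"
  have "(1/2) ^ Suc k * min 1 (?d x z k) \<le>
      (1/2) ^ Suc k * min 1 (?d x y k) + (1/2) ^ Suc k * min 1 (?d y z k)" for k
  proof -
    have "?d x z k \<le> ?d x y k + ?d y z k" "0 \<le> ?d x y k" "0 \<le> ?d y z k"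
      using c by (auto intro!: skorohod_dist_upto_triangle skorohod_dist_upto_nonneg cadlag_damp)
    then have "min 1 (?d x z k) \<le> min 1 (?d x y k) + min 1 (?d y z k)" by linarith
    then have "(1/2) ^ Suc k * min 1 (?d x z k) \<le> (1/2) ^ Suc k * (min 1 (?d x y k) + min 1 (?d y z k))"
      by (intro mult_left_mono) auto
    then show ?thesis by (simp only: distrib_left)
  qed
  then show ?thesis
    unfolding skorohod_dist_def
    by (subst suminf_add[OF skorohod_summable[OF c(1,2)] skorohod_summable[OF c(2,3)]])
      (intro suminf_le summable_add skorohod_summable c)
qed

lemma cadlag_Re: "cadlag w \<Longrightarrow> cadlag (\<lambda>t. Re (w t))"
  unfolding cadlag_def by (fast intro: tendsto_Re)

lemma cadlag_Im: "cadlag w \<Longrightarrow> cadlag (\<lambda>t. Im (w t))"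
  unfolding cadlag_def by (fast intro: tendsto_Im)

lemma skorohod_cdist_triangle:
  assumes "cadlag x" "cadlag y" "cadlag z"
  shows "skorohod_cdist x z \<le> skorohod_cdist x y + skorohod_cdist y z"
proof -
  let ?a = "\<lambda>x y. skorohod_dist (\<lambda>t. Re (x t)) (\<lambda>t. Re (y t))"
  let ?b = "\<lambda>x y. skorohod_dist (\<lambda>t. Im (x t)) (\<lambda>t. Im (y t))"
  have "skorohod_cdist x z \<le> sqrt ((?a x y + ?a y z)\<^sup>2 + (?b x y + ?b y z)\<^sup>2)"
    unfolding skorohod_cdist_def using assms
    by (intro real_sqrt_le_mono add_mono power_mono skorohod_dist_triangle skorohod_dist_nonneg
        cadlag_Re cadlag_Im)
  also have "\<dots> \<le> skorohod_cdist x y + skorohod_cdist y z"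
    unfolding skorohod_cdist_def by (rule real_sqrt_sum_squares_triangle_ineq)
  finally show ?thesis .
qed

lemma Metric_space_skorohod:
  "Metric_space cadlag_space
     (\<lambda>w1 w2. if w1 \<in> cadlag_space \<and> w2 \<in> cadlag_space then skorohod_cdist w1 w2 else 0)"
    (is "Metric_space _ ?d")
proof
  show "0 \<le> ?d x y" for x y by (simp add: skorohod_cdist_def)
  show "?d x y = ?d y x" for x y
    unfolding skorohod_cdist_def
    by (simp add: skorohod_dist_commute[of "\<lambda>t. Re (x t)"] skorohod_dist_commute[of "\<lambda>t. Im (x t)"])
  show "?d x y = 0 \<longleftrightarrow> x = y" if m: "x \<in> cadlag_space" "y \<in> cadlag_space" for x y
  proof -
    have c: "cadlag x" "cadlag y" using m by (auto simp: cadlag_space_def)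
    have "?d x y = 0 \<longleftrightarrow> (\<forall>t\<ge>0. Re (x t) = Re (y t)) \<and> (\<forall>t\<ge>0. Im (x t) = Im (y t))"
      using m c by (simp add: skorohod_cdist_def sum_power2_eq_zero_iff skorohod_dist_zero_iff
          cadlag_Re cadlag_Im)
    also have "\<dots> \<longleftrightarrow> (\<forall>t\<in>{0..}. x t = y t)" by (auto simp: complex_eq_iff)
    also have "\<dots> \<longleftrightarrow> x = y" using m by (auto simp: cadlag_space_def intro: extensionalityI)
    finally show ?thesis .
  qed
  show "?d x z \<le> ?d x y + ?d y z"
    if "x \<in> cadlag_space" "y \<in> cadlag_space" "z \<in> cadlag_space" for x y z
    using that by (simp add: skorohod_cdist_triangle cadlag_space_def)
qed

lemma mspace_skorohod: "mspace skorohod_metric = cadlag_space"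
  unfolding skorohod_metric_def by (rule Metric_space.mspace_metric[OF Metric_space_skorohod])

lemma mdist_skorohod:
  "w1 \<in> cadlag_space \<Longrightarrow> w2 \<in> cadlag_space \<Longrightarrow> mdist skorohod_metric w1 w2 = skorohod_cdist w1 w2"
  unfolding skorohod_metric_def by (simp add: Metric_space.mdist_metric[OF Metric_space_skorohod])


definition random_element :: "'a measure \<Rightarrow> 's metric \<Rightarrow> ('a \<Rightarrow> 's) \<Rightarrow> bool" where
  "random_element M S V \<longleftrightarrow> V \<in> measurable M (sigma (mspace S) {U. openin (mtopology_of S) U})"

definition quenched_converges ::
  "'a measure \<Rightarrow> 'a measure \<Rightarrow> 's metric \<Rightarrow> (nat \<Rightarrow> 'a \<Rightarrow> 's) \<Rightarrow> 'b measure \<Rightarrow> ('b \<Rightarrow> 's) \<Rightarrow> bool" where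
  "quenched_converges M F0 S V M' V' \<longleftrightarrow>
     (\<forall>n. random_element M S (V n)) \<and> random_element M' S V' \<and>
     (\<forall>f. continuous_map (mtopology_of S) euclideanreal f \<and> bounded (f ` mspace S) \<longrightarrow>
        (AE \<omega> in M. (\<lambda>n. real_cond_exp M F0 (\<lambda>\<omega>. f (V n \<omega>)) \<omega>)
           \<longlonglongrightarrow> (\<integral>\<omega>'. f (V' \<omega>') \<partial>M')))"


definition invertible_mpt :: "'a measure \<Rightarrow> ('a \<Rightarrow> 'a) \<Rightarrow> bool" where
  "invertible_mpt M T \<longleftrightarrow>
     bij_betw T (space M) (space M) \<and> T \<in> measurable M M \<and>
     inv_into (space M) T \<in> measurable M M \<and> distr M M T = M"

definition ergodic :: "'a measure \<Rightarrow> ('a \<Rightarrow> 'a) \<Rightarrow> bool" where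
  "ergodic M T \<longleftrightarrow> (\<forall>A\<in>sets M. T -` A \<inter> space M = A \<longrightarrow> measure M A = 0 \<or> measure M A = 1)"

definition int_iterate :: "'a measure \<Rightarrow> ('a \<Rightarrow> 'a) \<Rightarrow> int \<Rightarrow> 'a \<Rightarrow> 'a" where
  "int_iterate M T k = (if k \<ge> 0 then T ^^ nat k else inv_into (space M) T ^^ nat (- k))"

text \<open>Sigma-algebras are represented by the \<^const>\<open>sets\<close> component of a measure; the measure
  carried by \<open>F k\<close> plays no role.\<close>

definition T_filtration :: "'a measure \<Rightarrow> ('a \<Rightarrow> 'a) \<Rightarrow> (int \<Rightarrow> 'a measure) \<Rightarrow> bool" where
  "T_filtration M T F \<longleftrightarrow>
     subalgebra M (F 0) \<and>
     sets (F 0) \<subseteq> {T -` A \<inter> space M | A. A \<in> sets (F 0)} \<and>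
     (\<forall>k. space (F k) = space M \<and>
          sets (F k) = {int_iterate M T k -` A \<inter> space M | A. A \<in> sets (F 0)})"

definition countably_generated :: "'a measure \<Rightarrow> bool" where
  "countably_generated N \<longleftrightarrow>
     (\<exists>C. countable C \<and> C \<subseteq> Pow (space N) \<and> sets N = sigma_sets (space N) C)"

text \<open>The Bochner integral is 0 for functions that are not integrable.\<close>

definition regular_cond_exp :: "'a measure \<Rightarrow> 'a measure \<Rightarrow> bool" where
  "regular_cond_exp M F0 \<longleftrightarrow>
     (\<exists>P :: 'a \<Rightarrow> 'a measure.
        (\<forall>\<omega>\<in>space M. prob_space (P \<omega>) \<and> sets (P \<omega>) = sets M) \<and>
        (\<forall>X :: 'a \<Rightarrow> real. integrable M X \<longrightarrow>
           (\<lambda>\<omega>. \<integral>\<omega>'. X \<omega>' \<partial>P \<omega>) \<in> borel_measurable F0 \<and>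
           (AE \<omega> in M. (\<integral>\<omega>'. X \<omega>' \<partial>P \<omega>) = real_cond_exp M F0 X \<omega>)))"

definition point_spectrum :: "'a measure \<Rightarrow> ('a \<Rightarrow> 'a) \<Rightarrow> complex set" where
  "point_spectrum M T =
     {\<alpha>. \<exists>q>0. \<exists>X :: 'a \<Rightarrow> complex. X \<in> borel_measurable M \<and>
        integrable M (\<lambda>\<omega>. norm (X \<omega>) powr q) \<and> \<not> (AE \<omega> in M. X \<omega> = 0) \<and>
        (AE \<omega> in M. X (T \<omega>) = \<alpha> * X \<omega>)}"

text \<open>\<open>L2 M N\<close> consists of the \<open>N\<close>-measurable functions that are square integrable under \<open>M\<close>.\<close>

definition L2 :: "'a measure \<Rightarrow> 'a measure \<Rightarrow> ('a \<Rightarrow> complex) set" where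
  "L2 M N = {X \<in> borel_measurable N. integrable M (\<lambda>\<omega>. (norm (X \<omega>))\<^sup>2)}"

definition L2_ominus :: "'a measure \<Rightarrow> 'a measure \<Rightarrow> 'a measure \<Rightarrow> ('a \<Rightarrow> complex) set" where
  "L2_ominus M N N' = {X \<in> L2 M N. \<forall>Y\<in>L2 M N'. (\<integral>\<omega>. X \<omega> * cnj (Y \<omega>) \<partial>M) = 0}"


definition standard_brownian_motion :: "'b measure \<Rightarrow> (real \<Rightarrow> 'b \<Rightarrow> real) \<Rightarrow> bool" where
  "standard_brownian_motion M B \<longleftrightarrow>
     (\<forall>t\<ge>0. B t \<in> borel_measurable M) \<and>
     (AE \<omega> in M. B 0 \<omega> = 0) \<and>
     (\<forall>\<omega>\<in>space M. continuous_on {0..} (\<lambda>t. B t \<omega>)) \<and>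
     (\<forall>s t. 0 \<le> s \<and> s < t \<longrightarrow>
        distributed M lborel (\<lambda>\<omega>. B t \<omega> - B s \<omega>) (normal_density 0 (sqrt (t - s)))) \<and>
     (\<forall>n. \<forall>t :: nat \<Rightarrow> real. 0 \<le> t 0 \<and> strict_mono t \<longrightarrow>
        prob_space.indep_vars M (\<lambda>_. borel) (\<lambda>i \<omega>. B (t (Suc i)) \<omega> - B (t i) \<omega>) {..<n})"

definition indep_processes ::
  "'b measure \<Rightarrow> (real \<Rightarrow> 'b \<Rightarrow> real) \<Rightarrow> (real \<Rightarrow> 'b \<Rightarrow> real) \<Rightarrow> bool" where
  "indep_processes M B1 B2 \<longleftrightarrow>
     prob_space.indep_var M
       (PiM {0..} (\<lambda>_. borel)) (\<lambda>\<omega>. \<lambda>t\<in>{0..}. B1 t \<omega>)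
       (PiM {0..} (\<lambda>_. borel)) (\<lambda>\<omega>. \<lambda>t\<in>{0..}. B2 t \<omega>)"

definition fourier_sum :: "('a \<Rightarrow> 'a) \<Rightarrow> ('a \<Rightarrow> complex) \<Rightarrow> real \<Rightarrow> nat \<Rightarrow> 'a \<Rightarrow> complex" where
  "fourier_sum T D \<theta> n \<omega> = (\<Sum>k<n. D ((T ^^ k) \<omega>) * exp (\<i> * of_nat k * of_real \<theta>))"

definition fourier_path :: "('a \<Rightarrow> 'a) \<Rightarrow> ('a \<Rightarrow> complex) \<Rightarrow> real \<Rightarrow> nat \<Rightarrow> 'a \<Rightarrow> real \<Rightarrow> complex" where
  "fourier_path T D \<theta> n \<omega> =
     (\<lambda>t\<in>{0..}. fourier_sum T D \<theta> (nat \<lfloor>real n * t\<rfloor>) \<omega> / of_real (sqrt (real n)))"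

definition limit_path :: "real \<Rightarrow> (real \<Rightarrow> 'b \<Rightarrow> real) \<Rightarrow> (real \<Rightarrow> 'b \<Rightarrow> real) \<Rightarrow> 'b \<Rightarrow> real \<Rightarrow> complex" where
  "limit_path c B1 B2 \<omega> = (\<lambda>t\<in>{0..}. of_real c * (of_real (B1 t \<omega>) + \<i> * of_real (B2 t \<omega>)))"

end

theory Submission
  imports Defs
begin

text \<open>
  By regularity, conditioning on \<open>F 0\<close> means integrating against fibre measures \<open>P \<omega>\<close>.  So the
  claim is that for almost every \<open>\<omega>\<close> the rescaled Fourier sums converge in distribution when the
  orbit is started from \<open>P \<omega>\<close>, and it follows from a functional central limit theorem for one
  martingale under one measure (\<open>lipschitz_functional_clt\<close>) as soon as almost every fibre measure
  satisfies the hypotheses of that theorem (\<open>fibre_averaging_martingale\<close>).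

  \<^emph>\<open>Fibres.\<close>  For \<open>k \<ge> 1\<close> the terms \<open>cis (k * \<theta>) * D (T^k \<omega>)\<close> are martingale differences under \<open>M\<close>,
  the \<open>k\<close>-th given \<open>F (k - 1)\<close>.  Being a version of a conditional expectation given \<open>F (k - 1)\<close> is
  an equality of integrals over the sets of that sigma-algebra.  Since it contains \<open>F 0\<close> and is
  countably generated, only countably many of these equalities have to be tested, and each of them
  passes to almost every fibre (\<open>cond_version_fibre\<close>).  The term \<open>k = 0\<close> moves a path by at most
  \<open>norm D / sqrt n\<close> and can be dropped.

  \<^emph>\<open>Variances.\<close>  In the direction of a unit vector \<open>u\<close> the conditional variance of a term \<open>z\<close> is the
  conditional expectation of \<open>((norm z)\<^sup>2 + Re (u\<^sup>2 * z\<^sup>2)) / 2\<close>.  Birkhoff's theorem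
  (\<open>birkhoff_ergodic\<close>, from Garsia's maximal inequality) sends the averages of the first part to
  \<open>E (norm D)\<^sup>2\<close>.  The conditional expectation of \<open>z\<^sup>2\<close> carries the factor \<open>cis (2 * k * \<theta>)\<close>;
  the ergodic theorem for the product of \<open>T\<close> with a rotation of the circle shows that its averages
  converge too, and their limit is multiplied by \<open>cis (- 2 * \<theta>)\<close> under \<open>T\<close>, so that it vanishes by
  the spectral hypothesis (\<open>rotated_average_tendsto_0\<close>).  Thus all directions have asymptotic variance
  \<open>E (norm D)\<^sup>2 / 2\<close> per unit of time, which is the covariance of two independent Brownian motions
  scaled by the root of this number.

  \<^emph>\<open>Central limit theorem.\<close>  On a fibre only almost sure convergence of the averages of the conditional
  moments is available, with no uniform bound.  The martingale is therefore cut off as soon as its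
  next term would bring the accumulated conditional variance above a fixed level.  This decision is
  predictable, so it leaves a martingale, and with high probability it changes nothing.  For the
  martingale that was cut off, \<open>exp (\<i> * S + V / 2)\<close> with \<open>V\<close> the accumulated variance has mean close
  to 1, step by step (\<open>char_martingale_bound\<close>).  This gives the limits of the joint characteristic
  functions of the increments over blocks of \<open>n / m\<close> terms (\<open>block_increments_charfun\<close>), and then, by
  the one-dimensional theorem of Levy applied coordinate by coordinate, of the expectations of
  Lipschitz functions of these increments (\<open>charfun_imp_lipschitz_convergence\<close>).

  \<^emph>\<open>Paths.\<close>  Two paths within \<open>e\<close> of each other on \<open>[0, K]\<close> have Skorohod distance at most
  \<open>2 * (e + 2^(- K))\<close>.  A maximal inequality bounds the probability that a path moves by \<open>2 * \<eta>\<close> inside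
  a block by the mean excess over \<open>\<eta>\<close> of its increment over that block.  In the limit this increment is
  Gaussian of variance proportional to \<open>1 / m\<close>, and its fourth moment makes the bound of order
  \<open>m^(- 2)\<close> (\<open>block_oscillation_eventually\<close>).  The blocks that meet \<open>[0, K]\<close> number about \<open>K * m\<close>, so for
  large \<open>m\<close> the path is close to the step path of its block increments.  Finally, convergence for
  bounded Lipschitz functions implies convergence for bounded continuous ones
  (\<open>lipschitz_tests_suffice\<close>).
\<close>

section \<open>Lipschitz test functions\<close>

text \<open>The largest minorant of \<open>f\<close> on \<open>S\<close> that is Lipschitz with constant \<open>k\<close> (the Pasch--Hausdorff
  envelope of \<open>f\<close>).\<close>

definition inf_conv :: "'s metric \<Rightarrow> real \<Rightarrow> ('s \<Rightarrow> real) \<Rightarrow> 's \<Rightarrow> real" where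
  "inf_conv S k f x = (INF y\<in>mspace S. f y + k * mdist S x y)"

lemma mdist_refl: "x \<in> mspace S \<Longrightarrow> mdist S x x = 0"
proof -
  interpret Metric_space "mspace S" "mdist S" by simp
  show "x \<in> mspace S \<Longrightarrow> mdist S x x = 0" by simp
qed

context
  fixes S :: "'s metric" and f :: "'s \<Rightarrow> real" and c k :: real
  assumes lower: "\<And>y. y \<in> mspace S \<Longrightarrow> c \<le> f y" and k: "0 \<le> k"
begin

lemma inf_conv_bdd_below: "bdd_below ((\<lambda>y. f y + k * mdist S x y) ` mspace S)"
  using lower k by (intro bdd_belowI2[of _ c]) (simp add: add_increasing2)

lemma inf_conv_le: "x \<in> mspace S \<Longrightarrow> inf_conv S k f x \<le> f x"
  unfolding inf_conv_def using cINF_lower[OF inf_conv_bdd_below, of x x] mdist_refl[of x S] by simp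

lemma inf_conv_ge: "x \<in> mspace S \<Longrightarrow> c \<le> inf_conv S k f x"
  unfolding inf_conv_def using lower k by (intro cINF_greatest) (auto simp: add_increasing2)

lemma inf_conv_add_le:
  assumes "x \<in> mspace S" "y \<in> mspace S"
  shows "inf_conv S k f x \<le> inf_conv S k f y + k * mdist S x y"
proof -
  have "inf_conv S k f x - k * mdist S x y \<le> f z + k * mdist S y z" if "z \<in> mspace S" for z
  proof -
    have "inf_conv S k f x \<le> f z + k * mdist S x z"
      unfolding inf_conv_def by (rule cINF_lower[OF inf_conv_bdd_below that])
    also have "k * mdist S x z \<le> k * (mdist S x y + mdist S y z)"
      using mdist_triangle[OF assms that] k by (intro mult_left_mono)
    finally show ?thesis by (simp add: algebra_simps)
  qed
  then have "inf_conv S k f x - k * mdist S x y \<le> inf_conv S k f y"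
    unfolding inf_conv_def[of _ _ _ y] using assms by (intro cINF_greatest) auto
  then show ?thesis by simp
qed

lemma inf_conv_lipschitz:
  "Lipschitz_continuous_map S euclidean_metric (inf_conv S k f)"
proof -
  have "\<bar>inf_conv S k f x - inf_conv S k f y\<bar> \<le> k * mdist S x y" if "x \<in> mspace S" "y \<in> mspace S" for x y
    using inf_conv_add_le[OF that] inf_conv_add_le[OF that(2,1)] by (simp add: mdist_commute abs_le_iff)
  then show ?thesis by (auto simp: Lipschitz_continuous_map_def dist_real_def)
qed

text \<open>A point far from \<open>x\<close> pays the penalty, a point near \<open>x\<close> has a value near \<open>f x\<close>.\<close>

lemma inf_conv_lower:
  assumes "x \<in> mspace S" "\<And>y. y \<in> mspace S \<Longrightarrow> mdist S x y < r \<Longrightarrow> f x - e \<le> f y" "f x - e \<le> c + k * r"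
  shows "f x - e \<le> inf_conv S k f x"
  unfolding inf_conv_def
proof (rule cINF_greatest)
  fix y assume y: "y \<in> mspace S"
  show "f x - e \<le> f y + k * mdist S x y"
  proof (cases "mdist S x y < r")
    case True
    then show ?thesis using assms(2)[OF y] k by (simp add: add_increasing2)
  next
    case False
    then have "k * r \<le> k * mdist S x y" using k by (intro mult_left_mono) auto
    then show ?thesis using assms(3) lower[OF y] by linarith
  qed
qed (use assms(1) in auto)

end

lemma Lipschitz_continuous_real:
  fixes f :: "'s \<Rightarrow> real"
  assumes "Lipschitz_continuous_map S euclidean_metric f"
  shows "continuous_map (mtopology_of S) euclideanreal f"
  using Lipschitz_continuous_imp_continuous_map[OF assms] by simp

text \<open>Near \<open>x\<close> the function \<open>f\<close> is not much below \<open>f x\<close>; away from \<open>x\<close> the penalty \<open>k * r\<close> exceeds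
  \<open>f x - c\<close> once \<open>k\<close> is large.\<close>

lemma inf_conv_tendsto:
  fixes f :: "'s \<Rightarrow> real"
  assumes cont: "continuous_map (mtopology_of S) euclideanreal f"
    and lower: "\<And>y. y \<in> mspace S \<Longrightarrow> c \<le> f y" and x: "x \<in> mspace S"
  shows "(\<lambda>k. inf_conv S (real k) f x) \<longlonglongrightarrow> f x"
proof (rule LIMSEQ_I)
  fix e :: real assume e: "0 < e"
  interpret Metric_space "mspace S" "mdist S" by simp
  have "continuous_map mtopology Met_TC.mtopology f" using cont by (simp add: mtopology_of_def)
  then obtain r where r: "r > 0" "\<And>y. y \<in> mspace S \<Longrightarrow> mdist S x y < r \<Longrightarrow> \<bar>f x - f y\<bar> < e / 2"
    using x e unfolding metric_continuous_map[OF Met_TC.Metric_space_axioms]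
    by (metis dist_real_def half_gt_zero)
  obtain m :: nat where m: "(f x - c) / r \<le> real m" using real_arch_simple by blast
  have "norm (inf_conv S (real k) f x - f x) < e" if "k \<ge> m" for k
  proof -
    have "(f x - c) / r \<le> real k" using m that by linarith
    then have "f x - c \<le> real k * r" using r(1) by (simp add: pos_divide_le_eq)
    then have 1: "f x - e / 2 \<le> c + real k * r" using e by linarith
    have 2: "f x - e / 2 \<le> f y" if "y \<in> mspace S" "mdist S x y < r" for y
      using r(2)[OF that] by linarith
    have "f x - e / 2 \<le> inf_conv S (real k) f x"
      by (rule inf_conv_lower[where c = c and r = r]) (use lower x 1 2 in auto)
    moreover have "inf_conv S (real k) f x \<le> f x"
      by (rule inf_conv_le[where c = c]) (use lower x in auto)
    ultimately show ?thesis using e by (simp add: abs_if)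
  qed
  then show "\<exists>m. \<forall>k\<ge>m. norm (inf_conv S (real k) f x - f x) < e" by blast
qed

lemma random_element_in_space: "random_element M S V \<Longrightarrow> \<omega> \<in> space M \<Longrightarrow> V \<omega> \<in> mspace S"
  unfolding random_element_def by (drule measurable_space, assumption) (simp add: space_measure_of_conv)

lemma random_element_compose:
  fixes f :: "'s \<Rightarrow> real"
  assumes "random_element M S V" "continuous_map (mtopology_of S) euclideanreal f"
  shows "(\<lambda>\<omega>. f (V \<omega>)) \<in> borel_measurable M"
proof (rule borel_measurableI)
  fix U :: "real set" assume "open U"
  then have "openin (mtopology_of S) {x \<in> mspace S. f x \<in> U}"
    using assms(2) by (simp add: continuous_map_def)
  then have "{x \<in> mspace S. f x \<in> U} \<in> sets (sigma (mspace S) {U. openin (mtopology_of S) U})"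
    by (subst sets_measure_of)
       (auto dest: openin_subset[of "mtopology_of S", simplified])
  then have "V -` {x \<in> mspace S. f x \<in> U} \<inter> space M \<in> sets M"
    using assms(1) unfolding random_element_def by (rule measurable_sets[rotated])
  also have "V -` {x \<in> mspace S. f x \<in> U} \<inter> space M = (\<lambda>\<omega>. f (V \<omega>)) -` U \<inter> space M"
    using random_element_in_space[OF assms(1)] by auto
  finally show "(\<lambda>\<omega>. f (V \<omega>)) -` U \<inter> space M \<in> sets M" .
qed

lemma random_elementI:
  assumes "\<And>\<omega>. \<omega> \<in> space M \<Longrightarrow> V \<omega> \<in> mspace S"
    and "\<And>U. openin (mtopology_of S) U \<Longrightarrow> V -` U \<inter> space M \<in> sets M"
  shows "random_element M S V"
  unfolding random_element_def
  by (rule measurable_measure_of) (use assms in \<open>auto dest: openin_subset[of "mtopology_of S", simplified]\<close>)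

lemma random_element_cong_sets:
  "sets M = sets M' \<Longrightarrow> random_element M S V \<longleftrightarrow> random_element M' S V"
  unfolding random_element_def using measurable_cong_sets by blast

text \<open>For an open set \<open>U\<close> the function \<open>h = inf_conv S 1 (indicator U)\<close> is the distance to the
  complement of \<open>U\<close>, capped at 1.  It is continuous and positive exactly on \<open>U\<close>, so the event that the
  limit lies in \<open>U\<close> is \<open>h > 0\<close> for a pointwise limit \<open>h\<close> of measurable functions.\<close>

lemma random_element_limit:
  assumes V: "\<And>n. random_element M S (V n)"
    and V': "\<And>\<omega>. \<omega> \<in> space M \<Longrightarrow> V' \<omega> \<in> mspace S"
    and lim: "\<And>\<omega>. \<omega> \<in> space M \<Longrightarrow> (\<lambda>n. mdist S (V n \<omega>) (V' \<omega>)) \<longlonglongrightarrow> 0"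
  shows "random_element M S V'"
proof (rule random_elementI)
  fix U assume U: "openin (mtopology_of S) U"
  interpret Metric_space "mspace S" "mdist S" by simp
  define h where "h = inf_conv S 1 (indicator U :: _ \<Rightarrow> real)"
  have lower: "\<And>y. y \<in> mspace S \<Longrightarrow> 0 \<le> (indicator U y :: real)" by simp
  have lip: "h x \<le> h y + mdist S x y" if "x \<in> mspace S" "y \<in> mspace S" for x y
    using inf_conv_add_le[where c = 0 and k = 1 and f = "indicator U" and S = S, OF _ _ that] by (simp add: h_def)
  have "h x > 0 \<longleftrightarrow> x \<in> U" if x: "x \<in> mspace S" for x
  proof
    assume "h x > 0"
    moreover have "h x \<le> indicator U x" unfolding h_def by (rule inf_conv_le[OF lower _ x]) auto
    ultimately have "indicator U x > (0::real)" by linarith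
    then show "x \<in> U" by (auto simp: indicator_def split: if_splits)
  next
    assume "x \<in> U"
    then obtain r where r: "r > 0" "mball x r \<subseteq> U"
      using U unfolding mtopology_of_def openin_mtopology by blast
    have "indicator U x - (1 - min 1 r) \<le> h x" unfolding h_def
      by (rule inf_conv_lower[OF lower, where r = r]) (use r x \<open>x \<in> U\<close> in \<open>auto simp: indicator_def subset_iff\<close>)
    then show "h x > 0" using r(1) \<open>x \<in> U\<close> by (simp add: min_def split: if_splits)
  qed
  then have eq: "V' -` U \<inter> space M = {\<omega> \<in> space M. h (V' \<omega>) > 0}"
    using V' by auto
  have m: "(\<lambda>\<omega>. h (V n \<omega>)) \<in> borel_measurable M" for n
    unfolding h_def by (rule random_element_compose[OF V])
      (rule Lipschitz_continuous_real, rule inf_conv_lipschitz[OF lower], auto)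
  have "(\<lambda>\<omega>. h (V' \<omega>)) \<in> borel_measurable M"
  proof (rule borel_measurable_LIMSEQ_real[OF _ m])
    fix \<omega> assume w: "\<omega> \<in> space M"
    have VS: "V n \<omega> \<in> mspace S" for n using random_element_in_space[OF V w] .
    have "\<bar>h (V n \<omega>) - h (V' \<omega>)\<bar> \<le> mdist S (V n \<omega>) (V' \<omega>)" for n
      using lip[of "V n \<omega>" "V' \<omega>"] lip[of "V' \<omega>" "V n \<omega>"]
        VS V'[OF w] by (simp add: abs_le_iff mdist_commute)
    then have "(\<lambda>n. h (V n \<omega>) - h (V' \<omega>)) \<longlonglongrightarrow> 0"
      by (intro tendsto_0_le[OF lim[OF w], of _ 1]) (auto simp: abs_mult)
    then show "(\<lambda>n. h (V n \<omega>)) \<longlonglongrightarrow> h (V' \<omega>)" by (simp add: LIM_zero_iff)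
  qed
  then show "V' -` U \<inter> space M \<in> sets M" unfolding eq by measurable
qed (rule V')

text \<open>The Lipschitz minorants \<open>inf_conv S k f\<close> increase to \<open>f\<close>, so one of them has nearly the same
  mean under the limit law, and it stays below \<open>f\<close> along the sequence.\<close>

lemma expectation_lower_limit:
  fixes f :: "'s \<Rightarrow> real"
  assumes "prob_space N" "prob_space N'" and V: "\<And>n. random_element N S (V n)" and V': "random_element N' S V'"
    and lip: "\<And>g :: 's \<Rightarrow> real. Lipschitz_continuous_map S euclidean_metric g \<Longrightarrow> bounded (g ` mspace S) \<Longrightarrow>
        (\<lambda>n. \<integral>\<omega>. g (V n \<omega>) \<partial>N) \<longlonglongrightarrow> (\<integral>\<omega>. g (V' \<omega>) \<partial>N')"
    and f: "continuous_map (mtopology_of S) euclideanreal f" "bounded (f ` mspace S)" and e: "e > 0"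
  shows "eventually (\<lambda>n. (\<integral>\<omega>. f (V n \<omega>) \<partial>N) > (\<integral>\<omega>. f (V' \<omega>) \<partial>N') - e) sequentially"
proof -
  interpret N: prob_space N by fact
  interpret N': prob_space N' by fact
  obtain B where B: "\<And>x. x \<in> mspace S \<Longrightarrow> \<bar>f x\<bar> \<le> B" using f(2) unfolding bounded_iff by auto
  have lower: "- B \<le> f y" if "y \<in> mspace S" for y using B[OF that] by linarith
  define g where "g k = inf_conv S (real k) f" for k
  have g_le: "g k x \<le> f x" if "x \<in> mspace S" for k x
    unfolding g_def by (rule inf_conv_le[OF lower]) (use that in auto)
  have g_ge: "- B \<le> g k x" if "x \<in> mspace S" for k x
    unfolding g_def by (rule inf_conv_ge[OF lower]) (use that in auto)
  have gB: "\<bar>g k x\<bar> \<le> B" if "x \<in> mspace S" for k x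
    using g_le[OF that, of k] g_ge[OF that, of k] B[OF that] by linarith
  have g_lip: "Lipschitz_continuous_map S euclidean_metric (g k)" for k
    unfolding g_def by (rule inf_conv_lipschitz[OF lower]) auto
  have "(\<lambda>k. \<integral>\<omega>. g k (V' \<omega>) \<partial>N') \<longlonglongrightarrow> (\<integral>\<omega>. f (V' \<omega>) \<partial>N')"
  proof (rule integral_dominated_convergence[where w = "\<lambda>_. B"])
    show "AE \<omega> in N'. (\<lambda>k. g k (V' \<omega>)) \<longlonglongrightarrow> f (V' \<omega>)" unfolding g_def
      by (intro AE_I2 inf_conv_tendsto[OF f(1) lower]) (use random_element_in_space[OF V'] in auto)
    show "AE \<omega> in N'. norm (g k (V' \<omega>)) \<le> B" for k
      using gB random_element_in_space[OF V'] by (intro AE_I2) auto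
  qed (use random_element_compose[OF V' f(1)]
        random_element_compose[OF V' Lipschitz_continuous_real[OF g_lip]] in auto)
  then have "eventually (\<lambda>k. (\<integral>\<omega>. g k (V' \<omega>) \<partial>N') > (\<integral>\<omega>. f (V' \<omega>) \<partial>N') - e) sequentially"
    by (rule order_tendstoD) (use e in auto)
  then obtain k where k: "(\<integral>\<omega>. g k (V' \<omega>) \<partial>N') > (\<integral>\<omega>. f (V' \<omega>) \<partial>N') - e"
    by (auto simp: eventually_sequentially)
  have "bounded (g k ` mspace S)" using gB by (auto simp: bounded_iff)
  from order_tendstoD(1)[OF lip[OF g_lip this] k]
  show ?thesis
  proof eventually_elim
    case (elim n)
    have "(\<integral>\<omega>. g k (V n \<omega>) \<partial>N) \<le> (\<integral>\<omega>. f (V n \<omega>) \<partial>N)"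
    proof (rule integral_mono)
      show "integrable N (\<lambda>\<omega>. g k (V n \<omega>))"
        by (rule N.integrable_const_bound[of _ B])
          (use gB random_element_in_space[OF V]
              random_element_compose[OF V Lipschitz_continuous_real[OF g_lip]] in auto)
      show "integrable N (\<lambda>\<omega>. f (V n \<omega>))"
        by (rule N.integrable_const_bound[of _ B])
          (use B random_element_in_space[OF V] random_element_compose[OF V f(1)] in auto)
    qed (use g_le random_element_in_space[OF V] in auto)
    then show ?case using elim by simp
  qed
qed

text \<open>The lower estimate above for \<open>f\<close> and for \<open>- f\<close>.\<close>

lemma lipschitz_tests_suffice:
  fixes f :: "'s \<Rightarrow> real"
  assumes "prob_space N" "prob_space N'" "\<And>n. random_element N S (V n)" "random_element N' S V'"
    and "\<And>g :: 's \<Rightarrow> real. Lipschitz_continuous_map S euclidean_metric g \<Longrightarrow> bounded (g ` mspace S) \<Longrightarrow>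
        (\<lambda>n. \<integral>\<omega>. g (V n \<omega>) \<partial>N) \<longlonglongrightarrow> (\<integral>\<omega>. g (V' \<omega>) \<partial>N')"
    and f: "continuous_map (mtopology_of S) euclideanreal f" "bounded (f ` mspace S)"
  shows "(\<lambda>n. \<integral>\<omega>. f (V n \<omega>) \<partial>N) \<longlonglongrightarrow> (\<integral>\<omega>. f (V' \<omega>) \<partial>N')"
proof (rule order_tendstoI)
  note low = expectation_lower_limit[OF assms(1-4), OF assms(5)]
  show "eventually (\<lambda>n. (\<integral>\<omega>. f (V n \<omega>) \<partial>N) > a) sequentially" if "a < (\<integral>\<omega>. f (V' \<omega>) \<partial>N')" for a
    using low[OF _ _ f, of "(\<integral>\<omega>. f (V' \<omega>) \<partial>N') - a"] that by simp
  have f': "continuous_map (mtopology_of S) euclideanreal (\<lambda>x. - f x)" "bounded ((\<lambda>x. - f x) ` mspace S)"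
    using f(1) bounded_uminus[of "f ` mspace S"] f(2) by (auto intro: continuous_map_minus simp: image_image)
  show "eventually (\<lambda>n. (\<integral>\<omega>. f (V n \<omega>) \<partial>N) < a) sequentially" if "a > (\<integral>\<omega>. f (V' \<omega>) \<partial>N')" for a
    using low[OF _ _ f', of "a - (\<integral>\<omega>. f (V' \<omega>) \<partial>N')"] that by simp
qed

section \<open>Skorohod distance and paths on a grid\<close>

lemma skorohod_dist_upto_le:
  assumes "0 \<le> e" "\<And>t. t \<in> {0..b} \<Longrightarrow> \<bar>x t - y t\<bar> \<le> e"
  shows "skorohod_dist_upto b x y \<le> e"
proof (rule field_le_epsilon)
  fix d :: real assume "d > 0"
  then have "e + d \<in> skorohod_bounds b x y"
    using assms id_time_change[of b]
    by (auto simp: skorohod_bounds_def intro!: bexI[of _ "\<lambda>t. t"]) (smt (verit))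
  then show "skorohod_dist_upto b x y \<le> e + d"
    unfolding skorohod_dist_upto_def by (rule cInf_lower[OF _ skorohod_bounds_bdd])
qed

text \<open>The identity is an admissible time change.  The first \<open>K\<close> terms of the series that defines the
  distance compare \<open>x\<close> and \<open>y\<close> on \<open>[0, K]\<close> only, and damping does not increase their distance; the other
  terms add up to at most \<open>(1/2) ^ K\<close>.\<close>

lemma skorohod_dist_le:
  fixes K :: nat
  assumes c: "cadlag x" "cadlag y" and e: "0 \<le> e"
    and le: "\<And>t. 0 \<le> t \<Longrightarrow> t \<le> real K \<Longrightarrow> \<bar>x t - y t\<bar> \<le> e"
  shows "skorohod_dist x y \<le> e + (1/2) ^ K"
proof -
  let ?d = "\<lambda>k. skorohod_dist_upto (real (Suc k)) (damp (real (Suc k)) x) (damp (real (Suc k)) y)"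
  have 1: "(1/2) ^ Suc k * min 1 (?d k) \<le> (1/2) ^ Suc k * e + (if k < K then 0 else (1/2) ^ Suc k)" for k
  proof (cases "k < K")
    case True
    have "?d k \<le> e"
    proof (rule skorohod_dist_upto_le[OF e])
      fix t assume t: "t \<in> {0..real (Suc k)}"
      define a where "a = max 0 (min 1 (real (Suc k) - t))"
      have "\<bar>damp (real (Suc k)) x t - damp (real (Suc k)) y t\<bar> = a * \<bar>x t - y t\<bar>"
        by (simp add: damp_def a_def abs_mult flip: right_diff_distrib)
      also have "\<dots> \<le> 1 * e"
        using t True le[of t] by (intro mult_mono) (auto simp: a_def)
      finally show "\<bar>damp (real (Suc k)) x t - damp (real (Suc k)) y t\<bar> \<le> e" by simp
    qed
    then have "min 1 (?d k) \<le> e" by linarith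
    then show ?thesis using True by (simp add: mult_left_mono)
  next
    case False
    have "(1/2) ^ Suc k * min 1 (?d k) \<le> (1/2) ^ Suc k * 1" by (intro mult_left_mono) auto
    then show ?thesis using False e by (simp add: add_increasing)
  qed
  have g: "(\<lambda>k. (1/2::real) ^ Suc k) sums 1" by (rule power_half_series)
  have "(\<lambda>k. if k < K then 0 else (1/2::real) ^ Suc k) sums (1/2) ^ K"
  proof -
    have "(\<lambda>k. (1/2::real) ^ Suc k * (1/2) ^ K) sums (1 * (1/2) ^ K)"
      by (intro sums_mult2 g)
    then have "(\<lambda>k. if k + K < K then 0 else (1/2::real) ^ Suc (k + K)) sums (1/2) ^ K"
      by (simp add: power_add mult.assoc)
    then show ?thesis by (subst sums_zero_iff_shift[symmetric]) auto
  qed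
  from sums_add[OF sums_mult2[OF g, of e] this]
  have s: "(\<lambda>k. (1/2) ^ Suc k * e + (if k < K then 0 else (1/2) ^ Suc k)) sums (e + (1/2) ^ K)"
    by simp
  have "skorohod_dist x y \<le> (\<Sum>k. (1/2) ^ Suc k * e + (if k < K then 0 else (1/2) ^ Suc k))"
    unfolding skorohod_dist_def
    by (intro suminf_le 1 skorohod_summable c sums_summable[OF s])
  also have "\<dots> = e + (1/2) ^ K" using s by (rule sums_unique[symmetric])
  finally show ?thesis .
qed

lemma skorohod_mdist_le:
  fixes K :: nat
  assumes w: "w1 \<in> cadlag_space" "w2 \<in> cadlag_space" and e: "0 \<le> e"
    and le: "\<And>t. 0 \<le> t \<Longrightarrow> t \<le> real K \<Longrightarrow> norm (w1 t - w2 t) \<le> e"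
  shows "mdist skorohod_metric w1 w2 \<le> 2 * (e + (1/2) ^ K)"
proof -
  have c: "cadlag w1" "cadlag w2" using w by (auto simp: cadlag_space_def)
  have re: "skorohod_dist (\<lambda>t. Re (w1 t)) (\<lambda>t. Re (w2 t)) \<le> e + (1/2) ^ K"
  proof (rule skorohod_dist_le[OF cadlag_Re[OF c(1)] cadlag_Re[OF c(2)] e])
    fix t :: real assume "0 \<le> t" "t \<le> real K"
    then show "\<bar>Re (w1 t) - Re (w2 t)\<bar> \<le> e"
      using le[of t] abs_Re_le_cmod[of "w1 t - w2 t"] by simp
  qed
  have im: "skorohod_dist (\<lambda>t. Im (w1 t)) (\<lambda>t. Im (w2 t)) \<le> e + (1/2) ^ K"
  proof (rule skorohod_dist_le[OF cadlag_Im[OF c(1)] cadlag_Im[OF c(2)] e])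
    fix t :: real assume "0 \<le> t" "t \<le> real K"
    then show "\<bar>Im (w1 t) - Im (w2 t)\<bar> \<le> e"
      using le[of t] abs_Im_le_cmod[of "w1 t - w2 t"] by simp
  qed
  have "mdist skorohod_metric w1 w2 \<le>
      \<bar>skorohod_dist (\<lambda>t. Re (w1 t)) (\<lambda>t. Re (w2 t))\<bar> + \<bar>skorohod_dist (\<lambda>t. Im (w1 t)) (\<lambda>t. Im (w2 t))\<bar>"
    unfolding mdist_skorohod[OF w] skorohod_cdist_def by (rule sqrt_sum_squares_le_sum_abs)
  also have "\<dots> \<le> (e + (1/2) ^ K) + (e + (1/2) ^ K)"
    using re im skorohod_dist_nonneg[OF cadlag_Re[OF c(1)] cadlag_Re[OF c(2)]]
      skorohod_dist_nonneg[OF cadlag_Im[OF c(1)] cadlag_Im[OF c(2)]] by (intro add_mono) auto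
  finally show ?thesis by simp
qed

definition grid_path :: "real \<Rightarrow> (nat \<Rightarrow> complex) \<Rightarrow> real \<Rightarrow> complex" where
  "grid_path r y = (\<lambda>t\<in>{0..}. y (nat \<lfloor>r * t\<rfloor>))"

lemma grid_path_cadlag:
  assumes r: "0 < r"
  shows "grid_path r y \<in> cadlag_space"
proof -
  have "(grid_path r y \<longlongrightarrow> grid_path r y t) (at_right t)" if t: "t \<ge> 0" for t
  proof (rule tendsto_eventually, unfold eventually_at_right_field, intro exI conjI allI impI)
    show "t < (of_int \<lfloor>r * t\<rfloor> + 1) / r" using r by (simp add: pos_less_divide_eq mult.commute)
    fix s assume s: "t < s" "s < (of_int \<lfloor>r * t\<rfloor> + 1) / r"
    then have "r * s < of_int \<lfloor>r * t\<rfloor> + 1" using r by (simp add: pos_less_divide_eq mult.commute)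
    moreover have "r * t < r * s" using r s by simp
    ultimately have "\<lfloor>r * s\<rfloor> = \<lfloor>r * t\<rfloor>" by linarith
    then show "grid_path r y s = grid_path r y t" using s t by (simp add: grid_path_def)
  qed
  moreover have "\<exists>l. (grid_path r y \<longlongrightarrow> l) (at_left t)" if t: "t > 0" for t
  proof (rule exI[of _ "y (nat (\<lceil>r * t\<rceil> - 1))"], rule tendsto_eventually, unfold eventually_at_left_field,
      intro exI conjI allI impI)
    have rt: "0 < r * t" using r t by simp
    show "(of_int \<lceil>r * t\<rceil> - 1) / r < t" using r by (simp add: pos_divide_less_eq mult.commute) linarith
    fix s assume s: "(of_int \<lceil>r * t\<rceil> - 1) / r < s" "s < t"
    then have "of_int \<lceil>r * t\<rceil> - 1 < r * s" using r by (simp add: pos_divide_less_eq mult.commute)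
    moreover have "r * s < r * t" using r s by simp
    ultimately have "\<lfloor>r * s\<rfloor> = \<lceil>r * t\<rceil> - 1" by linarith
    moreover have "s \<ge> 0"
    proof -
      have "0 \<le> (of_int \<lceil>r * t\<rceil> - 1 :: real) / r" using rt r by (intro divide_nonneg_pos) auto
      then show ?thesis using s by linarith
    qed
    ultimately show "grid_path r y s = y (nat (\<lceil>r * t\<rceil> - 1))" by (simp add: grid_path_def)
  qed
  ultimately show ?thesis by (auto simp: cadlag_space_def cadlag_def grid_path_def)
qed

text \<open>The path depends continuously on its sequence of values, in the product topology: to control the
  distance up to \<open>e\<close> it suffices to look at times up to some \<open>K\<close>, hence at finitely many values.
  Measurability therefore reduces to that of the coordinates.\<close>

lemma random_element_grid_path:
  assumes r: "0 < r" and Y: "\<And>i. (\<lambda>\<omega>. Y \<omega> i) \<in> borel_measurable M"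
  shows "random_element M skorohod_metric (\<lambda>\<omega>. grid_path r (Y \<omega>))"
proof (rule random_elementI)
  show "grid_path r (Y \<omega>) \<in> mspace skorohod_metric" for \<omega>
    using grid_path_cadlag[OF r] by (simp add: mspace_skorohod)
  fix U assume U: "openin (mtopology_of skorohod_metric) U"
  interpret Metric_space "mspace skorohod_metric" "mdist skorohod_metric" by simp
  have "\<exists>T. open T \<and> y \<in> T \<and> T \<subseteq> {y. grid_path r y \<in> U}" if "grid_path r y \<in> U" for y
  proof -
    from that obtain e where e: "e > 0" "mball (grid_path r y) e \<subseteq> U"
      using U unfolding mtopology_of_def openin_mtopology by blast
    obtain K :: nat where K: "(1/2) ^ K < e / 8"
      using real_arch_pow_inv[of "e / 8" "1/2"] e(1) by auto
    define N where "N = nat \<lfloor>r * real K\<rfloor>"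
    let ?T = "{y'. \<forall>i\<in>{..N}. y' i \<in> ball (y i) (e / 8)}"
    have "open ?T" by (rule product_topology_basis'[where x = "\<lambda>i. i"]) auto
    moreover have "y \<in> ?T" using e(1) by auto
    moreover have "?T \<subseteq> {y. grid_path r y \<in> U}"
    proof
      fix y' assume y': "y' \<in> ?T"
      have "mdist skorohod_metric (grid_path r y) (grid_path r y') \<le> 2 * (e / 8 + (1/2) ^ K)"
      proof (rule skorohod_mdist_le[OF grid_path_cadlag[OF r] grid_path_cadlag[OF r]])
        fix t :: real assume t: "0 \<le> t" "t \<le> real K"
        then have "r * t \<le> r * real K" using r by simp
        then have "nat \<lfloor>r * t\<rfloor> \<le> N" unfolding N_def by (intro nat_mono floor_mono)
        then have "dist (y (nat \<lfloor>r * t\<rfloor>)) (y' (nat \<lfloor>r * t\<rfloor>)) < e / 8"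
          using y' by auto
        then show "norm (grid_path r y t - grid_path r y' t) \<le> e / 8"
          using t by (simp add: grid_path_def dist_norm)
      qed (use e(1) in simp)
      also have "\<dots> < e" using K e(1) by simp
      finally have "grid_path r y' \<in> mball (grid_path r y) e"
        using grid_path_cadlag[OF r, of y] grid_path_cadlag[OF r, of y'] mspace_skorohod in_mball by blast
      then show "y' \<in> {y. grid_path r y \<in> U}" using e(2) by auto
    qed
    ultimately show "\<exists>T. open T \<and> y \<in> T \<and> T \<subseteq> {y. grid_path r y \<in> U}" by blast
  qed
  then have "open {y. grid_path r y \<in> U}" by (subst open_subopen) auto
  then have "{y. grid_path r y \<in> U} \<in> sets borel" by simp
  moreover have "Y \<in> borel_measurable M" by (rule measurable_coordinatewise_then_product[OF Y])
  ultimately have "Y -` {y. grid_path r y \<in> U} \<inter> space M \<in> sets M" by (rule measurable_sets[rotated])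
  then show "(\<lambda>\<omega>. grid_path r (Y \<omega>)) -` U \<inter> space M \<in> sets M" by (simp add: vimage_def)
qed

text \<open>Uniform continuity on the compact interval \<open>[0, K]\<close>.\<close>

lemma grid_path_modulus:
  assumes w: "continuous_on {0..} (w :: real \<Rightarrow> complex)" and d: "d > 0"
  shows "\<exists>m0>0. \<forall>m\<ge>m0. \<forall>t. 0 \<le> t \<and> t \<le> real K \<longrightarrow>
    norm (w (real (nat \<lfloor>real m * t\<rfloor>) / real m) - w t) < d"
proof -
  have "uniformly_continuous_on {0..real K} w"
    by (intro compact_uniformly_continuous continuous_on_subset[OF w]) auto
  then obtain \<delta> where \<delta>: "\<delta> > 0" "\<And>s t. s \<in> {0..real K} \<Longrightarrow> t \<in> {0..real K} \<Longrightarrow> dist s t < \<delta> \<Longrightarrow> dist (w s) (w t) < d"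
    unfolding uniformly_continuous_on_def using d by blast
  obtain m0 where m0: "m0 > 0" "inverse (real m0) < \<delta>" using ex_inverse_of_nat_less[OF \<delta>(1)] by auto
  have "norm (w (real (nat \<lfloor>real m * t\<rfloor>) / real m) - w t) < d" if m: "m \<ge> m0" and t: "0 \<le> t" "t \<le> real K" for m t
  proof -
    have mp: "real m > 0" using m m0 by simp
    have "real (nat \<lfloor>real m * t\<rfloor>) = of_int \<lfloor>real m * t\<rfloor>" using t mp by simp
    then have 1: "real (nat \<lfloor>real m * t\<rfloor>) / real m \<le> t" "t - 1 / real m < real (nat \<lfloor>real m * t\<rfloor>) / real m"
      using mp by (auto simp: divide_le_eq less_divide_eq algebra_simps) linarith+
    have "1 / real m \<le> inverse (real m0)" using m m0 by (simp add: inverse_eq_divide frac_le)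
    then have "dist (real (nat \<lfloor>real m * t\<rfloor>) / real m) t < \<delta>" using 1 m0 by (simp add: dist_real_def)
    then have "dist (w (real (nat \<lfloor>real m * t\<rfloor>) / real m)) (w t) < d"
      using 1 t by (intro \<delta>(2)) auto
    then show ?thesis by (simp add: dist_norm)
  qed
  then show ?thesis using m0(1) by blast
qed

lemma continuous_cadlag:
  assumes "continuous_on {0..} w"
  shows "restrict w {0..} \<in> cadlag_space"
proof -
  have 1: "((restrict w {0..}) \<longlongrightarrow> restrict w {0..} t) (at t within {0..})" if "t \<ge> 0" for t
  proof -
    have "continuous_on {0..} (restrict w {0..})" using assms by (rule continuous_on_eq) simp
    then show ?thesis using that unfolding continuous_on_def by blast
  qed
  have "((restrict w {0..}) \<longlongrightarrow> restrict w {0..} t) (at_right t)" if "t \<ge> 0" for t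
    by (rule tendsto_within_subset[OF 1[OF that]]) (use that in auto)
  moreover have "((restrict w {0..}) \<longlongrightarrow> restrict w {0..} t) (at_left t)" if "t > 0" for t
  proof -
    have "at t within {0..} = at t"
      by (rule at_within_open_subset[of t "{0<..}"]) (use that in auto)
    then have "((restrict w {0..}) \<longlongrightarrow> restrict w {0..} t) (at t)" using 1[of t] that by simp
    then show ?thesis by (rule tendsto_mono[rotated]) (simp add: at_le)
  qed
  ultimately show ?thesis unfolding cadlag_space_def cadlag_def by (auto simp: restrict_extensional)
qed

lemma grid_path_tendsto:
  assumes w: "continuous_on {0..} w"
  shows "(\<lambda>m. mdist skorohod_metric (grid_path (real (Suc m)) (\<lambda>i. w (real i / real (Suc m)))) (restrict w {0..})) \<longlonglongrightarrow> 0"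
proof (rule LIMSEQ_I)
  fix e :: real assume e: "0 < e"
  obtain K :: nat where K: "(1/2) ^ K < e / 8" using real_arch_pow_inv[of "e / 8" "1/2"] e(1) by auto
  obtain m0 where m0: "\<And>m t. m \<ge> m0 \<Longrightarrow> 0 \<le> t \<Longrightarrow> t \<le> real K \<Longrightarrow>
      norm (w (real (nat \<lfloor>real m * t\<rfloor>) / real m) - w t) < e / 8"
    using grid_path_modulus[OF w, of "e/8" K] e by auto
  have "norm (mdist skorohod_metric (grid_path (real (Suc m)) (\<lambda>i. w (real i / real (Suc m)))) (restrict w {0..}) - 0) < e"
    if "m \<ge> m0" for m
  proof -
    let ?a = "mdist skorohod_metric (grid_path (real (Suc m)) (\<lambda>i. w (real i / real (Suc m)))) (restrict w {0..})"
    have "?a \<le> 2 * (e / 8 + (1/2) ^ K)"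
    proof (rule skorohod_mdist_le[OF grid_path_cadlag continuous_cadlag[OF w]])
      fix t :: real assume "0 \<le> t" "t \<le> real K"
      then show "norm (grid_path (real (Suc m)) (\<lambda>i. w (real i / real (Suc m))) t - restrict w {0..} t) \<le> e / 8"
        using m0[of "Suc m" t] that by (simp add: grid_path_def del: of_nat_Suc)
    qed (use e in auto)
    then show ?thesis using K e by simp
  qed
  then show "\<exists>m0. \<forall>m\<ge>m0. norm (mdist skorohod_metric (grid_path (real (Suc m)) (\<lambda>i. w (real i / real (Suc m)))) (restrict w {0..}) - 0) < e"
    by blast
qed

lemma fourier_path_eq:
  "fourier_path T D \<theta> n \<omega> = grid_path (real n) (\<lambda>k. fourier_sum T D \<theta> k \<omega> / of_real (sqrt (real n)))"
  by (simp add: fourier_path_def grid_path_def)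

text \<open>A continuous path is the limit of the paths obtained by freezing it on grids of mesh
  \<open>1 / (m + 1)\<close>, and these depend on countably many coordinates only.\<close>

lemma random_element_limit_path:
  assumes "\<forall>t\<ge>0. B1 t \<in> borel_measurable M" "\<forall>t\<ge>0. B2 t \<in> borel_measurable M"
    and "\<forall>\<omega>\<in>space M. continuous_on {0..} (\<lambda>t. B1 t \<omega>)" "\<forall>\<omega>\<in>space M. continuous_on {0..} (\<lambda>t. B2 t \<omega>)"
  shows "random_element M skorohod_metric (limit_path c B1 B2)"
proof -
  define w where "w \<omega> t = of_real c * (of_real (B1 t \<omega>) + \<i> * of_real (B2 t \<omega>))" for \<omega> t
  have eq: "limit_path c B1 B2 = (\<lambda>\<omega>. restrict (w \<omega>) {0..})"
    by (simp add: limit_path_def w_def fun_eq_iff)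
  have cont: "continuous_on {0..} (w \<omega>)" if "\<omega> \<in> space M" for \<omega>
    unfolding w_def using assms(3,4) that by (intro continuous_intros) auto
  show ?thesis unfolding eq
  proof (rule random_element_limit)
    show "random_element M skorohod_metric (\<lambda>\<omega>. grid_path (real (Suc m)) (\<lambda>i. w \<omega> (real i / real (Suc m))))" for m
    proof (rule random_element_grid_path)
      fix i
      have [measurable]: "B1 (real i / real (Suc m)) \<in> borel_measurable M" "B2 (real i / real (Suc m)) \<in> borel_measurable M"
        using assms(1,2) by auto
      show "(\<lambda>\<omega>. w \<omega> (real i / real (Suc m))) \<in> borel_measurable M"
        unfolding w_def by measurable
    qed auto
    show "restrict (w \<omega>) {0..} \<in> mspace skorohod_metric" if "\<omega> \<in> space M" for \<omega>
      using continuous_cadlag[OF cont[OF that]] by (simp add: mspace_skorohod)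
    show "(\<lambda>m. mdist skorohod_metric (grid_path (real (Suc m)) (\<lambda>i. w \<omega> (real i / real (Suc m)))) (restrict (w \<omega>) {0..})) \<longlonglongrightarrow> 0"
      if "\<omega> \<in> space M" for \<omega> using grid_path_tendsto[OF cont[OF that]] .
  qed
qed

section \<open>The ergodic theorem\<close>

locale mpt = prob_space +
  fixes T :: "'a \<Rightarrow> 'a"
  assumes T_measurable [measurable]: "T \<in> measurable M M"
    and T_preserving: "distr M M T = M"
begin

definition orbit_sum :: "('a \<Rightarrow> real) \<Rightarrow> nat \<Rightarrow> 'a \<Rightarrow> real" where
  "orbit_sum f n \<omega> = (\<Sum>k<n. f ((T ^^ k) \<omega>))"

lemma T_iterate_measurable [measurable]: "(T ^^ k) \<in> measurable M M"
  by (induction k) (auto intro: measurable_comp[OF _ T_measurable])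

lemma orbit_sum_measurable [measurable]:
  "f \<in> borel_measurable M \<Longrightarrow> orbit_sum f n \<in> borel_measurable M"
  unfolding orbit_sum_def[abs_def]
  by (intro borel_measurable_sum measurable_compose[OF T_iterate_measurable])

lemma orbit_sum_Suc: "orbit_sum f (Suc n) \<omega> = f \<omega> + orbit_sum f n (T \<omega>)"
  unfolding orbit_sum_def by (subst sum.lessThan_Suc_shift) (simp add: funpow_swap1)

lemma integral_T:
  fixes f :: "'a \<Rightarrow> 'b::{banach, second_countable_topology}"
  assumes [measurable]: "f \<in> borel_measurable M"
  shows "(\<integral>\<omega>. f (T \<omega>) \<partial>M) = (\<integral>\<omega>. f \<omega> \<partial>M)"
  using integral_distr[OF T_measurable assms] by (simp add: T_preserving)

lemma integrable_T:
  fixes f :: "'a \<Rightarrow> 'b::{banach, second_countable_topology}"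
  assumes "integrable M f"
  shows "integrable M (\<lambda>\<omega>. f (T \<omega>))"
  using integrable_distr[OF T_measurable, of f] assms by (simp add: T_preserving)

lemma iterate_preserving: "distr M M (T ^^ k) = M"
proof (induction k)
  case 0
  then show ?case by (simp add: distr_id2)
next
  case (Suc k)
  have "distr M M (T ^^ Suc k) = distr (distr M M (T ^^ k)) M T"
    by (subst distr_distr) auto
  then show ?case using Suc T_preserving by (simp add: o_def)
qed

lemma mpt_iterate: "mpt M (T ^^ k)"
  by unfold_locales (auto simp: iterate_preserving)

lemma T_space: "\<omega> \<in> space M \<Longrightarrow> T \<omega> \<in> space M"
  using measurable_space[OF T_measurable] .

primrec max_sum :: "('a \<Rightarrow> real) \<Rightarrow> nat \<Rightarrow> 'a \<Rightarrow> real" where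
  "max_sum f 0 \<omega> = 0"
| "max_sum f (Suc n) \<omega> = max (max_sum f n \<omega>) (orbit_sum f (Suc n) \<omega>)"

lemma max_sum_measurable [measurable]: "f \<in> borel_measurable M \<Longrightarrow> max_sum f n \<in> borel_measurable M"
  by (induction n) (auto simp: fun_eq_iff[symmetric] max_sum.simps[abs_def])

lemma max_sum_nonneg: "0 \<le> max_sum f n \<omega>"
  by (induction n) auto

lemma orbit_sum_le_max_sum: "k \<le> n \<Longrightarrow> orbit_sum f k \<omega> \<le> max_sum f n \<omega>"
proof (induction n)
  case (Suc n)
  then show ?case by (cases "k = Suc n") (auto simp: le_max_iff_disj)
qed (simp add: orbit_sum_def)

lemma max_sum_attained: "max_sum f n \<omega> > 0 \<Longrightarrow> \<exists>k<n. max_sum f n \<omega> = orbit_sum f (Suc k) \<omega>"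
proof (induction n)
  case (Suc n)
  show ?case
  proof (cases "max_sum f n \<omega> \<ge> orbit_sum f (Suc n) \<omega>")
    case True
    then show ?thesis using Suc by (auto simp: max_absorb1 less_Suc_eq)
  next
    case False
    then show ?thesis by (intro exI[of _ n]) (simp add: max_absorb2)
  qed
qed simp

text \<open>Where the maximum is positive it is attained by a sum of at least one term, and removing the
  first term of that sum leaves an orbit sum of \<open>T \<omega>\<close>.\<close>

lemma max_sum_step: "max_sum f n \<omega> > 0 \<Longrightarrow> max_sum f n \<omega> \<le> f \<omega> + max_sum f n (T \<omega>)"
  using max_sum_attained[of f n \<omega>] orbit_sum_le_max_sum[of _ n f "T \<omega>"]
  by (auto simp: orbit_sum_Suc)

lemma integrable_orbit_sum: "integrable M f \<Longrightarrow> integrable M (orbit_sum f n)"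
  unfolding orbit_sum_def[abs_def]
  by (intro Bochner_Integration.integrable_sum mpt.integrable_T[OF mpt_iterate])

lemma integrable_max_sum: "integrable M f \<Longrightarrow> integrable M (max_sum f n)"
  by (induction n) (auto simp: max_sum.simps[abs_def] intro: integrable_orbit_sum)

definition invariant :: "'a set \<Rightarrow> bool" where
  "invariant A \<longleftrightarrow> A \<in> sets M \<and> T -` A \<inter> space M = A"

text \<open>Garsia's proof.  On the set where \<open>max_sum f n > 0\<close> one has
  \<open>max_sum f n - max_sum f n \<circ> T \<le> f\<close>, and elsewhere the left-hand side is at most 0.  Its integral over
  an invariant set is 0, so the integral of \<open>f\<close> over the part of \<open>A\<close> with \<open>max_sum f n > 0\<close> is
  nonnegative.  These parts increase to \<open>A\<close>.\<close>

lemma maximal_ergodic: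
  assumes f: "integrable M f" and A: "invariant A"
    and pos: "\<And>\<omega>. \<omega> \<in> A \<Longrightarrow> \<exists>n. orbit_sum f (Suc n) \<omega> > 0"
  shows "(\<integral>\<omega>. indicator A \<omega> * f \<omega> \<partial>M) \<ge> 0"
proof -
  have [measurable]: "f \<in> borel_measurable M" "A \<in> sets M" using f A by (auto simp: invariant_def)
  have AT: "indicator A (T \<omega>) = (indicator A \<omega> :: real)" if "\<omega> \<in> space M" for \<omega>
    using A that unfolding invariant_def by (auto simp: indicator_def)
  define P where "P n = {\<omega> \<in> space M. max_sum f n \<omega> > 0}" for n
  have [measurable]: "P n \<in> sets M" for n unfolding P_def by measurable
  have fin: "integrable M (\<lambda>\<omega>. indicator A \<omega> * (indicator (P n) \<omega> * f \<omega>))" for n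
    by (rule Bochner_Integration.integrable_bound[OF f]) (auto simp: indicator_def)
  have "(\<integral>\<omega>. indicator A \<omega> * (indicator (P n) \<omega> * f \<omega>) \<partial>M) \<ge> 0" for n
  proof -
    have i1: "integrable M (\<lambda>\<omega>. indicator A \<omega> * max_sum f n \<omega>)"
      by (rule Bochner_Integration.integrable_bound[OF integrable_max_sum[OF f, of n]]) (auto simp: indicator_def)
    have i2: "integrable M (\<lambda>\<omega>. indicator A (T \<omega>) * max_sum f n (T \<omega>))"
      using integrable_T[OF i1] .
    have "0 = (\<integral>\<omega>. indicator A \<omega> * max_sum f n \<omega> \<partial>M) - (\<integral>\<omega>. indicator A (T \<omega>) * max_sum f n (T \<omega>) \<partial>M)"
      using integral_T[of "\<lambda>\<omega>. indicator A \<omega> * max_sum f n \<omega>"] by simp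
    also have "\<dots> = (\<integral>\<omega>. indicator A \<omega> * max_sum f n \<omega> - indicator A (T \<omega>) * max_sum f n (T \<omega>) \<partial>M)"
      by (rule Bochner_Integration.integral_diff[symmetric, OF i1 i2])
    also have "\<dots> \<le> (\<integral>\<omega>. indicator A \<omega> * (indicator (P n) \<omega> * f \<omega>) \<partial>M)"
    proof (rule integral_mono[OF Bochner_Integration.integrable_diff[OF i1 i2] fin])
      fix \<omega> assume w: "\<omega> \<in> space M"
      show "indicator A \<omega> * max_sum f n \<omega> - indicator A (T \<omega>) * max_sum f n (T \<omega>) \<le>
          indicator A \<omega> * (indicator (P n) \<omega> * f \<omega>)"
        using max_sum_step[of f n \<omega>] max_sum_nonneg[of f n "T \<omega>"] max_sum_nonneg[of f n \<omega>] w
        unfolding AT[OF w] by (auto simp: indicator_def P_def)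
    qed
    finally show ?thesis .
  qed
  moreover have "(\<lambda>n. \<integral>\<omega>. indicator A \<omega> * (indicator (P n) \<omega> * f \<omega>) \<partial>M) \<longlonglongrightarrow> (\<integral>\<omega>. indicator A \<omega> * f \<omega> \<partial>M)"
  proof (rule integral_dominated_convergence[where w = "\<lambda>\<omega>. \<bar>f \<omega>\<bar>"])
    show "AE \<omega> in M. (\<lambda>n. indicator A \<omega> * (indicator (P n) \<omega> * f \<omega>)) \<longlonglongrightarrow> indicator A \<omega> * f \<omega>"
    proof (rule AE_I2)
      fix \<omega> assume w: "\<omega> \<in> space M"
      show "(\<lambda>n. indicator A \<omega> * (indicator (P n) \<omega> * f \<omega>)) \<longlonglongrightarrow> indicator A \<omega> * f \<omega>"
      proof (cases "\<omega> \<in> A")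
        case True
        then obtain N where N: "orbit_sum f (Suc N) \<omega> > 0" using pos by blast
        have "max_sum f n \<omega> > 0" if "n \<ge> Suc N" for n
          using N orbit_sum_le_max_sum[OF that, of f \<omega>] by linarith
        then have "eventually (\<lambda>n. indicator A \<omega> * (indicator (P n) \<omega> * f \<omega>) = indicator A \<omega> * f \<omega>) sequentially"
          using w by (auto simp: eventually_sequentially P_def indicator_def)
        then show ?thesis by (rule tendsto_eventually)
      qed simp
    qed
  qed (use f in \<open>auto simp: indicator_def\<close>)
  ultimately show ?thesis by (intro LIMSEQ_le_const) auto
qed

text \<open>The points where the upper limit of the averages exceeds \<open>a\<close>.  The slack \<open>1 / (j + 1)\<close> makes
  room for the change of finitely many terms of the sum, so that the set is invariant at every point
  and not just up to a null set.\<close>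

definition upper_set :: "('a \<Rightarrow> real) \<Rightarrow> real \<Rightarrow> 'a set" where
  "upper_set f a = {\<omega> \<in> space M. \<exists>j::nat. \<exists>\<^sub>\<infinity>n. orbit_sum f n \<omega> \<ge> (a + 1 / real (Suc j)) * real n}"

lemma upper_set_measurable [measurable]:
  assumes [measurable]: "f \<in> borel_measurable M"
  shows "upper_set f a \<in> sets M"
  unfolding upper_set_def INFM_nat_le by measurable

text \<open>A bounded change \<open>C\<close> is absorbed, for large \<open>n\<close>, by passing from the slack \<open>1 / (j + 1)\<close> to
  \<open>1 / (j + 2)\<close>.  The index map \<open>g\<close> is a shift by one in either direction.\<close>

lemma frequently_ge_perturb:
  fixes s s' :: "nat \<Rightarrow> real"
  assumes s: "\<exists>\<^sub>\<infinity>n. s n \<ge> (a + 1 / real (Suc j)) * real n"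
    and diff: "\<And>n. s n \<ge> (a + 1 / real (Suc j)) * real n \<Longrightarrow> s' (g n) \<ge> (a + 1 / real (Suc j)) * real (g n) - C"
    and g: "\<And>n. n \<le> Suc (g n)"
  shows "\<exists>j::nat. \<exists>\<^sub>\<infinity>n. s' n \<ge> (a + 1 / real (Suc j)) * real n"
proof (rule exI[of _ "Suc j"], unfold INFM_nat_le, intro allI)
  fix m :: nat
  define \<delta> where "\<delta> = 1 / real (Suc j) - 1 / real (Suc (Suc j))"
  have \<delta>: "\<delta> > 0" unfolding \<delta>_def by (simp add: frac_less2)
  obtain N where N: "C / \<delta> \<le> real N" using real_arch_simple by blast
  obtain n where n: "n \<ge> Suc (m + N)" "s n \<ge> (a + 1 / real (Suc j)) * real n"
    using s unfolding INFM_nat_le by blast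
  have gn: "g n \<ge> m" "real (g n) \<ge> real N" using g[of n] n(1) by auto
  have "C / \<delta> \<le> real (g n)" using N gn(2) by linarith
  then have "C \<le> real (g n) * \<delta>" using \<delta> by (simp only: pos_divide_le_eq)
  then have "s' (g n) \<ge> (a + 1 / real (Suc (Suc j))) * real (g n)"
    using diff[OF n(2)] unfolding \<delta>_def by (simp add: algebra_simps)
  then show "\<exists>n\<ge>m. s' n \<ge> (a + 1 / real (Suc (Suc j))) * real n" using gn by blast
qed

lemma upper_set_invariant:
  assumes "f \<in> borel_measurable M"
  shows "invariant (upper_set f a)"
proof -
  have "T \<omega> \<in> upper_set f a \<longleftrightarrow> \<omega> \<in> upper_set f a" if w: "\<omega> \<in> space M" for \<omega>
  proof
    assume "T \<omega> \<in> upper_set f a"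
    then obtain j where "\<exists>\<^sub>\<infinity>n. orbit_sum f n (T \<omega>) \<ge> (a + 1 / real (Suc j)) * real n"
      unfolding upper_set_def by blast
    moreover have "orbit_sum f (Suc n) \<omega> \<ge> (a + 1 / real (Suc j)) * real (Suc n) - (\<bar>f \<omega>\<bar> + \<bar>a + 1 / real (Suc j)\<bar>)"
      if "orbit_sum f n (T \<omega>) \<ge> (a + 1 / real (Suc j)) * real n" for n
    proof -
      have "(a + 1 / real (Suc j)) * real (Suc n) = (a + 1 / real (Suc j)) * real n + (a + 1 / real (Suc j))"
        by (simp add: distrib_left)
      then show ?thesis using that unfolding orbit_sum_Suc by linarith
    qed
    ultimately have "\<exists>j::nat. \<exists>\<^sub>\<infinity>n. orbit_sum f n \<omega> \<ge> (a + 1 / real (Suc j)) * real n"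
      by (rule frequently_ge_perturb[where g = Suc]) auto
    then show "\<omega> \<in> upper_set f a" using w by (simp add: upper_set_def)
  next
    assume "\<omega> \<in> upper_set f a"
    then obtain j where "\<exists>\<^sub>\<infinity>n. orbit_sum f n \<omega> \<ge> (a + 1 / real (Suc j)) * real n"
      unfolding upper_set_def by blast
    moreover have "orbit_sum f (n - 1) (T \<omega>) \<ge> (a + 1 / real (Suc j)) * real (n - 1) - (\<bar>f \<omega>\<bar> + \<bar>a + 1 / real (Suc j)\<bar>)"
      if "orbit_sum f n \<omega> \<ge> (a + 1 / real (Suc j)) * real n" for n
    proof (cases n)
      case 0
      then show ?thesis by (simp add: orbit_sum_def)
    next
      case (Suc k)
      have "(a + 1 / real (Suc j)) * real (Suc k) = (a + 1 / real (Suc j)) * real k + (a + 1 / real (Suc j))"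
        by (simp add: distrib_left)
      then show ?thesis using that unfolding Suc orbit_sum_Suc diff_Suc_1 by linarith
    qed
    ultimately have "\<exists>j::nat. \<exists>\<^sub>\<infinity>n. orbit_sum f n (T \<omega>) \<ge> (a + 1 / real (Suc j)) * real n"
      by (rule frequently_ge_perturb[where g = "\<lambda>n. n - 1"]) auto
    then show "T \<omega> \<in> upper_set f a" using T_space[OF w] by (simp add: upper_set_def)
  qed
  moreover have "upper_set f a \<subseteq> space M" by (auto simp: upper_set_def)
  ultimately show ?thesis using upper_set_measurable[OF assms] by (auto simp: invariant_def)
qed

text \<open>On \<open>A\<close> some orbit sum of \<open>f - a\<close> is positive, so the maximal inequality applies to \<open>f - a\<close>.\<close>

lemma upper_set_integral:
  assumes f: "integrable M f" and A: "invariant A" "A \<subseteq> upper_set f a"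
  shows "a * prob A \<le> (\<integral>\<omega>. indicator A \<omega> * f \<omega> \<partial>M)"
proof -
  have [measurable]: "f \<in> borel_measurable M" "A \<in> sets M" using f A by (auto simp: invariant_def)
  have "(\<integral>\<omega>. indicator A \<omega> * (f \<omega> - a) \<partial>M) \<ge> 0"
  proof (rule maximal_ergodic[OF _ A(1)])
    show "integrable M (\<lambda>\<omega>. f \<omega> - a)" using f by simp
    fix \<omega> assume "\<omega> \<in> A"
    then obtain j where "\<exists>\<^sub>\<infinity>n. orbit_sum f n \<omega> \<ge> (a + 1 / real (Suc j)) * real n"
      using A(2) by (auto simp: upper_set_def)
    then obtain n where n: "n \<ge> 1" "orbit_sum f n \<omega> \<ge> (a + 1 / real (Suc j)) * real n"
      unfolding INFM_nat_le by blast
    have "orbit_sum (\<lambda>\<omega>. f \<omega> - a) n \<omega> = orbit_sum f n \<omega> - a * real n"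
      by (simp add: orbit_sum_def sum_subtractf)
    also have "\<dots> \<ge> (1 / real (Suc j)) * real n" using n(2) by (simp add: algebra_simps)
    finally have "orbit_sum (\<lambda>\<omega>. f \<omega> - a) n \<omega> \<ge> (1 / real (Suc j)) * real n" .
    moreover have "(1 / real (Suc j)) * real n > 0" using n(1) by simp
    ultimately have "orbit_sum (\<lambda>\<omega>. f \<omega> - a) n \<omega> > 0" by linarith
    then show "\<exists>n. orbit_sum (\<lambda>\<omega>. f \<omega> - a) (Suc n) \<omega> > 0"
      using n(1) by (intro exI[of _ "n - 1"]) simp
  qed
  also have "(\<integral>\<omega>. indicator A \<omega> * (f \<omega> - a) \<partial>M) = (\<integral>\<omega>. indicator A \<omega> * f \<omega> \<partial>M) - a * prob A"
  proof -
    have "integrable M (\<lambda>\<omega>. indicator A \<omega> * f \<omega>)"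
      by (rule Bochner_Integration.integrable_bound[OF f]) (auto simp: indicator_def)
    moreover have "integrable M (\<lambda>\<omega>. a * indicator A \<omega>)"
      by (rule integrable_const_bound[where B = "\<bar>a\<bar>"]) (auto simp: indicator_def)
    ultimately have "(\<integral>\<omega>. indicator A \<omega> * f \<omega> - a * indicator A \<omega> \<partial>M) =
        (\<integral>\<omega>. indicator A \<omega> * f \<omega> \<partial>M) - (\<integral>\<omega>. a * indicator A \<omega> \<partial>M)"
      by (rule Bochner_Integration.integral_diff)
    then show ?thesis by (simp add: right_diff_distrib mult.commute)
  qed
  finally show ?thesis by simp
qed

lemma orbit_sum_uminus: "orbit_sum (\<lambda>\<omega>. - f \<omega>) n \<omega> = - orbit_sum f n \<omega>"
  by (simp add: orbit_sum_def sum_negf)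

lemma not_upper_set:
  assumes "\<omega> \<in> space M" "\<omega> \<notin> upper_set f a" "a < b"
  shows "eventually (\<lambda>n. orbit_sum f n \<omega> / real n < b) sequentially"
proof -
  obtain j where "inverse (real (Suc j)) < b - a" using reals_Archimedean[of "b - a"] assms(3) by auto
  then have j: "a + 1 / real (Suc j) < b" by (simp add: inverse_eq_divide)
  have "eventually (\<lambda>n. orbit_sum f n \<omega> < (a + 1 / real (Suc j)) * real n) sequentially"
    using assms(1,2) by (auto simp: upper_set_def not_INFM MOST_nat_le not_le eventually_sequentially)
  with eventually_gt_at_top[of 0] show ?thesis
  proof eventually_elim
    case (elim n)
    have "orbit_sum f n \<omega> / real n < a + 1 / real (Suc j)" using elim by (simp add: pos_divide_less_eq)
    then show ?case using j by linarith
  qed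
qed

text \<open>If the lower limit of the averages is below \<open>a\<close> and the upper limit above \<open>b > a\<close> on a set of
  positive measure, \<open>upper_set_integral\<close> for \<open>f\<close> and for \<open>- f\<close> puts the integral of \<open>f\<close> over that
  invariant set between \<open>b\<close> times and \<open>a\<close> times its measure.  Rational \<open>a\<close> and \<open>b\<close> suffice.  The same
  estimate with \<open>b \<rightarrow> \<infinity>\<close> excludes infinite limits.  This level of
  generality is used for the product of \<open>T\<close> with a rotation, which need not be ergodic.\<close>

theorem birkhoff_convergent:
  assumes f: "integrable M f"
  shows "AE \<omega> in M. convergent (\<lambda>n. orbit_sum f n \<omega> / real n)"
proof -
  have [measurable]: "f \<in> borel_measurable M" using f by auto
  have inv_Int: "invariant (A \<inter> B)" if "invariant A" "invariant B" for A B
    using that unfolding invariant_def by (auto simp: vimage_Int)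
  note up = upper_set_invariant
  have cross: "AE \<omega> in M. \<omega> \<notin> upper_set f b \<inter> upper_set (\<lambda>\<omega>. - f \<omega>) (- a)" if "a < b" for a b
  proof -
    let ?C = "upper_set f b \<inter> upper_set (\<lambda>\<omega>. - f \<omega>) (- a)"
    have C: "invariant ?C" by (intro inv_Int up) auto
    have "b * prob ?C \<le> (\<integral>\<omega>. indicator ?C \<omega> * f \<omega> \<partial>M)"
      by (rule upper_set_integral[OF f C]) auto
    moreover have "- a * prob ?C \<le> (\<integral>\<omega>. indicator ?C \<omega> * - f \<omega> \<partial>M)"
      by (rule upper_set_integral[OF _ C]) (use f in auto)
    ultimately have "(b - a) * prob ?C \<le> 0" by (simp add: algebra_simps)
    then have "prob ?C = 0" using that by (simp add: mult_le_0_iff measure_le_0_iff)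
    then show ?thesis using C by (intro AE_not_in) (auto simp: null_sets_def invariant_def emeasure_eq_measure)
  qed
  have bnd: "AE \<omega> in M. \<exists>b::nat. \<omega> \<notin> upper_set g (real b)" if g: "integrable M g" for g
  proof -
    have [measurable]: "g \<in> borel_measurable M" using g by auto
    let ?C = "\<Inter>b::nat. upper_set g (real b)"
    have "T -` ?C \<inter> space M = (\<Inter>b::nat. T -` upper_set g (real b) \<inter> space M)" by auto
    also have "\<dots> = ?C" using up[of g] unfolding invariant_def by simp
    finally have C: "invariant ?C" unfolding invariant_def by simp
    have "real b * prob ?C \<le> (\<integral>\<omega>. indicator ?C \<omega> * g \<omega> \<partial>M)" for b
      by (rule upper_set_integral[OF g C]) auto
    then have *: "real b * prob ?C \<le> (\<integral>\<omega>. indicator ?C \<omega> * g \<omega> \<partial>M)" for b .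
    have "prob ?C = 0"
    proof (rule ccontr)
      assume "prob ?C \<noteq> 0"
      then have "prob ?C > 0" using measure_nonneg[of M ?C] by linarith
      then obtain b :: nat where "(\<integral>\<omega>. indicator ?C \<omega> * g \<omega> \<partial>M) < real b * prob ?C"
        using reals_Archimedean3 by blast
      then show False using *[of b] by linarith
    qed
    then have "AE \<omega> in M. \<omega> \<notin> ?C"
      using C by (intro AE_not_in) (auto simp: null_sets_def invariant_def emeasure_eq_measure)
    then show ?thesis by eventually_elim auto
  qed
  have "AE \<omega> in M. \<forall>p\<in>{p :: rat \<times> rat. fst p < snd p}.
      \<omega> \<notin> upper_set f (of_rat (snd p)) \<inter> upper_set (\<lambda>\<omega>. - f \<omega>) (- of_rat (fst p))"
    by (subst AE_ball_countable) (auto intro: cross simp: of_rat_less simp del: Int_iff)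
  moreover have "AE \<omega> in M. \<exists>b::nat. \<omega> \<notin> upper_set f (real b)" by (rule bnd[OF f])
  moreover have "AE \<omega> in M. \<exists>b::nat. \<omega> \<notin> upper_set (\<lambda>\<omega>. - f \<omega>) (real b)" by (rule bnd) (use f in simp)
  ultimately show ?thesis using AE_space
  proof eventually_elim
    case (elim \<omega>)
    note 1 = elim(1) and 2 = elim(2) and 3 = elim(3) and w = elim(4)
    let ?a = "\<lambda>n. orbit_sum f n \<omega> / real n"
    obtain b where b: "eventually (\<lambda>n. ?a n < b) sequentially" using 2 not_upper_set[OF w] by (metis less_add_one)
    obtain c where "eventually (\<lambda>n. orbit_sum (\<lambda>\<omega>. - f \<omega>) n \<omega> / real n < c) sequentially"
      using 3 not_upper_set[OF w] by (metis less_add_one)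
    then have c: "eventually (\<lambda>n. - c < ?a n) sequentially"
      by eventually_elim (simp add: orbit_sum_uminus)
    have lim: "liminf (\<lambda>n. ereal (?a n)) = limsup (\<lambda>n. ereal (?a n))"
    proof (rule antisym)
      show "liminf (\<lambda>n. ereal (?a n)) \<le> limsup (\<lambda>n. ereal (?a n))" by (rule Liminf_le_Limsup) simp
      show "limsup (\<lambda>n. ereal (?a n)) \<le> liminf (\<lambda>n. ereal (?a n))"
      proof (rule ccontr)
        assume "\<not> ?thesis"
        then have lt: "liminf (\<lambda>n. ereal (?a n)) < limsup (\<lambda>n. ereal (?a n))" by simp
        then obtain x :: real where x: "liminf (\<lambda>n. ereal (?a n)) < ereal x" "ereal x < limsup (\<lambda>n. ereal (?a n))"
          using ereal_dense2 by blast
        then obtain y :: real where y: "ereal x < ereal y" "ereal y < limsup (\<lambda>n. ereal (?a n))"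
          using ereal_dense2 by blast
        have "x < y" using y(1) by simp
        then obtain p :: rat where p: "x < of_rat p" "of_rat p < y" using of_rat_dense by blast
        then obtain q :: rat where q: "of_rat p < (of_rat q :: real)" "of_rat q < y" using of_rat_dense by blast
        note pq = p(1) q
        have "p < q" using q(1) by (simp add: of_rat_less)
        then have "\<omega> \<notin> upper_set f (of_rat q) \<or> \<omega> \<notin> upper_set (\<lambda>\<omega>. - f \<omega>) (- of_rat p)" using 1 by auto
        then show False
        proof
          assume "\<omega> \<notin> upper_set f (of_rat q)"
          from not_upper_set[OF w this pq(3)]
          have "eventually (\<lambda>n. ereal (?a n) \<le> ereal y) sequentially" by eventually_elim simp
          then have "limsup (\<lambda>n. ereal (?a n)) \<le> ereal y" by (rule Limsup_bounded)
          then show False using y(2) by simp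
        next
          assume "\<omega> \<notin> upper_set (\<lambda>\<omega>. - f \<omega>) (- of_rat p)"
          from not_upper_set[OF w this, of "- x"] pq(1)
          have "eventually (\<lambda>n. ereal x \<le> ereal (?a n)) sequentially"
            by (auto elim!: eventually_mono simp: orbit_sum_uminus)
          then have "ereal x \<le> liminf (\<lambda>n. ereal (?a n))" by (rule Liminf_bounded)
          then show False using x(1) by simp
        qed
      qed
    qed
    have "limsup (\<lambda>n. ereal (?a n)) \<le> ereal b"
      by (rule Limsup_bounded) (use b in \<open>auto elim: eventually_mono\<close>)
    moreover have "ereal (- c) \<le> liminf (\<lambda>n. ereal (?a n))"
      by (rule Liminf_bounded) (use c in \<open>auto elim: eventually_mono\<close>)
    ultimately obtain l where l: "limsup (\<lambda>n. ereal (?a n)) = ereal l"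
      using lim by (cases "limsup (\<lambda>n. ereal (?a n))") auto
    then have "(\<lambda>n. ereal (?a n)) \<longlonglongrightarrow> ereal l"
      using lim Liminf_eq_Limsup[of sequentially "\<lambda>n. ereal (?a n)"] by simp
    then show ?case by (auto simp: convergent_def)
  qed
qed

text \<open>For \<open>a\<close> above the mean, an invariant set of full measure inside \<open>upper_set f a\<close> would contradict
  \<open>upper_set_integral\<close>; ergodicity leaves only measure 0.\<close>

theorem birkhoff_ergodic:
  assumes erg: "ergodic M T" and f: "integrable M f"
  shows "AE \<omega> in M. (\<lambda>n. orbit_sum f n \<omega> / real n) \<longlonglongrightarrow> (\<integral>\<omega>. f \<omega> \<partial>M)"
proof -
  have null: "AE \<omega> in M. \<omega> \<notin> upper_set g a" if g: "integrable M g" and a: "a > (\<integral>\<omega>. g \<omega> \<partial>M)" for g a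
  proof -
    have inv: "invariant (upper_set g a)" using g by (intro upper_set_invariant) auto
    then have "prob (upper_set g a) = 0 \<or> prob (upper_set g a) = 1"
      using erg unfolding ergodic_def invariant_def by blast
    moreover have "prob (upper_set g a) \<noteq> 1"
    proof
      assume p: "prob (upper_set g a) = 1"
      have "a * 1 \<le> (\<integral>\<omega>. indicator (upper_set g a) \<omega> * g \<omega> \<partial>M)"
        using upper_set_integral[OF g inv order_refl] p by simp
      also have "\<dots> = (\<integral>\<omega>. g \<omega> \<partial>M)"
      proof (rule integral_cong_AE)
        have "AE \<omega> in M. \<omega> \<in> upper_set g a" using p inv by (intro AE_prob_1) auto
        then show "AE \<omega> in M. indicator (upper_set g a) \<omega> * g \<omega> = g \<omega>" by eventually_elim simp
      qed (use g inv in \<open>auto simp: invariant_def\<close>)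
      finally show False using a by simp
    qed
    ultimately have "prob (upper_set g a) = 0" by blast
    then show ?thesis using inv by (intro AE_not_in) (auto simp: null_sets_def invariant_def emeasure_eq_measure)
  qed
  have up: "AE \<omega> in M. \<forall>j::nat. \<omega> \<notin> upper_set g ((\<integral>\<omega>. g \<omega> \<partial>M) + 1 / real (Suc j))"
    if "integrable M g" for g
    by (subst AE_all_countable) (auto intro: null[OF that] simp del: of_nat_Suc)
  have ev: "eventually (\<lambda>n. orbit_sum g n \<omega> / real n < b) sequentially"
    if *: "\<forall>j::nat. \<omega> \<notin> upper_set g (I + 1 / real (Suc j))" "I < b" "\<omega> \<in> space M" for g \<omega> I b
  proof -
    obtain j where "inverse (real (Suc j)) < b - I" using reals_Archimedean[of "b - I"] *(2) by auto
    then have "I + 1 / real (Suc j) < b" by (simp add: inverse_eq_divide)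
    then show ?thesis using not_upper_set[OF *(3)] *(1) by blast
  qed
  have up2: "AE \<omega> in M. \<forall>j::nat. \<omega> \<notin> upper_set (\<lambda>\<omega>. - f \<omega>) (- (\<integral>\<omega>. f \<omega> \<partial>M) + 1 / real (Suc j))"
    using up[of "\<lambda>\<omega>. - f \<omega>"] f by simp
  from up[OF f] up2 AE_space show ?thesis
  proof eventually_elim
    case (elim \<omega>)
    show ?case
    proof (rule order_tendstoI)
      show "eventually (\<lambda>n. orbit_sum f n \<omega> / real n < b) sequentially" if "(\<integral>\<omega>. f \<omega> \<partial>M) < b" for b
        by (rule ev[OF elim(1) that elim(3)])
      show "eventually (\<lambda>n. b < orbit_sum f n \<omega> / real n) sequentially" if "b < (\<integral>\<omega>. f \<omega> \<partial>M)" for b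
        using ev[OF elim(2) _ elim(3), of "- b"] that by (auto elim!: eventually_mono simp: orbit_sum_uminus)
    qed
  qed
qed

end

section \<open>Rotated ergodic averages\<close>

text \<open>The circle is \<open>[0, 1)\<close> with addition modulo 1; \<open>rotate1 \<alpha>\<close> is addition of \<open>\<alpha>\<close>, for
  \<open>0 \<le> \<alpha> < 1\<close>.\<close>

definition circle_measure :: "real measure" where
  "circle_measure = uniform_measure lborel {0..<1}"

definition rotate1 :: "real \<Rightarrow> real \<Rightarrow> real" where
  "rotate1 \<alpha> u = (if u + \<alpha> < 1 then u + \<alpha> else u + \<alpha> - 1)"

lemma circle_measure_prob_space: "prob_space circle_measure"
  unfolding circle_measure_def by (rule prob_space_uniform_measure) auto

lemma sets_circle_measure [measurable_cong, simp]: "sets circle_measure = sets borel"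
  by (simp add: circle_measure_def)

lemma rotate1_measurable [measurable]: "rotate1 \<alpha> \<in> borel_measurable borel"
  unfolding rotate1_def[abs_def] by measurable

lemma emeasure_lborel_shift: "A \<in> sets borel \<Longrightarrow> emeasure lborel ((\<lambda>u. c + u) -` A) = emeasure lborel A" for c :: real
  using emeasure_distr[of "(+) c" lborel borel A] by (simp add: lborel_distr_plus)

text \<open>The preimage of a set consists of a translate of its part in \<open>[\<alpha>, 1)\<close> and a translate of its
  part in \<open>[0, \<alpha>)\<close>.\<close>

lemma rotate1_preserving:
  assumes \<alpha>: "0 \<le> \<alpha>" "\<alpha> < 1"
  shows "distr circle_measure circle_measure (rotate1 \<alpha>) = circle_measure"
proof (rule measure_eqI)
  fix A assume "A \<in> sets (distr circle_measure circle_measure (rotate1 \<alpha>))"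
  then have A [measurable]: "A \<in> sets borel" by simp
  have e: "emeasure circle_measure B = emeasure lborel ({0..<1} \<inter> B)" if "B \<in> sets borel" for B
    using that unfolding circle_measure_def by (subst emeasure_uniform_measure) (auto simp: divide_ennreal_def)
  have "emeasure (distr circle_measure circle_measure (rotate1 \<alpha>)) A = emeasure circle_measure (rotate1 \<alpha> -` A)"
    by (subst emeasure_distr) (auto simp: space_uniform_measure circle_measure_def)
  also have "\<dots> = emeasure lborel ({0..<1} \<inter> rotate1 \<alpha> -` A)"
    by (rule e) (use measurable_sets[OF rotate1_measurable A] in simp)
  also have "{0..<1} \<inter> rotate1 \<alpha> -` A = ((\<lambda>u. \<alpha> + u) -` (A \<inter> {\<alpha>..<1})) \<union> ((\<lambda>u. (\<alpha> - 1) + u) -` (A \<inter> {0..<\<alpha>}))"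
    using \<alpha> by (auto simp: rotate1_def add.commute add_diff_eq split: if_splits)
  also have "emeasure lborel \<dots> = emeasure lborel ((\<lambda>u. \<alpha> + u) -` (A \<inter> {\<alpha>..<1})) + emeasure lborel ((\<lambda>u. (\<alpha> - 1) + u) -` (A \<inter> {0..<\<alpha>}))"
  proof (rule plus_emeasure[symmetric])
    show "(\<lambda>u. \<alpha> + u) -` (A \<inter> {\<alpha>..<1}) \<in> sets lborel" "(\<lambda>u. (\<alpha> - 1) + u) -` (A \<inter> {0..<\<alpha>}) \<in> sets lborel"
      by (auto intro!: measurable_sets_borel[of _ borel])
  qed auto
  also have "\<dots> = emeasure lborel (A \<inter> {\<alpha>..<1}) + emeasure lborel (A \<inter> {0..<\<alpha>})"
    by (subst (1 2) emeasure_lborel_shift) auto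
  also have "\<dots> = emeasure lborel ((A \<inter> {\<alpha>..<1}) \<union> (A \<inter> {0..<\<alpha>}))"
    by (rule plus_emeasure) auto
  also have "(A \<inter> {\<alpha>..<1}) \<union> (A \<inter> {0..<\<alpha>}) = {0..<1} \<inter> A" using \<alpha> by auto
  also have "emeasure lborel \<dots> = emeasure circle_measure A" by (simp add: e)
  finally show "emeasure (distr circle_measure circle_measure (rotate1 \<alpha>)) A = emeasure circle_measure A" .
qed simp

lemma cis_rotate1: "cis (2 * pi * rotate1 \<alpha> u) = cis (2 * pi * u) * cis (2 * pi * \<alpha>)"
proof -
  have "cis (2 * pi * (u + \<alpha> - 1)) = cis (2 * pi * (u + \<alpha>)) * cis (2 * pi * -1)"
    unfolding cis_mult by (simp add: algebra_simps)
  also have "cis (2 * pi * -1) = 1" by (simp add: complex_eq_iff)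
  finally have "cis (2 * pi * (u + \<alpha> - 1)) = cis (2 * pi * (u + \<alpha>))" by simp
  then show ?thesis by (simp add: rotate1_def cis_mult distrib_left)
qed

context mpt
begin

text \<open>Along the orbit of \<open>(\<omega>, u)\<close> under \<open>T \<times> rotate1 \<alpha>\<close> the function
  \<open>cis (2 * pi * u) * Y \<omega>\<close> takes the values \<open>cis (2 * pi * u)\<close> times the rotated terms.  The factor
  \<open>cis (2 * pi * u)\<close> is a constant of modulus 1, so convergence at almost every \<open>(\<omega>, u)\<close> is convergence
  at almost every \<open>\<omega>\<close>.\<close>

lemma rotated_average_convergent:
  fixes Y :: "'a \<Rightarrow> complex"
  assumes Y: "integrable M Y" and \<alpha>: "0 \<le> \<alpha>" "\<alpha> < 1"
  shows "AE \<omega> in M. convergent (\<lambda>n. (\<Sum>k<n. cis (2 * pi * \<alpha>) ^ k * Y ((T ^^ k) \<omega>)) / of_nat n)"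
proof -
  interpret C: prob_space circle_measure by (rule circle_measure_prob_space)
  interpret P: pair_prob_space M circle_measure by unfold_locales
  define S where "S p = (T (fst p), rotate1 \<alpha> (snd p))" for p :: "'a \<times> real"
  have [measurable]: "Y \<in> borel_measurable M" using Y by auto
  have Rm [measurable]: "rotate1 \<alpha> \<in> measurable circle_measure circle_measure"
    using rotate1_measurable by (simp cong: measurable_cong_sets)
  have Sm [measurable]: "S \<in> measurable (M \<Otimes>\<^sub>M circle_measure) (M \<Otimes>\<^sub>M circle_measure)"
    unfolding S_def[abs_def] by measurable
  interpret S: mpt "M \<Otimes>\<^sub>M circle_measure" S
  proof
    have "distr M M T \<Otimes>\<^sub>M distr circle_measure circle_measure (rotate1 \<alpha>) =
        distr (M \<Otimes>\<^sub>M circle_measure) (M \<Otimes>\<^sub>M circle_measure) (\<lambda>(x, y). (T x, rotate1 \<alpha> y))"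
      by (rule pair_measure_distr) (use rotate1_preserving[OF \<alpha>] C.sigma_finite_measure_axioms in auto)
    then show "distr (M \<Otimes>\<^sub>M circle_measure) (M \<Otimes>\<^sub>M circle_measure) S = M \<Otimes>\<^sub>M circle_measure"
      by (simp add: T_preserving rotate1_preserving[OF \<alpha>] S_def[abs_def] case_prod_beta')
  qed (rule Sm)
  define f where "f p = cis (2 * pi * snd p) * Y (fst p)" for p :: "'a \<times> real"
  have iter: "f ((S ^^ k) p) = cis (2 * pi * snd p) * (cis (2 * pi * \<alpha>) ^ k * Y ((T ^^ k) (fst p)))" for k p
  proof -
    have "fst ((S ^^ k) p) = (T ^^ k) (fst p)" by (induction k) (auto simp: S_def)
    moreover have "cis (2 * pi * snd ((S ^^ k) p)) = cis (2 * pi * snd p) * cis (2 * pi * \<alpha>) ^ k"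
    proof (induction k)
      case (Suc k)
      have "cis (2 * pi * snd ((S ^^ Suc k) p)) = cis (2 * pi * rotate1 \<alpha> (snd ((S ^^ k) p)))" by (simp add: S_def)
      then show ?case unfolding cis_rotate1 Suc by (simp add: mult.assoc mult.commute)
    qed simp
    ultimately show ?thesis by (simp add: f_def mult.assoc)
  qed
  have [measurable]: "f \<in> borel_measurable (M \<Otimes>\<^sub>M circle_measure)"
  proof -
    have [measurable]: "(\<lambda>p :: 'a \<times> real. cis (2 * pi * snd p)) \<in> borel_measurable (M \<Otimes>\<^sub>M circle_measure)"
      by (rule measurable_compose[of "\<lambda>p. 2 * pi * snd p" _ borel]) 
         (auto intro!: borel_measurable_continuous_onI continuous_intros)
    show ?thesis unfolding f_def[abs_def] by measurable
  qed
  have fi: "integrable (M \<Otimes>\<^sub>M circle_measure) f"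
  proof (rule Bochner_Integration.integrable_bound)
    have "integrable (distr (M \<Otimes>\<^sub>M circle_measure) M fst) Y"
      using Y C.distr_pair_fst[of M] C.emeasure_space_1 by simp
    then show "integrable (M \<Otimes>\<^sub>M circle_measure) (\<lambda>p. Y (fst p))"
      by (subst (asm) integrable_distr_eq) auto
    show "AE p in M \<Otimes>\<^sub>M circle_measure. norm (f p) \<le> norm (Y (fst p))" by (simp add: f_def norm_mult)
  qed simp
  have conv: "AE p in M \<Otimes>\<^sub>M circle_measure. convergent (\<lambda>n. S.orbit_sum (\<lambda>p. Re (f p)) n p / real n)"
    "AE p in M \<Otimes>\<^sub>M circle_measure. convergent (\<lambda>n. S.orbit_sum (\<lambda>p. Im (f p)) n p / real n)"
    using fi by (auto intro!: S.birkhoff_convergent)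
  let ?A = "\<lambda>\<omega> n. (\<Sum>k<n. cis (2 * pi * \<alpha>) ^ k * Y ((T ^^ k) \<omega>)) / of_nat n"
  have "AE p in M \<Otimes>\<^sub>M circle_measure. convergent (?A (fst p))"
    using conv
  proof eventually_elim
    case (elim p)
    then obtain a b where a: "(\<lambda>n. S.orbit_sum (\<lambda>p. Re (f p)) n p / real n) \<longlonglongrightarrow> a"
      and b: "(\<lambda>n. S.orbit_sum (\<lambda>p. Im (f p)) n p / real n) \<longlonglongrightarrow> b" by (auto simp: convergent_def)
    let ?z = "cis (2 * pi * snd p)"
    have eq: "Complex (S.orbit_sum (\<lambda>p. Re (f p)) n p / real n) (S.orbit_sum (\<lambda>p. Im (f p)) n p / real n) = ?z * ?A (fst p) n" for n
    proof -
      have "?z * ?A (fst p) n = (\<Sum>k<n. f ((S ^^ k) p)) / of_real (real n)"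
        by (simp add: iter sum_distrib_left)
      then show ?thesis
        by (simp only: complex_eq_iff Re_divide_of_real Im_divide_of_real Re_sum Im_sum complex.sel S.orbit_sum_def)
    qed
    have "(\<lambda>n. ?z * ?A (fst p) n) \<longlonglongrightarrow> Complex a b"
      using tendsto_Complex[OF a b] unfolding eq .
    then have "(\<lambda>n. cnj ?z * (?z * ?A (fst p) n)) \<longlonglongrightarrow> cnj ?z * Complex a b" by (intro tendsto_intros)
    moreover have "cnj ?z * (?z * x) = x" for x
      by (simp add: cis_cnj cis_mult flip: mult.assoc)
    ultimately show ?case by (auto simp: convergent_def)
  qed
  then have "AE \<omega> in M. AE u in circle_measure. convergent (?A (fst (\<omega>, u)))" by (rule P.AE_pair)
  then show ?thesis by eventually_elim (simp add: C.AE_const)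
qed

text \<open>The limit \<open>Z\<close> satisfies \<open>Z \<circ> T = cis (- (2 * pi * \<alpha>)) * Z\<close>, because shifting the orbit by one
  divides every rotation factor by \<open>cis (2 * pi * \<alpha>)\<close>, and it is integrable by Fatou's lemma.  A nonzero
  \<open>Z\<close> would thus be an eigenfunction.\<close>

theorem rotated_average_tendsto_0:
  fixes Y :: "'a \<Rightarrow> complex"
  assumes Y: "integrable M Y" and \<alpha>: "0 \<le> \<alpha>" "\<alpha> < 1"
    and spec: "cis (- (2 * pi * \<alpha>)) \<notin> point_spectrum M T"
  shows "AE \<omega> in M. (\<lambda>n. (\<Sum>k<n. cis (2 * pi * \<alpha>) ^ k * Y ((T ^^ k) \<omega>)) / of_nat n) \<longlonglongrightarrow> 0"
proof -
  define z where "z = cis (2 * pi * \<alpha>)"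
  define A where "A n \<omega> = (\<Sum>k<n. z ^ k * Y ((T ^^ k) \<omega>)) / of_nat n" for n \<omega>
  define Z where "Z \<omega> = lim (\<lambda>n. A n \<omega>)" for \<omega>
  have z: "norm z = 1" "z \<noteq> 0" "inverse z = cis (- (2 * pi * \<alpha>))" by (auto simp: z_def cis_inverse)
  have [measurable]: "Y \<in> borel_measurable M" using Y by auto
  have YTm [measurable]: "(\<lambda>\<omega>. Y ((T ^^ k) \<omega>)) \<in> borel_measurable M" for k by (rule measurable_compose[OF T_iterate_measurable]) simp
  have [measurable]: "A n \<in> borel_measurable M" for n unfolding A_def[abs_def] by measurable
  have [measurable]: "Z \<in> borel_measurable M" unfolding Z_def[abs_def] by (rule borel_measurable_lim_metric) simp
  have lim: "AE \<omega> in M. (\<lambda>n. A n \<omega>) \<longlonglongrightarrow> Z \<omega>"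
    using rotated_average_convergent[OF Y \<alpha>] unfolding A_def z_def Z_def convergent_LIMSEQ_iff by simp
  have shift: "A n (T \<omega>) = inverse z * ((of_nat (Suc n) / of_nat n) * A (Suc n) \<omega> - Y \<omega> / of_nat n)" if "n > 0" for n \<omega>
  proof -
    have "(\<Sum>k<Suc n. z ^ k * Y ((T ^^ k) \<omega>)) = Y \<omega> + z * (\<Sum>k<n. z ^ k * Y ((T ^^ k) (T \<omega>)))"
      by (subst sum.lessThan_Suc_shift) (simp add: funpow_swap1 sum_distrib_left mult.assoc)
    then have "of_nat (Suc n) * A (Suc n) \<omega> = Y \<omega> + z * (of_nat n * A n (T \<omega>))"
      using that by (simp add: A_def del: of_nat_Suc)
    then show ?thesis using that z(2) by (simp add: field_simps)
  qed
  have eig: "AE \<omega> in M. Z (T \<omega>) = inverse z * Z \<omega>"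
    using lim
  proof eventually_elim
    case (elim \<omega>)
    have r: "(\<lambda>n. of_nat (Suc n) / of_nat n :: complex) \<longlonglongrightarrow> 1"
    proof -
      have "(\<lambda>n. of_real (real (Suc n) / real n) :: complex) \<longlonglongrightarrow> of_real 1"
        by (intro tendsto_of_real LIMSEQ_Suc_n_over_n)
      then show ?thesis by simp
    qed
    have "(\<lambda>n. Y \<omega> / of_nat n) \<longlonglongrightarrow> 0" by (rule lim_const_over_n)
    then have "(\<lambda>n. inverse z * ((of_nat (Suc n) / of_nat n) * A (Suc n) \<omega> - Y \<omega> / of_nat n)) \<longlonglongrightarrow> inverse z * (1 * Z \<omega> - 0)"
      using LIMSEQ_Suc[OF elim] by (intro tendsto_intros r)
    then have "(\<lambda>n. inverse z * ((of_nat (Suc n) / of_nat n) * A (Suc n) \<omega> - Y \<omega> / of_nat n)) \<longlonglongrightarrow> inverse z * Z \<omega>"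
      by simp
    moreover have "eventually (\<lambda>n. inverse z * ((of_nat (Suc n) / of_nat n) * A (Suc n) \<omega> - Y \<omega> / of_nat n) = A n (T \<omega>)) sequentially"
      using eventually_gt_at_top[of 0] by eventually_elim (simp only: shift)
    ultimately have "(\<lambda>n. A n (T \<omega>)) \<longlonglongrightarrow> inverse z * Z \<omega>"
      by (rule Lim_transform_eventually)
    then show ?case unfolding Z_def[of "T \<omega>"] by (rule limI)
  qed
  have int: "integrable M (\<lambda>\<omega>. norm (Z \<omega>) powr 1)"
  proof (rule integrableI_bounded)
    let ?I = "\<integral>\<omega>. norm (Y \<omega>) \<partial>M"
    have "(\<integral>\<^sup>+\<omega>. ennreal (norm (norm (Z \<omega>) powr 1)) \<partial>M) = (\<integral>\<^sup>+\<omega>. liminf (\<lambda>n. ennreal (norm (A n \<omega>))) \<partial>M)"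
    proof (rule nn_integral_cong_AE)
      show "AE \<omega> in M. ennreal (norm (norm (Z \<omega>) powr 1)) = liminf (\<lambda>n. ennreal (norm (A n \<omega>)))"
        using lim
      proof eventually_elim
        case (elim \<omega>)
        have "(\<lambda>n. ennreal (norm (A n \<omega>))) \<longlonglongrightarrow> ennreal (norm (Z \<omega>))"
          by (intro tendsto_ennrealI tendsto_norm elim)
        then have "liminf (\<lambda>n. ennreal (norm (A n \<omega>))) = ennreal (norm (Z \<omega>))"
          by (intro lim_imp_Liminf) auto
        then show ?case by simp
      qed
    qed
    also have "\<dots> \<le> liminf (\<lambda>n. \<integral>\<^sup>+\<omega>. ennreal (norm (A n \<omega>)) \<partial>M)"
      by (rule nn_integral_liminf) simp
    also have "\<dots> \<le> ennreal ?I"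
    proof (rule order_trans[OF Liminf_le_Limsup Limsup_bounded])
      show "eventually (\<lambda>n. (\<integral>\<^sup>+\<omega>. ennreal (norm (A n \<omega>)) \<partial>M) \<le> ennreal ?I) sequentially"
      proof (rule always_eventually, rule allI)
        fix n
        have i: "integrable M (\<lambda>\<omega>. norm (Y ((T ^^ k) \<omega>)))" for k
          using mpt.integrable_T[OF mpt_iterate, of "\<lambda>\<omega>. norm (Y \<omega>)" k] Y by simp
        have eq: "(\<integral>\<omega>. norm (Y ((T ^^ k) \<omega>)) \<partial>M) = ?I" for k
          using mpt.integral_T[OF mpt_iterate, of "\<lambda>\<omega>. norm (Y \<omega>)" k] by simp
        have "(\<integral>\<^sup>+\<omega>. ennreal (norm (A n \<omega>)) \<partial>M) \<le> (\<integral>\<^sup>+\<omega>. ennreal ((\<Sum>k<n. norm (Y ((T ^^ k) \<omega>))) / real n) \<partial>M)"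
        proof (intro nn_integral_mono ennreal_leI)
          fix \<omega>
          have "norm (\<Sum>k<n. z ^ k * Y ((T ^^ k) \<omega>)) \<le> (\<Sum>k<n. norm (Y ((T ^^ k) \<omega>)))"
            by (rule order_trans[OF norm_sum]) (simp add: norm_mult norm_power z)
          then show "norm (A n \<omega>) \<le> (\<Sum>k<n. norm (Y ((T ^^ k) \<omega>))) / real n"
            by (simp add: A_def norm_divide divide_right_mono)
        qed
        also have "\<dots> = ennreal (\<integral>\<omega>. (\<Sum>k<n. norm (Y ((T ^^ k) \<omega>))) / real n \<partial>M)"
          using i by (intro nn_integral_eq_integral) (auto simp: sum_nonneg)
        also have "(\<integral>\<omega>. (\<Sum>k<n. norm (Y ((T ^^ k) \<omega>))) / real n \<partial>M) = (real n * ?I) / real n"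
          using i by (simp add: eq)
        also have "ennreal \<dots> \<le> ennreal ?I" by (cases n) (auto simp del: of_nat_Suc)
        finally show "(\<integral>\<^sup>+\<omega>. ennreal (norm (A n \<omega>)) \<partial>M) \<le> ennreal ?I" .
      qed
    qed simp
    also have "\<dots> < \<infinity>" by simp
    finally show "(\<integral>\<^sup>+\<omega>. ennreal (norm (norm (Z \<omega>) powr 1)) \<partial>M) < \<infinity>" .
  qed simp
  have "AE \<omega> in M. Z \<omega> = 0"
  proof (rule ccontr)
    assume "\<not> (AE \<omega> in M. Z \<omega> = 0)"
    then have "inverse z \<in> point_spectrum M T"
      unfolding point_spectrum_def using eig int
      by (intro CollectI exI[of _ "1 :: real"] exI[of _ Z] conjI) simp_all
    then show False using spec z(3) by simp
  qed
  with lim show ?thesis unfolding A_def z_def[symmetric] by eventually_elim simp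
qed

end

section \<open>A characteristic function estimate for martingales\<close>

text \<open>\<open>g\<close> is a version of the conditional expectation of \<open>f\<close> given \<open>G\<close>.  Unlike an almost everywhere
  equation with \<open>real_cond_exp\<close>, this form names one function \<open>g\<close> that can serve for many measures \<open>N\<close> at
  once; here it will serve for almost every fibre measure.\<close>

definition cond_version :: "'a measure \<Rightarrow> 'a measure \<Rightarrow> ('a \<Rightarrow> real) \<Rightarrow> ('a \<Rightarrow> real) \<Rightarrow> bool" where
  "cond_version N G f g \<longleftrightarrow> integrable N f \<and> integrable N g \<and> g \<in> borel_measurable G \<and>
     (\<forall>A\<in>sets G. (\<integral>\<omega>. indicator A \<omega> * f \<omega> \<partial>N) = (\<integral>\<omega>. indicator A \<omega> * g \<omega> \<partial>N))"

lemma cond_version_integrable: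
  "cond_version N G f g \<Longrightarrow> integrable N f" "cond_version N G f g \<Longrightarrow> integrable N g"
  "cond_version N G f g \<Longrightarrow> g \<in> borel_measurable G"
  by (auto simp: cond_version_def)

lemma integrable_bounded_mult:
  fixes f H :: "'a \<Rightarrow> 'b::{banach, second_countable_topology, real_normed_field}"
  assumes f: "integrable N f" and H: "H \<in> borel_measurable N" "\<And>\<omega>. norm (H \<omega>) \<le> B"
  shows "integrable N (\<lambda>\<omega>. H \<omega> * f \<omega>)"
proof (rule Bochner_Integration.integrable_bound)
  show "integrable N (\<lambda>\<omega>. B * norm (f \<omega>))" using f by simp
  show "AE \<omega> in N. norm (H \<omega> * f \<omega>) \<le> norm (B * norm (f \<omega>))"
  proof (rule AE_I2)
    fix \<omega>
    have "norm (H \<omega>) * norm (f \<omega>) \<le> B * norm (f \<omega>)" using H(2) by (intro mult_right_mono) auto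
    then show "norm (H \<omega> * f \<omega>) \<le> norm (B * norm (f \<omega>))" by (simp add: norm_mult)
  qed
qed (use f H in auto)

context prob_space
begin

lemma cond_version_cond_exp:
  assumes sub: "subalgebra M G" and cv: "cond_version M G f g"
  shows "AE \<omega> in M. real_cond_exp M G f \<omega> = g \<omega>"
proof -
  interpret finite_measure_subalgebra M G
    by (simp add: finite_measure_subalgebra_def finite_measure_subalgebra_axioms_def sub finite_measure_axioms)
  show ?thesis
    by (rule real_cond_exp_charact) (use cv in \<open>auto simp: cond_version_def set_lebesgue_integral_def\<close>)
qed

lemma cond_version_test:
  assumes sub: "subalgebra M G" and cv: "cond_version M G f g"
    and H: "H \<in> borel_measurable G" "\<And>\<omega>. \<bar>H \<omega>\<bar> \<le> B"
  shows "(\<integral>\<omega>. H \<omega> * f \<omega> \<partial>M) = (\<integral>\<omega>. H \<omega> * g \<omega> \<partial>M)"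
proof -
  interpret finite_measure_subalgebra M G
    by (simp add: finite_measure_subalgebra_def finite_measure_subalgebra_axioms_def sub finite_measure_axioms)
  have HM: "H \<in> borel_measurable M" by (rule measurable_from_subalg[OF sub H(1)])
  have f: "integrable M f" and gM: "g \<in> borel_measurable M" using cv by (auto simp: cond_version_def)
  have "(\<integral>\<omega>. H \<omega> * f \<omega> \<partial>M) = (\<integral>\<omega>. H \<omega> * real_cond_exp M G f \<omega> \<partial>M)"
    by (rule real_cond_exp_intg(2)[symmetric])
       (use f H integrable_bounded_mult[OF f HM, of B] in auto)
  also have "\<dots> = (\<integral>\<omega>. H \<omega> * g \<omega> \<partial>M)"
    by (rule integral_cong_AE) (use cond_version_cond_exp[OF sub cv] HM gM in auto)
  finally show ?thesis .
qed

lemma cond_version_ctest: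
  fixes H :: "'a \<Rightarrow> complex"
  assumes sub: "subalgebra M G" and cv: "cond_version M G f g"
    and H: "H \<in> borel_measurable G" "\<And>\<omega>. norm (H \<omega>) \<le> B"
  shows "(\<integral>\<omega>. H \<omega> * of_real (f \<omega>) \<partial>M) = (\<integral>\<omega>. H \<omega> * of_real (g \<omega>) \<partial>M)"
proof -
  have HM: "H \<in> borel_measurable M" by (rule measurable_from_subalg[OF sub H(1)])
  have i: "integrable M (\<lambda>\<omega>. H \<omega> * of_real (f \<omega>))" "integrable M (\<lambda>\<omega>. H \<omega> * of_real (g \<omega>))"
    using cv H(2) by (auto intro!: integrable_bounded_mult[OF _ HM] simp: cond_version_def)
  have "(\<integral>\<omega>. Re (H \<omega>) * f \<omega> \<partial>M) = (\<integral>\<omega>. Re (H \<omega>) * g \<omega> \<partial>M)"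
    by (rule cond_version_test[OF sub cv, where B = B])
       (use H in \<open>auto intro: order_trans[OF abs_Re_le_cmod]\<close>)
  moreover have "(\<integral>\<omega>. Im (H \<omega>) * f \<omega> \<partial>M) = (\<integral>\<omega>. Im (H \<omega>) * g \<omega> \<partial>M)"
    by (rule cond_version_test[OF sub cv, where B = B])
       (use H in \<open>auto intro: order_trans[OF abs_Im_le_cmod]\<close>)
  ultimately show ?thesis
    using integral_Re[OF i(1)] integral_Re[OF i(2)] integral_Im[OF i(1)] integral_Im[OF i(2)]
    by (intro complex_eqI) simp_all
qed

lemma cond_version_indicator:
  assumes sub: "subalgebra M G" and cv: "cond_version M G f g" and A: "A \<in> sets G"
  shows "cond_version M G (\<lambda>\<omega>. indicator A \<omega> * f \<omega>) (\<lambda>\<omega>. indicator A \<omega> * g \<omega>)"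
proof -
  have AM: "A \<in> sets M" using A sub by (auto simp: subalgebra_def)
  have "(\<integral>\<omega>. indicator B \<omega> * (indicator A \<omega> * f \<omega>) \<partial>M) = (\<integral>\<omega>. indicator B \<omega> * (indicator A \<omega> * g \<omega>) \<partial>M)"
    if B: "B \<in> sets G" for B
  proof -
    have "B \<inter> A \<in> sets G" using A B by auto
    then have "(\<integral>\<omega>. indicator (B \<inter> A) \<omega> * f \<omega> \<partial>M) = (\<integral>\<omega>. indicator (B \<inter> A) \<omega> * g \<omega> \<partial>M)"
      using cv unfolding cond_version_def by blast
    then show ?thesis by (simp only: indicator_inter_arith mult.assoc)
  qed
  then show ?thesis using cv A AM unfolding cond_version_def
    by (auto intro!: integrable_bounded_mult[where B = 1] simp: indicator_def)
qed

lemma cond_version_cmult: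
  "cond_version M G f g \<Longrightarrow> cond_version M G (\<lambda>\<omega>. c * f \<omega>) (\<lambda>\<omega>. c * g \<omega>)"
  unfolding cond_version_def by (auto simp: mult.left_commute[of _ c])

lemma cond_version_add:
  assumes sub: "subalgebra M G" and 1: "cond_version M G f1 g1" and 2: "cond_version M G f2 g2"
  shows "cond_version M G (\<lambda>\<omega>. f1 \<omega> + f2 \<omega>) (\<lambda>\<omega>. g1 \<omega> + g2 \<omega>)"
proof -
  have "integrable M (\<lambda>\<omega>. indicator A \<omega> * f \<omega>)" if "A \<in> sets G" "integrable M f" for A and f :: "'a \<Rightarrow> real"
  proof -
    have "A \<in> sets M" using sub that by (auto simp: subalgebra_def)
    then show ?thesis using that(2) by (intro integrable_bounded_mult[where B = 1]) (auto simp: indicator_def)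
  qed
  then show ?thesis using 1 2 unfolding cond_version_def by (auto simp: distrib_left)
qed

text \<open>A version for a nonnegative function is nonnegative only almost everywhere; the truncation
  provides one that is nonnegative everywhere.\<close>

lemma cond_version_max0:
  assumes sub: "subalgebra M G" and cv: "cond_version M G f g" and nn: "\<And>\<omega>. 0 \<le> f \<omega>"
  shows "cond_version M G f (\<lambda>\<omega>. max 0 (g \<omega>))" "AE \<omega> in M. g \<omega> = max 0 (g \<omega>)"
proof -
  interpret finite_measure_subalgebra M G
    by (simp add: finite_measure_subalgebra_def finite_measure_subalgebra_axioms_def sub finite_measure_axioms)
  have f: "integrable M f" and g: "integrable M g" "g \<in> borel_measurable G" using cv by (auto simp: cond_version_def)
  have "AE \<omega> in M. real_cond_exp M G f \<omega> \<ge> 0"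
    by (rule real_cond_exp_pos) (use f nn in auto)
  with cond_version_cond_exp[OF sub cv] show *: "AE \<omega> in M. g \<omega> = max 0 (g \<omega>)"
    by eventually_elim auto
  have "(\<integral>\<omega>. indicator A \<omega> * g \<omega> \<partial>M) = (\<integral>\<omega>. indicator A \<omega> * max 0 (g \<omega>) \<partial>M)" if "A \<in> sets G" for A
    by (rule integral_cong_AE) (use * g that sub in \<open>auto simp: subalgebra_def\<close>)
  then show "cond_version M G f (\<lambda>\<omega>. max 0 (g \<omega>))"
    using cv unfolding cond_version_def by auto
qed

end

lemma exp_minus_quadratic: 
  fixes x :: real
  assumes "0 \<le> x"
  shows "\<bar>1 - x - exp (- x)\<bar> \<le> x\<^sup>2 / 2"
proof -
  have p: "1 + x + x\<^sup>2 / 2 > 0" using assms by (simp add: add_pos_nonneg)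
  have "1 \<le> (1 - x + x\<^sup>2 / 2) * (1 + x + x\<^sup>2 / 2)"
  proof -
    have "(1 - x + x\<^sup>2 / 2) * (1 + x + x\<^sup>2 / 2) = 1 + (x\<^sup>2)\<^sup>2 / 4" by (simp add: field_simps power2_eq_square)
    then show ?thesis by simp
  qed
  then have "1 / (1 + x + x\<^sup>2 / 2) \<le> 1 - x + x\<^sup>2 / 2" using p by (simp add: pos_divide_le_eq)
  moreover have "exp (- x) \<le> 1 / (1 + x + x\<^sup>2 / 2)"
    using exp_lower_Taylor_quadratic[OF assms] p by (simp add: exp_minus inverse_eq_divide frac_le)
  moreover have "1 - x \<le> exp (- x)" using exp_ge_add_one_self[of "- x"] by simp
  ultimately show ?thesis by (simp add: abs_le_iff)
qed

lemma abs_exp_diff_le: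
  fixes a b :: real
  assumes "a \<le> c" "b \<le> c"
  shows "\<bar>exp a - exp b\<bar> \<le> exp c * \<bar>a - b\<bar>"
proof -
  have *: "exp a - exp b \<le> exp c * (a - b)" "0 \<le> exp a - exp b" if "b \<le> a" "a \<le> c" for a b :: real
  proof -
    have "exp a * (1 - exp (b - a)) \<le> exp a * (a - b)"
      using exp_ge_add_one_self[of "b - a"] by (intro mult_left_mono) (linarith, simp)
    also have "\<dots> \<le> exp c * (a - b)" using that by (intro mult_right_mono) auto
    finally show "exp a - exp b \<le> exp c * (a - b)" by (simp add: right_diff_distrib flip: exp_add)
    show "0 \<le> exp a - exp b" using that by simp
  qed
  show ?thesis
  proof (cases "b \<le> a")
    case True
    then show ?thesis using *[of b a] assms by simp
  next
    case False
    then show ?thesis using *[of a b] assms by simp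
  qed
qed

text \<open>The factors \<open>t k\<close> switch a term off as soon as it would bring the full sum above \<open>C\<close>.\<close>

lemma sum_truncated_le:
  fixes a :: "nat \<Rightarrow> real"
  assumes "\<And>k. 0 \<le> a k" "\<And>k. t k = 0 \<or> t k = 1 \<and> (\<Sum>j\<le>k. a j) \<le> C" "0 \<le> C"
  shows "(\<Sum>k<n. t k * a k) \<le> C"
proof (induction n)
  case (Suc n)
  show ?case
  proof (cases "t n = 0")
    case False
    have "(\<Sum>k<n. t k * a k) \<le> (\<Sum>k<n. a k)"
      using assms(1,2) by (intro sum_mono) (metis mult.left_neutral mult_zero_left order_refl)
    moreover have "t n = 1" "(\<Sum>j\<le>n. a j) \<le> C" using assms(2)[of n] False by auto
    ultimately show ?thesis by (simp add: lessThan_Suc_atMost[symmetric])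
  qed (use Suc in simp)
qed (use assms in simp)

context prob_space
begin

lemma filtration_measurable:
  fixes f :: "'a \<Rightarrow> real"
  assumes sub: "\<And>k. subalgebra M (G k)" and mono: "\<And>k. sets (G k) \<subseteq> sets (G (Suc k))"
    and "f \<in> borel_measurable (G j)" "j \<le> k"
  shows "f \<in> borel_measurable (G k)"
proof -
  have "sets (G j) \<subseteq> sets (G k)" using lift_Suc_mono_le[of "\<lambda>k. sets (G k)", OF mono assms(4)] .
  moreover have "space (G k) = space M" for k using sub by (simp add: subalgebra_def)
  ultimately show ?thesis using assms(3) unfolding measurable_def by auto
qed

text \<open>Let \<open>Z n = exp (\<i> * S n + V n / 2)\<close> with \<open>S n\<close> and \<open>V n\<close> the partial sums of \<open>\<xi>\<close> and of the
  conditional variances \<open>s\<close>.  Then \<open>Z (k + 1) - Z k = H * (exp (\<i> * \<xi> k) - exp (- s k / 2))\<close> with \<open>H\<close>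
  known at time \<open>k\<close>.  Expanding both exponentials, the constant terms cancel, the linear term \<open>\<xi> k\<close> has
  conditional mean 0, and \<open>(\<xi> k)\<^sup>2\<close> and \<open>s k\<close> have the same conditional mean.  What remains is
  \<open>\<epsilon> * (\<xi> k)\<^sup>2\<close> where \<open>\<xi> k\<close> is at most \<open>\<epsilon>\<close>, the truncated moment \<open>h k\<close> where it is not, and \<open>(s k)\<^sup>2\<close>.\<close>

lemma char_bound_bounded_variance:
  fixes \<xi> s h l :: "nat \<Rightarrow> 'a \<Rightarrow> real"
  assumes sub: "\<And>k. subalgebra M (G k)" and mono: "\<And>k. sets (G k) \<subseteq> sets (G (Suc k))"
    and \<xi>: "\<And>k. \<xi> k \<in> borel_measurable (G (Suc k))"
    and c0: "\<And>k. cond_version M (G k) (\<xi> k) (\<lambda>_. 0)"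
    and c2: "\<And>k. cond_version M (G k) (\<lambda>\<omega>. (\<xi> k \<omega>)\<^sup>2) (s k)"
    and ch: "\<And>k. cond_version M (G k) (h k) (l k)"
    and h: "\<And>k \<omega>. \<epsilon> < \<bar>\<xi> k \<omega>\<bar> \<Longrightarrow> (\<xi> k \<omega>)\<^sup>2 \<le> h k \<omega>" "\<And>k \<omega>. 0 \<le> h k \<omega>"
    and s: "\<And>k \<omega>. 0 \<le> s k \<omega>" and l: "\<And>k \<omega>. 0 \<le> l k \<omega>"
    and C: "\<And>m \<omega>. (\<Sum>k<m. s k \<omega>) \<le> C" and \<epsilon>: "0 < \<epsilon>" "\<epsilon> \<le> 1"
  shows "norm ((\<integral>\<omega>. exp (\<i> * of_real (\<Sum>k<n. \<xi> k \<omega>)) * of_real (exp ((\<Sum>k<n. s k \<omega>) / 2)) \<partial>M) - 1)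
    \<le> exp (C / 2) * (2 * C * \<epsilon> + (1 + C) * (\<Sum>k<n. \<integral>\<omega>. l k \<omega> \<partial>M))"
proof -
  define Z where "Z n \<omega> = exp (\<i> * of_real (\<Sum>k<n. \<xi> k \<omega>)) * of_real (exp ((\<Sum>k<n. s k \<omega>) / 2))" for n \<omega>
  have C0: "0 \<le> C" using C[of _ 0] by simp
  note mG = filtration_measurable[where G = G, OF sub mono]
  have \<xi>G: "\<xi> j \<in> borel_measurable (G k)" if "j < k" for j k using mG[OF \<xi>, of j k] that by simp
  have sG: "s j \<in> borel_measurable (G k)" if "j \<le> k" for j k
    using mG[OF cond_version_integrable(3)[OF c2] that] .
  have fromG: "f \<in> borel_measurable M" if "f \<in> borel_measurable (G k)" for f :: "'a \<Rightarrow> 'b::topological_space" and k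
    by (rule measurable_from_subalg[OF sub that])
  have [measurable]: "\<xi> k \<in> borel_measurable M" "s k \<in> borel_measurable M" "h k \<in> borel_measurable M" for k
    using fromG[OF \<xi>] fromG[OF sG[OF order_refl]] cond_version_integrable(1)[OF ch] by auto
  have Z_le: "norm (Z n \<omega>) \<le> exp (C / 2)" for n \<omega>
    unfolding Z_def using C[of \<omega> n] by (simp add: norm_mult)
  have [measurable]: "Z n \<in> borel_measurable M" for n unfolding Z_def[abs_def] by measurable
  have Z_int: "integrable M (Z n)" for n
    by (rule integrable_const_bound[where B = "exp (C / 2)"]) (use Z_le in auto)
  have sC: "s k \<omega> \<le> C" for k \<omega>
  proof -
    have "0 \<le> (\<Sum>j<k. s j \<omega>)" using s by (intro sum_nonneg)
    then show ?thesis using C[of \<omega> "Suc k"] by simp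
  qed
  have i2: "integrable M (\<lambda>\<omega>. (\<xi> k \<omega>)\<^sup>2)" "integrable M (s k)" for k using cond_version_integrable[OF c2] by auto
  have ih: "integrable M (h k)" "integrable M (l k)" for k using cond_version_integrable[OF ch] by auto
  have i1: "integrable M (\<xi> k)" for k using cond_version_integrable[OF c0] by auto
  have E2: "(\<integral>\<omega>. (\<xi> k \<omega>)\<^sup>2 \<partial>M) = (\<integral>\<omega>. s k \<omega> \<partial>M)" for k
    using cond_version_test[OF sub[of k] c2[of k], where H = "\<lambda>_. 1" and B = 1] by simp
  have Eh: "(\<integral>\<omega>. h k \<omega> \<partial>M) = (\<integral>\<omega>. l k \<omega> \<partial>M)" for k
    using cond_version_test[OF sub[of k] ch[of k], where H = "\<lambda>_. 1" and B = 1] by simp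
  have is2: "integrable M (\<lambda>\<omega>. (s k \<omega>)\<^sup>2)" for k
    using integrable_bounded_mult[OF i2(2)[of k], of "s k" C] s sC by (simp add: power2_eq_square)
  \<comment> \<open>one factor \<open>s k\<close> may be replaced by \<open>(\<xi> k)\<^sup>2\<close>, which is at most \<open>\<epsilon>\<close> or else covered by \<open>h k\<close>\<close>
  have Es2: "(\<integral>\<omega>. (s k \<omega>)\<^sup>2 \<partial>M) \<le> \<epsilon> * (\<integral>\<omega>. s k \<omega> \<partial>M) + C * (\<integral>\<omega>. l k \<omega> \<partial>M)" for k
  proof -
    have "(\<integral>\<omega>. (s k \<omega>)\<^sup>2 \<partial>M) = (\<integral>\<omega>. s k \<omega> * (\<xi> k \<omega>)\<^sup>2 \<partial>M)"
      using cond_version_test[OF sub[of k] c2[of k], where H = "s k" and B = C] sG[of k k] s sC by (simp add: power2_eq_square)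
    also have "\<dots> \<le> (\<integral>\<omega>. \<epsilon> * s k \<omega> + C * h k \<omega> \<partial>M)"
    proof (rule integral_mono)
      show "integrable M (\<lambda>\<omega>. s k \<omega> * (\<xi> k \<omega>)\<^sup>2)"
        using s sC by (intro integrable_bounded_mult[OF i2(1), where B = C]) auto
      show "s k \<omega> * (\<xi> k \<omega>)\<^sup>2 \<le> \<epsilon> * s k \<omega> + C * h k \<omega>" for \<omega>
      proof (cases "\<epsilon> < \<bar>\<xi> k \<omega>\<bar>")
        case True
        have "s k \<omega> * (\<xi> k \<omega>)\<^sup>2 \<le> C * h k \<omega>" using h(1)[OF True] h(2) s sC C0 by (intro mult_mono) auto
        then show ?thesis using s[of k \<omega>] \<epsilon> by (simp add: add_increasing)
      next
        case False
        have "(\<xi> k \<omega>)\<^sup>2 \<le> \<epsilon>\<^sup>2" using False \<epsilon> by (simp add: abs_le_square_iff[symmetric])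
        also have "\<dots> \<le> \<epsilon>" using \<epsilon> by (simp add: power2_eq_square mult_left_le)
        finally have "s k \<omega> * (\<xi> k \<omega>)\<^sup>2 \<le> s k \<omega> * \<epsilon>" using s by (intro mult_left_mono) auto
        then show ?thesis using h(2)[of k \<omega>] C0 by (simp add: add_increasing2 mult.commute)
      qed
    qed (use i2 ih in auto)
    also have "\<dots> = \<epsilon> * (\<integral>\<omega>. s k \<omega> \<partial>M) + C * (\<integral>\<omega>. l k \<omega> \<partial>M)"
      using i2 ih by (simp add: Eh)
    finally show ?thesis .
  qed
  have step: "norm ((\<integral>\<omega>. Z (Suc k) \<omega> \<partial>M) - (\<integral>\<omega>. Z k \<omega> \<partial>M))
      \<le> exp (C / 2) * (2 * \<epsilon> * (\<integral>\<omega>. s k \<omega> \<partial>M) + (1 + C) * (\<integral>\<omega>. l k \<omega> \<partial>M))" for k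
  proof -
    define H where "H \<omega> = exp (\<i> * of_real (\<Sum>j<k. \<xi> j \<omega>)) * of_real (exp ((\<Sum>j<Suc k. s j \<omega>) / 2))" for \<omega>
    define R1 where "R1 \<omega> = exp (\<i> * of_real (\<xi> k \<omega>)) - (1 + \<i> * of_real (\<xi> k \<omega>) - of_real ((\<xi> k \<omega>)\<^sup>2) / 2)" for \<omega>
    define R2 where "R2 \<omega> = 1 - s k \<omega> / 2 - exp (- (s k \<omega> / 2))" for \<omega>
    have HG: "H \<in> borel_measurable (G k)"
    proof -
      have [measurable]: "(\<lambda>\<omega>. \<Sum>j<k. \<xi> j \<omega>) \<in> borel_measurable (G k)" "(\<lambda>\<omega>. \<Sum>j<Suc k. s j \<omega>) \<in> borel_measurable (G k)"
        by (intro borel_measurable_sum \<xi>G sG; simp)+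
      show ?thesis unfolding H_def by measurable
    qed
    have HM: "H \<in> borel_measurable M" by (rule fromG[OF HG])
    have HB: "norm (H \<omega>) \<le> exp (C / 2)" for \<omega>
      unfolding H_def norm_mult norm_exp_i_times norm_of_real mult_1 using C[of \<omega> "Suc k"] by simp
    have [measurable]: "R1 \<in> borel_measurable M" "R2 \<in> borel_measurable M" unfolding R1_def R2_def by measurable
    have R1_le: "norm (R1 \<omega>) \<le> \<epsilon> * (\<xi> k \<omega>)\<^sup>2 + h k \<omega>" for \<omega>
    proof -
      let ?x = "\<xi> k \<omega>"
      have eq: "R1 \<omega> = iexp ?x - (\<Sum>j\<le>2. (\<i> * ?x) ^ j / fact j)"
        by (simp add: R1_def numeral_2_eq_2 power_mult_distrib) 
      show ?thesis
      proof (cases "\<epsilon> < \<bar>?x\<bar>")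
        case True
        have "norm (R1 \<omega>) \<le> ?x\<^sup>2" using iexp_approx2[of ?x 2] unfolding eq by simp
        then show ?thesis using h(1)[OF True] \<epsilon> by (simp add: add_increasing)
      next
        case False
        have "norm (R1 \<omega>) \<le> \<bar>?x\<bar> ^ 3 / 6" using iexp_approx1[of ?x 2] unfolding eq
          by (simp add: numeral_3_eq_3 fact_numeral)
        also have "\<dots> \<le> \<bar>?x\<bar> ^ 3" by simp
        also have "\<dots> = \<bar>?x\<bar> * ?x\<^sup>2" by (simp add: power3_eq_cube power2_eq_square)
        also have "\<dots> \<le> \<epsilon> * ?x\<^sup>2" using False by (intro mult_right_mono) auto
        finally show ?thesis using h(2)[of k \<omega>] by simp
      qed
    qed
    have R1_int: "integrable M R1"
    proof (rule Bochner_Integration.integrable_bound)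
      show "integrable M (\<lambda>\<omega>. \<epsilon> * (\<xi> k \<omega>)\<^sup>2 + h k \<omega>)" using i2 ih by auto
      show "AE \<omega> in M. norm (R1 \<omega>) \<le> norm (\<epsilon> * (\<xi> k \<omega>)\<^sup>2 + h k \<omega>)"
        using R1_le by (intro AE_I2) (smt (verit) real_norm_def)
    qed simp
    have R2_le: "\<bar>R2 \<omega>\<bar> \<le> (s k \<omega>)\<^sup>2" for \<omega>
    proof -
      have "\<bar>R2 \<omega>\<bar> \<le> (s k \<omega> / 2)\<^sup>2 / 2" unfolding R2_def using s[of k \<omega>] by (intro exp_minus_quadratic) simp
      also have "\<dots> \<le> (s k \<omega>)\<^sup>2" by (simp add: power_divide)
      finally show ?thesis .
    qed
    have R2_int: "integrable M R2"
      by (rule Bochner_Integration.integrable_bound[OF is2[of k]]) (use R2_le in auto)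
    have dec: "Z (Suc k) \<omega> - Z k \<omega> = H \<omega> * R1 \<omega> + \<i> * (H \<omega> * of_real (\<xi> k \<omega>))
        - (H \<omega> * of_real ((\<xi> k \<omega>)\<^sup>2) - H \<omega> * of_real (s k \<omega>)) / 2 + H \<omega> * of_real (R2 \<omega>)" for \<omega>
    proof -
      have "Z (Suc k) \<omega> = H \<omega> * exp (\<i> * of_real (\<xi> k \<omega>))"
        unfolding Z_def H_def by (simp add: exp_add distrib_left)
      moreover have "Z k \<omega> = H \<omega> * of_real (exp (- (s k \<omega> / 2)))"
        unfolding Z_def H_def by (simp add: add_divide_distrib mult.assoc flip: exp_add of_real_mult)
      ultimately show ?thesis unfolding R1_def R2_def by (simp add: field_simps)
    qed
    note hb = integrable_bounded_mult[OF _ HM HB]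
    have j1: "integrable M (\<lambda>\<omega>. H \<omega> * R1 \<omega>)" by (rule hb[OF R1_int])
    have j2: "integrable M (\<lambda>\<omega>. H \<omega> * of_real (\<xi> k \<omega>))" by (rule hb) (use i1 in simp)
    have j3: "integrable M (\<lambda>\<omega>. H \<omega> * of_real ((\<xi> k \<omega>)\<^sup>2))" by (rule hb) (use i2 in \<open>simp del: of_real_power\<close>)
    have j4: "integrable M (\<lambda>\<omega>. H \<omega> * of_real (s k \<omega>))" by (rule hb) (use i2 in simp)
    have j5: "integrable M (\<lambda>\<omega>. H \<omega> * of_real (R2 \<omega>))" by (rule hb) (use R2_int in simp)
    have "(\<integral>\<omega>. Z (Suc k) \<omega> \<partial>M) - (\<integral>\<omega>. Z k \<omega> \<partial>M) = (\<integral>\<omega>. Z (Suc k) \<omega> - Z k \<omega> \<partial>M)"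
      using Z_int by simp
    also have "\<dots> = (\<integral>\<omega>. H \<omega> * R1 \<omega> \<partial>M) + \<i> * (\<integral>\<omega>. H \<omega> * of_real (\<xi> k \<omega>) \<partial>M)
        - ((\<integral>\<omega>. H \<omega> * of_real ((\<xi> k \<omega>)\<^sup>2) \<partial>M) - (\<integral>\<omega>. H \<omega> * of_real (s k \<omega>) \<partial>M)) / 2
        + (\<integral>\<omega>. H \<omega> * of_real (R2 \<omega>) \<partial>M)"
      unfolding dec using j1 j2 j3 j4 j5 by (simp del: of_real_power)
    also have "\<dots> = (\<integral>\<omega>. H \<omega> * R1 \<omega> \<partial>M) + (\<integral>\<omega>. H \<omega> * of_real (R2 \<omega>) \<partial>M)"
      using cond_version_ctest[OF sub c0 HG HB] cond_version_ctest[OF sub c2 HG HB] by simp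
    finally have "norm ((\<integral>\<omega>. Z (Suc k) \<omega> \<partial>M) - (\<integral>\<omega>. Z k \<omega> \<partial>M)) \<le>
        norm (\<integral>\<omega>. H \<omega> * R1 \<omega> \<partial>M) + norm (\<integral>\<omega>. H \<omega> * of_real (R2 \<omega>) \<partial>M)"
      by (simp add: norm_triangle_ineq)
    also have "\<dots> \<le> (\<integral>\<omega>. norm (H \<omega> * R1 \<omega>) \<partial>M) + (\<integral>\<omega>. norm (H \<omega> * of_real (R2 \<omega>)) \<partial>M)"
      by (intro add_mono integral_norm_bound)
    also have "\<dots> \<le> (\<integral>\<omega>. exp (C / 2) * (\<epsilon> * (\<xi> k \<omega>)\<^sup>2 + h k \<omega>) \<partial>M) + (\<integral>\<omega>. exp (C / 2) * (s k \<omega>)\<^sup>2 \<partial>M)"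
    proof (intro add_mono integral_mono)
      show "norm (H \<omega> * R1 \<omega>) \<le> exp (C / 2) * (\<epsilon> * (\<xi> k \<omega>)\<^sup>2 + h k \<omega>)" for \<omega>
        unfolding norm_mult using HB R1_le by (intro mult_mono) auto
      show "norm (H \<omega> * of_real (R2 \<omega>)) \<le> exp (C / 2) * (s k \<omega>)\<^sup>2" for \<omega>
        unfolding norm_mult norm_of_real using HB R2_le by (intro mult_mono) auto
    qed (use j1 j5 i2 ih is2 in auto)
    also have "\<dots> = exp (C / 2) * (\<epsilon> * (\<integral>\<omega>. s k \<omega> \<partial>M) + (\<integral>\<omega>. l k \<omega> \<partial>M) + (\<integral>\<omega>. (s k \<omega>)\<^sup>2 \<partial>M))"
      using i2 ih by (simp add: E2 Eh distrib_left)
    also have "\<dots> \<le> exp (C / 2) * (2 * \<epsilon> * (\<integral>\<omega>. s k \<omega> \<partial>M) + (1 + C) * (\<integral>\<omega>. l k \<omega> \<partial>M))"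
      using Es2[of k] by (intro mult_left_mono) (auto simp: algebra_simps)
    finally show ?thesis .
  qed
  have "norm ((\<integral>\<omega>. Z n \<omega> \<partial>M) - 1) \<le> (\<Sum>k<n. exp (C / 2) * (2 * \<epsilon> * (\<integral>\<omega>. s k \<omega> \<partial>M) + (1 + C) * (\<integral>\<omega>. l k \<omega> \<partial>M)))"
  proof (induction n)
    case 0
    then show ?case by (simp add: Z_def prob_space)
  next
    case (Suc n)
    have "norm ((\<integral>\<omega>. Z (Suc n) \<omega> \<partial>M) - 1) \<le> norm ((\<integral>\<omega>. Z (Suc n) \<omega> \<partial>M) - (\<integral>\<omega>. Z n \<omega> \<partial>M)) + norm ((\<integral>\<omega>. Z n \<omega> \<partial>M) - 1)"
      using norm_triangle_ineq[of "(\<integral>\<omega>. Z (Suc n) \<omega> \<partial>M) - (\<integral>\<omega>. Z n \<omega> \<partial>M)" "(\<integral>\<omega>. Z n \<omega> \<partial>M) - 1"] by simp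
    then show ?case using step[of n] Suc by simp
  qed
  also have "\<dots> = exp (C / 2) * (2 * \<epsilon> * (\<integral>\<omega>. (\<Sum>k<n. s k \<omega>) \<partial>M) + (1 + C) * (\<Sum>k<n. \<integral>\<omega>. l k \<omega> \<partial>M))"
    using i2 by (simp add: sum_distrib_left sum.distrib distrib_left)
  also have "\<dots> \<le> exp (C / 2) * (2 * \<epsilon> * C + (1 + C) * (\<Sum>k<n. \<integral>\<omega>. l k \<omega> \<partial>M))"
  proof -
    have "(\<integral>\<omega>. (\<Sum>k<n. s k \<omega>) \<partial>M) \<le> (\<integral>\<omega>. C \<partial>M)" using C i2 by (intro integral_mono) auto
    then show ?thesis using \<epsilon> by (simp add: prob_space)
  qed
  finally show ?thesis unfolding Z_def by (simp add: mult.assoc mult.left_commute mult.commute)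
qed

text \<open>Switch off the term \<open>k\<close> unless the sums of \<open>s\<close> and of \<open>l\<close> through \<open>k\<close> are at most \<open>v + 1\<close> and 1.
  This is decided at time \<open>k\<close>, so the truncated sequence is again a martingale difference and the
  previous lemma applies to it with \<open>C = v + 1\<close>.  Nothing has been switched off unless the sum of \<open>s\<close> is
  more than 1 above \<open>v\<close> or the sum of \<open>l\<close> exceeds 1, and each of these events is paid for by one of the
  two means on the right-hand side.  The truncations at 1 let these
  means converge whenever the sums converge almost surely.\<close>

lemma char_martingale_bound:
  fixes \<xi> s h l :: "nat \<Rightarrow> 'a \<Rightarrow> real"
  assumes sub: "\<And>k. subalgebra M (G k)" and mono: "\<And>k. sets (G k) \<subseteq> sets (G (Suc k))"
    and \<xi>: "\<And>k. \<xi> k \<in> borel_measurable (G (Suc k))"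
    and c0: "\<And>k. cond_version M (G k) (\<xi> k) (\<lambda>_. 0)"
    and c2: "\<And>k. cond_version M (G k) (\<lambda>\<omega>. (\<xi> k \<omega>)\<^sup>2) (s k)"
    and ch: "\<And>k. cond_version M (G k) (h k) (l k)"
    and h: "\<And>k \<omega>. \<epsilon> < \<bar>\<xi> k \<omega>\<bar> \<Longrightarrow> (\<xi> k \<omega>)\<^sup>2 \<le> h k \<omega>" "\<And>k \<omega>. 0 \<le> h k \<omega>"
    and s: "\<And>k \<omega>. 0 \<le> s k \<omega>" and l: "\<And>k \<omega>. 0 \<le> l k \<omega>"
    and v: "0 \<le> v" and \<epsilon>: "0 < \<epsilon>" "\<epsilon> \<le> 1"
  shows "norm ((\<integral>\<omega>. exp (\<i> * of_real (\<Sum>k<n. \<xi> k \<omega>)) \<partial>M) - of_real (exp (- v / 2)))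
    \<le> exp ((v + 1) / 2) * (2 * v + 5) *
      (\<epsilon> + (\<integral>\<omega>. min 1 (\<Sum>k<n. l k \<omega>) \<partial>M) + (\<integral>\<omega>. min 1 \<bar>(\<Sum>k<n. s k \<omega>) - v\<bar> \<partial>M))"
proof -
  define C where "C = v + 1"
  \<comment> \<open>the sums run through \<open>k\<close> itself, since \<open>s k\<close> and \<open>l k\<close> are already known at time \<open>k\<close>\<close>
  define A where "A k = {\<omega> \<in> space M. (\<Sum>j\<le>k. s j \<omega>) \<le> C \<and> (\<Sum>j\<le>k. l j \<omega>) \<le> 1}" for k
  define tr where "tr f k \<omega> = indicator (A k) \<omega> * f k \<omega>" for f :: "nat \<Rightarrow> 'a \<Rightarrow> real" and k \<omega>
  have spG: "space (G k) = space M" for k using sub by (simp add: subalgebra_def)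
  note mG = filtration_measurable[where G = G, OF sub mono]
  have AG: "A k \<in> sets (G k)" for k
  proof -
    have [measurable]: "(\<lambda>\<omega>. \<Sum>j\<le>k. s j \<omega>) \<in> borel_measurable (G k)" "(\<lambda>\<omega>. \<Sum>j\<le>k. l j \<omega>) \<in> borel_measurable (G k)"
      by (intro borel_measurable_sum mG[OF cond_version_integrable(3)[OF c2]] mG[OF cond_version_integrable(3)[OF ch]]; simp)+
    have "A k = {\<omega> \<in> space (G k). (\<Sum>j\<le>k. s j \<omega>) \<le> C \<and> (\<Sum>j\<le>k. l j \<omega>) \<le> 1}" by (simp add: A_def spG)
    then show ?thesis by simp
  qed
  have AG': "A k \<in> sets (G (Suc k))" for k using AG mono by blast
  have [measurable]: "A k \<in> sets M" for k using AG[of k] sub[of k] by (auto simp: subalgebra_def)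
  have fromG: "f \<in> borel_measurable M" if "f \<in> borel_measurable (G k)" for f :: "'a \<Rightarrow> real" and k
    by (rule measurable_from_subalg[OF sub that])
  have [measurable]: "\<xi> k \<in> borel_measurable M" "s k \<in> borel_measurable M" "l k \<in> borel_measurable M" for k
    using fromG[OF \<xi>] cond_version_integrable(2)[OF c2] cond_version_integrable(2)[OF ch] by auto
  have [measurable]: "tr f k \<in> borel_measurable M" if "f k \<in> borel_measurable M" for f k
    using that unfolding tr_def by measurable
  have C1: "C \<ge> 1" using v by (simp add: C_def)
  have ts: "(\<Sum>k<n. tr s k \<omega>) \<le> C" for n \<omega>
    unfolding tr_def using C1 by (intro sum_truncated_le s) (auto simp: indicator_def A_def)
  have tl: "(\<Sum>k<n. tr l k \<omega>) \<le> min 1 (\<Sum>k<n. l k \<omega>)" for \<omega>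
  proof -
    have "(\<Sum>k<n. tr l k \<omega>) \<le> 1" unfolding tr_def by (intro sum_truncated_le l) (auto simp: indicator_def A_def)
    moreover have "(\<Sum>k<n. tr l k \<omega>) \<le> (\<Sum>k<n. l k \<omega>)" unfolding tr_def using l by (intro sum_mono) (auto simp: indicator_def)
    ultimately show ?thesis by simp
  qed
  define Y where "Y \<omega> = exp (\<i> * of_real (\<Sum>k<n. tr \<xi> k \<omega>)) * of_real (exp ((\<Sum>k<n. tr s k \<omega>) / 2))" for \<omega>
  have "norm ((\<integral>\<omega>. Y \<omega> \<partial>M) - 1) \<le> exp (C / 2) * (2 * C * \<epsilon> + (1 + C) * (\<Sum>k<n. \<integral>\<omega>. tr l k \<omega> \<partial>M))"
    unfolding Y_def
  proof (rule char_bound_bounded_variance[where G = G and h = "tr h"])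
    show "tr \<xi> k \<in> borel_measurable (G (Suc k))" for k
      unfolding tr_def using \<xi>[of k] AG'[of k] by measurable
    show "cond_version M (G k) (tr \<xi> k) (\<lambda>_. 0)" for k
      using cond_version_indicator[OF sub c0 AG[of k]] by (simp add: tr_def[abs_def])
    show "cond_version M (G k) (\<lambda>\<omega>. (tr \<xi> k \<omega>)\<^sup>2) (tr s k)" for k
    proof -
      have "(\<lambda>\<omega>. (tr \<xi> k \<omega>)\<^sup>2) = (\<lambda>\<omega>. indicator (A k) \<omega> * (\<xi> k \<omega>)\<^sup>2)"
        by (auto simp: tr_def indicator_def)
      then show ?thesis using cond_version_indicator[OF sub c2 AG[of k]] by (simp add: tr_def[abs_def])
    qed
    show "cond_version M (G k) (tr h k) (tr l k)" for k
      using cond_version_indicator[OF sub ch AG[of k]] by (simp add: tr_def[abs_def])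
    show "\<epsilon> < \<bar>tr \<xi> k \<omega>\<bar> \<Longrightarrow> (tr \<xi> k \<omega>)\<^sup>2 \<le> tr h k \<omega>" for k \<omega>
      using h(1)[of k \<omega>] \<epsilon> by (auto simp: tr_def indicator_def split: if_splits)
  qed (use sub mono h s l ts \<epsilon> in \<open>auto simp: tr_def\<close>)
  also have "(\<Sum>k<n. \<integral>\<omega>. tr l k \<omega> \<partial>M) = (\<integral>\<omega>. (\<Sum>k<n. tr l k \<omega>) \<partial>M)"
    using cond_version_integrable(2)[OF cond_version_indicator[OF sub ch AG]]
    by (intro Bochner_Integration.integral_sum[symmetric]) (simp add: tr_def[abs_def])
  also have "\<dots> \<le> (\<integral>\<omega>. min 1 (\<Sum>k<n. l k \<omega>) \<partial>M)"
  proof (rule integral_mono)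
    show "integrable M (\<lambda>\<omega>. \<Sum>k<n. tr l k \<omega>)"
      using cond_version_integrable(2)[OF cond_version_indicator[OF sub ch AG]]
      by (intro Bochner_Integration.integrable_sum) (simp add: tr_def[abs_def])
    show "integrable M (\<lambda>\<omega>. min 1 (\<Sum>k<n. l k \<omega>))"
      using l by (intro integrable_const_bound[where B = 1]) (auto simp: sum_nonneg)
  qed (rule tl)
  finally have 1: "norm ((\<integral>\<omega>. Y \<omega> \<partial>M) - 1) \<le> exp (C / 2) * (2 * C * \<epsilon> + (1 + C) * (\<integral>\<omega>. min 1 (\<Sum>k<n. l k \<omega>) \<partial>M))"
    using C1 by (simp add: mult_left_mono)
  have pw: "norm (exp (\<i> * of_real (\<Sum>k<n. \<xi> k \<omega>)) * of_real (exp (v / 2)) - Y \<omega>) \<le>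
      2 * exp (C / 2) * (min 1 (\<Sum>k<n. l k \<omega>) + min 1 \<bar>(\<Sum>k<n. s k \<omega>) - v\<bar>)" if w: "\<omega> \<in> space M" for \<omega>
  proof (cases "(\<Sum>k<n. s k \<omega>) \<le> C \<and> (\<Sum>k<n. l k \<omega>) \<le> 1")
    case True
    have "\<omega> \<in> A k" if "k < n" for k
    proof -
      have "(\<Sum>j\<le>k. s j \<omega>) \<le> (\<Sum>k<n. s k \<omega>)" "(\<Sum>j\<le>k. l j \<omega>) \<le> (\<Sum>k<n. l k \<omega>)"
        using that s l by (auto intro!: sum_mono2)
      then show ?thesis using True w by (simp add: A_def)
    qed
    then have eq: "(\<Sum>k<n. tr \<xi> k \<omega>) = (\<Sum>k<n. \<xi> k \<omega>)" "(\<Sum>k<n. tr s k \<omega>) = (\<Sum>k<n. s k \<omega>)"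
      by (auto simp: tr_def)
    have "norm (exp (\<i> * of_real (\<Sum>k<n. \<xi> k \<omega>)) * of_real (exp (v / 2)) - Y \<omega>) =
        \<bar>exp (v / 2) - exp ((\<Sum>k<n. s k \<omega>) / 2)\<bar>"
      unfolding Y_def eq by (simp add: norm_mult flip: right_diff_distrib of_real_diff)
    also have "\<dots> \<le> exp (C / 2) * min 1 \<bar>(\<Sum>k<n. s k \<omega>) - v\<bar>"
    proof -
      have "\<bar>exp (v / 2) - exp ((\<Sum>k<n. s k \<omega>) / 2)\<bar> \<le> exp (C / 2) * \<bar>v / 2 - (\<Sum>k<n. s k \<omega>) / 2\<bar>"
        using True by (intro abs_exp_diff_le) (auto simp: C_def)
      also have "\<dots> \<le> exp (C / 2) * \<bar>(\<Sum>k<n. s k \<omega>) - v\<bar>" by (intro mult_left_mono) (auto simp: abs_if)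
      finally have a: "\<bar>exp (v / 2) - exp ((\<Sum>k<n. s k \<omega>) / 2)\<bar> \<le> exp (C / 2) * \<bar>(\<Sum>k<n. s k \<omega>) - v\<bar>" .
      have "exp (v / 2) \<le> exp (C / 2)" "exp ((\<Sum>k<n. s k \<omega>) / 2) \<le> exp (C / 2)" using True by (auto simp: C_def)
      then have "\<bar>exp (v / 2) - exp ((\<Sum>k<n. s k \<omega>) / 2)\<bar> \<le> exp (C / 2)"
        using exp_gt_zero[of "v / 2"] exp_gt_zero[of "(\<Sum>k<n. s k \<omega>) / 2"] by linarith
      then show ?thesis using a by (simp add: min_def)
    qed
    also have "\<dots> \<le> 2 * exp (C / 2) * (min 1 (\<Sum>k<n. l k \<omega>) + min 1 \<bar>(\<Sum>k<n. s k \<omega>) - v\<bar>)"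
      using l by (simp add: mult.assoc mult_left_mono sum_nonneg add_increasing algebra_simps)
    finally show ?thesis .
  next
    case False
    have "norm (exp (\<i> * of_real (\<Sum>k<n. \<xi> k \<omega>)) * of_real (exp (v / 2)) - Y \<omega>) \<le> exp (v / 2) + exp ((\<Sum>k<n. tr s k \<omega>) / 2)"
      unfolding Y_def by (rule order_trans[OF norm_triangle_ineq4]) (simp add: norm_mult)
    also have "\<dots> \<le> exp (C / 2) + exp (C / 2)" using ts[of \<omega> n] by (intro add_mono) (auto simp: C_def)
    also have "\<dots> \<le> 2 * exp (C / 2) * (min 1 (\<Sum>k<n. l k \<omega>) + min 1 \<bar>(\<Sum>k<n. s k \<omega>) - v\<bar>)"
    proof -
      have "1 \<le> min 1 (\<Sum>k<n. l k \<omega>) + min 1 \<bar>(\<Sum>k<n. s k \<omega>) - v\<bar>"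
        using False sum_nonneg[of "{..<n}" "\<lambda>k. l k \<omega>"] l by (auto simp: C_def)
      then show ?thesis by simp
    qed
    finally show ?thesis .
  qed
  have [measurable]: "Y \<in> borel_measurable M" unfolding Y_def[abs_def] by measurable
  have Yi: "integrable M Y"
    by (rule integrable_const_bound[where B = "exp (C / 2)"]) (use ts in \<open>auto simp: Y_def norm_mult\<close>)
  have ei: "integrable M (\<lambda>\<omega>. exp (\<i> * of_real (\<Sum>k<n. \<xi> k \<omega>)))"
    by (rule integrable_const_bound[where B = 1]) auto
  have mi: "integrable M (\<lambda>\<omega>. min 1 (\<Sum>k<n. l k \<omega>))" "integrable M (\<lambda>\<omega>. min 1 \<bar>(\<Sum>k<n. s k \<omega>) - v\<bar>)"
    using l by (auto intro!: integrable_const_bound[where B = 1] simp: sum_nonneg)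
  have 2: "norm ((\<integral>\<omega>. exp (\<i> * of_real (\<Sum>k<n. \<xi> k \<omega>)) \<partial>M) * of_real (exp (v / 2)) - (\<integral>\<omega>. Y \<omega> \<partial>M)) \<le>
      2 * exp (C / 2) * ((\<integral>\<omega>. min 1 (\<Sum>k<n. l k \<omega>) \<partial>M) + (\<integral>\<omega>. min 1 \<bar>(\<Sum>k<n. s k \<omega>) - v\<bar> \<partial>M))"
  proof -
    have "(\<integral>\<omega>. exp (\<i> * of_real (\<Sum>k<n. \<xi> k \<omega>)) \<partial>M) * of_real (exp (v / 2)) - (\<integral>\<omega>. Y \<omega> \<partial>M) =
        (\<integral>\<omega>. exp (\<i> * of_real (\<Sum>k<n. \<xi> k \<omega>)) * of_real (exp (v / 2)) - Y \<omega> \<partial>M)"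
      using Yi ei by simp
    also have "norm \<dots> \<le> (\<integral>\<omega>. norm (exp (\<i> * of_real (\<Sum>k<n. \<xi> k \<omega>)) * of_real (exp (v / 2)) - Y \<omega>) \<partial>M)"
      by (rule integral_norm_bound)
    also have "\<dots> \<le> (\<integral>\<omega>. 2 * exp (C / 2) * (min 1 (\<Sum>k<n. l k \<omega>) + min 1 \<bar>(\<Sum>k<n. s k \<omega>) - v\<bar>) \<partial>M)"
      using Yi ei mi pw by (intro integral_mono) auto
    finally show ?thesis using mi by simp
  qed
  let ?l = "\<integral>\<omega>. min 1 (\<Sum>k<n. l k \<omega>) \<partial>M" and ?s = "\<integral>\<omega>. min 1 \<bar>(\<Sum>k<n. s k \<omega>) - v\<bar> \<partial>M"
  let ?e = "\<integral>\<omega>. exp (\<i> * of_real (\<Sum>k<n. \<xi> k \<omega>)) \<partial>M"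
  have nn: "0 \<le> ?l" "0 \<le> ?s" using l by (auto intro!: integral_nonneg_AE AE_I2 simp: sum_nonneg)
  have "norm (?e - of_real (exp (- v / 2))) = exp (- v / 2) * norm (?e * of_real (exp (v / 2)) - 1)"
  proof -
    have "?e - of_real (exp (- v / 2)) = of_real (exp (- v / 2)) * (?e * of_real (exp (v / 2)) - 1)"
      by (simp add: algebra_simps flip: of_real_mult exp_add)
    then show ?thesis by (simp add: norm_mult)
  qed
  also have "\<dots> \<le> 1 * norm (?e * of_real (exp (v / 2)) - 1)" using v by (intro mult_right_mono) auto
  also have "\<dots> \<le> norm (?e * of_real (exp (v / 2)) - (\<integral>\<omega>. Y \<omega> \<partial>M)) + norm ((\<integral>\<omega>. Y \<omega> \<partial>M) - 1)"
    using norm_triangle_ineq[of "?e * of_real (exp (v / 2)) - (\<integral>\<omega>. Y \<omega> \<partial>M)" "(\<integral>\<omega>. Y \<omega> \<partial>M) - 1"] by simp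
  also have "\<dots> \<le> 2 * exp (C / 2) * (?l + ?s) + exp (C / 2) * (2 * C * \<epsilon> + (1 + C) * ?l)"
    by (rule add_mono[OF 2 1])
  also have "\<dots> = exp (C / 2) * (2 * C * \<epsilon> + (3 + C) * ?l + 2 * ?s)" by (simp add: algebra_simps)
  also have "\<dots> \<le> exp (C / 2) * ((2 * C + 3) * \<epsilon> + (2 * C + 3) * ?l + (2 * C + 3) * ?s)"
  proof -
    have "2 * C * \<epsilon> \<le> (2 * C + 3) * \<epsilon>" using \<epsilon> by (intro mult_right_mono) auto
    moreover have "(3 + C) * ?l \<le> (2 * C + 3) * ?l" using C1 nn by (intro mult_right_mono) auto
    moreover have "2 * ?s \<le> (2 * C + 3) * ?s" using C1 nn by (intro mult_right_mono) auto
    ultimately show ?thesis by (intro mult_left_mono add_mono) auto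
  qed
  finally show ?thesis by (simp add: C_def algebra_simps)
qed

end

section \<open>A maximal inequality for martingales\<close>

context prob_space
begin

lemma cond_version_test_integrable:
  assumes sub: "subalgebra M G" and cv: "cond_version M G f g"
    and H: "H \<in> borel_measurable G" "integrable M (\<lambda>\<omega>. H \<omega> * f \<omega>)"
  shows "(\<integral>\<omega>. H \<omega> * f \<omega> \<partial>M) = (\<integral>\<omega>. H \<omega> * g \<omega> \<partial>M)"
proof -
  interpret finite_measure_subalgebra M G
    by (simp add: finite_measure_subalgebra_def finite_measure_subalgebra_axioms_def sub finite_measure_axioms)
  have HM: "H \<in> borel_measurable M" by (rule measurable_from_subalg[OF sub H(1)])
  have f: "f \<in> borel_measurable M" and gM: "g \<in> borel_measurable M" using cv by (auto simp: cond_version_def)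
  have "(\<integral>\<omega>. H \<omega> * f \<omega> \<partial>M) = (\<integral>\<omega>. H \<omega> * real_cond_exp M G f \<omega> \<partial>M)"
    by (rule real_cond_exp_intg(2)[symmetric, OF H(2,1) f])
  also have "\<dots> = (\<integral>\<omega>. H \<omega> * g \<omega> \<partial>M)"
    by (rule integral_cong_AE) (use cond_version_cond_exp[OF sub cv] HM gM in auto)
  finally show ?thesis .
qed

text \<open>Doob's argument with a linear test.  Let \<open>E k\<close> be the event that \<open>2 * \<eta>\<close> is reached first at time
  \<open>k\<close>.  On \<open>E k\<close>, multiplication by the sign of \<open>S k\<close> gives a mean of \<open>S n\<close> that equals that of \<open>S k\<close>,
  hence is at least \<open>2 * \<eta>\<close> times the probability, while \<open>\<bar>S n\<bar>\<close> is at most \<open>\<eta>\<close> plus the excess.  Only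
  first moments enter.\<close>

lemma maximal_excess:
  fixes \<xi> :: "nat \<Rightarrow> 'a \<Rightarrow> real"
  assumes sub: "\<And>k. subalgebra M (G k)" and mono: "\<And>k. sets (G k) \<subseteq> sets (G (Suc k))"
    and \<xi>: "\<And>k. \<xi> k \<in> borel_measurable (G (Suc k))"
    and c0: "\<And>k. cond_version M (G k) (\<xi> k) (\<lambda>_. 0)"
  shows "\<eta> * prob {\<omega> \<in> space M. \<exists>k\<le>n. 2 * \<eta> \<le> \<bar>\<Sum>j<k. \<xi> j \<omega>\<bar>} \<le> (\<integral>\<omega>. max 0 (\<bar>\<Sum>j<n. \<xi> j \<omega>\<bar> - \<eta>) \<partial>M)"
proof -
  define S where "S k \<omega> = (\<Sum>j<k. \<xi> j \<omega>)" for k \<omega>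
  define E where "E k = {\<omega> \<in> space M. 2 * \<eta> \<le> \<bar>S k \<omega>\<bar> \<and> (\<forall>j\<in>{..<k}. \<bar>S j \<omega>\<bar> < 2 * \<eta>)}" for k
  have monoG: "sets (G j) \<subseteq> sets (G k)" if "j \<le> k" for j k using lift_Suc_mono_le[of "\<lambda>k. sets (G k)", OF mono that] .
  have spG: "space (G k) = space M" for k using sub by (simp add: subalgebra_def)
  note mG = filtration_measurable[where G = G, OF sub mono]
  have SG: "S j \<in> borel_measurable (G k)" if "j \<le> k" for j k
    unfolding S_def[abs_def] using that by (intro borel_measurable_sum mG[OF \<xi>]) auto
  have EG: "E k \<in> sets (G k)" for k
  proof -
    have "{\<omega> \<in> space (G k). \<bar>S j \<omega>\<bar> < 2 * \<eta>} \<in> sets (G k)" if "j \<in> {..<k}" for j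
    proof -
      have [measurable]: "S j \<in> borel_measurable (G k)" using that by (intro SG) auto
      show ?thesis by measurable
    qed
    then have "{\<omega> \<in> space (G k). \<forall>j\<in>{..<k}. \<bar>S j \<omega>\<bar> < 2 * \<eta>} \<in> sets (G k)"
      by (intro sets.sets_Collect_finite_All) auto
    moreover have "{\<omega> \<in> space (G k). 2 * \<eta> \<le> \<bar>S k \<omega>\<bar>} \<in> sets (G k)"
    proof -
      have [measurable]: "S k \<in> borel_measurable (G k)" by (rule SG) simp
      show ?thesis by measurable
    qed
    ultimately have "{\<omega> \<in> space (G k). 2 * \<eta> \<le> \<bar>S k \<omega>\<bar> \<and> (\<forall>j\<in>{..<k}. \<bar>S j \<omega>\<bar> < 2 * \<eta>)} \<in> sets (G k)"
      by (intro sets.sets_Collect_conj)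
    then show ?thesis by (simp add: E_def spG)
  qed
  have EM [measurable]: "E k \<in> sets M" for k using EG[of k] sub[of k] by (auto simp: subalgebra_def)
  have \<xi>i: "integrable M (\<xi> k)" for k using cond_version_integrable(1)[OF c0] .
  have Si: "integrable M (S k)" for k unfolding S_def[abs_def] using \<xi>i by auto
  have ei: "integrable M (\<lambda>\<omega>. max 0 (\<bar>S n \<omega>\<bar> - \<eta>))" using Si by (intro integrable_max) auto
  have ind: "integrable M (\<lambda>\<omega>. indicator (E k) \<omega> * f \<omega>)" if "integrable M f" for f :: "'a \<Rightarrow> real" and k
    by (rule integrable_bounded_mult[OF that, where B = 1]) (auto simp: indicator_def)
  have block: "\<eta> * prob (E k) \<le> (\<integral>\<omega>. indicator (E k) \<omega> * max 0 (\<bar>S n \<omega>\<bar> - \<eta>) \<partial>M)" if k: "k \<le> n" for k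
  proof -
    define H where "H \<omega> = indicator (E k) \<omega> * sgn (S k \<omega>)" for \<omega>
    have HG: "H \<in> borel_measurable (G j)" if "k \<le> j" for j
    proof -
      have "E k \<in> sets (G j)" using EG monoG[OF that] by blast
      moreover have "S k \<in> borel_measurable (G j)" using SG that by blast
      ultimately show ?thesis unfolding H_def[abs_def] by measurable
    qed
    have HB: "\<bar>H \<omega>\<bar> \<le> 1" for \<omega> by (auto simp: H_def indicator_def sgn_real_def)
    have HM: "H \<in> borel_measurable M" using measurable_from_subalg[OF sub HG[OF order_refl]] .
    have Hi: "integrable M (\<lambda>\<omega>. H \<omega> * f \<omega>)" if "integrable M f" for f
      by (rule integrable_bounded_mult[OF that HM, where B = 1]) (use HB in simp)
    have z: "(\<integral>\<omega>. H \<omega> * \<xi> j \<omega> \<partial>M) = 0" if "k \<le> j" for j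
      using cond_version_test[OF sub c0 HG[OF that] HB] by simp
    have "S n \<omega> = S k \<omega> + (\<Sum>j\<in>{k..<n}. \<xi> j \<omega>)" for \<omega>
      using sum.atLeastLessThan_concat[of 0 k n "\<lambda>j. \<xi> j \<omega>"] k by (simp add: S_def lessThan_atLeast0)
    then have "(\<integral>\<omega>. H \<omega> * S n \<omega> \<partial>M) = (\<integral>\<omega>. H \<omega> * S k \<omega> + (\<Sum>j\<in>{k..<n}. H \<omega> * \<xi> j \<omega>) \<partial>M)"
      by (simp add: distrib_left sum_distrib_left)
    also have "\<dots> = (\<integral>\<omega>. H \<omega> * S k \<omega> \<partial>M)" using Hi[OF Si] Hi[OF \<xi>i] z by simp
    finally have eq: "(\<integral>\<omega>. H \<omega> * S n \<omega> \<partial>M) = (\<integral>\<omega>. H \<omega> * S k \<omega> \<partial>M)" .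
    have "2 * \<eta> * prob (E k) = (\<integral>\<omega>. indicator (E k) \<omega> * (2 * \<eta>) \<partial>M)" by simp
    also have "\<dots> \<le> (\<integral>\<omega>. H \<omega> * S k \<omega> \<partial>M)"
    proof (rule integral_mono[OF ind Hi[OF Si]])
      show "indicator (E k) \<omega> * (2 * \<eta>) \<le> H \<omega> * S k \<omega>" for \<omega>
        by (auto simp: H_def indicator_def E_def mult.commute[of "sgn _"] simp flip: abs_sgn)
    qed simp
    also have "\<dots> = (\<integral>\<omega>. H \<omega> * S n \<omega> \<partial>M)" by (simp add: eq)
    also have "\<dots> \<le> (\<integral>\<omega>. indicator (E k) \<omega> * \<eta> + indicator (E k) \<omega> * max 0 (\<bar>S n \<omega>\<bar> - \<eta>) \<partial>M)"
    proof (rule integral_mono[OF Hi[OF Si]])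
      show "H \<omega> * S n \<omega> \<le> indicator (E k) \<omega> * \<eta> + indicator (E k) \<omega> * max 0 (\<bar>S n \<omega>\<bar> - \<eta>)" for \<omega>
        by (auto simp: H_def indicator_def sgn_real_def)
      show "integrable M (\<lambda>\<omega>. indicator (E k) \<omega> * \<eta> + indicator (E k) \<omega> * max 0 (\<bar>S n \<omega>\<bar> - \<eta>))"
        by (intro Bochner_Integration.integrable_add ind ei) auto
    qed
    also have "\<dots> = \<eta> * prob (E k) + (\<integral>\<omega>. indicator (E k) \<omega> * max 0 (\<bar>S n \<omega>\<bar> - \<eta>) \<partial>M)"
    proof -
      have "integrable M (\<lambda>\<omega>. indicator (E k) \<omega> * \<eta>)" by (rule ind) simp
      then have "(\<integral>\<omega>. indicator (E k) \<omega> * \<eta> + indicator (E k) \<omega> * max 0 (\<bar>S n \<omega>\<bar> - \<eta>) \<partial>M) =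
          (\<integral>\<omega>. indicator (E k) \<omega> * \<eta> \<partial>M) + (\<integral>\<omega>. indicator (E k) \<omega> * max 0 (\<bar>S n \<omega>\<bar> - \<eta>) \<partial>M)"
        using ind[OF ei] by (rule Bochner_Integration.integral_add)
      then show ?thesis by simp
    qed
    finally show ?thesis by simp
  qed
  have disj: "disjoint_family_on E {..n}"
    unfolding disjoint_family_on_def E_def by (auto simp: not_less) (metis lessThan_iff linorder_neqE_nat not_le)
  have "{\<omega> \<in> space M. \<exists>k\<le>n. 2 * \<eta> \<le> \<bar>S k \<omega>\<bar>} = (\<Union>k\<in>{..n}. E k)"
  proof (intro equalityI subsetI)
    fix \<omega> assume w: "\<omega> \<in> {\<omega> \<in> space M. \<exists>k\<le>n. 2 * \<eta> \<le> \<bar>S k \<omega>\<bar>}"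
    then obtain k where k: "k \<le> n" "2 * \<eta> \<le> \<bar>S k \<omega>\<bar>" by auto
    define k0 where "k0 = (LEAST k. 2 * \<eta> \<le> \<bar>S k \<omega>\<bar>)"
    have "2 * \<eta> \<le> \<bar>S k0 \<omega>\<bar>" unfolding k0_def by (rule LeastI[of "\<lambda>k. 2 * \<eta> \<le> \<bar>S k \<omega>\<bar>", OF k(2)])
    moreover have "k0 \<le> k" unfolding k0_def by (rule Least_le[of "\<lambda>k. 2 * \<eta> \<le> \<bar>S k \<omega>\<bar>", OF k(2)])
    moreover have "\<bar>S j \<omega>\<bar> < 2 * \<eta>" if "j < k0" for j using not_less_Least[OF that[unfolded k0_def]] by simp
    ultimately have "\<omega> \<in> E k0" "k0 \<le> n" using k w by (auto simp: E_def)
    then show "\<omega> \<in> (\<Union>k\<in>{..n}. E k)" by auto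
  qed (auto simp: E_def)
  then have "prob {\<omega> \<in> space M. \<exists>k\<le>n. 2 * \<eta> \<le> \<bar>S k \<omega>\<bar>} = (\<Sum>k\<le>n. prob (E k))"
    using finite_measure_finite_Union[OF finite_atMost _ disj] EM by (simp add: image_subset_iff)
  then have "\<eta> * prob {\<omega> \<in> space M. \<exists>k\<le>n. 2 * \<eta> \<le> \<bar>S k \<omega>\<bar>} = (\<Sum>k\<le>n. \<eta> * prob (E k))"
    by (simp add: sum_distrib_left)
  also have "\<dots> \<le> (\<Sum>k\<le>n. \<integral>\<omega>. indicator (E k) \<omega> * max 0 (\<bar>S n \<omega>\<bar> - \<eta>) \<partial>M)"
    by (intro sum_mono block) auto
  also have "\<dots> = (\<integral>\<omega>. (\<Sum>k\<le>n. indicator (E k) \<omega>) * max 0 (\<bar>S n \<omega>\<bar> - \<eta>) \<partial>M)"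
    using ind[OF ei] unfolding sum_distrib_right by (intro Bochner_Integration.integral_sum[symmetric])
  also have "\<dots> \<le> (\<integral>\<omega>. max 0 (\<bar>S n \<omega>\<bar> - \<eta>) \<partial>M)"
  proof (rule integral_mono[OF _ ei])
    show "integrable M (\<lambda>\<omega>. (\<Sum>k\<le>n. indicator (E k) \<omega>) * max 0 (\<bar>S n \<omega>\<bar> - \<eta>))"
      using ind[OF ei] unfolding sum_distrib_right by (intro Bochner_Integration.integrable_sum)
    fix \<omega>
    have "(\<Sum>k\<le>n. indicator (E k) \<omega>) = (indicator (\<Union>k\<in>{..n}. E k) \<omega> :: real)"
      by (simp add: indicator_UN_disjoint[OF finite_atMost disj])
    then show "(\<Sum>k\<le>n. indicator (E k) \<omega>) * max 0 (\<bar>S n \<omega>\<bar> - \<eta>) \<le> max 0 (\<bar>S n \<omega>\<bar> - \<eta>)"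
      by (simp add: indicator_def)
  qed
  finally show ?thesis by (simp add: S_def)
qed

lemma second_moment_le:
  fixes \<xi> s :: "nat \<Rightarrow> 'a \<Rightarrow> real"
  assumes sub: "\<And>k. subalgebra M (G k)" and mono: "\<And>k. sets (G k) \<subseteq> sets (G (Suc k))"
    and \<xi>: "\<And>k. \<xi> k \<in> borel_measurable (G (Suc k))"
    and c0: "\<And>k. cond_version M (G k) (\<xi> k) (\<lambda>_. 0)"
    and c2: "\<And>k. cond_version M (G k) (\<lambda>\<omega>. (\<xi> k \<omega>)\<^sup>2) (s k)"
    and C: "\<And>\<omega>. (\<Sum>k<n. s k \<omega>) \<le> C"
  shows "integrable M (\<lambda>\<omega>. (\<Sum>k<n. \<xi> k \<omega>)\<^sup>2)" "(\<integral>\<omega>. (\<Sum>k<n. \<xi> k \<omega>)\<^sup>2 \<partial>M) \<le> C"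
proof -
  note mG = filtration_measurable[where G = G, OF sub mono]
  have [measurable]: "\<xi> k \<in> borel_measurable M" for k using measurable_from_subalg[OF sub \<xi>] .
  have i2: "integrable M (\<lambda>\<omega>. (\<xi> k \<omega>)\<^sup>2)" "integrable M (s k)" for k using cond_version_integrable[OF c2] by auto
  have E2: "(\<integral>\<omega>. (\<xi> k \<omega>)\<^sup>2 \<partial>M) = (\<integral>\<omega>. s k \<omega> \<partial>M)" for k
    using cond_version_test[OF sub[of k] c2[of k], where H = "\<lambda>_. 1" and B = 1] by simp
  have *: "integrable M (\<lambda>\<omega>. (\<Sum>k<n. \<xi> k \<omega>)\<^sup>2) \<and> (\<integral>\<omega>. (\<Sum>k<n. \<xi> k \<omega>)\<^sup>2 \<partial>M) = (\<Sum>k<n. \<integral>\<omega>. s k \<omega> \<partial>M)" for n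
  proof (induction n)
    case (Suc n)
    let ?S = "\<lambda>\<omega>. \<Sum>k<n. \<xi> k \<omega>"
    have xi: "integrable M (\<lambda>\<omega>. ?S \<omega> * \<xi> n \<omega>)"
    proof (rule Bochner_Integration.integrable_bound)
      show "integrable M (\<lambda>\<omega>. (?S \<omega>)\<^sup>2 + (\<xi> n \<omega>)\<^sup>2)" using Suc i2 by simp
      show "AE \<omega> in M. norm (?S \<omega> * \<xi> n \<omega>) \<le> norm ((?S \<omega>)\<^sup>2 + (\<xi> n \<omega>)\<^sup>2)"
      proof (rule AE_I2)
        fix \<omega>
        have "2 * (\<bar>?S \<omega>\<bar> * \<bar>\<xi> n \<omega>\<bar>) \<le> (?S \<omega>)\<^sup>2 + (\<xi> n \<omega>)\<^sup>2"
          using sum_squares_bound[of "\<bar>?S \<omega>\<bar>" "\<bar>\<xi> n \<omega>\<bar>"] by (simp add: mult.assoc)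
        moreover have "0 \<le> \<bar>?S \<omega>\<bar> * \<bar>\<xi> n \<omega>\<bar>" by simp
        ultimately have "\<bar>?S \<omega>\<bar> * \<bar>\<xi> n \<omega>\<bar> \<le> (?S \<omega>)\<^sup>2 + (\<xi> n \<omega>)\<^sup>2" by linarith
        then show "norm (?S \<omega> * \<xi> n \<omega>) \<le> norm ((?S \<omega>)\<^sup>2 + (\<xi> n \<omega>)\<^sup>2)" by (simp add: abs_mult)
      qed
    qed simp
    have "(\<integral>\<omega>. ?S \<omega> * \<xi> n \<omega> \<partial>M) = (\<integral>\<omega>. ?S \<omega> * 0 \<partial>M)"
      by (rule cond_version_test_integrable[OF sub[of n] c0[of n] _ xi])
         (intro borel_measurable_sum mG[OF \<xi>], auto)
    then have z: "(\<integral>\<omega>. ?S \<omega> * \<xi> n \<omega> \<partial>M) = 0" by simp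
    have eq: "(\<Sum>k<Suc n. \<xi> k \<omega>)\<^sup>2 = (?S \<omega>)\<^sup>2 + 2 * (?S \<omega> * \<xi> n \<omega>) + (\<xi> n \<omega>)\<^sup>2" for \<omega>
      by (simp add: power2_sum)
    show ?case unfolding eq using Suc xi i2 z by (simp add: E2)
  qed (simp add: prob_space)
  then show "integrable M (\<lambda>\<omega>. (\<Sum>k<n. \<xi> k \<omega>)\<^sup>2)" by blast
  have "(\<integral>\<omega>. (\<Sum>k<n. \<xi> k \<omega>)\<^sup>2 \<partial>M) = (\<integral>\<omega>. (\<Sum>k<n. s k \<omega>) \<partial>M)" using * i2 by simp
  also have "\<dots> \<le> (\<integral>\<omega>. C \<partial>M)" using C i2 by (intro integral_mono) auto
  finally show "(\<integral>\<omega>. (\<Sum>k<n. \<xi> k \<omega>)\<^sup>2 \<partial>M) \<le> C" by (simp add: prob_space)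
qed

text \<open>The martingale that is switched off before the accumulated variance exceeds \<open>C\<close> satisfies the
  maximal inequality, and its second moment is at most \<open>C\<close>.  So its excess may be capped at \<open>R\<close> at the
  cost of \<open>C / R\<close>, and on the complement of the event \<open>D\<close> that the variance passes \<open>C\<close> it is the original
  martingale.  The capped excess is a bounded continuous function of the block sum, which is what a
  limit in distribution can evaluate.\<close>

lemma block_oscillation:
  fixes \<xi> s :: "nat \<Rightarrow> 'a \<Rightarrow> real"
  assumes sub: "\<And>k. subalgebra M (G k)" and mono: "\<And>k. sets (G k) \<subseteq> sets (G (Suc k))"
    and \<xi>: "\<And>k. \<xi> k \<in> borel_measurable (G (Suc k))"
    and c0: "\<And>k. cond_version M (G k) (\<xi> k) (\<lambda>_. 0)"
    and c2: "\<And>k. cond_version M (G k) (\<lambda>\<omega>. (\<xi> k \<omega>)\<^sup>2) (s k)"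
    and s: "\<And>k \<omega>. 0 \<le> s k \<omega>"
    and ab: "a \<le> b" "b \<le> n" and pos: "0 < \<eta>" "0 < R" "0 < C"
  shows "prob {\<omega> \<in> space M. \<exists>k\<in>{a..b}. 2 * \<eta> \<le> \<bar>\<Sum>j\<in>{a..<k}. \<xi> j \<omega>\<bar>} \<le>
    ((\<integral>\<omega>. min R (max 0 (\<bar>\<Sum>j\<in>{a..<b}. \<xi> j \<omega>\<bar> - \<eta>)) \<partial>M)
      + R * prob {\<omega> \<in> space M. C < (\<Sum>k<n. s k \<omega>)} + C / R) / \<eta> + prob {\<omega> \<in> space M. C < (\<Sum>k<n. s k \<omega>)}"
proof -
  define A where "A k = {\<omega> \<in> space M. (\<Sum>j\<le>k. s j \<omega>) \<le> C}" for k
  define x where "x j \<omega> = indicator (A (a + j)) \<omega> * \<xi> (a + j) \<omega>" for j \<omega>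
  define v where "v j \<omega> = indicator (A (a + j)) \<omega> * s (a + j) \<omega>" for j \<omega>
  define D where "D = {\<omega> \<in> space M. C < (\<Sum>k<n. s k \<omega>)}"
  define m where "m = b - a"
  have spG: "space (G k) = space M" for k using sub by (simp add: subalgebra_def)
  note mG = filtration_measurable[where G = G, OF sub mono]
  have AG: "A k \<in> sets (G k)" for k
  proof -
    have [measurable]: "(\<lambda>\<omega>. \<Sum>j\<le>k. s j \<omega>) \<in> borel_measurable (G k)"
      by (intro borel_measurable_sum mG[OF cond_version_integrable(3)[OF c2]]) simp
    have "A k = {\<omega> \<in> space (G k). (\<Sum>j\<le>k. s j \<omega>) \<le> C}" by (simp add: A_def spG)
    then show ?thesis by simp
  qed
  have AM [measurable]: "A k \<in> sets M" for k using AG[of k] sub[of k] by (auto simp: subalgebra_def)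
  have [measurable]: "\<xi> k \<in> borel_measurable M" "s k \<in> borel_measurable M" for k
    using measurable_from_subalg[OF sub \<xi>] cond_version_integrable(2)[OF c2] by auto
  have [measurable]: "D \<in> sets M" unfolding D_def by measurable
  have [measurable]: "x k \<in> borel_measurable M" for k unfolding x_def[abs_def] by measurable
  let ?G = "\<lambda>k. G (a + k)"
  have sub': "\<And>k. subalgebra M (?G k)" and mono': "\<And>k. sets (?G k) \<subseteq> sets (?G (Suc k))" using sub mono by auto
  have x': "x k \<in> borel_measurable (?G (Suc k))" for k
  proof -
    have "A (a + k) \<in> sets (G (Suc (a + k)))" using AG mono by blast
    then show ?thesis unfolding x_def[abs_def] using \<xi>[of "a + k"] by simp measurable
  qed
  have xc0: "cond_version M (?G k) (x k) (\<lambda>_. 0)" for k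
    using cond_version_indicator[OF sub c0 AG, of "a + k"] by (simp add: x_def[abs_def])
  have xc2: "cond_version M (?G k) (\<lambda>\<omega>. (x k \<omega>)\<^sup>2) (v k)" for k
  proof -
    have "(\<lambda>\<omega>. (x k \<omega>)\<^sup>2) = (\<lambda>\<omega>. indicator (A (a + k)) \<omega> * (\<xi> (a + k) \<omega>)\<^sup>2)" by (auto simp: x_def indicator_def)
    then show ?thesis using cond_version_indicator[OF sub c2 AG, of "a + k"] by (simp add: v_def[abs_def])
  qed
  have vC: "(\<Sum>k<m. v k \<omega>) \<le> C" for \<omega>
  proof -
    have "(\<Sum>k<m. v k \<omega>) \<le> (\<Sum>k<a + m. indicator (A k) \<omega> * s k \<omega>)"
    proof -
      have "(\<Sum>k<m. v k \<omega>) = (\<Sum>k\<in>{a..<a + m}. indicator (A k) \<omega> * s k \<omega>)"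
        unfolding v_def using sum.shift_bounds_nat_ivl[of "\<lambda>k. indicator (A k) \<omega> * s k \<omega>" 0 a m]
        by (simp add: lessThan_atLeast0 add.commute)
      also have "\<dots> \<le> (\<Sum>k<a + m. indicator (A k) \<omega> * s k \<omega>)"
        using s by (intro sum_mono2) auto
      finally show ?thesis .
    qed
    also have "\<dots> \<le> C" using pos by (intro sum_truncated_le s) (auto simp: indicator_def A_def)
    finally show ?thesis .
  qed
  have same: "x j \<omega> = \<xi> (a + j) \<omega>" if "\<omega> \<in> space M" "\<omega> \<notin> D" "j < m" for j \<omega>
  proof -
    have "(\<Sum>i\<le>a + j. s i \<omega>) \<le> (\<Sum>i<n. s i \<omega>)" using s that(3) ab by (intro sum_mono2) (auto simp: m_def)
    then show ?thesis using that by (auto simp: x_def A_def D_def)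
  qed
  have sums: "(\<Sum>j<k. x j \<omega>) = (\<Sum>j\<in>{a..<a + k}. \<xi> j \<omega>)" if "\<omega> \<in> space M" "\<omega> \<notin> D" "k \<le> m" for k \<omega>
  proof -
    have "(\<Sum>j<k. x j \<omega>) = (\<Sum>j<k. \<xi> (a + j) \<omega>)" using same[OF that(1,2)] that(3) by (intro sum.cong) auto
    then show ?thesis using sum.shift_bounds_nat_ivl[of "\<lambda>k. \<xi> k \<omega>" 0 a k]
      by (simp add: lessThan_atLeast0 add.commute)
  qed
  let ?S = "\<lambda>\<omega>. \<Sum>j<m. x j \<omega>"
  have S2: "integrable M (\<lambda>\<omega>. (?S \<omega>)\<^sup>2)" "(\<integral>\<omega>. (?S \<omega>)\<^sup>2 \<partial>M) \<le> C"
    using second_moment_le[of ?G x v m C, OF sub' mono' x' xc0 xc2 vC] by auto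
  let ?P = "{\<omega> \<in> space M. \<exists>k\<le>m. 2 * \<eta> \<le> \<bar>\<Sum>j<k. x j \<omega>\<bar>}"
  let ?t = "\<lambda>y :: real. min R (max 0 (\<bar>y\<bar> - \<eta>))"
  have PM: "?P \<in> sets M" by measurable
  have Di: "integrable M (indicator D :: 'a \<Rightarrow> real)"
    by (rule integrable_const_bound[where B = 1]) (auto simp: indicator_def)
  have tR: "0 \<le> ?t y" "?t y \<le> R" for y using pos by auto
  have ti: "integrable M (\<lambda>\<omega>. ?t (f \<omega>))" if "f \<in> borel_measurable M" for f
    by (rule integrable_const_bound[where B = R]) (use that tR in auto)
  have "\<eta> * prob ?P \<le> (\<integral>\<omega>. max 0 (\<bar>?S \<omega>\<bar> - \<eta>) \<partial>M)"
    by (rule maximal_excess[of ?G x, OF sub' mono' x' xc0])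
  also have "\<dots> \<le> (\<integral>\<omega>. ?t (\<Sum>j\<in>{a..<b}. \<xi> j \<omega>) + R * indicator D \<omega> + (?S \<omega>)\<^sup>2 / R \<partial>M)"
  proof (rule integral_mono)
    show "integrable M (\<lambda>\<omega>. max 0 (\<bar>?S \<omega>\<bar> - \<eta>))"
      using cond_version_integrable(1)[OF xc0] by (intro integrable_max) auto
    show "integrable M (\<lambda>\<omega>. ?t (\<Sum>j\<in>{a..<b}. \<xi> j \<omega>) + R * indicator D \<omega> + (?S \<omega>)\<^sup>2 / R)"
      using S2 Di by (intro Bochner_Integration.integrable_add ti) auto
    fix \<omega> assume w: "\<omega> \<in> space M"
    have 1: "max 0 (\<bar>?S \<omega>\<bar> - \<eta>) \<le> ?t (?S \<omega>) + (?S \<omega>)\<^sup>2 / R"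
    proof (cases "\<bar>?S \<omega>\<bar> \<le> R")
      case True
      then show ?thesis using pos by (simp add: add_increasing2)
    next
      case False
      have "\<bar>?S \<omega>\<bar> * R \<le> \<bar>?S \<omega>\<bar> * \<bar>?S \<omega>\<bar>" using False by (intro mult_left_mono) auto
      then have "\<bar>?S \<omega>\<bar> \<le> (?S \<omega>)\<^sup>2 / R" using pos by (simp add: pos_le_divide_eq power2_eq_square)
      then show ?thesis using tR(1)[of "?S \<omega>"] pos False by simp
    qed
    have 2: "?t (?S \<omega>) \<le> ?t (\<Sum>j\<in>{a..<b}. \<xi> j \<omega>) + R * indicator D \<omega>"
    proof (cases "\<omega> \<in> D")
      case True
      then have i: "indicator D \<omega> = (1 :: real)" by simp
      show ?thesis unfolding i using tR(2)[of "?S \<omega>"] tR(1)[of "\<Sum>j\<in>{a..<b}. \<xi> j \<omega>"] by linarith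
    next
      case False
      then have i: "indicator D \<omega> = (0 :: real)" by simp
      have "?S \<omega> = (\<Sum>j\<in>{a..<b}. \<xi> j \<omega>)" using sums[OF w False order_refl] ab by (simp add: m_def)
      then show ?thesis unfolding i by simp
    qed
    show "max 0 (\<bar>?S \<omega>\<bar> - \<eta>) \<le> ?t (\<Sum>j\<in>{a..<b}. \<xi> j \<omega>) + R * indicator D \<omega> + (?S \<omega>)\<^sup>2 / R"
      using 1 2 by linarith
  qed
  also have "\<dots> = (\<integral>\<omega>. ?t (\<Sum>j\<in>{a..<b}. \<xi> j \<omega>) \<partial>M) + R * prob D + (\<integral>\<omega>. (?S \<omega>)\<^sup>2 \<partial>M) / R"
    using S2 Di ti[of "\<lambda>\<omega>. \<Sum>j\<in>{a..<b}. \<xi> j \<omega>"] by simp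
  also have "\<dots> \<le> (\<integral>\<omega>. ?t (\<Sum>j\<in>{a..<b}. \<xi> j \<omega>) \<partial>M) + R * prob D + C / R"
    using S2 pos by (intro add_left_mono divide_right_mono) auto
  finally have P: "prob ?P \<le> ((\<integral>\<omega>. ?t (\<Sum>j\<in>{a..<b}. \<xi> j \<omega>) \<partial>M) + R * prob D + C / R) / \<eta>"
    using pos by (simp add: pos_le_divide_eq mult.commute)
  have "{\<omega> \<in> space M. \<exists>k\<in>{a..b}. 2 * \<eta> \<le> \<bar>\<Sum>j\<in>{a..<k}. \<xi> j \<omega>\<bar>} \<subseteq> ?P \<union> D"
  proof
    fix \<omega> assume "\<omega> \<in> {\<omega> \<in> space M. \<exists>k\<in>{a..b}. 2 * \<eta> \<le> \<bar>\<Sum>j\<in>{a..<k}. \<xi> j \<omega>\<bar>}"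
    then obtain k where w: "\<omega> \<in> space M" and k: "a \<le> k" "k \<le> b" "2 * \<eta> \<le> \<bar>\<Sum>j\<in>{a..<k}. \<xi> j \<omega>\<bar>" by auto
    show "\<omega> \<in> ?P \<union> D"
    proof (cases "\<omega> \<in> D")
      case False
      have "k - a \<le> m" using k by (simp add: m_def)
      moreover from sums[OF w False this] have "(\<Sum>j<k - a. x j \<omega>) = (\<Sum>j\<in>{a..<k}. \<xi> j \<omega>)" using k by simp
      ultimately show ?thesis using w k by auto
    qed simp
  qed
  then have "prob {\<omega> \<in> space M. \<exists>k\<in>{a..b}. 2 * \<eta> \<le> \<bar>\<Sum>j\<in>{a..<k}. \<xi> j \<omega>\<bar>} \<le> prob (?P \<union> D)"
    using PM by (intro finite_measure_mono) auto
  also have "\<dots> \<le> prob ?P + prob D" using PM by (intro measure_Un_le) auto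
  finally show ?thesis using P by (simp add: D_def)
qed

end

section \<open>From characteristic functions to Lipschitz functions of finitely many variables\<close>

definition tilted_distr :: "'a measure \<Rightarrow> ('a \<Rightarrow> real) \<Rightarrow> ('a \<Rightarrow> real) \<Rightarrow> real measure" where
  "tilted_distr N A X = distr (density N (\<lambda>\<omega>. ennreal (A \<omega> / (\<integral>\<omega>. A \<omega> \<partial>N)))) borel X"

context prob_space
begin

context
  fixes A X :: "'a \<Rightarrow> real"
  assumes A [measurable]: "A \<in> borel_measurable M" and X [measurable]: "X \<in> borel_measurable M"
    and bounds: "\<And>\<omega>. 1 \<le> A \<omega>" "\<And>\<omega>. A \<omega> \<le> 3"
begin

lemma weight_integrable: "integrable M A"
  by (rule integrable_const_bound[where B = 3])
     (use bounds order_trans[OF zero_le_one bounds(1)] in auto)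

lemma weight_mean_ge: "1 \<le> (\<integral>\<omega>. A \<omega> \<partial>M)"
  using integral_mono[of M "\<lambda>_. 1" A] weight_integrable bounds by (simp add: prob_space)

lemma tilted_real_distribution: "real_distribution (tilted_distr M A X)"
proof -
  have "prob_space (density M (\<lambda>\<omega>. ennreal (A \<omega> / (\<integral>\<omega>. A \<omega> \<partial>M))))"
  proof
    have "(\<integral>\<^sup>+\<omega>. ennreal (A \<omega> / (\<integral>\<omega>. A \<omega> \<partial>M)) \<partial>M) = ennreal (\<integral>\<omega>. A \<omega> / (\<integral>\<omega>. A \<omega> \<partial>M) \<partial>M)"
      using weight_integrable weight_mean_ge order_trans[OF zero_le_one bounds(1)]
      by (intro nn_integral_eq_integral) auto
    also have "\<dots> = 1" using weight_mean_ge by simp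
    finally show "emeasure (density M (\<lambda>\<omega>. ennreal (A \<omega> / (\<integral>\<omega>. A \<omega> \<partial>M))))
        (space (density M (\<lambda>\<omega>. ennreal (A \<omega> / (\<integral>\<omega>. A \<omega> \<partial>M))))) = 1"
      by (simp add: emeasure_density cong: nn_integral_cong)
  qed
  then show ?thesis unfolding tilted_distr_def
    by (intro prob_space.real_distribution_distr) auto
qed

lemma tilted_integral:
  fixes h :: "real \<Rightarrow> 'b::{banach, second_countable_topology}"
  assumes [measurable]: "h \<in> borel_measurable borel"
  shows "(\<integral>x. h x \<partial>tilted_distr M A X) = (1 / (\<integral>\<omega>. A \<omega> \<partial>M)) *\<^sub>R (\<integral>\<omega>. A \<omega> *\<^sub>R h (X \<omega>) \<partial>M)"
proof -
  have "(\<integral>x. h x \<partial>tilted_distr M A X) = (\<integral>\<omega>. (A \<omega> / (\<integral>\<omega>. A \<omega> \<partial>M)) *\<^sub>R h (X \<omega>) \<partial>M)"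
    unfolding tilted_distr_def
    using weight_mean_ge order_trans[OF zero_le_one bounds(1)]
    by (subst integral_distr, simp, simp, subst integral_density) (auto intro!: AE_I2 divide_nonneg_nonneg)
  also have "\<dots> = (\<integral>\<omega>. (1 / (\<integral>\<omega>. A \<omega> \<partial>M)) *\<^sub>R (A \<omega> *\<^sub>R h (X \<omega>)) \<partial>M)"
    by (simp add: divide_inverse mult.commute)
  also have "\<dots> = (1 / (\<integral>\<omega>. A \<omega> \<partial>M)) *\<^sub>R (\<integral>\<omega>. A \<omega> *\<^sub>R h (X \<omega>) \<partial>M)"
    by (rule integral_scaleR_right) 
  finally show ?thesis .
qed

end
end

text \<open>Normalised by its mean, a weight is a density, so the claim is Levy's continuity theorem for the
  law of \<open>X n\<close> under that density; the normalising constants converge by the case \<open>t = 0\<close>.  The bounds 1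
  and 3 keep these constants away from 0 and are met by \<open>2 + Re A\<close> with \<open>norm A \<le> 1\<close>.\<close>

lemma weighted_levy:
  fixes A X :: "nat \<Rightarrow> 'a \<Rightarrow> real" and A' X' :: "'b \<Rightarrow> real" and h :: "real \<Rightarrow> real"
  assumes "prob_space N" "prob_space N'"
    and m: "\<And>n. A n \<in> borel_measurable N" "\<And>n. X n \<in> borel_measurable N"
      "A' \<in> borel_measurable N'" "X' \<in> borel_measurable N'"
    and b: "\<And>n \<omega>. 1 \<le> A n \<omega>" "\<And>n \<omega>. A n \<omega> \<le> 3" "\<And>\<omega>. 1 \<le> A' \<omega>" "\<And>\<omega>. A' \<omega> \<le> 3"
    and conv: "\<And>t. (\<lambda>n. \<integral>\<omega>. A n \<omega> *\<^sub>R iexp (t * X n \<omega>) \<partial>N) \<longlonglongrightarrow> (\<integral>\<omega>. A' \<omega> *\<^sub>R iexp (t * X' \<omega>) \<partial>N')"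
    and h: "\<And>x. isCont h x" "\<And>x. \<bar>h x\<bar> \<le> B"
  shows "(\<lambda>n. \<integral>\<omega>. A n \<omega> * h (X n \<omega>) \<partial>N) \<longlonglongrightarrow> (\<integral>\<omega>. A' \<omega> * h (X' \<omega>) \<partial>N')"
proof -
  interpret N: prob_space N by fact
  interpret N': prob_space N' by fact
  let ?a = "\<lambda>n. \<integral>\<omega>. A n \<omega> \<partial>N" and ?a' = "\<integral>\<omega>. A' \<omega> \<partial>N'"
  have hm [measurable]: "h \<in> borel_measurable borel"
    using h(1) by (intro borel_measurable_continuous_onI continuous_at_imp_continuous_on) auto
  have a': "1 \<le> ?a'" using N'.weight_mean_ge[OF m(3,4) b(3,4)] .
  have a: "1 \<le> ?a n" for n using N.weight_mean_ge[OF m(1,2) b(1,2)] .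
  have "(\<lambda>n. Re (\<integral>\<omega>. A n \<omega> *\<^sub>R iexp (0 * X n \<omega>) \<partial>N)) \<longlonglongrightarrow> Re (\<integral>\<omega>. A' \<omega> *\<^sub>R iexp (0 * X' \<omega>) \<partial>N')"
    by (intro tendsto_Re conv)
  then have alim: "?a \<longlonglongrightarrow> ?a'" by (simp add: scaleR_conv_of_real)
  have "weak_conv_m (\<lambda>n. tilted_distr N (A n) (X n)) (tilted_distr N' A' X')"
  proof (rule levy_continuity)
    show "real_distribution (tilted_distr N (A n) (X n))" for n
      using N.tilted_real_distribution[OF m(1,2) b(1,2)] .
    show "real_distribution (tilted_distr N' A' X')"
      using N'.tilted_real_distribution[OF m(3,4) b(3,4)] .
    have c: "char (tilted_distr N (A n) (X n)) t = (1 / ?a n) *\<^sub>R (\<integral>\<omega>. A n \<omega> *\<^sub>R iexp (t * X n \<omega>) \<partial>N)" for n t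
      unfolding char_def by (rule N.tilted_integral[OF m(1,2) b(1,2)]) simp
    have c': "char (tilted_distr N' A' X') t = (1 / ?a') *\<^sub>R (\<integral>\<omega>. A' \<omega> *\<^sub>R iexp (t * X' \<omega>) \<partial>N')" for t
      unfolding char_def by (rule N'.tilted_integral[OF m(3,4) b(3,4)]) simp
    show "(\<lambda>n. char (tilted_distr N (A n) (X n)) t) \<longlonglongrightarrow> char (tilted_distr N' A' X') t" for t
      unfolding c c' using a' by (intro tendsto_intros conv alim) auto
  qed
  then have w: "(\<lambda>n. \<integral>x. h x \<partial>tilted_distr N (A n) (X n)) \<longlonglongrightarrow> (\<integral>x. h x \<partial>tilted_distr N' A' X')"
    by (rule weak_conv_imp_integral_bdd_continuous_conv[rotated 2])
       (use h N.tilted_real_distribution[OF m(1,2) b(1,2)] N'.tilted_real_distribution[OF m(3,4) b(3,4)] in auto)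
  have "(\<lambda>n. ?a n * (\<integral>x. h x \<partial>tilted_distr N (A n) (X n))) \<longlonglongrightarrow> ?a' * (\<integral>x. h x \<partial>tilted_distr N' A' X')"
    by (intro tendsto_mult alim w)
  moreover have "?a n * (\<integral>x. h x \<partial>tilted_distr N (A n) (X n)) = (\<integral>\<omega>. A n \<omega> * h (X n \<omega>) \<partial>N)" for n
    using N.tilted_integral[OF m(1,2) b(1,2) hm, of n n] a[of n] by simp
  moreover have "?a' * (\<integral>x. h x \<partial>tilted_distr N' A' X') = (\<integral>\<omega>. A' \<omega> * h (X' \<omega>) \<partial>N')"
    using N'.tilted_integral[OF m(3,4) b(3,4) hm] a' by simp
  ultimately show ?thesis by simp
qed

lemma (in prob_space) integral_Re_weight:
  fixes A :: "'a \<Rightarrow> complex" and X :: "'a \<Rightarrow> real"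
  assumes [measurable]: "A \<in> borel_measurable M" "X \<in> borel_measurable M" and b: "\<And>\<omega>. norm (A \<omega>) \<le> 1"
  shows "(\<integral>\<omega>. (2 + Re (A \<omega>)) *\<^sub>R iexp (t * X \<omega>) \<partial>M) = 2 * (\<integral>\<omega>. iexp (t * X \<omega>) \<partial>M) +
      ((\<integral>\<omega>. A \<omega> * iexp (t * X \<omega>) \<partial>M) + cnj (\<integral>\<omega>. A \<omega> * iexp (- t * X \<omega>) \<partial>M)) / 2"
proof -
  have i: "integrable M (\<lambda>\<omega>. A \<omega> * iexp (t * X \<omega>))" for t
    by (rule integrable_const_bound[where B = 1]) (use b in \<open>auto simp: norm_mult\<close>)
  have i0: "integrable M (\<lambda>\<omega>. iexp (t * X \<omega>))"
    by (rule integrable_const_bound[where B = 1]) auto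
  have "(2 + Re (A \<omega>)) *\<^sub>R iexp (t * X \<omega>) = 2 * iexp (t * X \<omega>) +
      (A \<omega> * iexp (t * X \<omega>) + cnj (A \<omega> * iexp (- t * X \<omega>))) / 2" for \<omega>
  proof -
    have "cnj (iexp (- t * X \<omega>)) = iexp (t * X \<omega>)" by (simp add: exp_cnj)
    moreover have "of_real (Re (A \<omega>)) = (A \<omega> + cnj (A \<omega>)) / 2" by (simp add: complex_eq_iff)
    ultimately show ?thesis by (simp add: scaleR_conv_of_real algebra_simps add_divide_distrib)
  qed
  then have "(\<integral>\<omega>. (2 + Re (A \<omega>)) *\<^sub>R iexp (t * X \<omega>) \<partial>M) =
      (\<integral>\<omega>. 2 * iexp (t * X \<omega>) + (A \<omega> * iexp (t * X \<omega>) + cnj (A \<omega> * iexp (- t * X \<omega>))) / 2 \<partial>M)" by simp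
  also have "\<dots> = 2 * (\<integral>\<omega>. iexp (t * X \<omega>) \<partial>M) +
      ((\<integral>\<omega>. A \<omega> * iexp (t * X \<omega>) \<partial>M) + cnj (\<integral>\<omega>. A \<omega> * iexp (- t * X \<omega>) \<partial>M)) / 2"
    using i[of t] i[of "- t"] i0 integrable_cnj[OF i[of "- t"]]
    by (simp del: complex_cnj_mult add: integral_cnj)
  finally show ?thesis .
qed

text \<open>Apply the theorem to the positive weights \<open>2 + Re A\<close> and \<open>2\<close> and subtract.\<close>

lemma levy_complex_weight_Re:
  fixes A :: "nat \<Rightarrow> 'a \<Rightarrow> complex" and X :: "nat \<Rightarrow> 'a \<Rightarrow> real" and A' :: "'b \<Rightarrow> complex" and X' :: "'b \<Rightarrow> real"
    and h :: "real \<Rightarrow> real"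
  assumes P: "prob_space N" "prob_space N'"
    and m: "\<And>n. A n \<in> borel_measurable N" "\<And>n. X n \<in> borel_measurable N"
      "A' \<in> borel_measurable N'" "X' \<in> borel_measurable N'"
    and b: "\<And>n \<omega>. norm (A n \<omega>) \<le> 1" "\<And>\<omega>. norm (A' \<omega>) \<le> 1"
    and conv: "\<And>t. (\<lambda>n. \<integral>\<omega>. A n \<omega> * iexp (t * X n \<omega>) \<partial>N) \<longlonglongrightarrow> (\<integral>\<omega>. A' \<omega> * iexp (t * X' \<omega>) \<partial>N')"
      "\<And>t. (\<lambda>n. \<integral>\<omega>. iexp (t * X n \<omega>) \<partial>N) \<longlonglongrightarrow> (\<integral>\<omega>. iexp (t * X' \<omega>) \<partial>N')"
    and h: "\<And>x. isCont h x" "\<And>x. \<bar>h x\<bar> \<le> B"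
  shows "(\<lambda>n. \<integral>\<omega>. Re (A n \<omega>) * h (X n \<omega>) \<partial>N) \<longlonglongrightarrow> (\<integral>\<omega>. Re (A' \<omega>) * h (X' \<omega>) \<partial>N')"
proof -
  interpret N: prob_space N by fact
  interpret N': prob_space N' by fact
  note [measurable] = m
  have hm [measurable]: "h \<in> borel_measurable borel"
    using h(1) by (intro borel_measurable_continuous_onI continuous_at_imp_continuous_on) auto
  have r: "\<bar>Re (A n \<omega>)\<bar> \<le> 1" "\<bar>Re (A' \<omega>')\<bar> \<le> 1" for n \<omega> \<omega>'
    using b order_trans[OF abs_Re_le_cmod] by auto
  have 1: "(\<lambda>n. \<integral>\<omega>. (2 + Re (A n \<omega>)) * h (X n \<omega>) \<partial>N) \<longlonglongrightarrow> (\<integral>\<omega>. (2 + Re (A' \<omega>)) * h (X' \<omega>) \<partial>N')"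
  proof (rule weighted_levy[OF P _ m(2) _ m(4) _ _ _ _ _ h])
    show "(\<lambda>n. \<integral>\<omega>. (2 + Re (A n \<omega>)) *\<^sub>R iexp (t * X n \<omega>) \<partial>N) \<longlonglongrightarrow> (\<integral>\<omega>. (2 + Re (A' \<omega>)) *\<^sub>R iexp (t * X' \<omega>) \<partial>N')" for t
      unfolding N.integral_Re_weight[OF m(1,2) b(1)] N'.integral_Re_weight[OF m(3,4) b(2)]
      by (intro tendsto_intros conv tendsto_cnj) auto
    show "1 \<le> 2 + Re (A n \<omega>)" "2 + Re (A n \<omega>) \<le> 3" for n \<omega> using r(1)[of n \<omega>] by linarith+
    show "1 \<le> 2 + Re (A' \<omega>)" "2 + Re (A' \<omega>) \<le> 3" for \<omega> using r(2)[of \<omega>] by linarith+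
  qed auto
  have 2: "(\<lambda>n. \<integral>\<omega>. 2 * h (X n \<omega>) \<partial>N) \<longlonglongrightarrow> (\<integral>\<omega>. 2 * h (X' \<omega>) \<partial>N')"
  proof (rule weighted_levy[OF P _ m(2) _ m(4) _ _ _ _ _ h])
    show "(\<lambda>n. \<integral>\<omega>. 2 *\<^sub>R iexp (t * X n \<omega>) \<partial>N) \<longlonglongrightarrow> (\<integral>\<omega>. 2 *\<^sub>R iexp (t * X' \<omega>) \<partial>N')" for t
      using tendsto_scaleR[OF tendsto_const conv(2), of 2 t] by simp
  qed auto
  have rh: "\<bar>Re (A n \<omega>) * h (X n \<omega>)\<bar> \<le> 1 * B" "\<bar>Re (A' \<omega>') * h (X' \<omega>')\<bar> \<le> 1 * B" for n \<omega> \<omega>'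
    unfolding abs_mult by (intro mult_mono r h; simp)+
  have i: "integrable N (\<lambda>\<omega>. Re (A n \<omega>) * h (X n \<omega>))" "integrable N (\<lambda>\<omega>. h (X n \<omega>))"
    "integrable N' (\<lambda>\<omega>. Re (A' \<omega>) * h (X' \<omega>))" "integrable N' (\<lambda>\<omega>. h (X' \<omega>))" for n
    using rh h(2) by (auto intro!: N.integrable_const_bound[where B = B] N'.integrable_const_bound[where B = B])
  show ?thesis using tendsto_diff[OF 1 2] i by (simp add: distrib_right)
qed

lemma levy_complex_weight:
  fixes A :: "nat \<Rightarrow> 'a \<Rightarrow> complex" and X :: "nat \<Rightarrow> 'a \<Rightarrow> real" and A' :: "'b \<Rightarrow> complex" and X' :: "'b \<Rightarrow> real"
    and h :: "real \<Rightarrow> real"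
  assumes P: "prob_space N" "prob_space N'"
    and m: "\<And>n. A n \<in> borel_measurable N" "\<And>n. X n \<in> borel_measurable N"
      "A' \<in> borel_measurable N'" "X' \<in> borel_measurable N'"
    and b: "\<And>n \<omega>. norm (A n \<omega>) \<le> 1" "\<And>\<omega>. norm (A' \<omega>) \<le> 1"
    and conv: "\<And>t. (\<lambda>n. \<integral>\<omega>. A n \<omega> * iexp (t * X n \<omega>) \<partial>N) \<longlonglongrightarrow> (\<integral>\<omega>. A' \<omega> * iexp (t * X' \<omega>) \<partial>N')"
      "\<And>t. (\<lambda>n. \<integral>\<omega>. iexp (t * X n \<omega>) \<partial>N) \<longlonglongrightarrow> (\<integral>\<omega>. iexp (t * X' \<omega>) \<partial>N')"
    and h: "\<And>x. isCont h x" "\<And>x. \<bar>h x\<bar> \<le> B"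
  shows "(\<lambda>n. \<integral>\<omega>. A n \<omega> * of_real (h (X n \<omega>)) \<partial>N) \<longlonglongrightarrow> (\<integral>\<omega>. A' \<omega> * of_real (h (X' \<omega>)) \<partial>N')"
proof -
  interpret N: prob_space N by fact
  interpret N': prob_space N' by fact
  note [measurable] = m
  have hm [measurable]: "h \<in> borel_measurable borel"
    using h(1) by (intro borel_measurable_continuous_onI continuous_at_imp_continuous_on) auto
  have re: "(\<lambda>n. \<integral>\<omega>. Re (A n \<omega>) * h (X n \<omega>) \<partial>N) \<longlonglongrightarrow> (\<integral>\<omega>. Re (A' \<omega>) * h (X' \<omega>) \<partial>N')"
    by (rule levy_complex_weight_Re[OF P m b conv h])
  have "(\<lambda>n. \<integral>\<omega>. Re (- \<i> * A n \<omega>) * h (X n \<omega>) \<partial>N) \<longlonglongrightarrow> (\<integral>\<omega>. Re (- \<i> * A' \<omega>) * h (X' \<omega>) \<partial>N')"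
  proof (rule levy_complex_weight_Re[OF P _ m(2) _ m(4) _ _ _ conv(2) h])
    show "(\<lambda>n. \<integral>\<omega>. - \<i> * A n \<omega> * iexp (t * X n \<omega>) \<partial>N) \<longlonglongrightarrow> (\<integral>\<omega>. - \<i> * A' \<omega> * iexp (t * X' \<omega>) \<partial>N')" for t
      using tendsto_mult[OF tendsto_const conv(1), of "- \<i>" t] by (simp add: mult.assoc)
  qed (use b in \<open>auto simp: norm_mult\<close>)
  then have im: "(\<lambda>n. \<integral>\<omega>. Im (A n \<omega>) * h (X n \<omega>) \<partial>N) \<longlonglongrightarrow> (\<integral>\<omega>. Im (A' \<omega>) * h (X' \<omega>) \<partial>N')" by simp
  have i: "integrable N (\<lambda>\<omega>. A n \<omega> * of_real (h (X n \<omega>)))" for n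
  proof (rule N.integrable_const_bound[where B = "1 * B"])
    show "AE \<omega> in N. norm (A n \<omega> * of_real (h (X n \<omega>))) \<le> 1 * B"
      unfolding norm_mult norm_of_real by (intro AE_I2 mult_mono b h) auto
  qed simp
  have i': "integrable N' (\<lambda>\<omega>. A' \<omega> * of_real (h (X' \<omega>)))"
  proof (rule N'.integrable_const_bound[where B = "1 * B"])
    show "AE \<omega> in N'. norm (A' \<omega> * of_real (h (X' \<omega>))) \<le> 1 * B"
      unfolding norm_mult norm_of_real by (intro AE_I2 mult_mono b h) auto
  qed simp
  show ?thesis
    unfolding tendsto_complex_iff integral_Re[OF i, symmetric] integral_Im[OF i, symmetric]
      integral_Re[OF i', symmetric] integral_Im[OF i', symmetric]
    using re im by simp
qed

text \<open>The factors \<open>iexp (u i * X i)\<close> are exchanged for \<open>h i (X i)\<close> one coordinate at a time.  When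
  coordinate \<open>j\<close> is treated, the remaining product is a complex weight of modulus at most 1, and the
  hypothesis for all \<open>u\<close> supplies the convergence with an additional factor \<open>iexp (t * X j)\<close>.\<close>

lemma charfun_imp_product_convergence:
  fixes X :: "nat \<Rightarrow> 'i \<Rightarrow> 'a \<Rightarrow> real" and X' :: "'i \<Rightarrow> 'b \<Rightarrow> real" and h :: "'i \<Rightarrow> real \<Rightarrow> real"
  assumes P: "prob_space N" "prob_space N'" and I: "finite I"
    and m: "\<And>n i. i \<in> I \<Longrightarrow> X n i \<in> borel_measurable N" "\<And>i. i \<in> I \<Longrightarrow> X' i \<in> borel_measurable N'"
    and conv: "\<And>u :: 'i \<Rightarrow> real. (\<lambda>n. \<integral>\<omega>. iexp (\<Sum>i\<in>I. u i * X n i \<omega>) \<partial>N) \<longlonglongrightarrow> (\<integral>\<omega>. iexp (\<Sum>i\<in>I. u i * X' i \<omega>) \<partial>N')"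
    and h: "\<And>i x. isCont (h i) x" "\<And>i x. \<bar>h i x\<bar> \<le> 1"
  shows "(\<lambda>n. \<integral>\<omega>. (\<Prod>i\<in>I. h i (X n i \<omega>)) \<partial>N) \<longlonglongrightarrow> (\<integral>\<omega>. (\<Prod>i\<in>I. h i (X' i \<omega>)) \<partial>N')"
proof -
  interpret N: prob_space N by fact
  interpret N': prob_space N' by fact
  have hm [measurable]: "h i \<in> borel_measurable borel" for i
    using h(1) by (intro borel_measurable_continuous_onI continuous_at_imp_continuous_on) auto
  have shift: "(\<Sum>i\<in>I. (u(j := u j + t)) i * x i) = (\<Sum>i\<in>I. u i * x i) + t * x j" if "j \<in> I" for u x :: "'i \<Rightarrow> real" and j t
  proof -
    have "(\<Sum>i\<in>I. (u(j := u j + t)) i * x i) = (\<Sum>i\<in>I. u i * x i + (if i = j then t * x j else 0))"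
      by (intro sum.cong) (auto simp: distrib_right)
    then show ?thesis using I that by (simp add: sum.distrib)
  qed
  have one: "(\<lambda>n. \<integral>\<omega>. iexp (t * X n j \<omega>) \<partial>N) \<longlonglongrightarrow> (\<integral>\<omega>. iexp (t * X' j \<omega>) \<partial>N')" if "j \<in> I" for j t
  proof -
    have "(\<Sum>i\<in>I. (if i = j then t else 0) * x i) = t * x j" for x :: "'i \<Rightarrow> real"
    proof -
      have "(\<Sum>i\<in>I. (if i = j then t else 0) * x i) = (\<Sum>i\<in>I. if i = j then t * x j else 0)"
        by (intro sum.cong) auto
      then show ?thesis using I that by simp
    qed
    then show ?thesis using conv[of "\<lambda>i. if i = j then t else 0"] by simp
  qed
  \<comment> \<open>\<open>J\<close> is the set of coordinates that have been exchanged; the factor \<open>iexp\<close> with all of \<open>I\<close> stays\<close>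
  have "(\<lambda>n. \<integral>\<omega>. of_real (\<Prod>i\<in>J. h i (X n i \<omega>)) * iexp (\<Sum>i\<in>I. u i * X n i \<omega>) \<partial>N) \<longlonglongrightarrow>
      (\<integral>\<omega>. of_real (\<Prod>i\<in>J. h i (X' i \<omega>)) * iexp (\<Sum>i\<in>I. u i * X' i \<omega>) \<partial>N')" if "finite J" "J \<subseteq> I" for J u
    using that
  proof (induction J arbitrary: u)
    case empty
    then show ?case using conv by simp
  next
    case (insert j J)
    then have j: "j \<in> I" and J: "J \<subseteq> I" by auto
    have pb: "\<bar>\<Prod>i\<in>J. h i (x i)\<bar> \<le> 1" for x
      using h(2) by (auto simp: abs_prod intro!: prod_le_1)
    let ?A = "\<lambda>n \<omega>. of_real (\<Prod>i\<in>J. h i (X n i \<omega>)) * iexp (\<Sum>i\<in>I. u i * X n i \<omega>)"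
    let ?A' = "\<lambda>\<omega>. of_real (\<Prod>i\<in>J. h i (X' i \<omega>)) * iexp (\<Sum>i\<in>I. u i * X' i \<omega>)"
    have "(\<lambda>n. \<integral>\<omega>. ?A n \<omega> * of_real (h j (X n j \<omega>)) \<partial>N) \<longlonglongrightarrow> (\<integral>\<omega>. ?A' \<omega> * of_real (h j (X' j \<omega>)) \<partial>N')"
    proof (rule levy_complex_weight[OF P _ _ _ _ _ _ _ one[OF j] h])
      show "?A n \<in> borel_measurable N" for n
      proof -
        have [measurable]: "(\<lambda>\<omega>. \<Prod>i\<in>J. h i (X n i \<omega>)) \<in> borel_measurable N"
          using m(1) J by (intro borel_measurable_prod measurable_compose[OF _ hm]) auto
        have [measurable]: "(\<lambda>\<omega>. \<Sum>i\<in>I. u i * X n i \<omega>) \<in> borel_measurable N"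
          using m(1) by (intro borel_measurable_sum borel_measurable_times) auto
        show ?thesis by measurable
      qed
      show "?A' \<in> borel_measurable N'"
      proof -
        have [measurable]: "(\<lambda>\<omega>. \<Prod>i\<in>J. h i (X' i \<omega>)) \<in> borel_measurable N'"
          using m(2) J by (intro borel_measurable_prod measurable_compose[OF _ hm]) auto
        have [measurable]: "(\<lambda>\<omega>. \<Sum>i\<in>I. u i * X' i \<omega>) \<in> borel_measurable N'"
          using m(2) by (intro borel_measurable_sum borel_measurable_times) auto
        show ?thesis by measurable
      qed
      show "norm (?A n \<omega>) \<le> 1" for n \<omega>
        using pb by (simp add: norm_mult del: of_real_prod)
      show "norm (?A' \<omega>) \<le> 1" for \<omega>
        using pb by (simp add: norm_mult del: of_real_prod)
      show "(\<lambda>n. \<integral>\<omega>. ?A n \<omega> * iexp (t * X n j \<omega>) \<partial>N) \<longlonglongrightarrow> (\<integral>\<omega>. ?A' \<omega> * iexp (t * X' j \<omega>) \<partial>N')" for t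
      proof -
        have e: "iexp (\<Sum>i\<in>I. (u(j := u j + t)) i * x i) = iexp (\<Sum>i\<in>I. u i * x i) * iexp (t * x j)" for x :: "'i \<Rightarrow> real"
          by (simp only: shift[OF j] of_real_add distrib_left exp_add)
        show ?thesis
          using insert.IH[OF J, of "u(j := u j + t)"]
            e[of "\<lambda>i. X _ i _"] e[of "\<lambda>i. X' i _"] by (simp only: mult.assoc)
      qed
    qed (use m j in auto)
    then show ?case using insert by (simp add: mult.commute mult.left_commute mult.assoc)
  qed
  from this[OF I order_refl, of "\<lambda>_. 0"]
  have "(\<lambda>n. of_real (\<integral>\<omega>. (\<Prod>i\<in>I. h i (X n i \<omega>)) \<partial>N)) \<longlonglongrightarrow> complex_of_real (\<integral>\<omega>. (\<Prod>i\<in>I. h i (X' i \<omega>)) \<partial>N')"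
    by (simp del: of_real_prod)
  then show ?thesis by (simp only: tendsto_of_real_iff)
qed

definition tent :: "real \<Rightarrow> real" where
  "tent x = max 0 (1 - \<bar>x\<bar>)"

lemma tent_bounds: "0 \<le> tent x" "tent x \<le> 1" "\<bar>tent x\<bar> \<le> 1"
  by (auto simp: tent_def)

text \<open>The integer translates of the tent function form a partition of unity of the line.\<close>

lemma sum_tent:
  assumes "finite S"
  shows "(\<Sum>k\<in>S. tent (y - of_int k)) =
    (if \<lfloor>y\<rfloor> \<in> S then 1 - frac y else 0) + (if \<lfloor>y\<rfloor> + 1 \<in> S then frac y else 0)"
proof -
  have z: "tent (y - of_int k) = 0" if "k \<noteq> \<lfloor>y\<rfloor>" "k \<noteq> \<lfloor>y\<rfloor> + 1" for k
  proof -
    have "k < \<lfloor>y\<rfloor> \<or> k > \<lfloor>y\<rfloor> + 1" using that by linarith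
    then have "1 \<le> \<bar>y - of_int k\<bar>" by linarith
    then show ?thesis by (simp add: tent_def)
  qed
  have "(\<Sum>k\<in>S. tent (y - of_int k)) = (\<Sum>k\<in>S. (if k = \<lfloor>y\<rfloor> then tent (y - of_int k) else 0) +
      (if k = \<lfloor>y\<rfloor> + 1 then tent (y - of_int k) else 0))"
    by (intro sum.cong) (auto simp: z)
  also have "\<dots> = (if \<lfloor>y\<rfloor> \<in> S then tent (y - of_int \<lfloor>y\<rfloor>) else 0) +
      (if \<lfloor>y\<rfloor> + 1 \<in> S then tent (y - of_int (\<lfloor>y\<rfloor> + 1)) else 0)"
    using assms by (simp add: sum.distrib sum.delta)
  also have "tent (y - of_int \<lfloor>y\<rfloor>) = 1 - frac y" by (simp add: tent_def frac_def) linarith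
  also have "tent (y - of_int (\<lfloor>y\<rfloor> + 1)) = frac y" by (simp add: tent_def frac_def)
  finally show ?thesis .
qed

lemma sum_tent_le_1: "finite S \<Longrightarrow> (\<Sum>k\<in>S. tent (y - of_int k)) \<le> 1"
  using frac_ge_0[of y] frac_lt_1[of y] by (simp add: sum_tent)

lemma sum_tent_eq_1:
  assumes "\<bar>y\<bar> \<le> real R"
  shows "(\<Sum>k\<in>{- int R..int R}. tent (y - of_int k)) = 1"
proof -
  have "\<lfloor>y\<rfloor> \<in> {- int R..int R}" using assms by (auto simp: le_floor_iff floor_le_iff)
  moreover have "frac y = 0" if "\<lfloor>y\<rfloor> + 1 \<notin> {- int R..int R}"
  proof -
    have "\<lfloor>y\<rfloor> \<ge> int R" using that \<open>\<lfloor>y\<rfloor> \<in> _\<close> by auto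
    then have "y \<ge> real R" by linarith
    then have "y = real R" using assms by linarith
    then show ?thesis by simp
  qed
  ultimately show ?thesis by (auto simp: sum_tent)
qed

text \<open>Products of tents on the grid of mesh \<open>\<delta>\<close> form a partition of unity of the space of coordinates,
  and each product lives within \<open>\<delta>\<close> of its grid point in every coordinate.  With indices from the finite
  set \<open>S\<close> the products add up to 1 only in a bounded region; the missing mass multiplies \<open>B\<close>.\<close>

lemma tent_approximation:
  fixes g :: "('i \<Rightarrow> real) \<Rightarrow> real"
  assumes I: "finite I" and \<delta>: "0 < \<delta>" and S: "finite S"
    and gB: "\<And>x. \<bar>g x\<bar> \<le> B" and gL: "\<And>x y. \<bar>g x - g y\<bar> \<le> L * (\<Sum>i\<in>I. \<bar>x i - y i\<bar>)" and L: "0 \<le> L"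
  shows "\<bar>g x - (\<Sum>\<kappa>\<in>PiE I (\<lambda>_. S). g (\<lambda>i. \<delta> * of_int (\<kappa> i)) * (\<Prod>i\<in>I. tent (x i / \<delta> - of_int (\<kappa> i))))\<bar>
    \<le> L * \<delta> * real (card I) + B * (1 - (\<Sum>\<kappa>\<in>PiE I (\<lambda>_. S). \<Prod>i\<in>I. tent (x i / \<delta> - of_int (\<kappa> i))))"
proof -
  let ?K = "PiE I (\<lambda>_. S)"
  let ?p = "\<lambda>\<kappa>. \<Prod>i\<in>I. tent (x i / \<delta> - of_int (\<kappa> i))"
  let ?y = "\<lambda>\<kappa> i. \<delta> * of_int (\<kappa> i)"
  have p0: "0 \<le> ?p \<kappa>" for \<kappa> by (intro prod_nonneg) (simp add: tent_bounds)
  have sum: "(\<Sum>\<kappa>\<in>?K. ?p \<kappa>) = (\<Prod>i\<in>I. \<Sum>k\<in>S. tent (x i / \<delta> - of_int k))"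
    by (rule prod_sum_PiE[symmetric]) (use I S in auto)
  have sum1: "(\<Sum>\<kappa>\<in>?K. ?p \<kappa>) \<le> 1"
    unfolding sum by (intro prod_le_1) (auto intro!: sum_nonneg sum_tent_le_1 S simp: tent_bounds)
  have near: "\<bar>g x - g (?y \<kappa>)\<bar> * ?p \<kappa> \<le> L * \<delta> * real (card I) * ?p \<kappa>" for \<kappa>
  proof (cases "?p \<kappa> = 0")
    case False
    have "\<bar>x i - ?y \<kappa> i\<bar> \<le> \<delta>" if "i \<in> I" for i
    proof -
      have "tent (x i / \<delta> - of_int (\<kappa> i)) \<noteq> 0" using False I that by auto
      then have "\<bar>x i / \<delta> - of_int (\<kappa> i)\<bar> \<le> 1" by (auto simp: tent_def max_def split: if_splits)
      then have "\<delta> * \<bar>x i / \<delta> - of_int (\<kappa> i)\<bar> \<le> \<delta> * 1" using \<delta> by (intro mult_left_mono) auto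
      moreover have "x i - ?y \<kappa> i = \<delta> * (x i / \<delta> - of_int (\<kappa> i))" using \<delta> by (simp add: right_diff_distrib)
      ultimately show ?thesis using \<delta> by (simp add: abs_mult)
    qed
    then have "(\<Sum>i\<in>I. \<bar>x i - ?y \<kappa> i\<bar>) \<le> (\<Sum>i\<in>I. \<delta>)" by (intro sum_mono)
    then have "L * (\<Sum>i\<in>I. \<bar>x i - ?y \<kappa> i\<bar>) \<le> L * (real (card I) * \<delta>)" using L by (intro mult_left_mono) auto
    then have "\<bar>g x - g (?y \<kappa>)\<bar> \<le> L * \<delta> * real (card I)"
      using gL[of x "?y \<kappa>"] by (simp add: mult.assoc mult.commute[of \<delta>])
    then show ?thesis using p0 by (rule mult_right_mono)
  qed simp
  have eq: "g x - (\<Sum>\<kappa>\<in>?K. g (?y \<kappa>) * ?p \<kappa>) = g x * (1 - (\<Sum>\<kappa>\<in>?K. ?p \<kappa>)) + (\<Sum>\<kappa>\<in>?K. (g x - g (?y \<kappa>)) * ?p \<kappa>)"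
    by (simp add: left_diff_distrib right_diff_distrib sum_subtractf sum_distrib_left)
  have "\<bar>g x - (\<Sum>\<kappa>\<in>?K. g (?y \<kappa>) * ?p \<kappa>)\<bar> \<le> \<bar>g x\<bar> * (1 - (\<Sum>\<kappa>\<in>?K. ?p \<kappa>)) + (\<Sum>\<kappa>\<in>?K. \<bar>g x - g (?y \<kappa>)\<bar> * ?p \<kappa>)"
    unfolding eq
  proof (rule order_trans[OF abs_triangle_ineq add_mono])
    show "\<bar>g x * (1 - (\<Sum>\<kappa>\<in>?K. ?p \<kappa>))\<bar> \<le> \<bar>g x\<bar> * (1 - (\<Sum>\<kappa>\<in>?K. ?p \<kappa>))" using sum1 by (simp add: abs_mult)
    show "\<bar>\<Sum>\<kappa>\<in>?K. (g x - g (?y \<kappa>)) * ?p \<kappa>\<bar> \<le> (\<Sum>\<kappa>\<in>?K. \<bar>g x - g (?y \<kappa>)\<bar> * ?p \<kappa>)"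
      by (rule order_trans[OF sum_abs]) (simp add: abs_mult p0)
  qed
  also have "\<dots> \<le> B * (1 - (\<Sum>\<kappa>\<in>?K. ?p \<kappa>)) + (\<Sum>\<kappa>\<in>?K. L * \<delta> * real (card I) * ?p \<kappa>)"
  proof (rule add_mono)
    show "\<bar>g x\<bar> * (1 - (\<Sum>\<kappa>\<in>?K. ?p \<kappa>)) \<le> B * (1 - (\<Sum>\<kappa>\<in>?K. ?p \<kappa>))"
      by (rule mult_right_mono[OF gB]) (use sum1 in simp)
    show "(\<Sum>\<kappa>\<in>?K. \<bar>g x - g (?y \<kappa>)\<bar> * ?p \<kappa>) \<le> (\<Sum>\<kappa>\<in>?K. L * \<delta> * real (card I) * ?p \<kappa>)"
    proof (rule sum_mono)
      fix \<kappa>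
      show "\<bar>g x - g (?y \<kappa>)\<bar> * ?p \<kappa> \<le> L * \<delta> * real (card I) * ?p \<kappa>" by (rule near)
    qed
  qed
  also have "(\<Sum>\<kappa>\<in>?K. L * \<delta> * real (card I) * ?p \<kappa>) = L * \<delta> * real (card I) * (\<Sum>\<kappa>\<in>?K. ?p \<kappa>)"
    by (rule sum_distrib_left[symmetric])
  also have "\<dots> \<le> L * \<delta> * real (card I) * 1" using sum1 L \<delta> by (intro mult_left_mono) auto
  finally show ?thesis by simp
qed

text \<open>A tent approximation is a finite combination of product functions, for which convergence is
  known.  The mass that it misses is small under the limit law for large \<open>R\<close>, and therefore, as it is
  itself such a combination, eventually also along the sequence; this replaces a tightness argument.\<close>

theorem charfun_imp_lipschitz_convergence:
  fixes X :: "nat \<Rightarrow> 'i \<Rightarrow> 'a \<Rightarrow> real" and X' :: "'i \<Rightarrow> 'b \<Rightarrow> real" and g :: "('i \<Rightarrow> real) \<Rightarrow> real"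
  assumes P: "prob_space N" "prob_space N'" and I: "finite I"
    and m: "\<And>n i. i \<in> I \<Longrightarrow> X n i \<in> borel_measurable N" "\<And>i. i \<in> I \<Longrightarrow> X' i \<in> borel_measurable N'"
    and conv: "\<And>u :: 'i \<Rightarrow> real. (\<lambda>n. \<integral>\<omega>. iexp (\<Sum>i\<in>I. u i * X n i \<omega>) \<partial>N) \<longlonglongrightarrow> (\<integral>\<omega>. iexp (\<Sum>i\<in>I. u i * X' i \<omega>) \<partial>N')"
    and gm: "\<And>n. (\<lambda>\<omega>. g (\<lambda>i. X n i \<omega>)) \<in> borel_measurable N" "(\<lambda>\<omega>. g (\<lambda>i. X' i \<omega>)) \<in> borel_measurable N'"
    and gB: "\<And>x. \<bar>g x\<bar> \<le> B" and gL: "\<And>x y. \<bar>g x - g y\<bar> \<le> L * (\<Sum>i\<in>I. \<bar>x i - y i\<bar>)" and L: "0 \<le> L"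
  shows "(\<lambda>n. \<integral>\<omega>. g (\<lambda>i. X n i \<omega>) \<partial>N) \<longlonglongrightarrow> (\<integral>\<omega>. g (\<lambda>i. X' i \<omega>) \<partial>N')"
proof (rule LIMSEQ_I)
  fix e :: real assume e: "0 < e"
  interpret N: prob_space N by fact
  interpret N': prob_space N' by fact
  have B: "0 \<le> B" using gB[of undefined] by linarith
  \<comment> \<open>the added 1 keeps \<open>c\<close> positive when \<open>L = 0\<close> or \<open>I\<close> is empty\<close>
  define c where "c = L * real (card I) + 1"
  define \<delta> where "\<delta> = e / (8 * c)"
  have c: "0 < c" using L by (simp add: c_def add_nonneg_pos)
  have \<delta>: "0 < \<delta>" using e c by (simp add: \<delta>_def)
  have \<delta>e: "L * \<delta> * real (card I) \<le> e / 8"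
  proof -
    have "L * \<delta> * real (card I) \<le> \<delta> * c" using \<delta> by (simp add: algebra_simps c_def)
    also have "\<dots> = e / 8" using c by (simp add: \<delta>_def)
    finally show ?thesis .
  qed
  define p where "p \<kappa> x = (\<Prod>i\<in>I. tent (x i / \<delta> - of_int (\<kappa> i)))" for \<kappa> :: "'i \<Rightarrow> int" and x :: "'i \<Rightarrow> real"
  define K where "K R = PiE I (\<lambda>_. {- int R..int R})" for R
  have finK: "finite (K R)" for R unfolding K_def using I by (intro finite_PiE) auto
  define q where "q R x = (\<Sum>\<kappa>\<in>K R. p \<kappa> x)" for R x
  define G where "G R x = (\<Sum>\<kappa>\<in>K R. g (\<lambda>i. \<delta> * of_int (\<kappa> i)) * p \<kappa> x)" for R x
  have pc: "(\<lambda>n. \<integral>\<omega>. p \<kappa> (\<lambda>i. X n i \<omega>) \<partial>N) \<longlonglongrightarrow> (\<integral>\<omega>. p \<kappa> (\<lambda>i. X' i \<omega>) \<partial>N')" for \<kappa>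
    unfolding p_def
    by (rule charfun_imp_product_convergence[OF P I m conv, where h = "\<lambda>i x. tent (x / \<delta> - of_int (\<kappa> i))"])
       (use \<delta> in \<open>auto simp: tent_bounds(3) tent_def intro!: continuous_intros\<close>)
  have tm [measurable]: "tent \<in> borel_measurable borel" unfolding tent_def[abs_def] by measurable
  have pm: "(\<lambda>\<omega>. p \<kappa> (\<lambda>i. X n i \<omega>)) \<in> borel_measurable N" "(\<lambda>\<omega>. p \<kappa> (\<lambda>i. X' i \<omega>)) \<in> borel_measurable N'" for n \<kappa>
    unfolding p_def using m by (auto intro!: borel_measurable_prod measurable_compose[OF _ tm])
  have p01: "0 \<le> p \<kappa> x" "p \<kappa> x \<le> 1" for \<kappa> x
    unfolding p_def by (auto intro!: prod_nonneg prod_le_1 simp: tent_bounds)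
  have pi: "integrable N (\<lambda>\<omega>. p \<kappa> (\<lambda>i. X n i \<omega>))" "integrable N' (\<lambda>\<omega>. p \<kappa> (\<lambda>i. X' i \<omega>))" for n \<kappa>
    using p01 pm by (auto intro!: N.integrable_const_bound[where B = 1] N'.integrable_const_bound[where B = 1])
  have Gc: "(\<lambda>n. \<integral>\<omega>. G R (\<lambda>i. X n i \<omega>) \<partial>N) \<longlonglongrightarrow> (\<integral>\<omega>. G R (\<lambda>i. X' i \<omega>) \<partial>N')" for R
    unfolding G_def using pi pc by (simp add: tendsto_sum tendsto_mult_left)
  have qc: "(\<lambda>n. \<integral>\<omega>. q R (\<lambda>i. X n i \<omega>) \<partial>N) \<longlonglongrightarrow> (\<integral>\<omega>. q R (\<lambda>i. X' i \<omega>) \<partial>N')" for R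
    unfolding q_def using pi pc by (simp add: tendsto_sum)
  have qi: "integrable N (\<lambda>\<omega>. q R (\<lambda>i. X n i \<omega>))" "integrable N' (\<lambda>\<omega>. q R (\<lambda>i. X' i \<omega>))" for n R
    unfolding q_def using pi by auto
  have Gi: "integrable N (\<lambda>\<omega>. G R (\<lambda>i. X n i \<omega>))" "integrable N' (\<lambda>\<omega>. G R (\<lambda>i. X' i \<omega>))" for n R
    unfolding G_def using pi by auto
  have gi: "integrable N (\<lambda>\<omega>. g (\<lambda>i. X n i \<omega>))" "integrable N' (\<lambda>\<omega>. g (\<lambda>i. X' i \<omega>))" for n
    using gB gm by (auto intro!: N.integrable_const_bound[where B = B] N'.integrable_const_bound[where B = B])
  have q_prod: "q R x = (\<Prod>i\<in>I. \<Sum>k\<in>{- int R..int R}. tent (x i / \<delta> - of_int k))" for R x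
    unfolding q_def p_def K_def by (rule prod_sum_PiE[symmetric]) (use I in auto)
  have q01: "0 \<le> q R x" "q R x \<le> 1" for R x
    unfolding q_prod by (auto intro!: prod_nonneg prod_le_1 sum_nonneg sum_tent_le_1 simp: tent_bounds)
  have "(\<lambda>R. \<integral>\<omega>. q R (\<lambda>i. X' i \<omega>) \<partial>N') \<longlonglongrightarrow> (\<integral>\<omega>. 1 \<partial>N')"
  proof (rule integral_dominated_convergence[where w = "\<lambda>_. 1"])
    show "AE \<omega> in N'. (\<lambda>R. q R (\<lambda>i. X' i \<omega>)) \<longlonglongrightarrow> 1"
    proof (rule AE_I2)
      fix \<omega>
      have "eventually (\<lambda>R. \<forall>i\<in>I. \<bar>X' i \<omega> / \<delta>\<bar> \<le> real R) sequentially"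
        unfolding eventually_ball_finite_distrib[OF I]
        using filterlim_real_sequentially by (auto simp: filterlim_at_top)
      then have "eventually (\<lambda>R. q R (\<lambda>i. X' i \<omega>) = 1) sequentially"
        by eventually_elim (auto simp: q_prod sum_tent_eq_1 intro!: prod.neutral)
      then show "(\<lambda>R. q R (\<lambda>i. X' i \<omega>)) \<longlonglongrightarrow> 1" by (rule tendsto_eventually)
    qed
    show "AE \<omega> in N'. norm (q R (\<lambda>i. X' i \<omega>)) \<le> 1" for R using q01 by auto
  qed (use qi in auto)
  then have "(\<lambda>R. B * (1 - (\<integral>\<omega>. q R (\<lambda>i. X' i \<omega>) \<partial>N'))) \<longlonglongrightarrow> B * (1 - 1)"
    by (intro tendsto_intros) (simp add: N'.prob_space)
  then have "eventually (\<lambda>R. B * (1 - (\<integral>\<omega>. q R (\<lambda>i. X' i \<omega>) \<partial>N')) < e / 8) sequentially"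
    by (rule order_tendstoD) (use e in simp)
  then obtain R where R: "B * (1 - (\<integral>\<omega>. q R (\<lambda>i. X' i \<omega>) \<partial>N')) < e / 8" by (auto simp: eventually_sequentially)
  have approx: "\<bar>g x - G R x\<bar> \<le> L * \<delta> * real (card I) + B * (1 - q R x)" for x
    unfolding G_def q_def p_def K_def by (rule tent_approximation) (use I \<delta> gB gL L in auto)
  have aN: "\<bar>(\<integral>\<omega>. g (\<lambda>i. X n i \<omega>) \<partial>N) - (\<integral>\<omega>. G R (\<lambda>i. X n i \<omega>) \<partial>N)\<bar> \<le> e / 8 + B * (1 - (\<integral>\<omega>. q R (\<lambda>i. X n i \<omega>) \<partial>N))" for n
  proof -
    have "\<bar>(\<integral>\<omega>. g (\<lambda>i. X n i \<omega>) \<partial>N) - (\<integral>\<omega>. G R (\<lambda>i. X n i \<omega>) \<partial>N)\<bar> = \<bar>\<integral>\<omega>. g (\<lambda>i. X n i \<omega>) - G R (\<lambda>i. X n i \<omega>) \<partial>N\<bar>"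
      using gi Gi by simp
    also have "\<dots> \<le> (\<integral>\<omega>. \<bar>g (\<lambda>i. X n i \<omega>) - G R (\<lambda>i. X n i \<omega>)\<bar> \<partial>N)" by (rule integral_abs_bound)
    also have "\<dots> \<le> (\<integral>\<omega>. e / 8 + B * (1 - q R (\<lambda>i. X n i \<omega>)) \<partial>N)"
      using gi Gi qi \<delta>e order_trans[OF approx] by (intro integral_mono) auto
    also have "\<dots> = e / 8 + B * (1 - (\<integral>\<omega>. q R (\<lambda>i. X n i \<omega>) \<partial>N))" using qi by (simp add: N.prob_space)
    finally show ?thesis .
  qed
  have aN': "\<bar>(\<integral>\<omega>. g (\<lambda>i. X' i \<omega>) \<partial>N') - (\<integral>\<omega>. G R (\<lambda>i. X' i \<omega>) \<partial>N')\<bar> \<le> e / 8 + B * (1 - (\<integral>\<omega>. q R (\<lambda>i. X' i \<omega>) \<partial>N'))"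
  proof -
    have "\<bar>(\<integral>\<omega>. g (\<lambda>i. X' i \<omega>) \<partial>N') - (\<integral>\<omega>. G R (\<lambda>i. X' i \<omega>) \<partial>N')\<bar> = \<bar>\<integral>\<omega>. g (\<lambda>i. X' i \<omega>) - G R (\<lambda>i. X' i \<omega>) \<partial>N'\<bar>"
      using gi Gi by simp
    also have "\<dots> \<le> (\<integral>\<omega>. \<bar>g (\<lambda>i. X' i \<omega>) - G R (\<lambda>i. X' i \<omega>)\<bar> \<partial>N')" by (rule integral_abs_bound)
    also have "\<dots> \<le> (\<integral>\<omega>. e / 8 + B * (1 - q R (\<lambda>i. X' i \<omega>)) \<partial>N')"
      using gi Gi qi \<delta>e order_trans[OF approx] by (intro integral_mono) auto
    also have "\<dots> = e / 8 + B * (1 - (\<integral>\<omega>. q R (\<lambda>i. X' i \<omega>) \<partial>N'))" using qi by (simp add: N'.prob_space)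
    finally show ?thesis .
  qed
  have "(\<lambda>n. B * (1 - (\<integral>\<omega>. q R (\<lambda>i. X n i \<omega>) \<partial>N))) \<longlonglongrightarrow> B * (1 - (\<integral>\<omega>. q R (\<lambda>i. X' i \<omega>) \<partial>N'))"
    by (intro tendsto_intros qc)
  then have "eventually (\<lambda>n. B * (1 - (\<integral>\<omega>. q R (\<lambda>i. X n i \<omega>) \<partial>N)) < e / 8) sequentially"
    using R by (rule order_tendstoD)
  moreover have "eventually (\<lambda>n. \<bar>(\<integral>\<omega>. G R (\<lambda>i. X n i \<omega>) \<partial>N) - (\<integral>\<omega>. G R (\<lambda>i. X' i \<omega>) \<partial>N')\<bar> < e / 8) sequentially"
    using tendstoD[OF Gc, of "e / 8" R] e by (simp add: dist_real_def)
  ultimately have "eventually (\<lambda>n. norm ((\<integral>\<omega>. g (\<lambda>i. X n i \<omega>) \<partial>N) - (\<integral>\<omega>. g (\<lambda>i. X' i \<omega>) \<partial>N')) < e) sequentially"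
  proof eventually_elim
    case (elim n)
    then show ?case using aN[of n] aN' R e unfolding real_norm_def by linarith
  qed
  then show "\<exists>n0. \<forall>n\<ge>n0. norm ((\<integral>\<omega>. g (\<lambda>i. X n i \<omega>) \<partial>N) - (\<integral>\<omega>. g (\<lambda>i. X' i \<omega>) \<partial>N')) < e"
    by (simp add: eventually_sequentially)
qed

section \<open>Increments of Brownian motion\<close>

definition grid_increment :: "(real \<Rightarrow> 'a \<Rightarrow> real) \<Rightarrow> nat \<Rightarrow> nat \<Rightarrow> 'a \<Rightarrow> real" where
  "grid_increment B m j \<omega> = B (real (Suc j) / real m) \<omega> - B (real j / real m) \<omega>"

context prob_space
begin

lemma normal_standardize:
  assumes D: "distributed M lborel X (normal_density 0 \<sigma>)" and \<sigma>: "0 < \<sigma>"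
  shows "random_variable borel X" "distr M borel (\<lambda>\<omega>. X \<omega> / \<sigma>) = std_normal_distribution"
proof -
  show "random_variable borel X" using distributed_measurable[OF D] by simp
  have "distributed M lborel (\<lambda>x. (X x - 0) / \<sigma>) std_normal_density"
    using D normal_standard_normal_convert[OF \<sigma>, of X 0] by simp
  then have "distr M lborel (\<lambda>x. X x / \<sigma>) = std_normal_distribution"
    using distributed_distr_eq_density by fastforce
  moreover have "distr M lborel (\<lambda>x. X x / \<sigma>) = distr M borel (\<lambda>x. X x / \<sigma>)" by (rule distr_cong) auto
  ultimately show "distr M borel (\<lambda>\<omega>. X \<omega> / \<sigma>) = std_normal_distribution" by simp
qed

lemma normal_char:
  assumes D: "distributed M lborel X (normal_density 0 \<sigma>)" and \<sigma>: "0 < \<sigma>"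
  shows "(\<integral>\<omega>. iexp (t * X \<omega>) \<partial>M) = of_real (exp (- (t * \<sigma>)\<^sup>2 / 2))"
proof -
  note [measurable] = normal_standardize(1)[OF D \<sigma>]
  have "of_real (exp (- (t * \<sigma>)\<^sup>2 / 2)) = (\<integral>x. iexp ((t * \<sigma>) * x) \<partial>std_normal_distribution)"
    using fun_cong[OF char_std_normal_distribution, of "t * \<sigma>"] unfolding char_def by (rule sym)
  also have "\<dots> = (\<integral>\<omega>. iexp ((t * \<sigma>) * (X \<omega> / \<sigma>)) \<partial>M)"
    unfolding normal_standardize(2)[OF D \<sigma>, symmetric] by (rule integral_distr) auto
  finally show ?thesis using \<sigma> by simp
qed

lemma normal_fourth_moment:
  assumes D: "distributed M lborel X (normal_density 0 \<sigma>)" and \<sigma>: "0 < \<sigma>"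
  shows "integrable M (\<lambda>\<omega>. X \<omega> ^ 4)" "(\<integral>\<omega>. X \<omega> ^ 4 \<partial>M) = 3 * \<sigma> ^ 4"
proof -
  note [measurable] = normal_standardize(1)[OF D \<sigma>]
  have m: "integrable std_normal_distribution (\<lambda>x. x ^ (2 * 2))"
    "(\<integral>x. x ^ (2 * 2) \<partial>std_normal_distribution) = 3"
    using std_normal_distribution_even_moments[of 2] by (simp_all add: fact_numeral)
  have e: "X \<omega> ^ 4 = \<sigma> ^ 4 * (X \<omega> / \<sigma>) ^ (2 * 2)" for \<omega> using \<sigma> by (simp add: power_divide)
  have "integrable M (\<lambda>\<omega>. (X \<omega> / \<sigma>) ^ (2 * 2))"
    using m(1) unfolding normal_standardize(2)[OF D \<sigma>, symmetric] by (subst (asm) integrable_distr_eq) auto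
  then show "integrable M (\<lambda>\<omega>. X \<omega> ^ 4)" unfolding e by simp
  have "(\<integral>\<omega>. (X \<omega> / \<sigma>) ^ (2 * 2) \<partial>M) = 3"
    using m(2) unfolding normal_standardize(2)[OF D \<sigma>, symmetric] by (subst (asm) integral_distr) auto
  then show "(\<integral>\<omega>. X \<omega> ^ 4 \<partial>M) = 3 * \<sigma> ^ 4" unfolding e by simp
qed

text \<open>The excess over \<open>\<eta>\<close> is at most \<open>x^4 / \<eta>^3\<close>.  The fourth power is needed: for \<open>\<sigma>\<^sup>2 = 1 / m\<close> the
  bound is of order \<open>m^(- 2)\<close>, and summed over a number of blocks proportional to \<open>m\<close> it still tends to 0.\<close>

lemma normal_excess:
  assumes D: "distributed M lborel X (normal_density 0 \<sigma>)" and \<sigma>: "0 < \<sigma>" and pos: "0 < \<eta>" "0 < R"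
  shows "(\<integral>\<omega>. min R (max 0 (\<bar>c * X \<omega>\<bar> - \<eta>)) \<partial>M) \<le> 3 * c ^ 4 * \<sigma> ^ 4 / \<eta> ^ 3"
proof -
  note [measurable] = normal_standardize(1)[OF D \<sigma>]
  have "(\<integral>\<omega>. min R (max 0 (\<bar>c * X \<omega>\<bar> - \<eta>)) \<partial>M) \<le> (\<integral>\<omega>. c ^ 4 / \<eta> ^ 3 * X \<omega> ^ 4 \<partial>M)"
  proof (rule integral_mono)
    show "integrable M (\<lambda>\<omega>. min R (max 0 (\<bar>c * X \<omega>\<bar> - \<eta>)))"
      by (rule integrable_const_bound[where B = R]) (use pos in auto)
    show "integrable M (\<lambda>\<omega>. c ^ 4 / \<eta> ^ 3 * X \<omega> ^ 4)" using normal_fourth_moment(1)[OF D \<sigma>] by simp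
    fix \<omega>
    let ?x = "\<bar>c * X \<omega>\<bar>"
    have "max 0 (?x - \<eta>) \<le> ?x ^ 4 / \<eta> ^ 3"
    proof (cases "?x \<le> \<eta>")
      case False
      have "?x * \<eta> ^ 3 \<le> ?x * ?x ^ 3" using False pos by (intro mult_left_mono power_mono) auto
      then have "?x \<le> ?x ^ 4 / \<eta> ^ 3" using pos by (simp add: pos_le_divide_eq power_Suc[symmetric] del: power_Suc)
      then show ?thesis using pos False by simp
    qed (use pos in simp)
    also have "?x ^ 4 / \<eta> ^ 3 = c ^ 4 / \<eta> ^ 3 * X \<omega> ^ 4" by (simp add: power_even_abs power_mult_distrib)
    finally show "min R (max 0 (?x - \<eta>)) \<le> c ^ 4 / \<eta> ^ 3 * X \<omega> ^ 4"
      by (rule order_trans[OF min.cobounded2])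
  qed
  also have "\<dots> = 3 * c ^ 4 * \<sigma> ^ 4 / \<eta> ^ 3" using normal_fourth_moment[OF D \<sigma>] by simp
  finally show ?thesis .
qed

lemma brownian_grid_increment:
  assumes B: "standard_brownian_motion M B" and m: "0 < m"
  shows "distributed M lborel (grid_increment B m j) (normal_density 0 (sqrt (1 / real m)))"
proof -
  have d: "real (Suc j) / real m - real j / real m = 1 / real m"
    by (simp add: diff_divide_distrib[symmetric])
  have "0 \<le> real j / real m \<and> real j / real m < real (Suc j) / real m" using m by (simp add: divide_strict_right_mono)
  then have "distributed M lborel (\<lambda>\<omega>. B (real (Suc j) / real m) \<omega> - B (real j / real m) \<omega>)
      (normal_density 0 (sqrt (real (Suc j) / real m - real j / real m)))"
    using B unfolding standard_brownian_motion_def by blast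
  then show ?thesis unfolding d grid_increment_def[abs_def] .
qed

lemma brownian_increments_char:
  assumes B: "standard_brownian_motion M B" and m: "0 < m"
  shows "(\<integral>\<omega>. iexp (\<Sum>j<J. a j * grid_increment B m j \<omega>) \<partial>M) = of_real (exp (- (\<Sum>j<J. (a j)\<^sup>2) / (2 * real m)))"
proof -
  have s: "0 < sqrt (1 / real m)" using m by simp
  note D = brownian_grid_increment[OF B m]
  have [measurable]: "grid_increment B m j \<in> borel_measurable M" for j using normal_standardize(1)[OF D s] .
  have "strict_mono (\<lambda>i. real i / real m)" using m by (auto simp: strict_mono_def divide_strict_right_mono)
  then have t: "0 \<le> (\<lambda>i. real i / real m) 0 \<and> strict_mono (\<lambda>i. real i / real m)" by simp
  have "\<forall>n. \<forall>t :: nat \<Rightarrow> real. 0 \<le> t 0 \<and> strict_mono t \<longrightarrow>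
      indep_vars (\<lambda>_. borel) (\<lambda>i \<omega>. B (t (Suc i)) \<omega> - B (t i) \<omega>) {..<n}"
    using B unfolding standard_brownian_motion_def by blast
  from this[rule_format, OF t]
  have "indep_vars (\<lambda>_. borel) (\<lambda>i \<omega>. B (real (Suc i) / real m) \<omega> - B (real i / real m) \<omega>) {..<J}" .
  then have "indep_vars (\<lambda>_. borel) (\<lambda>j. grid_increment B m j) {..<J}" unfolding grid_increment_def[abs_def] .
  then have ind: "indep_vars (\<lambda>_. borel) (\<lambda>j \<omega>. iexp (a j * grid_increment B m j \<omega>)) {..<J}"
    by (rule indep_vars_compose2) auto
  have "(\<integral>\<omega>. iexp (\<Sum>j<J. a j * grid_increment B m j \<omega>) \<partial>M) = (\<integral>\<omega>. (\<Prod>j<J. iexp (a j * grid_increment B m j \<omega>)) \<partial>M)"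
    by (simp add: exp_sum sum_distrib_left)
  also have "\<dots> = (\<Prod>j<J. \<integral>\<omega>. iexp (a j * grid_increment B m j \<omega>) \<partial>M)"
    by (rule indep_vars_lebesgue_integral[OF _ ind]) (auto intro!: integrable_const_bound[where B = 1])
  also have "\<dots> = (\<Prod>j<J. of_real (exp (- (a j * sqrt (1 / real m))\<^sup>2 / 2)))"
    by (simp only: normal_char[OF D s])
  also have "\<dots> = of_real (exp (\<Sum>j<J. - (a j * sqrt (1 / real m))\<^sup>2 / 2))" by (simp add: exp_sum)
  also have "(\<Sum>j<J. - (a j * sqrt (1 / real m))\<^sup>2 / 2) = - (\<Sum>j<J. (a j)\<^sup>2) / (2 * real m)"
    by (simp add: power_mult_distrib sum_negf sum_divide_distrib[symmetric] real_sqrt_divide power_divide)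
  finally show ?thesis .
qed

lemma brownian_pair_increments_char:
  assumes B: "standard_brownian_motion M B1" "standard_brownian_motion M B2" "indep_processes M B1 B2" and m: "0 < m"
  shows "(\<integral>\<omega>. iexp ((\<Sum>j<J. a j * grid_increment B1 m j \<omega>) + (\<Sum>j<J. b j * grid_increment B2 m j \<omega>)) \<partial>M) =
    of_real (exp (- ((\<Sum>j<J. (a j)\<^sup>2) + (\<Sum>j<J. (b j)\<^sup>2)) / (2 * real m)))"
proof -
  define Y where "Y a x = iexp (\<Sum>j<J. a j * (x (real (Suc j) / real m) - x (real j / real m)))" for a :: "nat \<Rightarrow> real" and x :: "real \<Rightarrow> real"
  have Ym: "Y a \<in> borel_measurable (PiM {0..} (\<lambda>_. borel))" for a
  proof -
    have [measurable]: "(\<lambda>x. x (real j / real m)) \<in> borel_measurable (PiM {0..} (\<lambda>_. borel :: real measure))" for j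
      by (rule measurable_component_singleton) simp
    show ?thesis unfolding Y_def[abs_def] by measurable
  qed
  have eq: "Y a (\<lambda>t\<in>{0..}. B t \<omega>) = iexp (\<Sum>j<J. a j * grid_increment B m j \<omega>)" for a and B :: "real \<Rightarrow> 'a \<Rightarrow> real" and \<omega>
    by (simp add: Y_def grid_increment_def)
  have s: "0 < sqrt (1 / real m)" using m by simp
  have [measurable]: "grid_increment B1 m j \<in> borel_measurable M" "grid_increment B2 m j \<in> borel_measurable M" for j
    using normal_standardize(1)[OF brownian_grid_increment[OF B(1) m] s]
      normal_standardize(1)[OF brownian_grid_increment[OF B(2) m] s] .
  have "indep_var borel (Y a \<circ> (\<lambda>\<omega>. \<lambda>t\<in>{0..}. B1 t \<omega>)) borel (Y b \<circ> (\<lambda>\<omega>. \<lambda>t\<in>{0..}. B2 t \<omega>))"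
    by (rule indep_var_compose[OF B(3)[unfolded indep_processes_def] Ym Ym])
  then have ind: "indep_var borel (\<lambda>\<omega>. iexp (\<Sum>j<J. a j * grid_increment B1 m j \<omega>)) borel (\<lambda>\<omega>. iexp (\<Sum>j<J. b j * grid_increment B2 m j \<omega>))"
    by (simp only: comp_def eq)
  have "(\<integral>\<omega>. iexp ((\<Sum>j<J. a j * grid_increment B1 m j \<omega>) + (\<Sum>j<J. b j * grid_increment B2 m j \<omega>)) \<partial>M) =
      (\<integral>\<omega>. iexp (\<Sum>j<J. a j * grid_increment B1 m j \<omega>) * iexp (\<Sum>j<J. b j * grid_increment B2 m j \<omega>) \<partial>M)"
    by (simp only: of_real_add distrib_left exp_add)
  also have "\<dots> = (\<integral>\<omega>. iexp (\<Sum>j<J. a j * grid_increment B1 m j \<omega>) \<partial>M) * (\<integral>\<omega>. iexp (\<Sum>j<J. b j * grid_increment B2 m j \<omega>) \<partial>M)"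
    by (rule indep_var_lebesgue_integral[OF ind]) (auto intro!: integrable_const_bound[where B = 1])
  also have "\<dots> = of_real (exp (- ((\<Sum>j<J. (a j)\<^sup>2) + (\<Sum>j<J. (b j)\<^sup>2)) / (2 * real m)))"
    unfolding brownian_increments_char[OF B(1) m] brownian_increments_char[OF B(2) m]
    by (simp add: add_divide_distrib diff_divide_distrib exp_add[symmetric] flip: of_real_mult)
  finally show ?thesis .
qed

end

section \<open>Martingales with convergent averages of conditional moments\<close>

definition block_start :: "nat \<Rightarrow> nat \<Rightarrow> nat \<Rightarrow> nat" where
  "block_start m n j = n * j div m"

lemma block_start_0 [simp]: "block_start m n 0 = 0"
  by (simp add: block_start_def)

lemma block_start_mono: "j \<le> j' \<Longrightarrow> block_start m n j \<le> block_start m n j'"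
  unfolding block_start_def by (intro div_le_mono mult_le_mono) auto

text \<open>The block that contains \<open>k\<close>: \<open>n * j div m \<le> k < n * (j + 1) div m\<close> amounts to
  \<open>n * j < m * (k + 1) \<le> n * (j + 1)\<close>.\<close>

definition block_index :: "nat \<Rightarrow> nat \<Rightarrow> nat \<Rightarrow> nat" where
  "block_index m n k = (m * Suc k - 1) div n"

lemma block_index_eq:
  assumes m: "0 < m" and k: "block_start m n j \<le> k" "k < block_start m n (Suc j)"
  shows "block_index m n k = j"
proof -
  have "n * j < m * Suc k"
  proof -
    have "n * j div m < Suc k" using k(1) by (simp add: block_start_def)
    then show ?thesis using m by (simp add: div_less_iff_less_mult mult.commute)
  qed
  moreover have "m * Suc k \<le> n * Suc j"
  proof -
    have "Suc k \<le> n * Suc j div m" using k(2) by (simp add: block_start_def)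
    then show ?thesis using m by (simp add: less_eq_div_iff_mult_less_eq mult.commute)
  qed
  ultimately have "j * n \<le> m * Suc k - 1" "m * Suc k - 1 < Suc j * n"
    by (auto simp: mult.commute)
  then show ?thesis unfolding block_index_def by (intro div_nat_eqI) (auto simp: mult.commute)
qed

lemma sum_blocks:
  fixes f :: "nat \<Rightarrow> 'b::comm_monoid_add"
  shows "(\<Sum>k<block_start m n J. f k) = (\<Sum>j<J. \<Sum>k\<in>{block_start m n j..<block_start m n (Suc j)}. f k)"
proof (induction J)
  case (Suc J)
  show ?case
    using sum.atLeastLessThan_concat[OF le0 block_start_mono[of J "Suc J" m n], of f] Suc
    by (simp add: lessThan_atLeast0)
qed simp

lemma block_start_ratio:
  assumes m: "0 < m"
  shows "(\<lambda>n. real (block_start m n j) / real n) \<longlonglongrightarrow> real j / real m"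
proof (rule tendsto_sandwich)
  have *: "real j / real m - 1 / real n \<le> real (block_start m n j) / real n \<and>
      real (block_start m n j) / real n \<le> real j / real m" if n: "n > 0" for n
  proof -
    have "real (block_start m n j) = of_int \<lfloor>real (n * j) / real m\<rfloor>"
      by (simp only: block_start_def floor_divide_of_nat_eq of_int_of_nat_eq)
    then have "real (n * j) / real m - 1 \<le> real (block_start m n j)" "real (block_start m n j) \<le> real (n * j) / real m"
      by linarith+
    then have "(real (n * j) / real m - 1) / real n \<le> real (block_start m n j) / real n"
      "real (block_start m n j) / real n \<le> (real (n * j) / real m) / real n"
      by (intro divide_right_mono; simp)+
    moreover have "(real (n * j) / real m) / real n = real j / real m" using n by simp
    ultimately show ?thesis by (simp add: diff_divide_distrib)
  qed
  show "eventually (\<lambda>n. real j / real m - 1 / real n \<le> real (block_start m n j) / real n) sequentially"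
    "eventually (\<lambda>n. real (block_start m n j) / real n \<le> real j / real m) sequentially"
    using eventually_gt_at_top[of 0] by (eventually_elim, use * in blast)+
  have "(\<lambda>n. real j / real m - 1 / real n) \<longlonglongrightarrow> real j / real m - 0"
    by (intro tendsto_intros lim_const_over_n)
  then show "(\<lambda>n. real j / real m - 1 / real n) \<longlonglongrightarrow> real j / real m" by simp
qed simp

lemma block_start_at_top:
  assumes m: "0 < m" and j: "0 < j"
  shows "filterlim (\<lambda>n. block_start m n j) at_top sequentially"
proof -
  have 1: "n div m \<le> block_start m n j" for n
    unfolding block_start_def using j by (intro div_le_mono) simp
  have 2: "filterlim (\<lambda>n. n div m) at_top sequentially"
    unfolding filterlim_at_top
  proof
    fix Z
    show "eventually (\<lambda>n. Z \<le> n div m) sequentially"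
      unfolding eventually_sequentially using m
      by (intro exI[of _ "Z * m"]) (simp add: less_eq_div_iff_mult_less_eq)
  qed
  show ?thesis by (rule filterlim_at_top_mono[OF 2 always_eventually]) (rule allI, rule 1)
qed

lemma prefix_average:
  fixes f :: "nat \<Rightarrow> 'b::{real_normed_field}"
  assumes m: "0 < m" and f: "(\<lambda>n. (\<Sum>k<n. f k) / of_nat n) \<longlonglongrightarrow> F"
  shows "(\<lambda>n. (\<Sum>k<block_start m n j. f k) / of_nat n) \<longlonglongrightarrow> of_real (real j / real m) * F"
proof (cases "j = 0")
  case False
  then have top: "filterlim (\<lambda>n. block_start m n j) at_top sequentially" using block_start_at_top[OF m] by simp
  have "(\<lambda>n. of_real (real (block_start m n j) / real n) * ((\<Sum>k<block_start m n j. f k) / of_nat (block_start m n j)))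
      \<longlonglongrightarrow> of_real (real j / real m) * F"
    by (intro tendsto_mult tendsto_of_real block_start_ratio[OF m] filterlim_compose[OF f top])
  moreover have "eventually (\<lambda>n. of_real (real (block_start m n j) / real n) *
      ((\<Sum>k<block_start m n j. f k) / of_nat (block_start m n j)) = (\<Sum>k<block_start m n j. f k) / of_nat n) sequentially"
  proof -
    have "eventually (\<lambda>n. block_start m n j \<ge> 1) sequentially" using top by (simp add: filterlim_at_top)
    then show ?thesis by eventually_elim auto
  qed
  ultimately show ?thesis by (rule Lim_transform_eventually)
qed simp

lemma block_average:
  fixes f :: "nat \<Rightarrow> 'b::{real_normed_field}"
  assumes m: "0 < m" and f: "(\<lambda>n. (\<Sum>k<n. f k) / of_nat n) \<longlonglongrightarrow> F"
  shows "(\<lambda>n. (\<Sum>k\<in>{block_start m n j..<block_start m n (Suc j)}. f k) / of_nat n) \<longlonglongrightarrow> F / of_nat m"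
proof -
  have "(\<lambda>n. (\<Sum>k<block_start m n (Suc j). f k) / of_nat n - (\<Sum>k<block_start m n j. f k) / of_nat n)
      \<longlonglongrightarrow> of_real (real (Suc j) / real m) * F - of_real (real j / real m) * F"
    by (intro tendsto_diff prefix_average m f)
  moreover have "(\<Sum>k<block_start m n (Suc j). f k) / of_nat n - (\<Sum>k<block_start m n j. f k) / of_nat n
      = (\<Sum>k\<in>{block_start m n j..<block_start m n (Suc j)}. f k) / of_nat n" for n
    using sum.atLeastLessThan_concat[OF le0 block_start_mono[of j "Suc j" m n], of f]
    by (simp add: lessThan_atLeast0 diff_divide_distrib[symmetric] algebra_simps)
  moreover have "of_real (real (Suc j) / real m) * F - of_real (real j / real m) * F = F / of_nat m"
    using m by (simp add: field_simps)
  ultimately show ?thesis by simp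
qed

lemma (in prob_space) expectation_min_tendsto:
  fixes W :: "nat \<Rightarrow> 'a \<Rightarrow> real"
  assumes [measurable]: "\<And>n. W n \<in> borel_measurable M" and lim: "AE \<omega> in M. (\<lambda>n. W n \<omega>) \<longlonglongrightarrow> w"
    and nn: "\<And>n \<omega>. 0 \<le> W n \<omega>"
  shows "(\<lambda>n. \<integral>\<omega>. min 1 (W n \<omega>) \<partial>M) \<longlonglongrightarrow> min 1 w"
proof -
  have "(\<lambda>n. \<integral>\<omega>. min 1 (W n \<omega>) \<partial>M) \<longlonglongrightarrow> (\<integral>\<omega>. min 1 w \<partial>M)"
  proof (rule integral_dominated_convergence[where w = "\<lambda>_. 1"])
    show "AE \<omega> in M. (\<lambda>n. min 1 (W n \<omega>)) \<longlonglongrightarrow> min 1 w"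
      using lim by eventually_elim (intro tendsto_intros)
  qed (use nn in auto)
  then show ?thesis by (simp add: prob_space)
qed

text \<open>A sequence of complex martingale differences \<open>X k\<close>, measurable with respect to \<open>G (k + 1)\<close> and
  centred given \<open>G k\<close>.  \<open>q\<close>, \<open>r\<close> and \<open>l c\<close> are versions of the conditional expectations of \<open>(norm X)\<^sup>2\<close>, of
  \<open>X\<^sup>2\<close>, and of \<open>(norm X)\<^sup>2\<close> restricted to \<open>norm X > c\<close>.  That the averages of \<open>r\<close> vanish in the limit
  says that real and imaginary parts become uncorrelated with equal variances; the condition on \<open>tail\<close>
  is Lindeberg's condition in an averaged form.\<close>

locale averaging_martingale = prob_space +
  fixes G :: "nat \<Rightarrow> 'a measure" and X :: "nat \<Rightarrow> 'a \<Rightarrow> complex"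
    and q :: "nat \<Rightarrow> 'a \<Rightarrow> real" and r :: "nat \<Rightarrow> 'a \<Rightarrow> complex" and l :: "nat \<Rightarrow> nat \<Rightarrow> 'a \<Rightarrow> real"
    and s2 :: real and tail :: "nat \<Rightarrow> real"
  assumes sub: "\<And>k. subalgebra M (G k)" and mono: "\<And>k. sets (G k) \<subseteq> sets (G (Suc k))"
    and X_adapted: "\<And>k. X k \<in> borel_measurable (G (Suc k))"
    and cond_Re: "\<And>k. cond_version M (G k) (\<lambda>\<omega>. Re (X k \<omega>)) (\<lambda>_. 0)"
    and cond_Im: "\<And>k. cond_version M (G k) (\<lambda>\<omega>. Im (X k \<omega>)) (\<lambda>_. 0)"
    and cond_sq: "\<And>k. cond_version M (G k) (\<lambda>\<omega>. (norm (X k \<omega>))\<^sup>2) (q k)"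
    and cond_sq_Re: "\<And>k. cond_version M (G k) (\<lambda>\<omega>. Re ((X k \<omega>)\<^sup>2)) (\<lambda>\<omega>. Re (r k \<omega>))"
    and cond_sq_Im: "\<And>k. cond_version M (G k) (\<lambda>\<omega>. Im ((X k \<omega>)\<^sup>2)) (\<lambda>\<omega>. Im (r k \<omega>))"
    and cond_tail: "\<And>c k. cond_version M (G k)
        (\<lambda>\<omega>. indicator {z. real c < norm z} (X k \<omega>) * (norm (X k \<omega>))\<^sup>2) (l c k)"
    and l_nonneg: "\<And>c k \<omega>. 0 \<le> l c k \<omega>"
    and average_q: "AE \<omega> in M. (\<lambda>n. (\<Sum>k<n. q k \<omega>) / of_nat n) \<longlonglongrightarrow> s2"
    and average_r: "AE \<omega> in M. (\<lambda>n. (\<Sum>k<n. r k \<omega>) / of_nat n) \<longlonglongrightarrow> 0"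
    and average_l: "\<And>c. AE \<omega> in M. (\<lambda>n. (\<Sum>k<n. l c k \<omega>) / of_nat n) \<longlonglongrightarrow> tail c"
    and tail_tendsto_0: "tail \<longlonglongrightarrow> 0"
    and s2_nonneg: "0 \<le> s2"
begin

lemma X_measurable [measurable]: "X k \<in> borel_measurable M"
  by (rule measurable_from_subalg[OF sub X_adapted])

lemma conditional_measurable [measurable]:
  "q k \<in> borel_measurable M" "(\<lambda>\<omega>. Re (r k \<omega>)) \<in> borel_measurable M" "(\<lambda>\<omega>. Im (r k \<omega>)) \<in> borel_measurable M"
  "l c k \<in> borel_measurable M"
  using cond_version_integrable(2)[OF cond_sq] cond_version_integrable(2)[OF cond_sq_Re]
    cond_version_integrable(2)[OF cond_sq_Im] cond_version_integrable(2)[OF cond_tail] by auto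

definition S :: "nat \<Rightarrow> 'a \<Rightarrow> complex" where
  "S n \<omega> = (\<Sum>k<n. X k \<omega>)"

lemma S_measurable [measurable]: "S n \<in> borel_measurable M"
  unfolding S_def[abs_def] by measurable

abbreviation block_sum :: "nat \<Rightarrow> nat \<Rightarrow> nat \<Rightarrow> 'a \<Rightarrow> complex" where
  "block_sum m n j \<omega> \<equiv> S (block_start m n (Suc j)) \<omega> - S (block_start m n j) \<omega>"

definition proj :: "(nat \<Rightarrow> complex) \<Rightarrow> nat \<Rightarrow> nat \<Rightarrow> 'a \<Rightarrow> real" where
  "proj c n k \<omega> = Re (c k * X k \<omega>) / sqrt (real n)"

text \<open>The conditional variance of \<open>proj c n k\<close>, from \<open>(Re z)\<^sup>2 = ((norm z)\<^sup>2 + Re (z\<^sup>2)) / 2\<close>.\<close>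

definition proj_var :: "(nat \<Rightarrow> complex) \<Rightarrow> nat \<Rightarrow> nat \<Rightarrow> 'a \<Rightarrow> real" where
  "proj_var c n k \<omega> = ((norm (c k))\<^sup>2 * q k \<omega> + Re ((c k)\<^sup>2 * r k \<omega>)) / (2 * real n)"

lemma proj_adapted: "proj c n k \<in> borel_measurable (G (Suc k))"
  unfolding proj_def[abs_def] using X_adapted[of k] by measurable

lemma proj_measurable [measurable]: "proj c n k \<in> borel_measurable M"
  by (rule measurable_from_subalg[OF sub proj_adapted])

lemma proj_var_measurable [measurable]: "proj_var c n k \<in> borel_measurable M"
proof -
  have "proj_var c n k = (\<lambda>\<omega>. ((norm (c k))\<^sup>2 * q k \<omega> + (Re ((c k)\<^sup>2) * Re (r k \<omega>) - Im ((c k)\<^sup>2) * Im (r k \<omega>))) / (2 * real n))"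
    by (simp add: proj_var_def[abs_def])
  then show ?thesis by simp
qed

lemma proj_cond_mean: "cond_version M (G k) (proj c n k) (\<lambda>_. 0)"
proof -
  have "cond_version M (G k) (\<lambda>\<omega>. (Re (c k) / sqrt (real n)) * Re (X k \<omega>) + (- Im (c k) / sqrt (real n)) * Im (X k \<omega>))
      (\<lambda>\<omega>. (Re (c k) / sqrt (real n)) * 0 + (- Im (c k) / sqrt (real n)) * 0)"
    by (intro cond_version_add[OF sub] cond_version_cmult cond_Re cond_Im)
  then show ?thesis by (simp add: proj_def[abs_def] diff_divide_distrib)
qed

lemma Re_square: "(Re z)\<^sup>2 = ((norm z)\<^sup>2 + Re (z\<^sup>2)) / 2"
  by (simp add: cmod_power2 Re_power2)

lemma proj_cond_var: "cond_version M (G k) (\<lambda>\<omega>. (proj c n k \<omega>)\<^sup>2) (proj_var c n k)"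
proof -
  have "cond_version M (G k)
     (\<lambda>\<omega>. (norm (c k))\<^sup>2 / (2 * real n) * (norm (X k \<omega>))\<^sup>2 +
        (Re ((c k)\<^sup>2) / (2 * real n) * Re ((X k \<omega>)\<^sup>2) + (- Im ((c k)\<^sup>2) / (2 * real n)) * Im ((X k \<omega>)\<^sup>2)))
     (\<lambda>\<omega>. (norm (c k))\<^sup>2 / (2 * real n) * q k \<omega> +
        (Re ((c k)\<^sup>2) / (2 * real n) * Re (r k \<omega>) + (- Im ((c k)\<^sup>2) / (2 * real n)) * Im (r k \<omega>)))"
    by (intro cond_version_add[OF sub] cond_version_cmult cond_sq cond_sq_Re cond_sq_Im)
  moreover have "(proj c n k \<omega>)\<^sup>2 = (norm (c k))\<^sup>2 / (2 * real n) * (norm (X k \<omega>))\<^sup>2 +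
        (Re ((c k)\<^sup>2) / (2 * real n) * Re ((X k \<omega>)\<^sup>2) + (- Im ((c k)\<^sup>2) / (2 * real n)) * Im ((X k \<omega>)\<^sup>2))" for \<omega>
  proof -
    have "(proj c n k \<omega>)\<^sup>2 = ((norm (c k * X k \<omega>))\<^sup>2 + Re ((c k * X k \<omega>)\<^sup>2)) / 2 / real n"
      by (simp add: proj_def power_divide Re_square[symmetric])
    also have "(c k * X k \<omega>)\<^sup>2 = (c k)\<^sup>2 * (X k \<omega>)\<^sup>2" by (rule power_mult_distrib)
    also have "((norm (c k * X k \<omega>))\<^sup>2 + Re ((c k)\<^sup>2 * (X k \<omega>)\<^sup>2)) / 2 / real n = 
       (norm (c k))\<^sup>2 / (2 * real n) * (norm (X k \<omega>))\<^sup>2 +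
        (Re ((c k)\<^sup>2) / (2 * real n) * Re ((X k \<omega>)\<^sup>2) + (- Im ((c k)\<^sup>2) / (2 * real n)) * Im ((X k \<omega>)\<^sup>2))"
      unfolding norm_mult power_mult_distrib times_complex.sel by (simp add: add_divide_distrib diff_divide_distrib)
    finally show ?thesis .
  qed
  moreover have "proj_var c n k \<omega> = (norm (c k))\<^sup>2 / (2 * real n) * q k \<omega> +
        (Re ((c k)\<^sup>2) / (2 * real n) * Re (r k \<omega>) + (- Im ((c k)\<^sup>2) / (2 * real n)) * Im (r k \<omega>))" for \<omega>
    unfolding proj_var_def times_complex.sel by (simp add: add_divide_distrib diff_divide_distrib)
  ultimately show ?thesis by (simp only: proj_var_def[abs_def]) 
qed

definition pos_var :: "(nat \<Rightarrow> complex) \<Rightarrow> nat \<Rightarrow> nat \<Rightarrow> 'a \<Rightarrow> real" where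
  "pos_var c n k \<omega> = max 0 (proj_var c n k \<omega>)"

lemma pos_var_cond: "cond_version M (G k) (\<lambda>\<omega>. (proj c n k \<omega>)\<^sup>2) (pos_var c n k)"
  unfolding pos_var_def[abs_def] by (rule cond_version_max0(1)[OF sub proj_cond_var]) simp

lemma pos_var_AE: "AE \<omega> in M. proj_var c n k \<omega> = pos_var c n k \<omega>"
  unfolding pos_var_def by (rule cond_version_max0(2)[OF sub proj_cond_var]) simp

lemma pos_var_measurable [measurable]: "pos_var c n k \<in> borel_measurable M"
  unfolding pos_var_def[abs_def] by measurable

lemma pos_var_nonneg: "0 \<le> pos_var c n k \<omega>"
  by (simp add: pos_var_def)

text \<open>A linear combination of block sums with coefficients \<open>w j\<close> is one sum of projections whose
  direction depends on the block; indices beyond the last block get weight 0.\<close>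

definition block_weight :: "nat \<Rightarrow> nat \<Rightarrow> (nat \<Rightarrow> complex) \<Rightarrow> nat \<Rightarrow> nat \<Rightarrow> complex" where
  "block_weight m J w n k = (if block_index m n k < J then w (block_index m n k) else 0)"

lemma block_weight_eq:
  assumes "0 < m" "j < J" "k \<in> {block_start m n j..<block_start m n (Suc j)}"
  shows "block_weight m J w n k = w j"
  using block_index_eq[OF assms(1), of n j k] assms by (simp add: block_weight_def)

lemma block_weight_le: "norm (block_weight m J w n k) \<le> (\<Sum>j<J. norm (w j))"
  by (auto simp: block_weight_def sum_nonneg intro!: member_le_sum)

lemma sum_proj_blocks:
  assumes m: "0 < m"
  shows "(\<Sum>k<block_start m n J. proj (block_weight m J w n) n k \<omega>) =
    (\<Sum>j<J. Re (w j * block_sum m n j \<omega>) / sqrt (real n))"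
proof -
  have "(\<Sum>k\<in>{block_start m n j..<block_start m n (Suc j)}. proj (block_weight m J w n) n k \<omega>) =
      Re (w j * block_sum m n j \<omega>) / sqrt (real n)" if j: "j < J" for j
  proof -
    have "(\<Sum>k\<in>{block_start m n j..<block_start m n (Suc j)}. proj (block_weight m J w n) n k \<omega>) =
        (\<Sum>k\<in>{block_start m n j..<block_start m n (Suc j)}. Re (w j * X k \<omega>) / sqrt (real n))"
      by (intro sum.cong refl) (simp only: proj_def block_weight_eq[OF m j])
    also have "\<dots> = Re (w j * (\<Sum>k\<in>{block_start m n j..<block_start m n (Suc j)}. X k \<omega>)) / sqrt (real n)"
      by (simp only: sum_distrib_left Re_sum sum_divide_distrib)
    also have "(\<Sum>k\<in>{block_start m n j..<block_start m n (Suc j)}. X k \<omega>) =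
        block_sum m n j \<omega>"
      using sum.atLeastLessThan_concat[OF le0 block_start_mono[of j "Suc j" m n], of "\<lambda>k. X k \<omega>"]
      by (simp add: S_def lessThan_atLeast0 algebra_simps)
    finally show ?thesis .
  qed
  then show ?thesis unfolding sum_blocks by (intro sum.cong) auto
qed

lemma pos_var_sum_tendsto:
  assumes m: "0 < m"
  shows "AE \<omega> in M. (\<lambda>n. \<Sum>k<block_start m n J. pos_var (block_weight m J w n) n k \<omega>) \<longlonglongrightarrow>
    (\<Sum>j<J. (norm (w j))\<^sup>2) * s2 / (2 * real m)"
proof -
  have "AE \<omega> in M. \<forall>n k. proj_var (block_weight m J w n) n k \<omega> = pos_var (block_weight m J w n) n k \<omega>"
    by (intro AE_all_countable[THEN iffD2] allI pos_var_AE)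
  with average_q average_r show ?thesis
  proof eventually_elim
    case (elim \<omega>)
    have eq: "(\<Sum>k<block_start m n J. pos_var (block_weight m J w n) n k \<omega>) =
        (\<Sum>j<J. (norm (w j))\<^sup>2 / 2 * ((\<Sum>k\<in>{block_start m n j..<block_start m n (Suc j)}. q k \<omega>) / of_nat n) +
            Re ((w j)\<^sup>2 * ((\<Sum>k\<in>{block_start m n j..<block_start m n (Suc j)}. r k \<omega>) / of_nat n)) / 2)" for n
    proof -
      have "(\<Sum>k\<in>{block_start m n j..<block_start m n (Suc j)}. pos_var (block_weight m J w n) n k \<omega>) =
        (norm (w j))\<^sup>2 / 2 * ((\<Sum>k\<in>{block_start m n j..<block_start m n (Suc j)}. q k \<omega>) / of_nat n) +
            Re ((w j)\<^sup>2 * ((\<Sum>k\<in>{block_start m n j..<block_start m n (Suc j)}. r k \<omega>) / of_nat n)) / 2" if j: "j < J" for j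
      proof -
        let ?B = "{block_start m n j..<block_start m n (Suc j)}"
        have "(\<Sum>k\<in>?B. pos_var (block_weight m J w n) n k \<omega>) =
            (\<Sum>k\<in>?B. ((norm (w j))\<^sup>2 * q k \<omega> + Re ((w j)\<^sup>2 * r k \<omega>)) / (2 * real n))"
          using elim(3) block_weight_eq[OF m j] by (intro sum.cong refl) (metis proj_var_def)
        also have "\<dots> = ((norm (w j))\<^sup>2 * (\<Sum>k\<in>?B. q k \<omega>) + Re ((w j)\<^sup>2 * (\<Sum>k\<in>?B. r k \<omega>))) / (2 * real n)"
          by (simp only: sum_distrib_left Re_sum sum_divide_distrib sum.distrib add_divide_distrib)
        also have "\<dots> = (norm (w j))\<^sup>2 / 2 * ((\<Sum>k\<in>?B. q k \<omega>) / of_nat n) + Re ((w j)\<^sup>2 * (\<Sum>k\<in>?B. r k \<omega>)) / real n / 2"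
          by (simp add: add_divide_distrib)
        also have "Re ((w j)\<^sup>2 * (\<Sum>k\<in>?B. r k \<omega>)) / real n = Re ((w j)\<^sup>2 * ((\<Sum>k\<in>?B. r k \<omega>) / of_nat n))"
          using Re_divide_of_real[of "(w j)\<^sup>2 * (\<Sum>k\<in>?B. r k \<omega>)" "real n"] by (simp only: times_divide_eq_right of_real_of_nat_eq)
        finally show ?thesis .
      qed
      then show ?thesis unfolding sum_blocks by (intro sum.cong) auto
    qed
    have "(\<lambda>n. \<Sum>k<block_start m n J. pos_var (block_weight m J w n) n k \<omega>) \<longlonglongrightarrow>
        (\<Sum>j<J. (norm (w j))\<^sup>2 / 2 * (s2 / of_nat m) + Re ((w j)\<^sup>2 * (0 / of_nat m)) / 2)"
      unfolding eq by (intro tendsto_intros tendsto_Re block_average m elim) auto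
    then show ?case by (simp add: sum_distrib_right sum_divide_distrib)
  qed
qed

text \<open>Both random sums in \<open>char_martingale_bound\<close> converge almost surely, since averages over
  blocks converge when averages over prefixes do.  The limit of the variances is \<open>v\<close>, to which \<open>r\<close> does
  not contribute; the limit of the truncated moments is proportional to \<open>tail c\<close>.\<close>

theorem block_increments_charfun:
  assumes m: "0 < m"
  shows "(\<lambda>n. \<integral>\<omega>. iexp (\<Sum>j<J. Re (w j * block_sum m n j \<omega>) / sqrt (real n)) \<partial>M)
    \<longlonglongrightarrow> of_real (exp (- ((\<Sum>j<J. (norm (w j))\<^sup>2) * s2 / (2 * real m)) / 2))"
proof (rule LIMSEQ_I)
  fix e :: real assume e: "0 < e"
  define v where "v = (\<Sum>j<J. (norm (w j))\<^sup>2) * s2 / (2 * real m)"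
  \<comment> \<open>bound for the directions, at least 1 so that it can be divided by\<close>
  define \<Lambda> where "\<Lambda> = 1 + (\<Sum>j<J. norm (w j))"
  define K where "K = exp ((v + 1) / 2) * (2 * v + 5)"
  have v: "0 \<le> v" unfolding v_def using s2_nonneg by (intro divide_nonneg_nonneg mult_nonneg_nonneg sum_nonneg) auto
  have \<Lambda>: "\<Lambda> \<ge> 1" by (simp add: \<Lambda>_def sum_nonneg)
  have K: "K > 0" using v by (simp add: K_def add_nonneg_pos)
  define \<epsilon> where "\<epsilon> = min 1 (e / (8 * K))"
  have \<epsilon>: "0 < \<epsilon>" "\<epsilon> \<le> 1" "K * \<epsilon> \<le> e / 8"
  proof -
    show "0 < \<epsilon>" "\<epsilon> \<le> 1" using e K by (auto simp: \<epsilon>_def)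
    have "K * \<epsilon> \<le> K * (e / (8 * K))" using K by (intro mult_left_mono) (auto simp: \<epsilon>_def)
    then show "K * \<epsilon> \<le> e / 8" using K by simp
  qed
  have "(\<lambda>c. K * (\<Lambda>\<^sup>2 * (real J / real m * tail c))) \<longlonglongrightarrow> K * (\<Lambda>\<^sup>2 * (real J / real m * 0))"
    by (intro tendsto_intros tail_tendsto_0)
  then have "eventually (\<lambda>c. K * (\<Lambda>\<^sup>2 * (real J / real m * tail c)) < e / 8) sequentially"
    by (rule order_tendstoD) (use e in simp)
  then obtain c where c: "K * (\<Lambda>\<^sup>2 * (real J / real m * tail c)) < e / 8" by (auto simp: eventually_sequentially)
  let ?N = "\<lambda>n. block_start m n J"
  let ?s = "\<lambda>n \<omega>. \<Sum>k<?N n. pos_var (block_weight m J w n) n k \<omega>"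
  let ?l = "\<lambda>n \<omega>. \<Sum>k<?N n. \<Lambda>\<^sup>2 / real n * l c k \<omega>"
  have s_lim: "(\<lambda>n. \<integral>\<omega>. min 1 \<bar>?s n \<omega> - v\<bar> \<partial>M) \<longlonglongrightarrow> min 1 0"
  proof (rule expectation_min_tendsto)
    show "AE \<omega> in M. (\<lambda>n. \<bar>?s n \<omega> - v\<bar>) \<longlonglongrightarrow> 0"
      using pos_var_sum_tendsto[OF m, of J w]
    proof eventually_elim
      case (elim \<omega>)
      then have "(\<lambda>n. ?s n \<omega> - v) \<longlonglongrightarrow> 0" unfolding v_def by (rule LIM_zero)
      then show ?case by (rule tendsto_rabs_zero)
    qed
  qed auto
  have l_lim: "(\<lambda>n. \<integral>\<omega>. min 1 (?l n \<omega>) \<partial>M) \<longlonglongrightarrow> min 1 (\<Lambda>\<^sup>2 * (real J / real m * tail c))"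
  proof (rule expectation_min_tendsto)
    show "AE \<omega> in M. (\<lambda>n. ?l n \<omega>) \<longlonglongrightarrow> \<Lambda>\<^sup>2 * (real J / real m * tail c)"
      using average_l[of c]
    proof eventually_elim
      case (elim \<omega>)
      have "(\<lambda>n. \<Lambda>\<^sup>2 * ((\<Sum>k<?N n. l c k \<omega>) / of_nat n)) \<longlonglongrightarrow> \<Lambda>\<^sup>2 * (of_real (real J / real m) * tail c)"
        by (intro tendsto_intros prefix_average m elim)
      then show ?case by (simp add: sum_distrib_left sum_divide_distrib mult.commute)
    qed
    show "0 \<le> ?l n \<omega>" for n \<omega> using l_nonneg by (intro sum_nonneg mult_nonneg_nonneg) auto
  qed auto
  have "(\<lambda>n. K * ((\<integral>\<omega>. min 1 (?l n \<omega>) \<partial>M) + (\<integral>\<omega>. min 1 \<bar>?s n \<omega> - v\<bar> \<partial>M))) \<longlonglongrightarrow>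
      K * (min 1 (\<Lambda>\<^sup>2 * (real J / real m * tail c)) + min 1 0)"
    by (intro tendsto_intros l_lim s_lim)
  moreover have "K * (min 1 (\<Lambda>\<^sup>2 * (real J / real m * tail c)) + min 1 0) < e / 4"
  proof -
    have "K * (min 1 (\<Lambda>\<^sup>2 * (real J / real m * tail c)) + min 1 0) \<le> K * (\<Lambda>\<^sup>2 * (real J / real m * tail c))"
      using K by (intro mult_left_mono) auto
    then show ?thesis using c e by linarith
  qed
  ultimately have ev1: "eventually (\<lambda>n. K * ((\<integral>\<omega>. min 1 (?l n \<omega>) \<partial>M) + (\<integral>\<omega>. min 1 \<bar>?s n \<omega> - v\<bar> \<partial>M)) < e / 4) sequentially"
    by (rule order_tendstoD)
  \<comment> \<open>for such \<open>n\<close> a projection larger than \<open>\<epsilon>\<close> forces \<open>norm (X k) > c\<close>\<close>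
  have ev2: "eventually (\<lambda>n. (\<Lambda> * real c / \<epsilon>)\<^sup>2 \<le> real n) sequentially"
    using filterlim_real_sequentially by (auto simp: filterlim_at_top)
  from ev1 ev2 eventually_gt_at_top[of 0]
  have "eventually (\<lambda>n. norm ((\<integral>\<omega>. iexp (\<Sum>j<J. Re (w j * block_sum m n j \<omega>) / sqrt (real n)) \<partial>M)
      - of_real (exp (- v / 2))) < e) sequentially"
  proof eventually_elim
    case (elim n)
    have n: "real n > 0" using elim by simp
    let ?x = "proj (block_weight m J w n) n"
    let ?h = "\<lambda>k \<omega>. \<Lambda>\<^sup>2 / real n * (indicator {z. real c < norm z} (X k \<omega>) * (norm (X k \<omega>))\<^sup>2)"
    have bw: "norm (block_weight m J w n k) \<le> \<Lambda>" for k using block_weight_le[of m J w n k] by (simp add: \<Lambda>_def)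
    have "norm ((\<integral>\<omega>. exp (\<i> * of_real (\<Sum>k<?N n. ?x k \<omega>)) \<partial>M) - of_real (exp (- v / 2))) \<le>
        K * (\<epsilon> + (\<integral>\<omega>. min 1 (?l n \<omega>) \<partial>M) + (\<integral>\<omega>. min 1 \<bar>?s n \<omega> - v\<bar> \<partial>M))"
      unfolding K_def
    proof (rule char_martingale_bound[where G = G and h = ?h])
      show "cond_version M (G k) (?h k) (\<lambda>\<omega>. \<Lambda>\<^sup>2 / real n * l c k \<omega>)" for k
        by (intro cond_version_cmult cond_tail)
      fix k \<omega>
      assume big: "\<epsilon> < \<bar>?x k \<omega>\<bar>"
      have le: "\<bar>?x k \<omega>\<bar> \<le> \<Lambda> * norm (X k \<omega>) / sqrt (real n)"
      proof -
        have "\<bar>Re (block_weight m J w n k * X k \<omega>)\<bar> \<le> norm (block_weight m J w n k) * norm (X k \<omega>)"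
          using abs_Re_le_cmod[of "block_weight m J w n k * X k \<omega>"] by (simp add: norm_mult)
        also have "\<dots> \<le> \<Lambda> * norm (X k \<omega>)" using bw by (intro mult_right_mono) auto
        finally show ?thesis unfolding proj_def using n by (simp add: divide_right_mono)
      qed
      have "\<Lambda> * real c / \<epsilon> \<le> sqrt (real n)" using elim(2) \<Lambda> \<epsilon> by (intro real_le_rsqrt) auto
      then have "\<Lambda> * real c \<le> \<epsilon> * sqrt (real n)" using \<epsilon> by (simp add: pos_divide_le_eq mult.commute)
      also have "\<epsilon> < \<Lambda> * norm (X k \<omega>) / sqrt (real n)" using big le by linarith
      then have "\<epsilon> * sqrt (real n) < \<Lambda> * norm (X k \<omega>)" using n by (simp add: pos_less_divide_eq)
      finally have "real c < norm (X k \<omega>)" using \<Lambda> by simp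
      moreover have "(?x k \<omega>)\<^sup>2 \<le> (\<Lambda> * norm (X k \<omega>) / sqrt (real n))\<^sup>2"
        using le by (metis abs_ge_zero power2_abs power_mono)
      ultimately show "(?x k \<omega>)\<^sup>2 \<le> ?h k \<omega>" by (simp add: power_divide power_mult_distrib)
    qed (use sub mono proj_adapted proj_cond_mean pos_var_cond pos_var_nonneg l_nonneg v \<epsilon> in auto)
    also have "\<dots> < e" using elim(1) \<epsilon> e by (simp add: distrib_left)
    finally show ?case by (simp only: sum_proj_blocks[OF m])
  qed
  then show "\<exists>n0. \<forall>n\<ge>n0. norm ((\<integral>\<omega>. iexp (\<Sum>j<J. Re (w j * block_sum m n j \<omega>) / sqrt (real n)) \<partial>M)
      - of_real (exp (- ((\<Sum>j<J. (norm (w j))\<^sup>2) * s2 / (2 * real m)) / 2))) < e"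
    unfolding v_def eventually_sequentially .
qed

end

section \<open>Oscillation over a block\<close>

context averaging_martingale
begin

lemma block_weight_const:
  assumes "0 < m" "i < block_start m n J"
  shows "block_weight m J (\<lambda>_. u) n i = u"
proof -
  have "Suc i \<le> n * J div m" using assms(2) by (simp add: block_start_def)
  then have "m * Suc i \<le> n * J" using assms(1) by (simp add: less_eq_div_iff_mult_less_eq mult.commute)
  moreover have "n > 0" using assms(2) by (cases n) (auto simp: block_start_def)
  ultimately have "block_index m n i < J"
    unfolding block_index_def using assms(1) by (simp add: div_less_iff_less_mult mult.commute)
  then show ?thesis by (simp add: block_weight_def)
qed

lemma single_block_charfun:
  assumes m: "0 < m"
  shows "(\<lambda>n. \<integral>\<omega>. iexp (t * (Re (u * block_sum m n j \<omega>) / sqrt (real n))) \<partial>M)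
    \<longlonglongrightarrow> of_real (exp (- (t\<^sup>2 * (norm u)\<^sup>2 * s2 / (2 * real m)) / 2))"
proof -
  define w where "w i = (if i = j then of_real t * u else 0)" for i
  have "(\<Sum>i<Suc j. Re (w i * block_sum m n i \<omega>) / sqrt (real n)) =
      t * (Re (u * block_sum m n j \<omega>) / sqrt (real n))" for n \<omega>
  proof -
    have "(\<Sum>i<Suc j. Re (w i * block_sum m n i \<omega>) / sqrt (real n)) =
        (\<Sum>i<Suc j. if i = j then t * (Re (u * block_sum m n j \<omega>) / sqrt (real n)) else 0)"
    proof (rule sum.cong[OF refl])
      fix i
      have "Re (of_real t * u * z) = t * Re (u * z)" for z by (simp add: mult.assoc)
      then show "Re (w i * block_sum m n i \<omega>) / sqrt (real n) =
          (if i = j then t * (Re (u * block_sum m n j \<omega>) / sqrt (real n)) else 0)"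
        unfolding w_def by (cases "i = j") (simp_all only: if_True if_False refl times_divide_eq_right, simp)
    qed
    then show ?thesis by simp
  qed
  moreover have "(\<Sum>i<Suc j. (norm (w i))\<^sup>2) = t\<^sup>2 * (norm u)\<^sup>2"
  proof -
    have "(\<Sum>i<Suc j. (norm (w i))\<^sup>2) = (\<Sum>i<Suc j. if i = j then t\<^sup>2 * (norm u)\<^sup>2 else 0)"
      by (rule sum.cong) (auto simp: w_def norm_mult power_mult_distrib)
    then show ?thesis by simp
  qed
  ultimately show ?thesis using block_increments_charfun[OF m, of w "Suc j"] by (simp only:)
qed

lemma block_excess_tendsto:
  assumes P: "prob_space M'" and B: "standard_brownian_motion M' B" and m: "0 < m" and u: "norm u = 1" and R: "0 < R"
  shows "(\<lambda>n. \<integral>\<omega>. min R (max 0 (\<bar>Re (u * block_sum m n j \<omega>) / sqrt (real n)\<bar> - \<eta>)) \<partial>M)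
    \<longlonglongrightarrow> (\<integral>\<omega>. min R (max 0 (\<bar>sqrt (s2 / 2) * grid_increment B m j \<omega>\<bar> - \<eta>)) \<partial>M')"
proof -
  interpret N: prob_space M' by fact
  have s: "0 < sqrt (1 / real m)" using m by simp
  note D = N.brownian_grid_increment[OF B m, of j]
  note [measurable] = N.normal_standardize(1)[OF D s]
  have "(\<lambda>n. \<integral>\<omega>. 1 * (\<lambda>x. min R (max 0 (\<bar>x\<bar> - \<eta>))) (Re (u * block_sum m n j \<omega>) / sqrt (real n)) \<partial>M)
    \<longlonglongrightarrow> (\<integral>\<omega>. 1 * (\<lambda>x. min R (max 0 (\<bar>x\<bar> - \<eta>))) (sqrt (s2 / 2) * grid_increment B m j \<omega>) \<partial>M')"
  proof (rule weighted_levy[where B = R and A = "\<lambda>_ _. 1" and A' = "\<lambda>_. 1"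
        and X = "\<lambda>n \<omega>. Re (u * block_sum m n j \<omega>) / sqrt (real n)"
        and X' = "\<lambda>\<omega>. sqrt (s2 / 2) * grid_increment B m j \<omega>" and h = "\<lambda>x. min R (max 0 (\<bar>x\<bar> - \<eta>))"])
    show "(\<lambda>n. \<integral>\<omega>. 1 *\<^sub>R iexp (t * (Re (u * block_sum m n j \<omega>) / sqrt (real n))) \<partial>M)
      \<longlonglongrightarrow> (\<integral>\<omega>. 1 *\<^sub>R iexp (t * (sqrt (s2 / 2) * grid_increment B m j \<omega>)) \<partial>M')" for t
    proof -
      have "(\<integral>\<omega>. iexp (t * (sqrt (s2 / 2) * grid_increment B m j \<omega>)) \<partial>M') = of_real (exp (- (t * sqrt (s2 / 2) * sqrt (1 / real m))\<^sup>2 / 2))"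
        using N.normal_char[OF D s, of "t * sqrt (s2 / 2)"] by (simp only: mult.assoc)
      also have "(t * sqrt (s2 / 2) * sqrt (1 / real m))\<^sup>2 = t\<^sup>2 * (norm u)\<^sup>2 * s2 / (2 * real m)"
        using s2_nonneg u by (simp add: power_mult_distrib power_divide real_sqrt_divide)
      finally have eq: "(\<integral>\<omega>. iexp (t * (sqrt (s2 / 2) * grid_increment B m j \<omega>)) \<partial>M') =
        of_real (exp (- (t\<^sup>2 * (norm u)\<^sup>2 * s2 / (2 * real m)) / 2))" .
      show ?thesis unfolding scaleR_one eq by (rule single_block_charfun[OF m])
    qed
    show "isCont (\<lambda>x. min R (max 0 (\<bar>x\<bar> - \<eta>))) x" for x by (intro continuous_intros)
  qed (use R P prob_space_axioms in auto)
  then show ?thesis by simp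
qed

text \<open>In \<open>block_oscillation\<close> the accumulated variance converges to \<open>v\<close>, so it exceeds \<open>C = v + 1\<close> with
  vanishing probability; the block sum converges in distribution to a Gaussian variable, so its capped
  excess converges to the one bounded by \<open>normal_excess\<close>; and \<open>R\<close> is chosen so that the cost of the cap is
  \<open>e / 2\<close>.\<close>

lemma block_oscillation_eventually:
  assumes P: "prob_space M'" and B: "standard_brownian_motion M' B" and m: "0 < m" and u: "norm u = 1"
    and \<eta>: "0 < \<eta>" and e: "0 < e"
  shows "eventually (\<lambda>n. prob {\<omega> \<in> space M. \<exists>k\<in>{block_start m n j..block_start m n (Suc j)}.
      2 * \<eta> \<le> \<bar>Re (u * (S k \<omega> - S (block_start m n j) \<omega>)) / sqrt (real n)\<bar>}
    < 3 * (sqrt (s2 / 2)) ^ 4 / ((real m)\<^sup>2 * \<eta> ^ 4) + e) sequentially"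
proof -
  interpret N: prob_space M' by fact
  define v where "v = (\<Sum>i<Suc j. (norm u)\<^sup>2) * s2 / (2 * real m)"
  define C where "C = v + 1"
  have v: "0 \<le> v" unfolding v_def using s2_nonneg by (intro divide_nonneg_nonneg mult_nonneg_nonneg sum_nonneg) auto
  have C: "0 < C" using v by (simp add: C_def)
  define R where "R = 2 * C / (\<eta> * e)"
  have R: "0 < R" "C / R / \<eta> = e / 2" using C \<eta> e by (auto simp: R_def field_simps)
  let ?b = "block_start m"
  let ?x = "\<lambda>n. proj (block_weight m (Suc j) (\<lambda>_. u) n) n" and ?s = "\<lambda>n. pos_var (block_weight m (Suc j) (\<lambda>_. u) n) n"
  let ?W = "\<lambda>n \<omega>. \<Sum>k<?b n (Suc j). ?s n k \<omega>"
  let ?D = "\<lambda>n. prob {\<omega> \<in> space M. C < ?W n \<omega>}"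
  let ?E = "\<lambda>n. \<integral>\<omega>. min R (max 0 (\<bar>Re (u * (S (?b n (Suc j)) \<omega> - S (?b n j) \<omega>)) / sqrt (real n)\<bar> - \<eta>)) \<partial>M"
  let ?E' = "\<integral>\<omega>. min R (max 0 (\<bar>sqrt (s2 / 2) * grid_increment B m j \<omega>\<bar> - \<eta>)) \<partial>M'"
  have Dlim: "?D \<longlonglongrightarrow> 0"
  proof (rule tendsto_sandwich[where f = "\<lambda>_. 0" and h = "\<lambda>n. \<integral>\<omega>. min 1 \<bar>?W n \<omega> - v\<bar> \<partial>M"])
    have "(\<lambda>n. \<integral>\<omega>. min 1 \<bar>?W n \<omega> - v\<bar> \<partial>M) \<longlonglongrightarrow> min 1 0"
    proof (rule expectation_min_tendsto)
      show "AE \<omega> in M. (\<lambda>n. \<bar>?W n \<omega> - v\<bar>) \<longlonglongrightarrow> 0"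
        using pos_var_sum_tendsto[OF m, of "Suc j" "\<lambda>_. u"]
      proof eventually_elim
        case (elim \<omega>)
        then have "(\<lambda>n. ?W n \<omega> - v) \<longlonglongrightarrow> 0" unfolding v_def by (rule LIM_zero)
        then show ?case by (rule tendsto_rabs_zero)
      qed
    qed auto
    then show "(\<lambda>n. \<integral>\<omega>. min 1 \<bar>?W n \<omega> - v\<bar> \<partial>M) \<longlonglongrightarrow> 0" by simp
    have "?D n \<le> (\<integral>\<omega>. min 1 \<bar>?W n \<omega> - v\<bar> \<partial>M)" for n
    proof -
      have "?D n = (\<integral>\<omega>. indicator {\<omega> \<in> space M. C < ?W n \<omega>} \<omega> \<partial>M)" by simp
      also have "\<dots> \<le> (\<integral>\<omega>. min 1 \<bar>?W n \<omega> - v\<bar> \<partial>M)"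
      proof (rule integral_mono)
        show "integrable M (indicator {\<omega> \<in> space M. C < ?W n \<omega>} :: 'a \<Rightarrow> real)"
          by (rule integrable_const_bound[where B = 1]) (auto simp: indicator_def)
        show "integrable M (\<lambda>\<omega>. min 1 \<bar>?W n \<omega> - v\<bar>)"
          by (rule integrable_const_bound[where B = 1]) auto
      qed (auto simp: indicator_def C_def)
      finally show ?thesis .
    qed
    then show "eventually (\<lambda>n. ?D n \<le> (\<integral>\<omega>. min 1 \<bar>?W n \<omega> - v\<bar> \<partial>M)) sequentially" by simp
  qed auto
  have "?E' \<le> 3 * (sqrt (s2 / 2)) ^ 4 * (sqrt (1 / real m)) ^ 4 / \<eta> ^ 3"
    by (rule N.normal_excess[OF N.brownian_grid_increment[OF B m]]) (use m \<eta> R in auto)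
  also have "(sqrt (1 / real m)) ^ 4 = 1 / (real m)\<^sup>2"
  proof -
    have "x ^ 4 = (x\<^sup>2)\<^sup>2" for x :: real by (simp add: power4_eq_xxxx power2_eq_square)
    from this[of "sqrt (1 / real m)"] show ?thesis by (simp add: power_divide)
  qed
  finally have "?E' / \<eta> \<le> 3 * (sqrt (s2 / 2)) ^ 4 * (1 / (real m)\<^sup>2) / \<eta> ^ 3 / \<eta>" using \<eta> by (intro divide_right_mono) auto
  also have "\<dots> = 3 * (sqrt (s2 / 2)) ^ 4 / ((real m)\<^sup>2 * \<eta> ^ 4)"
    by (simp add: power4_eq_xxxx power3_eq_cube field_simps)
  finally have E': "?E' / \<eta> \<le> 3 * (sqrt (s2 / 2)) ^ 4 / ((real m)\<^sup>2 * \<eta> ^ 4)" .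
  have "(\<lambda>n. (?E n + R * ?D n + C / R) / \<eta> + ?D n) \<longlonglongrightarrow> (?E' + R * 0 + C / R) / \<eta> + 0"
    by (intro tendsto_intros block_excess_tendsto[OF P B m u R(1)] Dlim) (use \<eta> in auto)
  moreover have "(?E' + R * 0 + C / R) / \<eta> + 0 < 3 * (sqrt (s2 / 2)) ^ 4 / ((real m)\<^sup>2 * \<eta> ^ 4) + e"
    using E' R(2) e by (simp add: add_divide_distrib)
  ultimately have "eventually (\<lambda>n. (?E n + R * ?D n + C / R) / \<eta> + ?D n < 3 * (sqrt (s2 / 2)) ^ 4 / ((real m)\<^sup>2 * \<eta> ^ 4) + e) sequentially"
    by (rule order_tendstoD)
  then show ?thesis
  proof eventually_elim
    case (elim n)
    have xs: "(\<Sum>i\<in>{?b n j..<k}. ?x n i \<omega>) = Re (u * (S k \<omega> - S (?b n j) \<omega>)) / sqrt (real n)"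
      if k: "?b n j \<le> k" "k \<le> ?b n (Suc j)" for k \<omega>
    proof -
      have "(\<Sum>i\<in>{?b n j..<k}. ?x n i \<omega>) = (\<Sum>i\<in>{?b n j..<k}. Re (u * X i \<omega>) / sqrt (real n))"
        unfolding proj_def using k by (intro sum.cong refl) (simp add: block_weight_const[OF m])
      also have "\<dots> = Re (u * (\<Sum>i\<in>{?b n j..<k}. X i \<omega>)) / sqrt (real n)"
        by (simp only: sum_distrib_left Re_sum sum_divide_distrib)
      also have "(\<Sum>i\<in>{?b n j..<k}. X i \<omega>) = S k \<omega> - S (?b n j) \<omega>"
        using sum.atLeastLessThan_concat[OF le0 k(1), of "\<lambda>i. X i \<omega>"]
        by (simp add: S_def lessThan_atLeast0 algebra_simps)
      finally show ?thesis .
    qed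
    have set_eq: "{\<omega> \<in> space M. \<exists>k\<in>{?b n j..?b n (Suc j)}. 2 * \<eta> \<le> \<bar>Re (u * (S k \<omega> - S (?b n j) \<omega>)) / sqrt (real n)\<bar>} =
        {\<omega> \<in> space M. \<exists>k\<in>{?b n j..?b n (Suc j)}. 2 * \<eta> \<le> \<bar>\<Sum>i\<in>{?b n j..<k}. ?x n i \<omega>\<bar>}"
      by (intro Collect_cong conj_cong refl bex_cong) (simp add: xs)
    have "prob {\<omega> \<in> space M. \<exists>k\<in>{?b n j..?b n (Suc j)}. 2 * \<eta> \<le> \<bar>\<Sum>i\<in>{?b n j..<k}. ?x n i \<omega>\<bar>} \<le>
       ((\<integral>\<omega>. min R (max 0 (\<bar>\<Sum>i\<in>{?b n j..<?b n (Suc j)}. ?x n i \<omega>\<bar> - \<eta>)) \<partial>M) + R * ?D n + C / R) / \<eta> + ?D n"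
      by (rule block_oscillation[where G = G])
         (use sub mono proj_adapted proj_cond_mean pos_var_cond pos_var_nonneg \<eta> R C block_start_mono in auto)
    also have "\<dots> = (?E n + R * ?D n + C / R) / \<eta> + ?D n"
      by (simp only: xs[OF block_start_mono[of j "Suc j" m n, OF le_SucI[OF order_refl]] order_refl])
    finally show ?case using elim unfolding set_eq by linarith
  qed
qed

definition scaled_path :: "nat \<Rightarrow> 'a \<Rightarrow> real \<Rightarrow> complex" where
  "scaled_path n \<omega> = grid_path (real n) (\<lambda>k. S k \<omega> / of_real (sqrt (real n)))"

end

text \<open>The path that jumps by \<open>y j\<close> at time \<open>(j + 1) / m\<close> for \<open>j < J\<close> and stays constant afterwards.\<close>

definition step_path :: "nat \<Rightarrow> nat \<Rightarrow> (nat \<Rightarrow> complex) \<Rightarrow> real \<Rightarrow> complex" where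
  "step_path m J y = grid_path (real m) (\<lambda>i. \<Sum>j<min i J. y j)"

lemma skorohod_mdist_le_uniform:
  assumes w: "w1 \<in> cadlag_space" "w2 \<in> cadlag_space" and le: "\<And>t. 0 \<le> t \<Longrightarrow> norm (w1 t - w2 t) \<le> e"
  shows "mdist skorohod_metric w1 w2 \<le> 2 * e"
proof -
  have e: "0 \<le> e" using le[of 0] norm_ge_zero order_trans by blast
  have "(\<lambda>K. 2 * (e + (1/2) ^ K)) \<longlonglongrightarrow> 2 * (e + 0)"
    by (intro tendsto_intros LIMSEQ_power_zero) auto
  then show ?thesis
    using skorohod_mdist_le[OF w e le] by (intro LIMSEQ_le_const) auto
qed

lemma step_path_lipschitz:
  assumes "0 < m"
  shows "mdist skorohod_metric (step_path m J y) (step_path m J y') \<le> 2 * (\<Sum>j<J. norm (y j - y' j))"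
proof (rule skorohod_mdist_le_uniform)
  fix t :: real assume t: "0 \<le> t"
  let ?i = "min (nat \<lfloor>real m * t\<rfloor>) J"
  have "norm (step_path m J y t - step_path m J y' t) = norm (\<Sum>j<?i. y j - y' j)"
    using t by (simp add: step_path_def grid_path_def sum_subtractf)
  also have "\<dots> \<le> (\<Sum>j<?i. norm (y j - y' j))" by (rule norm_sum)
  also have "\<dots> \<le> (\<Sum>j<J. norm (y j - y' j))" by (rule sum_mono2) auto
  finally show "norm (step_path m J y t - step_path m J y' t) \<le> (\<Sum>j<J. norm (y j - y' j))" .
qed (use assms in \<open>auto simp: step_path_def intro!: grid_path_cadlag\<close>)

section \<open>The functional central limit theorem\<close>

lemma step_path_at:
  assumes "0 \<le> t" "nat \<lfloor>real m * t\<rfloor> \<le> J"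
  shows "step_path m J (\<lambda>j. F (Suc j) - F j) t = F (nat \<lfloor>real m * t\<rfloor>) - F 0"
  using assms sum_lessThan_telescope[of F "nat \<lfloor>real m * t\<rfloor>"] by (simp add: step_path_def grid_path_def min_absorb1)

lemma floor_mult_le:
  assumes "0 \<le> t" "t \<le> real K"
  shows "nat \<lfloor>real m * t\<rfloor> \<le> K * m"
proof -
  have "real m * t \<le> real m * real K" using assms by (intro mult_left_mono) auto
  also have "\<dots> = real (K * m)" by simp
  finally have "real m * t \<le> real (K * m)" .
  then have "\<lfloor>real m * t\<rfloor> \<le> int (K * m)" by linarith
  then show ?thesis by linarith
qed

lemma block_start_floor:
  assumes m: "0 < m" and t: "0 \<le> t"
  shows "block_start m n (nat \<lfloor>real m * t\<rfloor>) \<le> nat \<lfloor>real n * t\<rfloor>"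
    "nat \<lfloor>real n * t\<rfloor> \<le> block_start m n (Suc (nat \<lfloor>real m * t\<rfloor>))"
proof -
  let ?i = "nat \<lfloor>real m * t\<rfloor>" and ?k = "nat \<lfloor>real n * t\<rfloor>"
  have i: "real ?i \<le> real m * t" "real m * t < real ?i + 1" using t by (auto intro: mult_nonneg_nonneg simp: of_nat_nat) 
  have k: "real ?k \<le> real n * t" using t by (simp add: of_nat_nat)
  have "real (block_start m n ?i) \<le> real (n * ?i) / real m"
  proof -
    have "real (block_start m n ?i) = of_int \<lfloor>real (n * ?i) / real m\<rfloor>"
      by (simp only: block_start_def floor_divide_of_nat_eq of_int_of_nat_eq)
    then show ?thesis by linarith
  qed
  also have "\<dots> \<le> real n * (real m * t) / real m"
    using i(1) by (intro divide_right_mono) (auto simp: mult_left_mono)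
  also have "\<dots> = real n * t" using m by simp
  finally show "block_start m n ?i \<le> ?k" by (rule le_nat_floor)
  have "real ?k * real m \<le> real n * t * real m" using k by (intro mult_right_mono) auto
  also have "\<dots> = real n * (real m * t)" by simp
  also have "\<dots> \<le> real n * (real ?i + 1)" using i(2) by (intro mult_left_mono) auto
  also have "\<dots> = real (n * Suc ?i)" by (simp add: distrib_left)
  finally have "real (?k * m) \<le> real (n * Suc ?i)" by (simp only: of_nat_mult)
  then have "?k * m \<le> n * Suc ?i" by (simp only: of_nat_le_iff)
  then show "?k \<le> block_start m n (Suc ?i)"
    unfolding block_start_def using m by (simp only: less_eq_div_iff_mult_less_eq)
qed

text \<open>A continuous path that starts at 0 is followed by the step path of its increments, uniformly on
  \<open>[0, K]\<close>, once the mesh is small; how small depends on the path, whence the event \<open>bad m\<close> of vanishing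
  probability.\<close>

lemma limit_path_step_approx:
  fixes f :: "(real \<Rightarrow> complex) \<Rightarrow> real"
  assumes P: "prob_space M'" and B: "standard_brownian_motion M' B1" "standard_brownian_motion M' B2"
    and fc: "continuous_map (mtopology_of skorohod_metric) euclideanreal f"
    and fL: "\<And>x y. x \<in> mspace skorohod_metric \<Longrightarrow> y \<in> mspace skorohod_metric \<Longrightarrow> \<bar>f x - f y\<bar> \<le> L * mdist skorohod_metric x y"
    and L: "0 \<le> L" and fB: "\<And>x. x \<in> mspace skorohod_metric \<Longrightarrow> \<bar>f x\<bar> \<le> b" and d: "0 < d" and e: "0 < e"
  shows "eventually (\<lambda>m. \<bar>(\<integral>\<omega>. f (step_path m (K * m) (\<lambda>j. of_real c * Complex (grid_increment B1 m j \<omega>) (grid_increment B2 m j \<omega>))) \<partial>M')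
      - (\<integral>\<omega>. f (limit_path c B1 B2 \<omega>) \<partial>M')\<bar> \<le> 2 * L * (d + (1/2) ^ K) + e) sequentially"
proof -
  interpret N: prob_space M' by fact
  define a where "a = 2 * L * (d + (1/2) ^ K)"
  define w where "w \<omega> t = of_real c * (of_real (B1 t \<omega>) + \<i> * of_real (B2 t \<omega>))" for \<omega> t
  define U where "U m \<omega> = step_path m (K * m) (\<lambda>j. of_real c * Complex (grid_increment B1 m j \<omega>) (grid_increment B2 m j \<omega>))" for m \<omega>
  have b: "0 \<le> b" using fB[of "grid_path 1 (\<lambda>_. 0)"] grid_path_cadlag[of 1 "\<lambda>_. 0"] by (simp add: mspace_skorohod)
  have B_meas: "\<forall>t\<ge>0. B1 t \<in> borel_measurable M'" "\<forall>t\<ge>0. B2 t \<in> borel_measurable M'"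
    and B_cont: "\<forall>\<omega>\<in>space M'. continuous_on {0..} (\<lambda>t. B1 t \<omega>)" "\<forall>\<omega>\<in>space M'. continuous_on {0..} (\<lambda>t. B2 t \<omega>)"
    and B0: "AE \<omega> in M'. B1 0 \<omega> = 0" "AE \<omega> in M'. B2 0 \<omega> = 0"
    using B unfolding standard_brownian_motion_def by auto
  have V: "random_element M' skorohod_metric (limit_path c B1 B2)"
    by (rule random_element_limit_path[OF B_meas B_cont])
  have Veq: "limit_path c B1 B2 \<omega> = restrict (w \<omega>) {0..}" for \<omega>
    by (auto simp: limit_path_def w_def fun_eq_iff restrict_def)
  have cont: "continuous_on {0..} (w \<omega>)" if "\<omega> \<in> space M'" for \<omega>
    unfolding w_def using B_cont that by (intro continuous_intros) auto
  have gm [measurable]: "grid_increment B1 m j \<in> borel_measurable M'" "grid_increment B2 m j \<in> borel_measurable M'" for m j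
  proof -
    have [measurable]: "B1 (real i / real m) \<in> borel_measurable M'" "B2 (real i / real m) \<in> borel_measurable M'" for i
      using B_meas by auto
    show "grid_increment B1 m j \<in> borel_measurable M'" "grid_increment B2 m j \<in> borel_measurable M'"
      unfolding grid_increment_def[abs_def] by measurable
  qed
  have UR: "random_element M' skorohod_metric (U m)" if "0 < m" for m
    unfolding U_def step_path_def
  proof (rule random_element_grid_path)
    fix i
    have "(\<lambda>\<omega>. of_real c * Complex (grid_increment B1 m j \<omega>) (grid_increment B2 m j \<omega>)) \<in> borel_measurable M'" for j
      unfolding Complex_eq by measurable
    then show "(\<lambda>\<omega>. \<Sum>j<min i (K * m). of_real c * Complex (grid_increment B1 m j \<omega>) (grid_increment B2 m j \<omega>)) \<in> borel_measurable M'"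
      by (intro borel_measurable_sum)
  qed (use that in simp)
  have fV [measurable]: "(\<lambda>\<omega>. f (limit_path c B1 B2 \<omega>)) \<in> borel_measurable M'" by (rule random_element_compose[OF V fc])
  have fU: "(\<lambda>\<omega>. f (U m \<omega>)) \<in> borel_measurable M'" if "0 < m" for m by (rule random_element_compose[OF UR[OF that] fc])
  have close: "AE \<omega> in M'. eventually (\<lambda>m. \<bar>f (U m \<omega>) - f (limit_path c B1 B2 \<omega>)\<bar> \<le> a) sequentially"
    using B0 AE_space
  proof eventually_elim
    case (elim \<omega>)
    have w0: "w \<omega> 0 = 0" using elim by (simp add: w_def)
    obtain m0 where m0: "m0 > 0" "\<And>m t. m \<ge> m0 \<Longrightarrow> 0 \<le> t \<Longrightarrow> t \<le> real K \<Longrightarrow>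
      norm (w \<omega> (real (nat \<lfloor>real m * t\<rfloor>) / real m) - w \<omega> t) < d"
      using grid_path_modulus[OF cont[OF elim(3)] d, of K] by blast
    have "\<bar>f (U m \<omega>) - f (limit_path c B1 B2 \<omega>)\<bar> \<le> a" if m: "m \<ge> m0" for m
    proof -
      have mp: "0 < m" using m m0 by simp
      have inc: "of_real c * Complex (grid_increment B1 m j \<omega>) (grid_increment B2 m j \<omega>) =
          w \<omega> (real (Suc j) / real m) - w \<omega> (real j / real m)" for j
        by (simp add: grid_increment_def w_def Complex_eq algebra_simps)
      have in_space: "U m \<omega> \<in> mspace skorohod_metric" "limit_path c B1 B2 \<omega> \<in> mspace skorohod_metric"
        using random_element_in_space[OF UR[OF mp] elim(3)] random_element_in_space[OF V elim(3)] by auto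
      have "mdist skorohod_metric (U m \<omega>) (limit_path c B1 B2 \<omega>) \<le> 2 * (d + (1/2) ^ K)"
      proof (rule skorohod_mdist_le)
        fix t assume t: "0 \<le> t" "t \<le> real K"
        have "U m \<omega> t = w \<omega> (real (nat \<lfloor>real m * t\<rfloor>) / real m) - w \<omega> (real 0 / real m)"
          unfolding U_def inc by (rule step_path_at[OF t(1) floor_mult_le[OF t]])
        then have "U m \<omega> t - limit_path c B1 B2 \<omega> t = w \<omega> (real (nat \<lfloor>real m * t\<rfloor>) / real m) - w \<omega> t"
          using t w0 by (simp add: Veq)
        then show "norm (U m \<omega> t - limit_path c B1 B2 \<omega> t) \<le> d" using m0(2)[OF m t] by simp
      qed (use in_space d in \<open>auto simp: mspace_skorohod\<close>)
      then have "L * mdist skorohod_metric (U m \<omega>) (limit_path c B1 B2 \<omega>) \<le> L * (2 * (d + (1/2) ^ K))"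
        using L by (rule mult_left_mono)
      also have "\<dots> = a" by (simp only: a_def mult.assoc mult.left_commute)
      finally show ?thesis using fL[OF in_space] by linarith
    qed
    then show ?case by (auto simp: eventually_sequentially)
  qed
  define bad where "bad m = {\<omega> \<in> space M'. a < \<bar>f (U m \<omega>) - f (limit_path c B1 B2 \<omega>)\<bar>}" for m
  have bad_sets: "bad m \<in> sets M'" if "0 < m" for m
  proof -
    note [measurable] = fU[OF that]
    show ?thesis unfolding bad_def by measurable
  qed
  have "(\<lambda>m. \<integral>\<omega>. indicator (bad (Suc m)) \<omega> \<partial>M') \<longlonglongrightarrow> (\<integral>\<omega>. 0 \<partial>M' :: real)"
  proof (rule integral_dominated_convergence[where w = "\<lambda>_. 1"])
    show "AE \<omega> in M'. (\<lambda>m. indicator (bad (Suc m)) \<omega> :: real) \<longlonglongrightarrow> 0"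
      using close
    proof eventually_elim
      case (elim \<omega>)
      then have "eventually (\<lambda>m. (indicator (bad m) \<omega> :: real) = 0) sequentially"
        by eventually_elim (auto simp: bad_def indicator_def)
      then show ?case by (intro LIMSEQ_Suc tendsto_eventually)
    qed
    show "(\<lambda>\<omega>. indicator (bad (Suc m)) \<omega> :: real) \<in> borel_measurable M'" for m using bad_sets[of "Suc m"] by simp
  qed (auto simp: indicator_def)
  then have "(\<lambda>m. N.prob (bad (Suc m))) \<longlonglongrightarrow> 0"
    using bad_sets by simp
  then have "(\<lambda>m. N.prob (bad m)) \<longlonglongrightarrow> 0" by (rule LIMSEQ_imp_Suc)
  then have "(\<lambda>m. 2 * b * N.prob (bad m)) \<longlonglongrightarrow> 2 * b * 0" by (intro tendsto_intros)
  then have "eventually (\<lambda>m. 2 * b * N.prob (bad m) < e) sequentially" by (rule order_tendstoD) (use e in simp)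
  with eventually_gt_at_top[of 0] show ?thesis
  proof eventually_elim
    case (elim m)
    note bm = bad_sets[OF elim(1)]
    have in_space: "U m \<omega> \<in> mspace skorohod_metric" "limit_path c B1 B2 \<omega> \<in> mspace skorohod_metric" if "\<omega> \<in> space M'" for \<omega>
      using random_element_in_space[OF UR[OF elim(1)] that] random_element_in_space[OF V that] by auto
    have i: "integrable M' (\<lambda>\<omega>. f (U m \<omega>))" "integrable M' (\<lambda>\<omega>. f (limit_path c B1 B2 \<omega>))"
      by (rule N.integrable_const_bound[where B = b], use in_space fB fU[OF elim(1)] in auto)+
    have ib: "integrable M' (\<lambda>\<omega>. indicator (bad m) \<omega> :: real)"
      by (rule N.integrable_const_bound[where B = 1]) (use bm in \<open>auto simp: indicator_def\<close>)
    have "\<bar>(\<integral>\<omega>. f (U m \<omega>) \<partial>M') - (\<integral>\<omega>. f (limit_path c B1 B2 \<omega>) \<partial>M')\<bar> =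
        \<bar>\<integral>\<omega>. f (U m \<omega>) - f (limit_path c B1 B2 \<omega>) \<partial>M'\<bar>" using i by simp
    also have "\<dots> \<le> (\<integral>\<omega>. \<bar>f (U m \<omega>) - f (limit_path c B1 B2 \<omega>)\<bar> \<partial>M')" by (rule integral_abs_bound)
    also have "\<dots> \<le> (\<integral>\<omega>. a + 2 * b * indicator (bad m) \<omega> \<partial>M')"
    proof (rule integral_mono)
      fix \<omega> assume w: "\<omega> \<in> space M'"
      have "\<bar>f (U m \<omega>) - f (limit_path c B1 B2 \<omega>)\<bar> \<le> 2 * b"
        using fB[OF in_space(1)[OF w]] fB[OF in_space(2)[OF w]] by linarith
      moreover have "0 \<le> a" using L d by (simp add: a_def)
      ultimately show "\<bar>f (U m \<omega>) - f (limit_path c B1 B2 \<omega>)\<bar> \<le> a + 2 * b * indicator (bad m) \<omega>"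
        using w by (cases "\<omega> \<in> bad m") (auto simp: bad_def)
    qed (use i ib in auto)
    also have "\<dots> = a + 2 * b * N.prob (bad m)" using ib bm by (simp add: N.prob_space)
    finally show ?case using elim unfolding U_def a_def by simp
  qed
qed

context averaging_martingale
begin

text \<open>A Lipschitz function of the step path is a Lipschitz function of the \<open>2 * J\<close> real coordinates of
  its jumps.  A real linear combination of these coordinates is the real part of a combination of block
  sums with complex weights \<open>w j\<close>, and \<open>(norm (w j))\<^sup>2\<close> is the sum of the squares of its two coefficients,
  as for two independent Brownian motions.\<close>

lemma step_path_convergence:
  fixes f :: "(real \<Rightarrow> complex) \<Rightarrow> real"
  assumes P: "prob_space M'" and B: "standard_brownian_motion M' B1" "standard_brownian_motion M' B2" "indep_processes M' B1 B2"
    and fc: "continuous_map (mtopology_of skorohod_metric) euclideanreal f"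
    and fL: "\<And>x y. x \<in> mspace skorohod_metric \<Longrightarrow> y \<in> mspace skorohod_metric \<Longrightarrow> \<bar>f x - f y\<bar> \<le> L * mdist skorohod_metric x y"
    and L: "0 \<le> L" and fB: "\<And>x. x \<in> mspace skorohod_metric \<Longrightarrow> \<bar>f x\<bar> \<le> b" and m: "0 < m"
  shows "(\<lambda>n. \<integral>\<omega>. f (step_path m J (\<lambda>j. block_sum m n j \<omega> / of_real (sqrt (real n)))) \<partial>M)
    \<longlonglongrightarrow> (\<integral>\<omega>. f (step_path m J (\<lambda>j. of_real (sqrt (s2 / 2)) * Complex (grid_increment B1 m j \<omega>) (grid_increment B2 m j \<omega>))) \<partial>M')"
proof -
  interpret N: prob_space M' by fact
  \<comment> \<open>coordinates \<open>(True, j)\<close> are real parts, \<open>(False, j)\<close> imaginary parts\<close>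
  define I where "I = (UNIV :: bool set) \<times> {..<J}"
  define dS where "dS n j \<omega> = block_sum m n j \<omega>" for n j \<omega>
  define x where "x n i \<omega> = (if fst i then Re (dS n (snd i) \<omega>) else Im (dS n (snd i) \<omega>)) / sqrt (real n)" for n and i :: "bool \<times> nat" and \<omega>
  define x' where "x' i \<omega> = sqrt (s2 / 2) * grid_increment (if fst i then B1 else B2) m (snd i) \<omega>" for i :: "bool \<times> nat" and \<omega>
  define y where "y z j = Complex (z (True, j)) (z (False, j))" for z :: "bool \<times> nat \<Rightarrow> real" and j
  define g where "g z = f (step_path m J (y z))" for z
  have sumI: "(\<Sum>i\<in>I. F i) = (\<Sum>j<J. F (True, j) + F (False, j))" for F :: "bool \<times> nat \<Rightarrow> real"
  proof -
    have "(\<Sum>i\<in>I. F i) = (\<Sum>p\<in>UNIV. \<Sum>j<J. F (p, j))" unfolding I_def by (simp add: sum.cartesian_product)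
    then show ?thesis by (simp add: UNIV_bool sum.distrib add.commute)
  qed
  have s: "0 < sqrt (1 / real m)" using m by simp
  have [measurable]: "dS n j \<in> borel_measurable M" for n j unfolding dS_def[abs_def] by measurable
  have [measurable]: "grid_increment B1 m j \<in> borel_measurable M'" "grid_increment B2 m j \<in> borel_measurable M'" for j
    using N.normal_standardize(1)[OF N.brownian_grid_increment[OF B(1) m] s]
      N.normal_standardize(1)[OF N.brownian_grid_increment[OF B(2) m] s] .
  have sp: "step_path m J z \<in> mspace skorohod_metric" for z
    unfolding step_path_def mspace_skorohod by (rule grid_path_cadlag) (use m in simp)
  have yx: "y (\<lambda>i. x n i \<omega>) j = dS n j \<omega> / of_real (sqrt (real n))" for n \<omega> j
    unfolding y_def x_def by (simp add: complex_eq_iff Re_divide_of_real Im_divide_of_real)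
  have yx': "y (\<lambda>i. x' i \<omega>) j = of_real (sqrt (s2 / 2)) * Complex (grid_increment B1 m j \<omega>) (grid_increment B2 m j \<omega>)" for \<omega> j
    unfolding y_def x'_def by (simp add: complex_eq_iff)
  have "(\<lambda>n. \<integral>\<omega>. g (\<lambda>i. x n i \<omega>) \<partial>M) \<longlonglongrightarrow> (\<integral>\<omega>. g (\<lambda>i. x' i \<omega>) \<partial>M')"
  proof (rule charfun_imp_lipschitz_convergence[where I = I and B = b and L = "2 * L" and X = x and X' = x' and g = g])
    show "finite I" by (simp add: I_def)
    show "x n i \<in> borel_measurable M" for n i unfolding x_def[abs_def] by (cases "fst i") simp_all
    show "x' i \<in> borel_measurable M'" for i unfolding x'_def[abs_def] by (cases "fst i") simp_all
    show "\<bar>g z\<bar> \<le> b" for z unfolding g_def by (rule fB[OF sp])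
    show "\<bar>g z - g z'\<bar> \<le> 2 * L * (\<Sum>i\<in>I. \<bar>z i - z' i\<bar>)" for z z'
    proof -
      have "\<bar>g z - g z'\<bar> \<le> L * mdist skorohod_metric (step_path m J (y z)) (step_path m J (y z'))"
        unfolding g_def by (rule fL[OF sp sp])
      also have "\<dots> \<le> L * (2 * (\<Sum>j<J. norm (y z j - y z' j)))"
        by (intro mult_left_mono step_path_lipschitz m L)
      also have "\<dots> \<le> L * (2 * (\<Sum>j<J. \<bar>z (True, j) - z' (True, j)\<bar> + \<bar>z (False, j) - z' (False, j)\<bar>))"
      proof (intro mult_left_mono sum_mono L)
        show "norm (y z j - y z' j) \<le> \<bar>z (True, j) - z' (True, j)\<bar> + \<bar>z (False, j) - z' (False, j)\<bar>" for j
          using cmod_le[of "y z j - y z' j"] by (simp add: y_def)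
      qed simp
      finally show ?thesis by (simp add: sumI)
    qed
    show "(\<lambda>\<omega>. g (\<lambda>i. x n i \<omega>)) \<in> borel_measurable M" for n
      unfolding g_def
    proof (rule random_element_compose[OF _ fc])
      show "random_element M skorohod_metric (\<lambda>\<omega>. step_path m J (y (\<lambda>i. x n i \<omega>)))"
        unfolding step_path_def yx by (rule random_element_grid_path) (use m in auto)
    qed
    show "(\<lambda>\<omega>. g (\<lambda>i. x' i \<omega>)) \<in> borel_measurable M'"
      unfolding g_def
    proof (rule random_element_compose[OF _ fc])
      show "random_element M' skorohod_metric (\<lambda>\<omega>. step_path m J (y (\<lambda>i. x' i \<omega>)))"
        unfolding step_path_def yx' Complex_eq by (rule random_element_grid_path) (use m in auto)
    qed
    show "(\<lambda>n. \<integral>\<omega>. iexp (\<Sum>i\<in>I. u i * x n i \<omega>) \<partial>M) \<longlonglongrightarrow> (\<integral>\<omega>. iexp (\<Sum>i\<in>I. u i * x' i \<omega>) \<partial>M')" for u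
    proof -
      \<comment> \<open>\<open>Re (w * z)\<close> subtracts the product of the imaginary parts, whence the sign\<close>
      define w where "w j = Complex (u (True, j)) (- u (False, j))" for j
      have 1: "(\<Sum>i\<in>I. u i * x n i \<omega>) = (\<Sum>j<J. Re (w j * dS n j \<omega>) / sqrt (real n))" for n \<omega>
        unfolding sumI by (intro sum.cong refl) (simp add: x_def w_def add_divide_distrib)
      have 2: "(\<Sum>i\<in>I. u i * x' i \<omega>) = (\<Sum>j<J. sqrt (s2 / 2) * u (True, j) * grid_increment B1 m j \<omega>) +
          (\<Sum>j<J. sqrt (s2 / 2) * u (False, j) * grid_increment B2 m j \<omega>)" for \<omega>
        unfolding sumI x'_def sum.distrib[symmetric] by (intro sum.cong refl) (simp add: mult.left_commute mult.assoc)
      have 3: "(\<integral>\<omega>. iexp (\<Sum>i\<in>I. u i * x' i \<omega>) \<partial>M') = of_real (exp (- ((\<Sum>j<J. (norm (w j))\<^sup>2) * s2 / (2 * real m)) / 2))"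
      proof -
        have W: "(\<Sum>j<J. (norm (w j))\<^sup>2) = (\<Sum>j<J. (u (True, j))\<^sup>2) + (\<Sum>j<J. (u (False, j))\<^sup>2)"
          by (simp add: w_def cmod_power2 sum.distrib)
        have A: "(\<Sum>j<J. (sqrt (s2 / 2) * u (p, j))\<^sup>2) = s2 / 2 * (\<Sum>j<J. (u (p, j))\<^sup>2)" for p
          using s2_nonneg by (simp add: power_mult_distrib sum_distrib_left)
        show ?thesis
          unfolding 2 N.brownian_pair_increments_char[OF B m] A W by (simp add: field_simps)
      qed
      show ?thesis unfolding 1 3 dS_def by (rule block_increments_charfun[OF m])
    qed
  qed (use P L prob_space_axioms in auto)
  then show ?thesis unfolding g_def yx yx' dS_def .
qed

text \<open>At time \<open>t\<close> the step path shows the partial sum at the start of the block \<open>\<lfloor>m * t\<rfloor>\<close>, which is the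
  block of the index \<open>\<lfloor>n * t\<rfloor>\<close>.  The directions \<open>1\<close> and \<open>- \<i>\<close> read off real and imaginary parts.  The
  time \<open>t = K\<close> falls into the block \<open>K * m\<close>, so \<open>K * m + 1\<close> blocks are involved.\<close>

lemma scaled_path_near_step_path:
  assumes n: "0 < n" and m: "0 < m"
    and small: "\<And>j k u. j \<le> K * m \<Longrightarrow> k \<in> {block_start m n j..block_start m n (Suc j)} \<Longrightarrow> u \<in> {1, - \<i>} \<Longrightarrow>
      \<bar>Re (u * (S k \<omega> - S (block_start m n j) \<omega>)) / sqrt (real n)\<bar> < 2 * \<eta>"
  shows "mdist skorohod_metric (scaled_path n \<omega>)
    (step_path m (K * m) (\<lambda>j. block_sum m n j \<omega> / of_real (sqrt (real n)))) \<le> 2 * (4 * \<eta> + (1/2) ^ K)"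
proof (rule skorohod_mdist_le)
  show "scaled_path n \<omega> \<in> cadlag_space" unfolding scaled_path_def by (rule grid_path_cadlag) (use n in simp)
  show "step_path m (K * m) (\<lambda>j. block_sum m n j \<omega> / of_real (sqrt (real n))) \<in> cadlag_space"
    unfolding step_path_def by (rule grid_path_cadlag) (use m in simp)
  have "\<bar>Re (1 * (S 0 \<omega> - S (block_start m n 0) \<omega>)) / sqrt (real n)\<bar> < 2 * \<eta>" by (rule small) auto
  then show "0 \<le> 4 * \<eta>" by simp
  fix t assume t: "0 \<le> t" "t \<le> real K"
  let ?i = "nat \<lfloor>real m * t\<rfloor>" and ?k = "nat \<lfloor>real n * t\<rfloor>"
  define F where "F j = S (block_start m n j) \<omega> / of_real (sqrt (real n))" for j
  have "step_path m (K * m) (\<lambda>j. block_sum m n j \<omega> / of_real (sqrt (real n))) t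
      = step_path m (K * m) (\<lambda>j. F (Suc j) - F j) t" by (simp only: F_def diff_divide_distrib)
  also have "\<dots> = F ?i - F 0" by (rule step_path_at[OF t(1) floor_mult_le[OF t]])
  also have "\<dots> = S (block_start m n ?i) \<omega> / of_real (sqrt (real n))" by (simp add: F_def S_def)
  finally have eq: "scaled_path n \<omega> t - step_path m (K * m) (\<lambda>j. block_sum m n j \<omega> / of_real (sqrt (real n))) t
      = (S ?k \<omega> - S (block_start m n ?i) \<omega>) / of_real (sqrt (real n))"
    using t by (simp add: scaled_path_def grid_path_def diff_divide_distrib)
  have k: "?k \<in> {block_start m n ?i..block_start m n (Suc ?i)}" using block_start_floor[OF m t(1)] by simp
  let ?z = "S ?k \<omega> - S (block_start m n ?i) \<omega>"
  have "\<bar>Re (1 * ?z) / sqrt (real n)\<bar> < 2 * \<eta>" "\<bar>Re (- \<i> * ?z) / sqrt (real n)\<bar> < 2 * \<eta>"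
    by (rule small[OF floor_mult_le[OF t] k], simp)+
  then have "\<bar>Re (?z / of_real (sqrt (real n)))\<bar> < 2 * \<eta>" "\<bar>Im (?z / of_real (sqrt (real n)))\<bar> < 2 * \<eta>"
    unfolding Re_divide_of_real Im_divide_of_real by simp_all
  then show "norm (scaled_path n \<omega> t - step_path m (K * m) (\<lambda>j. block_sum m n j \<omega> / of_real (sqrt (real n))) t) \<le> 4 * \<eta>"
    unfolding eq using cmod_le[of "?z / of_real (sqrt (real n))"] by linarith
qed

lemma random_element_scaled_path: "0 < n \<Longrightarrow> random_element M skorohod_metric (scaled_path n)"
  unfolding scaled_path_def[abs_def] by (rule random_element_grid_path) auto

text \<open>The exceptional event is the union of the oscillation events of \<open>K * m + 1\<close> blocks in two
  directions; on it two values of \<open>f\<close> differ by at most \<open>2 * b\<close>.\<close>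

lemma scaled_path_step_approx:
  fixes f :: "(real \<Rightarrow> complex) \<Rightarrow> real"
  assumes P: "prob_space M'" and B: "standard_brownian_motion M' B"
    and fc: "continuous_map (mtopology_of skorohod_metric) euclideanreal f"
    and fL: "\<And>x y. x \<in> mspace skorohod_metric \<Longrightarrow> y \<in> mspace skorohod_metric \<Longrightarrow> \<bar>f x - f y\<bar> \<le> L * mdist skorohod_metric x y"
    and L: "0 \<le> L" and fB: "\<And>x. x \<in> mspace skorohod_metric \<Longrightarrow> \<bar>f x\<bar> \<le> b" and m: "0 < m" and \<eta>: "0 < \<eta>" and e: "0 < e"
  shows "eventually (\<lambda>n. \<bar>(\<integral>\<omega>. f (scaled_path n \<omega>) \<partial>M) -
     (\<integral>\<omega>. f (step_path m (K * m) (\<lambda>j. block_sum m n j \<omega> / of_real (sqrt (real n)))) \<partial>M)\<bar>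
    \<le> 2 * L * (4 * \<eta> + (1/2) ^ K) + 4 * b * real (K * m + 1) * (3 * (sqrt (s2 / 2)) ^ 4 / ((real m)\<^sup>2 * \<eta> ^ 4)) + e) sequentially"
proof -
  define J where "J = K * m"
  define D where "D = 3 * (sqrt (s2 / 2)) ^ 4 / ((real m)\<^sup>2 * \<eta> ^ 4)"
  have b: "0 \<le> b" using fB[of "grid_path 1 (\<lambda>_. 0)"] grid_path_cadlag[of 1 "\<lambda>_. 0"] by (simp add: mspace_skorohod)
  \<comment> \<open>the added 1 keeps the denominator positive when \<open>b = 0\<close>\<close>
  define e' where "e' = e / (4 * b * real (J + 1) + 1)"
  have den: "0 < 4 * b * real (J + 1) + 1" using b by (intro add_nonneg_pos mult_nonneg_nonneg) auto
  have e': "0 < e'" "4 * b * real (J + 1) * e' \<le> e"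
  proof -
    show e'0: "0 < e'" using e den by (simp add: e'_def)
    have "4 * b * real (J + 1) * e' \<le> (4 * b * real (J + 1) + 1) * e'" using e'0 by (intro mult_right_mono) auto
    also have "\<dots> = e" using den by (simp add: e'_def)
    finally show "4 * b * real (J + 1) * e' \<le> e" .
  qed
  define bad where "bad n j u = {\<omega> \<in> space M. \<exists>k\<in>{block_start m n j..block_start m n (Suc j)}.
      2 * \<eta> \<le> \<bar>Re (u * (S k \<omega> - S (block_start m n j) \<omega>)) / sqrt (real n)\<bar>}" for n j u
  have bad_sets [measurable]: "bad n j u \<in> sets M" for n j u unfolding bad_def by measurable
  have "eventually (\<lambda>n. prob (bad n j u) < D + e') sequentially" if "u \<in> {1, - \<i>}" for j u
    unfolding bad_def D_def by (rule block_oscillation_eventually[OF P B m _ \<eta> e'(1)]) (use that in auto)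
  then have "eventually (\<lambda>n. \<forall>j\<in>{..J}. \<forall>u\<in>{1, - \<i>}. prob (bad n j u) < D + e') sequentially"
    by (intro eventually_ball_finite ballI) simp_all
  with eventually_gt_at_top[of 0] show ?thesis
  proof eventually_elim
    case (elim n)
    define U where "U \<omega> = step_path m (K * m) (\<lambda>j. block_sum m n j \<omega> / of_real (sqrt (real n)))" for \<omega>
    define Bad where "Bad = (\<Union>j\<in>{..J}. \<Union>u\<in>{1, - \<i>}. bad n j u)"
    have Bad_sets [measurable]: "Bad \<in> sets M" unfolding Bad_def by (intro sets.finite_UN) auto
    have "prob Bad \<le> (\<Sum>j\<in>{..J}. prob (\<Union>u\<in>{1, - \<i>}. bad n j u))"
      unfolding Bad_def by (intro measure_UNION_le) auto
    also have "\<dots> \<le> (\<Sum>j\<in>{..J}. \<Sum>u\<in>{1, - \<i>}. prob (bad n j u))"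
      by (intro sum_mono measure_UNION_le) auto
    also have "\<dots> \<le> (\<Sum>j\<in>{..J}. \<Sum>u\<in>{1, - \<i>}. D + e')"
      using elim(2) by (intro sum_mono) (auto intro: less_imp_le)
    also have "\<dots> = 2 * real (J + 1) * (D + e')"
    proof -
      have "card {1, - \<i>} = 2" by (simp add: complex_eq_iff)
      then show ?thesis by (simp add: algebra_simps)
    qed
    finally have PB: "prob Bad \<le> 2 * real (J + 1) * (D + e')" .
    have UR: "random_element M skorohod_metric U"
      unfolding U_def[abs_def] step_path_def by (rule random_element_grid_path) (use m in auto)
    note VR = random_element_scaled_path[OF elim(1)]
    note in_space = random_element_in_space[OF VR] random_element_in_space[OF UR]
    have i: "integrable M (\<lambda>\<omega>. f (scaled_path n \<omega>))" "integrable M (\<lambda>\<omega>. f (U \<omega>))"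
      by (rule integrable_const_bound[where B = b], use in_space fB random_element_compose[OF VR fc] random_element_compose[OF UR fc] in auto)+
    have ib: "integrable M (\<lambda>\<omega>. indicator Bad \<omega> :: real)"
      by (rule integrable_const_bound[where B = 1]) (auto simp: indicator_def)
    let ?a = "2 * L * (4 * \<eta> + (1/2) ^ K)"
    have "\<bar>(\<integral>\<omega>. f (scaled_path n \<omega>) \<partial>M) - (\<integral>\<omega>. f (U \<omega>) \<partial>M)\<bar> = \<bar>\<integral>\<omega>. f (scaled_path n \<omega>) - f (U \<omega>) \<partial>M\<bar>"
      using i by simp
    also have "\<dots> \<le> (\<integral>\<omega>. \<bar>f (scaled_path n \<omega>) - f (U \<omega>)\<bar> \<partial>M)" by (rule integral_abs_bound)
    also have "\<dots> \<le> (\<integral>\<omega>. ?a + 2 * b * indicator Bad \<omega> \<partial>M)"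
    proof (rule integral_mono)
      fix \<omega> assume w: "\<omega> \<in> space M"
      have a: "0 \<le> ?a" using L \<eta> by simp
      show "\<bar>f (scaled_path n \<omega>) - f (U \<omega>)\<bar> \<le> ?a + 2 * b * indicator Bad \<omega>"
      proof (cases "\<omega> \<in> Bad")
        case True
        then show ?thesis using fB[OF in_space(1)[OF w]] fB[OF in_space(2)[OF w]] a by simp
      next
        case False
        have "\<bar>f (scaled_path n \<omega>) - f (U \<omega>)\<bar> \<le> L * mdist skorohod_metric (scaled_path n \<omega>) (U \<omega>)"
          by (rule fL[OF in_space[OF w]])
        also have "\<dots> \<le> L * (2 * (4 * \<eta> + (1/2) ^ K))"
        proof (intro mult_left_mono L)
          show "mdist skorohod_metric (scaled_path n \<omega>) (U \<omega>) \<le> 2 * (4 * \<eta> + (1/2) ^ K)"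
            unfolding U_def
          proof (rule scaled_path_near_step_path[OF elim(1) m])
            fix j k u assume "j \<le> K * m" "k \<in> {block_start m n j..block_start m n (Suc j)}" "u \<in> {1, - \<i>}"
            moreover from this have "\<omega> \<notin> bad n j u" using False by (auto simp: Bad_def J_def)
            ultimately show "\<bar>Re (u * (S k \<omega> - S (block_start m n j) \<omega>)) / sqrt (real n)\<bar> < 2 * \<eta>"
              using w unfolding bad_def by (simp only: mem_Collect_eq) (meson not_less)
          qed
        qed
        also have "\<dots> = ?a" by (simp only: mult.assoc mult.left_commute)
        finally have "\<bar>f (scaled_path n \<omega>) - f (U \<omega>)\<bar> \<le> ?a" .
        moreover have "indicator Bad \<omega> = (0 :: real)" using False by simp
        ultimately show ?thesis by (simp only: mult_zero_right add_0_right)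
      qed
    qed (use i ib in auto)
    also have "\<dots> = ?a + 2 * b * prob Bad" using ib by (simp add: prob_space)
    also have "\<dots> \<le> ?a + 2 * b * (2 * real (J + 1) * (D + e'))"
      using PB b by (intro add_left_mono mult_left_mono) auto
    also have "\<dots> = ?a + 4 * b * real (J + 1) * D + 4 * b * real (J + 1) * e'" by (simp add: algebra_simps)
    also have "\<dots> \<le> ?a + 4 * b * real (J + 1) * D + e" using e'(2) by simp
    finally show ?case unfolding U_def D_def J_def .
  qed
qed

text \<open>The step paths link the two sides.  The horizon \<open>K\<close> and the oscillation \<open>\<eta>\<close> are fixed first, from
  the Lipschitz constant; then \<open>m\<close> is taken large, so that the oscillation bound, of order \<open>K / m\<close> for
  this \<open>\<eta>\<close>, is small and the limit path is close to its step path; \<open>n\<close> tends to infinity last.\<close>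

theorem lipschitz_functional_clt:
  fixes f :: "(real \<Rightarrow> complex) \<Rightarrow> real"
  assumes P: "prob_space M'" and B: "standard_brownian_motion M' B1" "standard_brownian_motion M' B2" "indep_processes M' B1 B2"
    and lip: "Lipschitz_continuous_map skorohod_metric euclidean_metric f" and bdd: "bounded (f ` mspace skorohod_metric)"
  shows "(\<lambda>n. \<integral>\<omega>. f (scaled_path n \<omega>) \<partial>M) \<longlonglongrightarrow> (\<integral>\<omega>. f (limit_path (sqrt (s2 / 2)) B1 B2 \<omega>) \<partial>M')"
proof -
  have fc: "continuous_map (mtopology_of skorohod_metric) euclideanreal f" by (rule Lipschitz_continuous_real[OF lip])
  obtain L0 where L0: "\<And>x y. x \<in> mspace skorohod_metric \<Longrightarrow> y \<in> mspace skorohod_metric \<Longrightarrow>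
      dist (f x) (f y) \<le> L0 * mdist skorohod_metric x y"
    using lip by (auto simp: Lipschitz_continuous_map_def)
  define L where "L = \<bar>L0\<bar>"
  have L: "0 \<le> L" by (simp add: L_def)
  have fL: "\<bar>f x - f y\<bar> \<le> L * mdist skorohod_metric x y" if "x \<in> mspace skorohod_metric" "y \<in> mspace skorohod_metric" for x y
  proof -
    have "\<bar>f x - f y\<bar> \<le> L0 * mdist skorohod_metric x y" using L0[OF that] by (simp add: dist_real_def)
    also have "\<dots> \<le> L * mdist skorohod_metric x y" by (intro mult_right_mono) (auto simp: L_def)
    finally show ?thesis .
  qed
  obtain b where fB: "\<And>x. x \<in> mspace skorohod_metric \<Longrightarrow> \<bar>f x\<bar> \<le> b" using bdd by (auto simp: bounded_iff)
  show ?thesis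
  proof (rule LIMSEQ_I)
    fix e :: real assume e: "0 < e"
    obtain K :: nat where K: "2 * L * (1/2) ^ K < e / 16"
    proof -
      have "(\<lambda>K. 2 * L * (1/2 :: real) ^ K) \<longlonglongrightarrow> 2 * L * 0" by (intro tendsto_intros LIMSEQ_power_zero) auto
      then have "eventually (\<lambda>K. 2 * L * (1/2 :: real) ^ K < e / 16) sequentially" by (rule order_tendstoD) (use e in simp)
      then show ?thesis using that by (auto simp: eventually_sequentially)
    qed
    \<comment> \<open>the added 1 keeps the denominator positive when \<open>L = 0\<close>\<close>
    define \<eta> where "\<eta> = e / (128 * (L + 1))"
    have \<eta>: "0 < \<eta>" "2 * L * (4 * \<eta>) \<le> e / 16"
    proof -
      show 0: "0 < \<eta>" using e L by (simp add: \<eta>_def)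
      have "2 * L * (4 * \<eta>) \<le> 8 * ((L + 1) * \<eta>)" using 0 by (simp add: algebra_simps)
      also have "(L + 1) * \<eta> = e / 128" using L by (simp add: \<eta>_def field_simps)
      finally show "2 * L * (4 * \<eta>) \<le> e / 16" by simp
    qed
    define a where "a = 3 * (sqrt (s2 / 2)) ^ 4 / \<eta> ^ 4"
    have "(\<lambda>m. 4 * b * a * (real K / real m + 1 / (real m * real m))) \<longlonglongrightarrow> 4 * b * a * (0 + 0)"
    proof (rule tendsto_mult[OF tendsto_const tendsto_add])
      show "(\<lambda>m. real K / real m) \<longlonglongrightarrow> 0" by (rule lim_const_over_n)
      have "(\<lambda>m. (1 / real m) * (1 / real m)) \<longlonglongrightarrow> 0 * 0" by (intro tendsto_mult lim_const_over_n)
      then show "(\<lambda>m. 1 / (real m * real m)) \<longlonglongrightarrow> 0" by simp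
    qed
    then have ev_a: "eventually (\<lambda>m. 4 * b * a * (real K / real m + 1 / (real m * real m)) < e / 16) sequentially"
      by (rule order_tendstoD) (use e in simp)
    have e16: "0 < e / 16" using e by simp
    have "eventually (\<lambda>m. \<bar>(\<integral>\<omega>. f (step_path m (K * m) (\<lambda>j. of_real (sqrt (s2 / 2)) * Complex (grid_increment B1 m j \<omega>) (grid_increment B2 m j \<omega>))) \<partial>M')
      - (\<integral>\<omega>. f (limit_path (sqrt (s2 / 2)) B1 B2 \<omega>) \<partial>M')\<bar> \<le> 2 * L * (\<eta> + (1/2) ^ K) + e / 16) sequentially"
      by (rule limit_path_step_approx[OF P B(1,2) fc _ L _ \<eta>(1) e16]) (use fL fB in auto)
    with ev_a eventually_gt_at_top[of 0]
    have "eventually (\<lambda>m. 0 < m \<and> 4 * b * a * (real K / real m + 1 / (real m * real m)) < e / 16 \<and>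
      \<bar>(\<integral>\<omega>. f (step_path m (K * m) (\<lambda>j. of_real (sqrt (s2 / 2)) * Complex (grid_increment B1 m j \<omega>) (grid_increment B2 m j \<omega>))) \<partial>M')
      - (\<integral>\<omega>. f (limit_path (sqrt (s2 / 2)) B1 B2 \<omega>) \<partial>M')\<bar> \<le> 2 * L * (\<eta> + (1/2) ^ K) + e / 16) sequentially"
      by eventually_elim blast
    then obtain m where m: "0 < m" and am: "4 * b * a * (real K / real m + 1 / (real m * real m)) < e / 16"
      and lm: "\<bar>(\<integral>\<omega>. f (step_path m (K * m) (\<lambda>j. of_real (sqrt (s2 / 2)) * Complex (grid_increment B1 m j \<omega>) (grid_increment B2 m j \<omega>))) \<partial>M')
      - (\<integral>\<omega>. f (limit_path (sqrt (s2 / 2)) B1 B2 \<omega>) \<partial>M')\<bar> \<le> 2 * L * (\<eta> + (1/2) ^ K) + e / 16"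
      by (auto simp: eventually_sequentially)
    let ?U = "\<lambda>n. \<integral>\<omega>. f (step_path m (K * m) (\<lambda>j. block_sum m n j \<omega> / of_real (sqrt (real n)))) \<partial>M"
    let ?W = "\<integral>\<omega>. f (step_path m (K * m) (\<lambda>j. of_real (sqrt (s2 / 2)) * Complex (grid_increment B1 m j \<omega>) (grid_increment B2 m j \<omega>))) \<partial>M'"
    have mid: "eventually (\<lambda>n. dist (?U n) ?W < e / 16) sequentially"
      by (rule tendstoD[OF step_path_convergence[OF P B fc fL L fB m]]) (use e in auto)
    have main: "4 * b * real (K * m + 1) * (3 * (sqrt (s2 / 2)) ^ 4 / ((real m)\<^sup>2 * \<eta> ^ 4)) < e / 16"
    proof -
      have "4 * b * real (K * m + 1) * (3 * (sqrt (s2 / 2)) ^ 4 / ((real m)\<^sup>2 * \<eta> ^ 4)) = 4 * b * a * (real (K * m + 1) / (real m)\<^sup>2)"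
        by (simp add: a_def mult_ac)
      also have "real (K * m + 1) / (real m)\<^sup>2 = real K / real m + 1 / (real m * real m)"
        using m by (simp add: power2_eq_square add_divide_distrib)
      finally show ?thesis using am by simp
    qed
    have "eventually (\<lambda>n. \<bar>(\<integral>\<omega>. f (scaled_path n \<omega>) \<partial>M) - ?U n\<bar>
        \<le> 2 * L * (4 * \<eta> + (1/2) ^ K) + 4 * b * real (K * m + 1) * (3 * (sqrt (s2 / 2)) ^ 4 / ((real m)\<^sup>2 * \<eta> ^ 4)) + e / 16) sequentially"
      by (rule scaled_path_step_approx[OF P B(1) fc _ L _ m \<eta>(1) e16]) (use fL fB in auto)
    with mid have "eventually (\<lambda>n. norm ((\<integral>\<omega>. f (scaled_path n \<omega>) \<partial>M) - (\<integral>\<omega>. f (limit_path (sqrt (s2 / 2)) B1 B2 \<omega>) \<partial>M')) < e) sequentially"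
    proof eventually_elim
      case (elim n)
      have "2 * L * (4 * \<eta> + (1/2) ^ K) \<le> e / 8" using \<eta>(2) K by (simp add: distrib_left)
      moreover have "2 * L * (\<eta> + (1/2) ^ K) \<le> e / 8"
      proof -
        have "2 * L * (\<eta> + (1/2) ^ K) \<le> 2 * L * (4 * \<eta> + (1/2) ^ K)" using L \<eta>(1) by (intro mult_left_mono) auto
        then show ?thesis using \<open>2 * L * (4 * \<eta> + (1/2) ^ K) \<le> e / 8\<close> by linarith
      qed
      ultimately show ?case using elim lm main e unfolding real_norm_def dist_real_def by linarith
    qed
    then show "\<exists>n0. \<forall>n\<ge>n0. norm ((\<integral>\<omega>. f (scaled_path n \<omega>) \<partial>M) - (\<integral>\<omega>. f (limit_path (sqrt (s2 / 2)) B1 B2 \<omega>) \<partial>M')) < e"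
      by (simp add: eventually_sequentially)
  qed
qed

end

section \<open>Disintegration over a sub-sigma-algebra\<close>

text \<open>The finite intersections of a countable generator.\<close>

lemma countable_pi_system:
  assumes "countably_generated G"
  obtains \<A> where "countable \<A>" "Int_stable \<A>" "\<A> \<subseteq> sets G" "space G \<in> \<A>" "sets G = sigma_sets (space G) \<A>"
proof -
  obtain C where C: "countable C" "C \<subseteq> Pow (space G)" "sets G = sigma_sets (space G) C"
    using assms unfolding countably_generated_def by blast
  define \<A> where "\<A> = (\<lambda>F. space G \<inter> \<Inter>F) ` {F. finite F \<and> F \<subseteq> C}"
  have CG: "C \<subseteq> sets G" using C(3) by auto
  have 1: "space G \<inter> \<Inter>F \<in> sets G" if "finite F" "F \<subseteq> C" for F
    using that
  proof (induction F)
    case (insert A F)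
    have "space G \<inter> \<Inter>(insert A F) = A \<inter> (space G \<inter> \<Inter>F)" by auto
    then show ?case using insert CG by auto
  qed simp
  show ?thesis
  proof (rule that[of \<A>])
    show "countable \<A>" unfolding \<A>_def
      using countable_Collect_finite_subset[OF C(1)] by (intro countable_image) (simp add: conj_commute)
    show "Int_stable \<A>"
    proof (rule Int_stableI)
      fix A B assume "A \<in> \<A>" "B \<in> \<A>"
      then obtain F1 F2 where F: "finite F1" "F1 \<subseteq> C" "A = space G \<inter> \<Inter>F1" "finite F2" "F2 \<subseteq> C" "B = space G \<inter> \<Inter>F2"
        by (auto simp: \<A>_def)
      then have "A \<inter> B = space G \<inter> \<Inter>(F1 \<union> F2)" by auto
      then show "A \<inter> B \<in> \<A>" using F unfolding \<A>_def by (intro image_eqI[of _ _ "F1 \<union> F2"]) auto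
    qed
    show PG: "\<A> \<subseteq> sets G" using 1 by (auto simp: \<A>_def)
    show "space G \<in> \<A>" unfolding \<A>_def by (intro image_eqI[of _ _ "{}"]) auto
    have "C \<subseteq> \<A>"
    proof
      fix A assume "A \<in> C"
      then show "A \<in> \<A>" using C(2) unfolding \<A>_def by (intro image_eqI[of _ _ "{A}"]) auto
    qed
    then have "sets G \<subseteq> sigma_sets (space G) \<A>" unfolding C(3) by (rule sigma_sets_mono')
    moreover have "sigma_sets (space G) \<A> \<subseteq> sets G" using PG by (rule sets.sigma_sets_subset)
    ultimately show "sets G = sigma_sets (space G) \<A>" by auto
  qed
qed

locale disintegration = prob_space +
  fixes F0 :: "'a measure" and P :: "'a \<Rightarrow> 'a measure"
  assumes F0: "subalgebra M F0"
    and P_prob: "\<And>\<omega>. \<omega> \<in> space M \<Longrightarrow> prob_space (P \<omega>)"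
    and P_sets: "\<And>\<omega>. \<omega> \<in> space M \<Longrightarrow> sets (P \<omega>) = sets M"
    and P_integral: "\<And>X :: 'a \<Rightarrow> real. integrable M X \<Longrightarrow> AE \<omega> in M. (\<integral>x. X x \<partial>P \<omega>) = real_cond_exp M F0 X \<omega>"

sublocale disintegration \<subseteq> finite_measure_subalgebra M F0
  by (simp add: finite_measure_subalgebra_def finite_measure_subalgebra_axioms_def F0 finite_measure_axioms)

context disintegration
begin

lemma P_space: "\<omega> \<in> space M \<Longrightarrow> space (P \<omega>) = space M"
  using P_sets by (rule sets_eq_imp_space_eq)

lemma AE_fibre:
  assumes "AE x in M. Q x"
  shows "AE \<omega> in M. AE x in P \<omega>. Q x"
proof -
  obtain N where N: "N \<in> null_sets M" "{x \<in> space M. \<not> Q x} \<subseteq> N" using assms by (auto simp: eventually_ae_filter)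
  have NM [measurable]: "N \<in> sets M" using N(1) by auto
  have "integrable M (indicator N :: 'a \<Rightarrow> real)"
    by (rule integrable_const_bound[where B = 1]) (auto simp: indicator_def)
  note P = P_integral[OF this]
  have "AE x in M. indicator N x = (0 :: real)" using AE_not_in[OF N(1)] by eventually_elim simp
  then have "AE \<omega> in M. real_cond_exp M F0 (indicator N) \<omega> = real_cond_exp M F0 (\<lambda>_. 0) \<omega>"
    by (rule real_cond_exp_cong) auto
  moreover have "AE \<omega> in M. real_cond_exp M F0 (\<lambda>_. 0) \<omega> = (\<lambda>_. 0) \<omega>" by (rule real_cond_exp_F_meas) auto
  ultimately show ?thesis using P AE_space
  proof eventually_elim
    case (elim \<omega>)
    interpret W: prob_space "P \<omega>" using P_prob elim(4) .
    have NP: "N \<in> sets (P \<omega>)" using P_sets[OF elim(4)] by simp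
    have "W.prob N = (\<integral>x. indicator N x \<partial>P \<omega>)" using NP by simp
    then have "W.prob N = 0" using elim by simp
    then have "N \<in> null_sets (P \<omega>)" using NP by (auto simp: null_sets_def W.emeasure_eq_measure)
    then show ?case by (rule AE_I') (use N(2) P_space[OF elim(4)] in auto)
  qed
qed

text \<open>The identity for the integral over a fibre does not by itself show integrability, as the integral
  of a function that is not integrable is 0.  It is applied to the bounded functions
  \<open>min m \<bar>X\<bar>\<close>, whose fibre means are at most the conditional expectation of \<open>\<bar>X\<bar>\<close>, and Fatou's lemma
  finishes.\<close>

lemma integrable_fibre:
  fixes X :: "'a \<Rightarrow> real"
  assumes X: "integrable M X"
  shows "AE \<omega> in M. integrable (P \<omega>) X"
proof -
  have [measurable]: "X \<in> borel_measurable M" using X by auto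
  define Y where "Y m x = min (real m) \<bar>X x\<bar>" for m x
  have Yi: "integrable M (Y m)" for m
    unfolding Y_def[abs_def] by (rule integrable_const_bound[where B = "real m"]) auto
  have "AE \<omega> in M. \<forall>m. (\<integral>x. Y m x \<partial>P \<omega>) = real_cond_exp M F0 (Y m) \<omega>"
    by (intro AE_all_countable[THEN iffD2] allI P_integral Yi)
  moreover have "AE \<omega> in M. \<forall>m. real_cond_exp M F0 (Y m) \<omega> \<le> real_cond_exp M F0 (\<lambda>x. \<bar>X x\<bar>) \<omega>"
    by (intro AE_all_countable[THEN iffD2] allI real_cond_exp_mono Yi) (use X in \<open>auto simp: Y_def\<close>)
  ultimately show ?thesis using AE_space
  proof eventually_elim
    case (elim \<omega>)
    interpret W: prob_space "P \<omega>" using P_prob elim(3) .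
    let ?c = "real_cond_exp M F0 (\<lambda>x. \<bar>X x\<bar>) \<omega>"
    have XP [measurable]: "X \<in> borel_measurable (P \<omega>)" using P_sets[OF elim(3)] by (simp cong: measurable_cong_sets)
    have YP [measurable]: "Y m \<in> borel_measurable (P \<omega>)" for m unfolding Y_def[abs_def] by measurable
    have YiP: "integrable (P \<omega>) (Y m)" for m
      by (rule W.integrable_const_bound[where B = "real m"]) (auto simp: Y_def)
    have "(\<integral>\<^sup>+x. ennreal (norm (X x)) \<partial>P \<omega>) = (\<integral>\<^sup>+x. liminf (\<lambda>m. ennreal (Y m x)) \<partial>P \<omega>)"
    proof (rule nn_integral_cong)
      fix x
      obtain m0 :: nat where m0: "\<bar>X x\<bar> \<le> real m0" using real_arch_simple by blast
      have "eventually (\<lambda>m. ennreal (Y m x) = ennreal (norm (X x))) sequentially"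
        unfolding eventually_sequentially using m0 by (intro exI[of _ m0]) (auto simp: Y_def min_absorb2)
      then have "(\<lambda>m. ennreal (Y m x)) \<longlonglongrightarrow> ennreal (norm (X x))" by (rule tendsto_eventually)
      then show "ennreal (norm (X x)) = liminf (\<lambda>m. ennreal (Y m x))"
        by (intro lim_imp_Liminf[symmetric]) auto
    qed
    also have "\<dots> \<le> liminf (\<lambda>m. \<integral>\<^sup>+x. ennreal (Y m x) \<partial>P \<omega>)" by (rule nn_integral_liminf) simp
    also have "\<dots> \<le> ennreal ?c"
    proof (rule order_trans[OF Liminf_le_Limsup Limsup_bounded])
      show "eventually (\<lambda>m. (\<integral>\<^sup>+x. ennreal (Y m x) \<partial>P \<omega>) \<le> ennreal ?c) sequentially"
      proof (rule always_eventually, rule allI)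
        fix m
        have "(\<integral>\<^sup>+x. ennreal (Y m x) \<partial>P \<omega>) = ennreal (\<integral>x. Y m x \<partial>P \<omega>)"
          by (rule nn_integral_eq_integral[OF YiP]) (simp add: Y_def)
        also have "\<dots> \<le> ennreal ?c" using elim(1,2) by (intro ennreal_leI) simp
        finally show "(\<integral>\<^sup>+x. ennreal (Y m x) \<partial>P \<omega>) \<le> ennreal ?c" .
      qed
    qed simp
    also have "\<dots> < \<infinity>" by simp
    finally show ?case by (intro integrableI_bounded) auto
  qed
qed

text \<open>For a set \<open>A\<close> of \<open>G\<close>, the functions \<open>indicator A * f\<close> and \<open>indicator A * g\<close> have the same integral
  over all sets of \<open>F0\<close>, as these belong to \<open>G\<close>.  Hence they have the same conditional expectation given
  \<open>F0\<close>, that is, the same integral over almost every fibre.  The exceptional null set depends on \<open>A\<close>;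
  taking \<open>A\<close> from a countable generating pi-system gives one null set, and a Dynkin argument inside
  each fibre extends the equality to all of \<open>G\<close>.\<close>

lemma cond_version_fibre:
  assumes G: "subalgebra M G" "sets F0 \<subseteq> sets G" "countably_generated G" and cv: "cond_version M G f g"
  shows "AE \<omega> in M. cond_version (P \<omega>) G f g"
proof -
  obtain \<A> where \<A>: "countable \<A>" "Int_stable \<A>" "\<A> \<subseteq> sets G" "space G \<in> \<A>" "sets G = sigma_sets (space G) \<A>"
    using countable_pi_system[OF G(3)] .
  have spG: "space G = space M" and GM: "sets G \<subseteq> sets M" using G(1) by (auto simp: subalgebra_def)
  have f: "integrable M f" and g: "integrable M g" "g \<in> borel_measurable G" using cv by (auto simp: cond_version_def)
  have ind: "integrable M (\<lambda>x. indicator A x * h x)" if "A \<in> sets G" "integrable M h" for A and h :: "'a \<Rightarrow> real"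
    using that GM by (intro integrable_bounded_mult[where B = 1]) (auto simp: indicator_def)
  have "AE \<omega> in M. (\<integral>x. indicator A x * f x \<partial>P \<omega>) = (\<integral>x. indicator A x * g x \<partial>P \<omega>)" if A: "A \<in> \<A>" for A
  proof -
    have AG: "A \<in> sets G" using A \<A>(3) by auto
    have "AE \<omega> in M. real_cond_exp M F0 (\<lambda>x. indicator A x * f x) \<omega> = real_cond_exp M F0 (\<lambda>x. indicator A x * g x) \<omega>"
    proof (rule real_cond_exp_charact)
      fix B assume B: "B \<in> sets F0"
      have "B \<inter> A \<in> sets G" using B AG G(2) by auto
      then have "(\<integral>x. indicator (B \<inter> A) x * f x \<partial>M) = (\<integral>x. indicator (B \<inter> A) x * g x \<partial>M)"
        using cv unfolding cond_version_def by blast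
      then have "(\<integral>x\<in>B. indicator A x * f x \<partial>M) = (\<integral>x\<in>B. indicator A x * g x \<partial>M)"
        by (simp add: set_lebesgue_integral_def indicator_inter_arith mult.assoc)
      then show "(\<integral>x\<in>B. indicator A x * f x \<partial>M) = (\<integral>x\<in>B. real_cond_exp M F0 (\<lambda>x. indicator A x * g x) x \<partial>M)"
        using real_cond_exp_intA[OF ind[OF AG g(1)] B] by simp
    qed (use ind[OF AG f] ind[OF AG g(1)] in auto)
    with P_integral[OF ind[OF AG f]] P_integral[OF ind[OF AG g(1)]] show ?thesis by eventually_elim simp
  qed
  then have "AE \<omega> in M. \<forall>A\<in>\<A>. (\<integral>x. indicator A x * f x \<partial>P \<omega>) = (\<integral>x. indicator A x * g x \<partial>P \<omega>)"
    using \<A>(1) by (subst AE_ball_countable) auto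
  with integrable_fibre[OF f] integrable_fibre[OF g(1)] AE_space show ?thesis
  proof eventually_elim
    case (elim \<omega>)
    have GP: "sets G \<subseteq> sets (P \<omega>)" using GM P_sets[OF elim(3)] by simp
    have iP: "integrable (P \<omega>) (\<lambda>x. indicator A x * h x)" if "A \<in> sets G" "integrable (P \<omega>) h" for A and h :: "'a \<Rightarrow> real"
      using that GP by (intro integrable_bounded_mult[where B = 1]) (auto simp: indicator_def)
    have "(\<integral>x. indicator A x * f x \<partial>P \<omega>) = (\<integral>x. indicator A x * g x \<partial>P \<omega>)" if "A \<in> sets G" for A
    proof -
      have Pow: "\<A> \<subseteq> Pow (space G)" using \<A>(3) sets.sets_into_space by blast
      have "A \<in> sigma_sets (space G) \<A>" using that \<A>(5) by simp
      then show ?thesis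
      proof (induction rule: sigma_sets_induct_disjoint[OF \<A>(2) Pow, consumes 1, case_names basic empty compl union])
        case (basic A)
        then show ?case using elim(4) by blast
      next
        case empty
        then show ?case by simp
      next
        case (compl A)
        have AG: "A \<in> sets G" using compl \<A>(5) by simp
        have "(\<integral>x. indicator (space G) x * h x \<partial>P \<omega>) - (\<integral>x. indicator A x * h x \<partial>P \<omega>) = (\<integral>x. indicator (space G - A) x * h x \<partial>P \<omega>)"
          if "integrable (P \<omega>) h" for h :: "'a \<Rightarrow> real"
        proof -
          have "(\<integral>x. indicator (space G) x * h x \<partial>P \<omega>) - (\<integral>x. indicator A x * h x \<partial>P \<omega>) =
              (\<integral>x. indicator (space G) x * h x - indicator A x * h x \<partial>P \<omega>)"
            by (rule Bochner_Integration.integral_diff[symmetric]) (auto intro!: iP AG that)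
          also have "\<dots> = (\<integral>x. indicator (space G - A) x * h x \<partial>P \<omega>)"
            using sets.sets_into_space[OF AG] by (intro Bochner_Integration.integral_cong refl) (auto simp: indicator_def)
          finally show ?thesis .
        qed
        from this[OF elim(1)] this[OF elim(2)] show ?case using compl elim(4) \<A>(4) by simp
      next
        case (union A)
        have AG: "A i \<in> sets G" for i using union \<A>(5) by auto
        have "(\<lambda>i. \<integral>x. indicator (A i) x * h x \<partial>P \<omega>) sums (\<integral>x. indicator (\<Union>i. A i) x * h x \<partial>P \<omega>)"
          if h: "integrable (P \<omega>) h" for h :: "'a \<Rightarrow> real"
        proof -
          have "(\<lambda>n. \<integral>x. (\<Sum>i<n. indicator (A i) x * h x) \<partial>P \<omega>) \<longlonglongrightarrow> (\<integral>x. indicator (\<Union>i. A i) x * h x \<partial>P \<omega>)"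
          proof (rule integral_dominated_convergence[where w = "\<lambda>x. \<bar>h x\<bar>"])
            have eq: "(\<Sum>i<n. indicator (A i) x * h x) = indicator (\<Union>i<n. A i) x * h x" for n x
            proof -
              have "indicator (\<Union>i<n. A i) x = (\<Sum>i<n. indicator (A i) x :: real)"
                using union by (intro indicator_UN_disjoint) (auto simp: disjoint_family_on_def)
              then show ?thesis by (simp only: sum_distrib_right)
            qed
            show "AE x in P \<omega>. (\<lambda>n. \<Sum>i<n. indicator (A i) x * h x) \<longlonglongrightarrow> indicator (\<Union>i. A i) x * h x"
            proof (rule AE_I2)
              fix x
              have "(\<lambda>n. indicator (\<Union>i<n. A i) x :: real) \<longlonglongrightarrow> indicator (\<Union>i. A i) x" by (rule LIMSEQ_indicator_UN)
              then show "(\<lambda>n. \<Sum>i<n. indicator (A i) x * h x) \<longlonglongrightarrow> indicator (\<Union>i. A i) x * h x"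
                unfolding eq by (intro tendsto_mult tendsto_const)
            qed
            show "AE x in P \<omega>. norm (\<Sum>i<n. indicator (A i) x * h x) \<le> \<bar>h x\<bar>" for n
              unfolding eq by (auto simp: indicator_def)
            have "(\<Union>i. A i) \<in> sets G" using AG by auto
            then show "(\<lambda>x. indicator (\<Union>i. A i) x * h x) \<in> borel_measurable (P \<omega>)" using iP[OF _ h] by blast
            show "(\<lambda>x. \<Sum>i<n. indicator (A i) x * h x) \<in> borel_measurable (P \<omega>)" for n
              using iP[OF AG h] by (intro borel_measurable_sum) auto
          qed (use h in auto)
          moreover have "(\<integral>x. (\<Sum>i<n. indicator (A i) x * h x) \<partial>P \<omega>) = (\<Sum>i<n. \<integral>x. indicator (A i) x * h x \<partial>P \<omega>)" for n
            by (rule Bochner_Integration.integral_sum) (rule iP[OF AG h])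
          ultimately show ?thesis unfolding sums_def by (simp only:)
        qed
        from this[OF elim(1)] this[OF elim(2)] show ?case using union by (simp add: sums_unique2)
      qed
    qed
    then show ?case using elim(1,2) g(2) by (simp add: cond_version_def)
  qed
qed

end

section \<open>Filtrations generated by a transformation\<close>

lemma (in prob_space) cond_version_real_cond_exp:
  assumes sub: "subalgebra M G" and f: "integrable M f"
  shows "cond_version M G f (real_cond_exp M G f)"
proof -
  interpret finite_measure_subalgebra M G
    by (simp add: finite_measure_subalgebra_def finite_measure_subalgebra_axioms_def sub finite_measure_axioms)
  show ?thesis
    using real_cond_exp_intA[OF f] f by (auto simp: cond_version_def set_lebesgue_integral_def)
qed

lemma (in prob_space) cond_version_complex_mult:
  fixes Y Z :: "'a \<Rightarrow> complex"
  assumes sub: "subalgebra M G" and re: "cond_version M G (\<lambda>\<omega>. Re (Y \<omega>)) (\<lambda>\<omega>. Re (Z \<omega>))"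
    and im: "cond_version M G (\<lambda>\<omega>. Im (Y \<omega>)) (\<lambda>\<omega>. Im (Z \<omega>))"
  shows "cond_version M G (\<lambda>\<omega>. Re (w * Y \<omega>)) (\<lambda>\<omega>. Re (w * Z \<omega>))"
    "cond_version M G (\<lambda>\<omega>. Im (w * Y \<omega>)) (\<lambda>\<omega>. Im (w * Z \<omega>))"
proof -
  have "cond_version M G (\<lambda>\<omega>. Re w * Re (Y \<omega>) + (- Im w) * Im (Y \<omega>)) (\<lambda>\<omega>. Re w * Re (Z \<omega>) + (- Im w) * Im (Z \<omega>))"
    by (intro cond_version_add[OF sub] cond_version_cmult re im)
  then show "cond_version M G (\<lambda>\<omega>. Re (w * Y \<omega>)) (\<lambda>\<omega>. Re (w * Z \<omega>))" by simp
  have "cond_version M G (\<lambda>\<omega>. Re w * Im (Y \<omega>) + Im w * Re (Y \<omega>)) (\<lambda>\<omega>. Re w * Im (Z \<omega>) + Im w * Re (Z \<omega>))"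
    by (intro cond_version_add[OF sub] cond_version_cmult re im)
  then show "cond_version M G (\<lambda>\<omega>. Im (w * Y \<omega>)) (\<lambda>\<omega>. Im (w * Z \<omega>))" by simp
qed

lemma average_drop_first:
  fixes f :: "nat \<Rightarrow> 'b::real_normed_field"
  assumes "(\<lambda>n. (\<Sum>k<n. f k) / of_nat n) \<longlonglongrightarrow> F"
  shows "(\<lambda>n. (\<Sum>k<n. if k = 0 then 0 else f k) / of_nat n) \<longlonglongrightarrow> F"
proof -
  have "(\<lambda>n. (\<Sum>k<n. f k) / of_nat n - f 0 / of_nat n) \<longlonglongrightarrow> F - 0"
    by (intro tendsto_diff assms lim_const_over_n)
  then have 1: "(\<lambda>n. (\<Sum>k<n. f k) / of_nat n - f 0 / of_nat n) \<longlonglongrightarrow> F" by simp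
  have 2: "eventually (\<lambda>n. (\<Sum>k<n. f k) / of_nat n - f 0 / of_nat n = (\<Sum>k<n. if k = 0 then 0 else f k) / of_nat n) sequentially"
    using eventually_gt_at_top[of 0]
  proof eventually_elim
    case (elim n)
    have "(\<Sum>k<n. f k) = (\<Sum>k<n. (if k = 0 then f 0 else 0) + (if k = 0 then 0 else f k))"
      by (intro sum.cong) auto
    also have "\<dots> = f 0 + (\<Sum>k<n. if k = 0 then 0 else f k)" using elim by (simp add: sum.distrib)
    finally show ?case by (simp add: diff_divide_distrib[symmetric])
  qed
  show ?thesis by (rule Lim_transform_eventually[OF 1 2])
qed

locale T_filtered_system = mpt +
  fixes F :: "int \<Rightarrow> 'a measure"
  assumes invertible: "invertible_mpt M T" and filtration: "T_filtration M T F"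
begin

lemmas filtration_parts = filtration[unfolded T_filtration_def]

lemma space_F [simp]: "space (F k) = space M"
  and sets_F: "sets (F k) = {int_iterate M T k -` A \<inter> space M | A. A \<in> sets (F 0)}"
  by (rule filtration_parts[THEN conjunct2, THEN conjunct2, THEN spec, THEN conjunct1],
      rule filtration_parts[THEN conjunct2, THEN conjunct2, THEN spec, THEN conjunct2])

lemma F0_sub: "sets (F 0) \<subseteq> sets M"
  using filtration_parts[THEN conjunct1] by (simp only: subalgebra_def)

lemma T_iterate_space: "\<omega> \<in> space M \<Longrightarrow> (T ^^ n) \<omega> \<in> space M"
  using measurable_space[OF T_iterate_measurable] .

lemma sets_F_nat: "sets (F (int n)) = {(T ^^ n) -` A \<inter> space M | A. A \<in> sets (F 0)}"
  by (subst sets_F) (simp add: int_iterate_def)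

lemma sets_F_minus_1: "sets (F (- 1)) = {inv_into (space M) T -` A \<inter> space M | A. A \<in> sets (F 0)}"
  by (subst sets_F) (simp add: int_iterate_def)

lemma inv_T: "\<omega> \<in> space M \<Longrightarrow> inv_into (space M) T (T \<omega>) = \<omega>"
  using invertible by (auto simp: invertible_mpt_def bij_betw_def intro: inv_into_f_f)

text \<open>\<open>F n\<close> is the preimage of \<open>F (- 1)\<close> under the iterate \<open>n + 1\<close>: the form in which a statement about
  \<open>D\<close> and \<open>F (- 1)\<close> is carried along the orbit.\<close>

lemma sets_F_nat_shift: "sets (F (int n)) = {(T ^^ Suc n) -` B \<inter> space M | B. B \<in> sets (F (- 1))}"
proof -
  have "(T ^^ Suc n) -` (inv_into (space M) T -` A \<inter> space M) \<inter> space M = (T ^^ n) -` A \<inter> space M" for A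
    using T_iterate_space[of _ n] T_iterate_space[of _ "Suc n"] by (auto simp: inv_T)
  note eq = this
  have "{(T ^^ Suc n) -` B \<inter> space M | B. B \<in> sets (F (- 1))} =
      {(T ^^ Suc n) -` (inv_into (space M) T -` A \<inter> space M) \<inter> space M | A. A \<in> sets (F 0)}"
    unfolding sets_F_minus_1 by blast
  also have "\<dots> = {(T ^^ n) -` A \<inter> space M | A. A \<in> sets (F 0)}" by (simp only: eq)
  finally show ?thesis by (simp only: sets_F_nat)
qed

lemma subalgebra_F_nat: "subalgebra M (F (int n))"
  using F0_sub measurable_sets[OF T_iterate_measurable] by (auto simp: subalgebra_def sets_F_nat)

lemma subalgebra_F_minus_1: "subalgebra M (F (- 1))"
proof -
  have "inv_into (space M) T \<in> measurable M M" using invertible by (simp add: invertible_mpt_def)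
  then show ?thesis using F0_sub measurable_sets by (auto simp: subalgebra_def sets_F_minus_1)
qed

lemma F_nat_mono: "sets (F (int n)) \<subseteq> sets (F (int (Suc n)))"
proof
  fix C assume "C \<in> sets (F (int n))"
  then obtain A where A: "A \<in> sets (F 0)" "C = (T ^^ n) -` A \<inter> space M" by (auto simp: sets_F_nat)
  then obtain B where B: "B \<in> sets (F 0)" "A = T -` B \<inter> space M"
    using filtration_parts[THEN conjunct2, THEN conjunct1] by blast
  have "C = (T ^^ Suc n) -` B \<inter> space M" using A B T_iterate_space[of _ n] by auto
  then show "C \<in> sets (F (int (Suc n)))" using B unfolding sets_F_nat by blast
qed

lemma F_0_le_F_nat: "sets (F 0) \<subseteq> sets (F (int n))"
  using lift_Suc_mono_le[of "\<lambda>n. sets (F (int n))" 0 n] F_nat_mono by simp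

lemma iterate_measurable_F: "T ^^ n \<in> measurable (F (int n)) (F 0)"
  by (rule measurableI) (auto simp: T_iterate_space sets_F_nat)

lemma iterate_measurable_F_minus_1: "T ^^ Suc n \<in> measurable (F (int n)) (F (- 1))"
  by (rule measurableI) (use T_iterate_space[of _ "Suc n"] in \<open>auto simp: sets_F_nat_shift\<close>)

lemma countably_generated_F_nat:
  assumes "countably_generated (F 0)"
  shows "countably_generated (F (int n))"
proof -
  obtain C where C: "countable C" "C \<subseteq> Pow (space M)" "sets (F 0) = sigma_sets (space M) C"
    using assms by (auto simp: countably_generated_def)
  have "sets (F (int n)) = sigma_sets (space M) {(T ^^ n) -` A \<inter> space M | A. A \<in> C}"
    unfolding sets_F_nat C(3) by (rule sigma_sets_vimage_commute) (use T_iterate_space in auto)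
  moreover have "countable {(T ^^ n) -` A \<inter> space M | A. A \<in> C}"
    using C(1) by (simp add: Setcompr_eq_image)
  ultimately show ?thesis unfolding countably_generated_def
    by (intro exI[of _ "{(T ^^ n) -` A \<inter> space M | A. A \<in> C}"]) auto
qed

text \<open>Substitution of \<open>T^(n + 1)\<close>, which preserves the measure and pulls \<open>F (- 1)\<close> back to \<open>F n\<close>.\<close>

lemma cond_version_iterate:
  assumes cv: "cond_version M (F (- 1)) f g"
  shows "cond_version M (F (int n)) (\<lambda>\<omega>. f ((T ^^ Suc n) \<omega>)) (\<lambda>\<omega>. g ((T ^^ Suc n) \<omega>))"
proof -
  interpret S: mpt M "T ^^ Suc n" by (rule mpt_iterate)
  have f: "integrable M f" and g: "integrable M g" "g \<in> borel_measurable (F (- 1))" using cv by (auto simp: cond_version_def)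
  have "(\<integral>\<omega>. indicator A \<omega> * f ((T ^^ Suc n) \<omega>) \<partial>M) = (\<integral>\<omega>. indicator A \<omega> * g ((T ^^ Suc n) \<omega>) \<partial>M)"
    if A: "A \<in> sets (F (int n))" for A
  proof -
    obtain B where B: "B \<in> sets (F (- 1))" "A = (T ^^ Suc n) -` B \<inter> space M" using A unfolding sets_F_nat_shift by blast
    have BM: "B \<in> sets M" using B(1) subalgebra_F_minus_1 by (auto simp: subalgebra_def)
    have "(\<integral>\<omega>. indicator A \<omega> * h ((T ^^ Suc n) \<omega>) \<partial>M) = (\<integral>\<omega>. indicator B \<omega> * h \<omega> \<partial>M)"
      if [measurable]: "h \<in> borel_measurable M" for h :: "'a \<Rightarrow> real"
    proof -
      have "(\<integral>\<omega>. indicator A \<omega> * h ((T ^^ Suc n) \<omega>) \<partial>M) = (\<integral>\<omega>. indicator B ((T ^^ Suc n) \<omega>) * h ((T ^^ Suc n) \<omega>) \<partial>M)"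
        by (rule Bochner_Integration.integral_cong) (auto simp: B(2) indicator_def)
      also have "\<dots> = (\<integral>\<omega>. indicator B \<omega> * h \<omega> \<partial>M)"
        using S.integral_T[of "\<lambda>\<omega>. indicator B \<omega> * h \<omega>"] BM by simp
      finally show ?thesis .
    qed
    from this[of f] this[of g] show ?thesis using cv B(1) f g(1) unfolding cond_version_def by auto
  qed
  moreover have "(\<lambda>\<omega>. g ((T ^^ Suc n) \<omega>)) \<in> borel_measurable (F (int n))"
    by (rule measurable_compose[OF iterate_measurable_F_minus_1 g(2)])
  ultimately show ?thesis using S.integrable_T[OF f] S.integrable_T[OF g(1)] unfolding cond_version_def by auto
qed

text \<open>Orthogonality is tested against indicators of sets in \<open>F (- 1)\<close>.\<close>

lemma L2_ominus_cond_mean: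
  assumes D: "D \<in> L2_ominus M (F 0) (F (- 1))"
  shows "integrable M D" "cond_version M (F (- 1)) (\<lambda>\<omega>. Re (D \<omega>)) (\<lambda>_. 0)" "cond_version M (F (- 1)) (\<lambda>\<omega>. Im (D \<omega>)) (\<lambda>_. 0)"
proof -
  have sq: "integrable M (\<lambda>\<omega>. (norm (D \<omega>))\<^sup>2)" and D0: "D \<in> borel_measurable (F 0)"
    and orth: "\<And>Y. Y \<in> L2 M (F (- 1)) \<Longrightarrow> (\<integral>\<omega>. D \<omega> * cnj (Y \<omega>) \<partial>M) = 0"
    using D by (auto simp: L2_ominus_def L2_def)
  have "subalgebra M (F 0)" using subalgebra_F_nat[of 0] by simp
  then have [measurable]: "D \<in> borel_measurable M" using D0 by (rule measurable_from_subalg)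
  have "integrable M (\<lambda>\<omega>. norm (D \<omega>))" by (rule square_integrable_imp_integrable) (use sq in auto)
  then show i: "integrable M D" by (simp add: integrable_norm_iff)
  have z: "(\<integral>\<omega>. D \<omega> * of_real (indicator A \<omega>) \<partial>M) = 0" and zi: "integrable M (\<lambda>\<omega>. D \<omega> * of_real (indicator A \<omega>))"
    if A: "A \<in> sets (F (- 1))" for A
  proof -
    have AM: "A \<in> sets M" using A subalgebra_F_minus_1 by (auto simp: subalgebra_def)
    have "(\<lambda>\<omega>. complex_of_real (indicator A \<omega>)) \<in> L2 M (F (- 1))"
      unfolding L2_def using A AM by (auto intro!: integrable_const_bound[where B = 1] simp: indicator_def)
    then show "(\<integral>\<omega>. D \<omega> * of_real (indicator A \<omega>) \<partial>M) = 0" using orth by fastforce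
    show "integrable M (\<lambda>\<omega>. D \<omega> * of_real (indicator A \<omega>))"
      by (rule Bochner_Integration.integrable_bound[OF i]) (use AM in \<open>auto simp: indicator_def\<close>)
  qed
  have "(\<integral>\<omega>. indicator A \<omega> * Re (D \<omega>) \<partial>M) = 0" "(\<integral>\<omega>. indicator A \<omega> * Im (D \<omega>) \<partial>M) = 0" if A: "A \<in> sets (F (- 1))" for A
    using integral_Re[OF zi[OF A]] integral_Im[OF zi[OF A]] z[OF A] by (simp_all add: mult.commute)
  then show "cond_version M (F (- 1)) (\<lambda>\<omega>. Re (D \<omega>)) (\<lambda>_. 0)" "cond_version M (F (- 1)) (\<lambda>\<omega>. Im (D \<omega>)) (\<lambda>_. 0)"
    using i by (auto simp: cond_version_def)
qed

end

locale quenched_setup = T_filtered_system M T F + disintegration M "F 0" P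
  for M :: "'a measure" and T F P +
  fixes D :: "'a \<Rightarrow> complex" and \<theta> :: real
  assumes erg: "ergodic M T" and cg: "countably_generated (F 0)"
    and D: "D \<in> L2_ominus M (F 0) (F (- 1))"
    and spec: "cis (- 2 * \<theta>) \<notin> point_spectrum M T"
begin

lemma D_F0: "D \<in> borel_measurable (F 0)" and D_sq: "integrable M (\<lambda>\<omega>. (norm (D \<omega>))\<^sup>2)"
  using D by (auto simp: L2_ominus_def L2_def)

lemma D_measurable [measurable]: "D \<in> borel_measurable M"
  using L2_ominus_cond_mean(1)[OF D] by auto

text \<open>Every \<open>past k\<close> contains \<open>F 0\<close>, as the passage to the fibres requires.  At \<open>k = 0\<close>, where \<open>F (- 1)\<close>
  would be too small, natural subtraction gives \<open>F 0\<close> again; correspondingly the difference with index 0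
  is replaced by 0 below.\<close>

definition past :: "nat \<Rightarrow> 'a measure" where
  "past k = F (int (k - 1))"

definition diff :: "nat \<Rightarrow> 'a \<Rightarrow> complex" where
  "diff k \<omega> = (if k = 0 then 0 else cis (real k * \<theta>) * D ((T ^^ k) \<omega>))"

text \<open>Conditional moments of \<open>D\<close> given \<open>F (- 1)\<close>; the functions \<open>var\<close>, \<open>sq\<close> and \<open>tails\<close> below follow them along the
  orbit.\<close>

definition var0 :: "'a \<Rightarrow> real" where
  "var0 = (\<lambda>\<omega>. max 0 (real_cond_exp M (F (- 1)) (\<lambda>\<omega>. (norm (D \<omega>))\<^sup>2) \<omega>))"

definition sq0 :: "'a \<Rightarrow> complex" where
  "sq0 \<omega> = Complex (real_cond_exp M (F (- 1)) (\<lambda>\<omega>. Re ((D \<omega>)\<^sup>2)) \<omega>) (real_cond_exp M (F (- 1)) (\<lambda>\<omega>. Im ((D \<omega>)\<^sup>2)) \<omega>)"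

definition large :: "nat \<Rightarrow> 'a \<Rightarrow> real" where
  "large c \<omega> = indicator {z. real c < norm z} (D \<omega>) * (norm (D \<omega>))\<^sup>2"

definition tail0 :: "nat \<Rightarrow> 'a \<Rightarrow> real" where
  "tail0 c = (\<lambda>\<omega>. max 0 (real_cond_exp M (F (- 1)) (large c) \<omega>))"

definition var :: "nat \<Rightarrow> 'a \<Rightarrow> real" where
  "var k \<omega> = (if k = 0 then 0 else var0 ((T ^^ k) \<omega>))"

definition sq :: "nat \<Rightarrow> 'a \<Rightarrow> complex" where
  "sq k \<omega> = (if k = 0 then 0 else cis (2 * \<theta>) ^ k * sq0 ((T ^^ k) \<omega>))"

definition tails :: "nat \<Rightarrow> nat \<Rightarrow> 'a \<Rightarrow> real" where
  "tails c k \<omega> = (if k = 0 then 0 else tail0 c ((T ^^ k) \<omega>))"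

lemma past_sub: "subalgebra M (past k)"
  unfolding past_def by (rule subalgebra_F_nat)

lemma past_mono: "sets (past k) \<subseteq> sets (past (Suc k))"
  by (cases k) (auto simp: past_def dest: F_nat_mono[THEN subsetD])

lemma zero_version: "cond_version M G (\<lambda>_. 0) (\<lambda>_. 0)"
  by (simp add: cond_version_def)

lemma past_version:
  assumes "cond_version M (F (- 1)) f g"
  shows "k \<noteq> 0 \<Longrightarrow> cond_version M (past k) (\<lambda>\<omega>. f ((T ^^ k) \<omega>)) (\<lambda>\<omega>. g ((T ^^ k) \<omega>))"
  using cond_version_iterate[OF assms, of "k - 1"] by (simp add: past_def)

lemma diff_adapted: "diff k \<in> borel_measurable (past (Suc k))"
proof -
  have "(\<lambda>\<omega>. D ((T ^^ k) \<omega>)) \<in> borel_measurable (F (int k))"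
    by (rule measurable_compose[OF iterate_measurable_F D_F0])
  then show ?thesis unfolding diff_def[abs_def] past_def by simp
qed

lemma Re_sq_integrable: "integrable M (\<lambda>\<omega>. Re ((D \<omega>)\<^sup>2))" and Im_sq_integrable: "integrable M (\<lambda>\<omega>. Im ((D \<omega>)\<^sup>2))"
proof -
  show "integrable M (\<lambda>\<omega>. Re ((D \<omega>)\<^sup>2))"
    by (rule Bochner_Integration.integrable_bound[OF D_sq]) (auto simp: norm_power[symmetric] intro!: abs_Re_le_cmod)
  show "integrable M (\<lambda>\<omega>. Im ((D \<omega>)\<^sup>2))"
    by (rule Bochner_Integration.integrable_bound[OF D_sq]) (auto simp: norm_power[symmetric] intro!: abs_Im_le_cmod)
qed

lemma large_measurable [measurable]: "large c \<in> borel_measurable M"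
proof -
  have "large c = (\<lambda>\<omega>. if real c < norm (D \<omega>) then (norm (D \<omega>))\<^sup>2 else 0)" by (auto simp: large_def)
  then show ?thesis by simp
qed

lemma large_integrable: "integrable M (large c)"
  by (rule Bochner_Integration.integrable_bound[OF D_sq]) (auto simp: large_def indicator_def)

lemma large_nonneg: "0 \<le> large c \<omega>"
  by (simp add: large_def)

lemma var0_version: "cond_version M (F (- 1)) (\<lambda>\<omega>. (norm (D \<omega>))\<^sup>2) var0"
  unfolding var0_def
  by (rule cond_version_max0(1)[OF subalgebra_F_minus_1 cond_version_real_cond_exp[OF subalgebra_F_minus_1 D_sq]]) simp

lemma tail0_version: "cond_version M (F (- 1)) (large c) (tail0 c)"
  unfolding tail0_def
  by (rule cond_version_max0(1)[OF subalgebra_F_minus_1 cond_version_real_cond_exp[OF subalgebra_F_minus_1 large_integrable] large_nonneg])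

lemma sq0_version:
  "cond_version M (F (- 1)) (\<lambda>\<omega>. Re ((D \<omega>)\<^sup>2)) (\<lambda>\<omega>. Re (sq0 \<omega>))"
  "cond_version M (F (- 1)) (\<lambda>\<omega>. Im ((D \<omega>)\<^sup>2)) (\<lambda>\<omega>. Im (sq0 \<omega>))"
  unfolding sq0_def complex.sel
  by (rule cond_version_real_cond_exp[OF subalgebra_F_minus_1 Re_sq_integrable],
      rule cond_version_real_cond_exp[OF subalgebra_F_minus_1 Im_sq_integrable])

lemma sq0_integrable: "integrable M sq0"
proof -
  have "integrable M (\<lambda>\<omega>. of_real (Re (sq0 \<omega>)) + \<i> * of_real (Im (sq0 \<omega>)))"
    using cond_version_integrable(2)[OF sq0_version(1)] cond_version_integrable(2)[OF sq0_version(2)] by simp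
  then show ?thesis by (simp flip: complex_eq)
qed

lemma diff_versions:
  "cond_version M (past k) (\<lambda>\<omega>. Re (diff k \<omega>)) (\<lambda>_. 0)"
  "cond_version M (past k) (\<lambda>\<omega>. Im (diff k \<omega>)) (\<lambda>_. 0)"
  "cond_version M (past k) (\<lambda>\<omega>. (norm (diff k \<omega>))\<^sup>2) (var k)"
  "cond_version M (past k) (\<lambda>\<omega>. Re ((diff k \<omega>)\<^sup>2)) (\<lambda>\<omega>. Re (sq k \<omega>))"
  "cond_version M (past k) (\<lambda>\<omega>. Im ((diff k \<omega>)\<^sup>2)) (\<lambda>\<omega>. Im (sq k \<omega>))"
  "cond_version M (past k) (\<lambda>\<omega>. indicator {z. real c < norm z} (diff k \<omega>) * (norm (diff k \<omega>))\<^sup>2) (tails c k)"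
proof -
  have Dk: "k \<noteq> 0 \<Longrightarrow> cond_version M (past k) (\<lambda>\<omega>. Re (D ((T ^^ k) \<omega>))) (\<lambda>\<omega>. Re 0)"
    "k \<noteq> 0 \<Longrightarrow> cond_version M (past k) (\<lambda>\<omega>. Im (D ((T ^^ k) \<omega>))) (\<lambda>\<omega>. Im 0)"
    using past_version[OF L2_ominus_cond_mean(2)[OF D]] past_version[OF L2_ominus_cond_mean(3)[OF D]] by simp_all
  show "cond_version M (past k) (\<lambda>\<omega>. Re (diff k \<omega>)) (\<lambda>_. 0)" "cond_version M (past k) (\<lambda>\<omega>. Im (diff k \<omega>)) (\<lambda>_. 0)"
    using cond_version_complex_mult[OF past_sub Dk, where w = "cis (real k * \<theta>)"]
    unfolding diff_def by (cases "k = 0"; simp add: zero_version)+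
  have n: "norm (diff k \<omega>) = norm (D ((T ^^ k) \<omega>))" if "k \<noteq> 0" for \<omega> using that by (simp add: diff_def norm_mult)
  show "cond_version M (past k) (\<lambda>\<omega>. (norm (diff k \<omega>))\<^sup>2) (var k)"
    using past_version[OF var0_version] n unfolding var_def[abs_def] by (cases "k = 0") (simp_all add: zero_version diff_def)
  show "cond_version M (past k) (\<lambda>\<omega>. indicator {z. real c < norm z} (diff k \<omega>) * (norm (diff k \<omega>))\<^sup>2) (tails c k)"
    using past_version[OF tail0_version[of c]] n unfolding tails_def[abs_def] large_def
    by (cases "k = 0") (simp_all add: zero_version diff_def indicator_def norm_mult)
  have s: "(diff k \<omega>)\<^sup>2 = cis (2 * \<theta>) ^ k * (D ((T ^^ k) \<omega>))\<^sup>2" if "k \<noteq> 0" for \<omega>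
  proof -
    have "(cis (real k * \<theta>))\<^sup>2 = cis (2 * \<theta>) ^ k" unfolding Complex.DeMoivre by (simp add: mult.left_commute)
    then show ?thesis using that by (simp add: diff_def power_mult_distrib)
  qed
  have "k \<noteq> 0 \<Longrightarrow> cond_version M (past k) (\<lambda>\<omega>. Re (cis (2 * \<theta>) ^ k * (D ((T ^^ k) \<omega>))\<^sup>2)) (\<lambda>\<omega>. Re (cis (2 * \<theta>) ^ k * sq0 ((T ^^ k) \<omega>)))"
    "k \<noteq> 0 \<Longrightarrow> cond_version M (past k) (\<lambda>\<omega>. Im (cis (2 * \<theta>) ^ k * (D ((T ^^ k) \<omega>))\<^sup>2)) (\<lambda>\<omega>. Im (cis (2 * \<theta>) ^ k * sq0 ((T ^^ k) \<omega>)))"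
    by (rule cond_version_complex_mult[OF past_sub past_version[OF sq0_version(1)] past_version[OF sq0_version(2)]]; simp)+
  then show "cond_version M (past k) (\<lambda>\<omega>. Re ((diff k \<omega>)\<^sup>2)) (\<lambda>\<omega>. Re (sq k \<omega>))"
    "cond_version M (past k) (\<lambda>\<omega>. Im ((diff k \<omega>)\<^sup>2)) (\<lambda>\<omega>. Im (sq k \<omega>))"
    by (cases "k = 0"; simp add: zero_version diff_def[of 0] sq_def s)+
qed

lemma average_var: "AE \<omega> in M. (\<lambda>n. (\<Sum>k<n. var k \<omega>) / of_nat n) \<longlonglongrightarrow> (\<integral>\<omega>. (norm (D \<omega>))\<^sup>2 \<partial>M)"
proof -
  have "(\<integral>\<omega>. var0 \<omega> \<partial>M) = (\<integral>\<omega>. (norm (D \<omega>))\<^sup>2 \<partial>M)"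
    using cond_version_test[OF subalgebra_F_minus_1 var0_version, where H = "\<lambda>_. 1" and B = 1] by simp
  then have "AE \<omega> in M. (\<lambda>n. orbit_sum var0 n \<omega> / real n) \<longlonglongrightarrow> (\<integral>\<omega>. (norm (D \<omega>))\<^sup>2 \<partial>M)"
    using birkhoff_ergodic[OF erg cond_version_integrable(2)[OF var0_version]] by simp
  then show ?thesis unfolding var_def orbit_sum_def by eventually_elim (rule average_drop_first)
qed

lemma average_tails: "AE \<omega> in M. (\<lambda>n. (\<Sum>k<n. tails c k \<omega>) / of_nat n) \<longlonglongrightarrow> (\<integral>\<omega>. large c \<omega> \<partial>M)"
proof -
  have "(\<integral>\<omega>. tail0 c \<omega> \<partial>M) = (\<integral>\<omega>. large c \<omega> \<partial>M)"
    using cond_version_test[OF subalgebra_F_minus_1 tail0_version[of c], where H = "\<lambda>_. 1" and B = 1] by simp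
  then have "AE \<omega> in M. (\<lambda>n. orbit_sum (tail0 c) n \<omega> / real n) \<longlonglongrightarrow> (\<integral>\<omega>. large c \<omega> \<partial>M)"
    using birkhoff_ergodic[OF erg cond_version_integrable(2)[OF tail0_version[of c]]] by simp
  then show ?thesis unfolding tails_def orbit_sum_def by eventually_elim (rule average_drop_first)
qed

text \<open>The rotated ergodic theorem at the angle \<open>2 * \<theta>\<close>, reduced modulo \<open>2 * pi\<close> to \<open>2 * pi * \<alpha>\<close> with
  \<open>0 \<le> \<alpha> < 1\<close>.\<close>

lemma average_sq: "AE \<omega> in M. (\<lambda>n. (\<Sum>k<n. sq k \<omega>) / of_nat n) \<longlonglongrightarrow> 0"
proof -
  define \<alpha> where "\<alpha> = frac (\<theta> / pi)"
  have per: "cis (s * (2 * pi * \<alpha>)) = cis (s * (2 * \<theta>))" if "s = 1 \<or> s = -1" for s :: real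
  proof -
    have "2 * pi * \<alpha> = 2 * \<theta> - 2 * pi * of_int \<lfloor>\<theta> / pi\<rfloor>" by (simp add: \<alpha>_def frac_def right_diff_distrib)
    then have "cis (2 * pi * \<alpha>) = cis (2 * \<theta>) * cis (- (2 * pi * of_int \<lfloor>\<theta> / pi\<rfloor>))" by (simp add: cis_mult)
    also have "cis (- (2 * pi * of_int \<lfloor>\<theta> / pi\<rfloor>)) = 1"
      using cis_multiple_2pi[of "of_int (- \<lfloor>\<theta> / pi\<rfloor>)"] by simp
    finally have "cis (2 * pi * \<alpha>) = cis (2 * \<theta>)" by simp
    moreover from arg_cong[OF this, of cnj] have "cis (- (2 * pi * \<alpha>)) = cis (- (2 * \<theta>))" by (simp only: cis_cnj)
    ultimately show ?thesis using that by auto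
  qed
  have z: "cis (2 * pi * \<alpha>) = cis (2 * \<theta>)" using per[of 1] by simp
  have "AE \<omega> in M. (\<lambda>n. (\<Sum>k<n. cis (2 * pi * \<alpha>) ^ k * sq0 ((T ^^ k) \<omega>)) / of_nat n) \<longlonglongrightarrow> 0"
    by (rule rotated_average_tendsto_0[OF sq0_integrable])
       (use spec per[of "-1"] in \<open>auto simp: \<alpha>_def frac_lt_1\<close>)
  then show ?thesis unfolding sq_def z by eventually_elim (rule average_drop_first)
qed

lemma large_tendsto_0: "(\<lambda>c. \<integral>\<omega>. large c \<omega> \<partial>M) \<longlonglongrightarrow> 0"
proof -
  have "(\<lambda>c. \<integral>\<omega>. large c \<omega> \<partial>M) \<longlonglongrightarrow> (\<integral>\<omega>. 0 \<partial>M)"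
  proof (rule integral_dominated_convergence[where w = "\<lambda>\<omega>. (norm (D \<omega>))\<^sup>2"])
    show "AE \<omega> in M. (\<lambda>c. large c \<omega>) \<longlonglongrightarrow> 0"
    proof (rule AE_I2)
      fix \<omega>
      obtain m :: nat where m: "norm (D \<omega>) \<le> real m" using real_arch_simple by blast
      have "eventually (\<lambda>c. large c \<omega> = 0) sequentially"
        unfolding eventually_sequentially using m by (intro exI[of _ m]) (auto simp: large_def indicator_def)
      then show "(\<lambda>c. large c \<omega>) \<longlonglongrightarrow> 0" by (rule tendsto_eventually)
    qed
  qed (use D_sq in \<open>auto simp: large_def indicator_def\<close>)
  then show ?thesis by simp
qed

text \<open>Each hypothesis of the central limit theorem is either a \<open>cond_version\<close> statement, which passes to
  the fibres by \<open>cond_version_fibre\<close>, or holds almost everywhere, and what holds almost everywhere does so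
  almost everywhere on almost every fibre.\<close>

theorem fibre_averaging_martingale:
  "AE \<omega> in M. averaging_martingale (P \<omega>) past diff var sq tails (\<integral>\<omega>. (norm (D \<omega>))\<^sup>2 \<partial>M) (\<lambda>c. \<integral>\<omega>. large c \<omega> \<partial>M)"
proof -
  have fib: "AE \<omega> in M. \<forall>k. cond_version (P \<omega>) (past k) (f k) (g k)"
    if "\<And>k. cond_version M (past k) (f k) (g k)" for f g
  proof (intro AE_all_countable[THEN iffD2] allI cond_version_fibre past_sub that)
    show "sets (F 0) \<subseteq> sets (past k)" "countably_generated (past k)" for k
      unfolding past_def by (rule F_0_le_F_nat, rule countably_generated_F_nat[OF cg])
  qed
  have t: "AE \<omega> in M. \<forall>c k. cond_version (P \<omega>) (past k) (\<lambda>\<omega>. indicator {z. real c < norm z} (diff k \<omega>) * (norm (diff k \<omega>))\<^sup>2) (tails c k)"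
    by (rule AE_all_countable[THEN iffD2], rule allI, rule fib[OF diff_versions(6)])
  have at: "AE \<omega> in M. \<forall>c. AE x in P \<omega>. (\<lambda>n. (\<Sum>k<n. tails c k x) / of_nat n) \<longlonglongrightarrow> (\<integral>\<omega>. large c \<omega> \<partial>M)"
    by (intro AE_all_countable[THEN iffD2] allI AE_fibre average_tails)
  show ?thesis
    using fib[OF diff_versions(1)] fib[OF diff_versions(2)] fib[OF diff_versions(3)] fib[OF diff_versions(4)]
      fib[OF diff_versions(5)] t AE_fibre[OF average_var] AE_fibre[OF average_sq] at AE_space
  proof eventually_elim
    case (elim \<omega>)
    interpret W: prob_space "P \<omega>" using P_prob elim(10) .
    show ?case
    proof
      show "subalgebra (P \<omega>) (past k)" for k
        using past_sub[of k] P_sets[OF elim(10)] P_space[OF elim(10)] by (simp add: subalgebra_def)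
      show "0 \<le> tails c k x" for c k x by (simp add: tails_def tail0_def)
      show "0 \<le> (\<integral>\<omega>. (norm (D \<omega>))\<^sup>2 \<partial>M)" by simp
    qed (use elim past_mono diff_adapted large_tendsto_0 in auto)
  qed
qed

end

section \<open>Quenched convergence\<close>

text \<open>The two sums differ by their term of index 0, which is \<open>D \<omega>\<close>.\<close>

lemma fourier_path_near_scaled_path:
  assumes A: "averaging_martingale N G X q r l s2 tail" and n: "0 < n"
    and X: "\<And>k. X k \<omega> = (if k = 0 then 0 else cis (real k * \<theta>) * D ((T ^^ k) \<omega>))"
  shows "mdist skorohod_metric (fourier_path T D \<theta> n \<omega>) (averaging_martingale.scaled_path X n \<omega>)
    \<le> 2 * (norm (D \<omega>) / sqrt (real n))"
proof -
  interpret averaging_martingale N G X q r l s2 tail by (rule A)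
  have diff: "norm (fourier_sum T D \<theta> k \<omega> - S k \<omega>) \<le> norm (D \<omega>)" for k
  proof -
    have "fourier_sum T D \<theta> k \<omega> - S k \<omega> = (\<Sum>j<k. if j = 0 then D \<omega> else 0)"
      unfolding fourier_sum_def S_def sum_subtractf[symmetric]
      by (intro sum.cong refl) (simp add: X cis_conv_exp mult.commute mult.left_commute)
    then show ?thesis by simp
  qed
  show ?thesis
  proof (rule skorohod_mdist_le_uniform)
    show "fourier_path T D \<theta> n \<omega> \<in> cadlag_space" "scaled_path n \<omega> \<in> cadlag_space"
      unfolding fourier_path_eq scaled_path_def using n by (auto intro!: grid_path_cadlag)
    fix t :: real assume t: "0 \<le> t"
    have "norm ((fourier_sum T D \<theta> k \<omega> - S k \<omega>) / of_real (sqrt (real n))) \<le> norm (D \<omega>) / sqrt (real n)" for k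
      unfolding norm_divide using diff[of k] by (simp add: divide_right_mono)
    then show "norm (fourier_path T D \<theta> n \<omega> t - scaled_path n \<omega> t) \<le> norm (D \<omega>) / sqrt (real n)"
      using t by (simp add: fourier_path_eq scaled_path_def grid_path_def diff_divide_distrib)
  qed
qed

context quenched_setup
begin

lemma random_element_fourier_path:
  assumes "0 < n"
  shows "random_element M skorohod_metric (fourier_path T D \<theta> n)"
proof -
  have [measurable]: "(\<lambda>\<omega>. D ((T ^^ k) \<omega>)) \<in> borel_measurable M" for k
    by (rule measurable_compose[OF T_iterate_measurable]) simp
  show ?thesis unfolding fourier_path_eq[abs_def]
    by (rule random_element_grid_path) (use assms in \<open>auto simp: fourier_sum_def\<close>)
qed

lemma fibre_lipschitz_convergence:
  fixes f :: "(real \<Rightarrow> complex) \<Rightarrow> real"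
  assumes w: "\<omega> \<in> space M"
    and A: "averaging_martingale (P \<omega>) past diff var sq tails s2 \<tau>"
    and B: "prob_space M'" "standard_brownian_motion M' B1" "standard_brownian_motion M' B2" "indep_processes M' B1 B2"
    and lip: "Lipschitz_continuous_map skorohod_metric euclidean_metric f" and bdd: "bounded (f ` mspace skorohod_metric)"
  shows "(\<lambda>n. \<integral>x. f (fourier_path T D \<theta> (Suc n) x) \<partial>P \<omega>) \<longlonglongrightarrow> (\<integral>x. f (limit_path (sqrt (s2 / 2)) B1 B2 x) \<partial>M')"
proof -
  interpret A: averaging_martingale "P \<omega>" past diff var sq tails s2 \<tau> by (rule A)
  have fc: "continuous_map (mtopology_of skorohod_metric) euclideanreal f" by (rule Lipschitz_continuous_real[OF lip])
  obtain L where L: "\<And>x y. x \<in> mspace skorohod_metric \<Longrightarrow> y \<in> mspace skorohod_metric \<Longrightarrow>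
      dist (f x) (f y) \<le> L * mdist skorohod_metric x y"
    using lip by (auto simp: Lipschitz_continuous_map_def)
  obtain b where b: "\<And>x. x \<in> mspace skorohod_metric \<Longrightarrow> \<bar>f x\<bar> \<le> b" using bdd by (auto simp: bounded_iff)
  let ?V = "\<lambda>n. fourier_path T D \<theta> (Suc n)" and ?U = "\<lambda>n. A.scaled_path (Suc n)"
  have V: "random_element (P \<omega>) skorohod_metric (?V n)" for n
    using random_element_fourier_path[of "Suc n"] random_element_cong_sets[OF P_sets[OF w]] by blast
  have U: "random_element (P \<omega>) skorohod_metric (?U n)" for n by (rule A.random_element_scaled_path) simp
  note VS = random_element_in_space[OF V] and US = random_element_in_space[OF U]
  have fV: "(\<lambda>x. f (?V n x)) \<in> borel_measurable (P \<omega>)" and fU: "(\<lambda>x. f (?U n x)) \<in> borel_measurable (P \<omega>)" for n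
    using random_element_compose[OF V fc] random_element_compose[OF U fc] .
  have iV: "integrable (P \<omega>) (\<lambda>x. f (?V n x))" for n
    by (rule A.integrable_const_bound[where B = b]) (use VS b fV in auto)
  have iU: "integrable (P \<omega>) (\<lambda>x. f (?U n x))" for n
    by (rule A.integrable_const_bound[where B = b]) (use US b fU in auto)
  have "(\<lambda>n. \<integral>x. f (?V n x) - f (?U n x) \<partial>P \<omega>) \<longlonglongrightarrow> (\<integral>x. 0 \<partial>P \<omega>)"
  proof (rule integral_dominated_convergence[where w = "\<lambda>_. 2 * b"])
    show "AE x in P \<omega>. (\<lambda>n. f (?V n x) - f (?U n x)) \<longlonglongrightarrow> 0"
    proof (rule AE_I2)
      fix x assume x: "x \<in> space (P \<omega>)"
      have 1: "\<bar>f (?V n x) - f (?U n x)\<bar> \<le> \<bar>L\<bar> * (2 * (norm (D x) / sqrt (real (Suc n))))" for n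
      proof -
        have "\<bar>f (?V n x) - f (?U n x)\<bar> \<le> L * mdist skorohod_metric (?V n x) (?U n x)"
          using L[OF VS[OF x] US[OF x]] by (simp add: dist_real_def)
        also have "\<dots> \<le> \<bar>L\<bar> * mdist skorohod_metric (?V n x) (?U n x)" by (intro mult_right_mono) auto
        also have "\<dots> \<le> \<bar>L\<bar> * (2 * (norm (D x) / sqrt (real (Suc n))))"
          by (intro mult_left_mono fourier_path_near_scaled_path[OF A]) (auto simp: diff_def)
        finally show ?thesis .
      qed
      have 2: "(\<lambda>n. \<bar>L\<bar> * (2 * (norm (D x) / sqrt (real (Suc n))))) \<longlonglongrightarrow> 0"
      proof -
        have "filterlim (\<lambda>n. sqrt (real (Suc n))) at_top sequentially"
          by (intro filterlim_compose[OF sqrt_at_top] filterlim_compose[OF filterlim_real_sequentially] filterlim_Suc)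
        then have "(\<lambda>n. norm (D x) / sqrt (real (Suc n))) \<longlonglongrightarrow> 0" by (rule tendsto_divide_0[OF tendsto_const filterlim_at_top_imp_at_infinity])
        then have "(\<lambda>n. \<bar>L\<bar> * (2 * (norm (D x) / sqrt (real (Suc n))))) \<longlonglongrightarrow> \<bar>L\<bar> * (2 * 0)" by (intro tendsto_intros)
        then show ?thesis by simp
      qed
      show "(\<lambda>n. f (?V n x) - f (?U n x)) \<longlonglongrightarrow> 0"
        by (rule Lim_null_comparison[OF always_eventually 2]) (rule allI, simp only: real_norm_def, rule 1)
    qed
    show "AE x in P \<omega>. norm (f (?V n x) - f (?U n x)) \<le> 2 * b" for n
    proof (rule AE_I2)
      fix x assume x: "x \<in> space (P \<omega>)"
      show "norm (f (?V n x) - f (?U n x)) \<le> 2 * b"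
        using b[OF VS[OF x, of n]] b[OF US[OF x, of n]] unfolding real_norm_def by linarith
    qed
  qed (use fV fU in auto)
  moreover have "(\<lambda>n. \<integral>x. f (?U n x) \<partial>P \<omega>) \<longlonglongrightarrow> (\<integral>x. f (limit_path (sqrt (s2 / 2)) B1 B2 x) \<partial>M')"
    by (rule LIMSEQ_Suc[OF A.lipschitz_functional_clt[OF B lip bdd]])
  ultimately have "(\<lambda>n. (\<integral>x. f (?V n x) - f (?U n x) \<partial>P \<omega>) + (\<integral>x. f (?U n x) \<partial>P \<omega>)) \<longlonglongrightarrow>
      (\<integral>x. 0 \<partial>P \<omega>) + (\<integral>x. f (limit_path (sqrt (s2 / 2)) B1 B2 x) \<partial>M')" by (rule tendsto_add)
  then show ?thesis using iV iU by simp
qed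

theorem quenched_fclt:
  assumes B: "prob_space M'" "standard_brownian_motion M' B1" "standard_brownian_motion M' B2" "indep_processes M' B1 B2"
  shows "quenched_converges M (F 0) skorohod_metric (\<lambda>n. fourier_path T D \<theta> (Suc n))
    M' (limit_path (sqrt ((\<integral>\<omega>. (norm (D \<omega>))\<^sup>2 \<partial>M) / 2)) B1 B2)"
proof -
  let ?c = "sqrt ((\<integral>\<omega>. (norm (D \<omega>))\<^sup>2 \<partial>M) / 2)"
  have V: "random_element M skorohod_metric (fourier_path T D \<theta> (Suc n))" for n
    by (rule random_element_fourier_path) simp
  have V': "random_element M' skorohod_metric (limit_path ?c B1 B2)"
    by (rule random_element_limit_path) (use B in \<open>auto simp: standard_brownian_motion_def\<close>)
  have "AE \<omega> in M. (\<lambda>n. real_cond_exp M (F 0) (\<lambda>\<omega>. f (fourier_path T D \<theta> (Suc n) \<omega>)) \<omega>)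
      \<longlonglongrightarrow> (\<integral>\<omega>'. f (limit_path ?c B1 B2 \<omega>') \<partial>M')"
    if f: "continuous_map (mtopology_of skorohod_metric) euclideanreal f" "bounded (f ` mspace skorohod_metric)" for f
  proof -
    obtain b where b: "\<And>x. x \<in> mspace skorohod_metric \<Longrightarrow> \<bar>f x\<bar> \<le> b" using f(2) by (auto simp: bounded_iff)
    have "integrable M (\<lambda>\<omega>. f (fourier_path T D \<theta> (Suc n) \<omega>))" for n
      by (rule integrable_const_bound[where B = b])
         (use b random_element_in_space[OF V] random_element_compose[OF V f(1)] in auto)
    then have "AE \<omega> in M. \<forall>n. (\<integral>x. f (fourier_path T D \<theta> (Suc n) x) \<partial>P \<omega>) =
        real_cond_exp M (F 0) (\<lambda>\<omega>. f (fourier_path T D \<theta> (Suc n) \<omega>)) \<omega>"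
      by (intro AE_all_countable[THEN iffD2] allI P_integral)
    with fibre_averaging_martingale AE_space show ?thesis
    proof eventually_elim
      case (elim \<omega>)
      have VP: "random_element (P \<omega>) skorohod_metric (fourier_path T D \<theta> (Suc n))" for n
        using V random_element_cong_sets[OF P_sets[OF elim(2)]] by blast
      have "(\<lambda>n. \<integral>x. f (fourier_path T D \<theta> (Suc n) x) \<partial>P \<omega>) \<longlonglongrightarrow> (\<integral>\<omega>'. f (limit_path ?c B1 B2 \<omega>') \<partial>M')"
        by (rule lipschitz_tests_suffice[OF P_prob[OF elim(2)] B(1) VP V' fibre_lipschitz_convergence[OF elim(2,1) B] f])
      then show ?case using elim(3) by simp
    qed
  qed
  then show ?thesis unfolding quenched_converges_def using V V' by blast
qed

end

theorem theorem5p19p1: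
  fixes M :: "'a measure" and T :: "'a \<Rightarrow> 'a" and F :: "int \<Rightarrow> 'a measure"
    and M' :: "'b measure" and B1 B2 :: "real \<Rightarrow> 'b \<Rightarrow> real"
    and \<theta> :: real and D0 :: "'a \<Rightarrow> complex"
  assumes "prob_space M"
    and "invertible_mpt M T" and "ergodic M T"
    and "T_filtration M T F"
    and "countably_generated (F 0)"
    and "regular_cond_exp M (F 0)"
    and "prob_space M'"
    and "standard_brownian_motion M' B1" and "standard_brownian_motion M' B2"
    and "indep_processes M' B1 B2"
    and "0 \<le> \<theta>" and "\<theta> < 2 * pi"
    and "exp (- 2 * \<i> * of_real \<theta>) \<notin> point_spectrum M T"
    and "D0 \<in> L2_ominus M (F 0) (F (- 1))"
  shows "quenched_converges M (F 0) skorohod_metric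
           (\<lambda>n. fourier_path T D0 \<theta> (Suc n))
           M' (limit_path (sqrt ((\<integral>\<omega>. (norm (D0 \<omega>))\<^sup>2 \<partial>M) / 2)) B1 B2)"
proof -
  obtain P where P: "\<forall>\<omega>\<in>space M. prob_space (P \<omega>) \<and> sets (P \<omega>) = sets M"
    "\<forall>X :: 'a \<Rightarrow> real. integrable M X \<longrightarrow> (\<lambda>\<omega>. \<integral>\<omega>'. X \<omega>' \<partial>P \<omega>) \<in> borel_measurable (F 0) \<and>
       (AE \<omega> in M. (\<integral>\<omega>'. X \<omega>' \<partial>P \<omega>) = real_cond_exp M (F 0) X \<omega>)"
    using assms(6) unfolding regular_cond_exp_def by blast
  interpret prob_space M by fact
  interpret T_filtered_system M T F
  proof
    show "T \<in> measurable M M" "distr M M T = M"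
      using assms(2) unfolding invertible_mpt_def by blast+
  qed (rule assms(2), rule assms(4))
  have "disintegration M (F 0) P"
    unfolding disintegration_def disintegration_axioms_def
  proof (intro conjI allI impI)
    show "prob_space M" by (rule assms(1))
    show "subalgebra M (F 0)" using subalgebra_F_nat[of 0] by simp
    show "prob_space (P \<omega>)" if "\<omega> \<in> space M" for \<omega>
      using P(1)[rule_format, OF that] by (rule conjunct1)
    show "sets (P \<omega>) = sets M" if "\<omega> \<in> space M" for \<omega>
      using P(1)[rule_format, OF that] by (rule conjunct2)
    show "AE \<omega> in M. (\<integral>x. X x \<partial>P \<omega>) = real_cond_exp M (F 0) X \<omega>" if "integrable M X" for X
      using P(2)[rule_format, OF that] by (rule conjunct2)
  qed
  moreover have "cis (- 2 * \<theta>) \<notin> point_spectrum M T"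
  proof -
    have "- 2 * \<i> * complex_of_real \<theta> = \<i> * complex_of_real (- 2 * \<theta>)" by simp
    then have "exp (- 2 * \<i> * complex_of_real \<theta>) = cis (- 2 * \<theta>)" by (simp only: cis_conv_exp)
    then show ?thesis using assms(13) by metis
  qed
  ultimately have "quenched_setup M T F P D0 \<theta>"
    unfolding quenched_setup_def quenched_setup_axioms_def
    by (intro conjI T_filtered_system_axioms assms(3,5,14))
  then show ?thesis by (rule quenched_setup.quenched_fclt[OF _ assms(7-10)])
qed

end
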